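(* Let $m,\ell\ge 0$ be integers, $\epsilon\in\{0,1\}$, and $d=2m+2\ell+\epsilon$. Then $$J_{2m+\ell+\epsilon,\ell}[X;q,t]=\sum_{T\ \text{standard},\ |T|=d}\mathrm{Stat}(T)\,S_{\mathrm{shape}(T)}[X^t],$$ where the sum runs over all standard tableaux of degree $d$, $$\mathrm{Stat}(T)=q^{\mathrm{cocharge}(T)}\,q^{(1-d)|\mathrm{dv}(T)|_\ell+2n(\mathrm{dv}(T))_\ell}\,t^{\ell-|\mathrm{dv}(T)|_\ell},$$ and the domino vector $\mathrm{dv}(T)=(\mathrm{dv}_1,\dots,\mathrm{dv}_{m+\ell})\in\{0,1\}^{m+\ell}$ is defined recursively by $$\mathrm{dv}(T)=\begin{cases}(0,\mathrm{dv}(\overset{*}{\mathbb B}{}_2^{(0)}T)) & \text{if } 1 \text{ precedes } 2 \text{ in the reading word of } T,\\ (1,\mathrm{dv}(\overset{*}{\mathbb B}{}_2^{(1)}T)) & \text{if } 2 \text{ precedes } 1 \text{ in the reading word of } T,\\ \emptyset & \text{if } T \text{ has degree}\le 1.\end{cases}$$ Here for $v=(v_1,\dots,v_k)$, $|v|_\ell=v_1+\cdots+v_\ell$ and $n(v)_\ell=v_2+2v_3+\cdots+(\ell-1)v_\ell$.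
   Context: Plethystic notation: for a symmetric function $f$ and a rational expression $E$ in $x_1,\dots,x_N,q,t$, $f[E]$ is obtained by writing $f$ as a polynomial in the power sums $p_k$ and replacing each $p_k$ by $E$ with every variable $u$ replaced by $u^k$. Put $X=x_1+\cdots+x_N$ and $X^t=X(1-t)$. $S_\mu$ is the Schur function. For a partition $\lambda$, for a cell $s$ of its diagram, $a(s)$ (arm) is the number of cells to the right of $s$ in its row and $\ell(s)$ (leg) the number of cells above $s$ in its column. The Macdonald polynomial $J_\lambda[X;q,t]$ is the unique symmetric function such that (i) $\langle J_\lambda,J_\mu\rangle_{q,t}=0$ for $\lambda\neq\mu$, where $\langle p_\lambda,p_\mu\rangle_{q,t}=\delta_{\lambda\mu}z_\lambda\prod_{i}\frac{1-q^{\lambda_i}}{1-t^{\lambda_i}}$ and $z_\lambda=\prod_i i^{m_i}m_i!$ ($m_i$ = number of parts equal to $i$); (ii) $J_\lambda=\sum_{\mu\le\lambda}v_{\lambda\mu}(q,t)S_\mu[X]$ (dominance order); (iii) $v_{\lambda\lambda}=\prod_{s\in\lambda}(1-q^{a(s)}t^{\ell(s)+1})$. Tableaux (French convention): the diagram of $\lambda$ has rows of lengths $\lambda_1\ge\lambda_2\ge\cdots$ from bottom to top. A tableau is a filling of a diagram by integers, identified with the pair (shape, reading word), the reading word listing the entries row by row from the top row down to the bottom row, each row left to right. Operators on words act on tableaux through their reading words, keeping the shape. A tableau is semistandard if rows weakly increase left to right and columns strictly increase upwards; standard of degree $n$ if semistandard with entries $1,\dots,n$ each once. The transpose $T^t$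 reflects the diagram and its entries across the main diagonal. Cocharge of a standard word $w$ of degree $n$: set $c_1=0$, and $c_{i+1}=c_i+1$ if $i+1$ appears to the left of $i$ in $w$, else $c_{i+1}=c_i$; $\mathrm{cocharge}(w)=c_1+\cdots+c_n$; the cocharge of a standard tableau is that of its reading word. Word operators (compositions act right to left): $\tau_k$ adds $k$ to every letter; $r_{(ab\to cd)}$ applies to a word whose letters lying in $\{a,b\}$ are, read left to right, exactly $a$ then $b$ (if $a=b$: exactly two occurrences of $a$), and replaces the first of them by $c$ and the second by $d$; $R_a$ deletes all letters (cells) equal to $a$; for a word $w$ with $(\mathrm{ev}_a,\mathrm{ev}_{a+1})\in\{(1,2),(2,1)\}$ (where $\mathrm{ev}_i$ is the number of occurrences of $i$), $\sigma_a$ replaces the subword of letters in $\{a,b\}$, $b=a+1$, keeping their positions, via $aab\leftrightarrow abb$, $aba\leftrightarrow bba$, $baa\leftrightarrow bab$. For a standard tableau $T$ of degree $n\ge2$ in which $1$ precedes $2$ in the reading word, $\overset{*}{\mathbb B}{}_2^{(0)}T=R_{n-1}\sigma_{n-2}\cdots\sigma_1\,r_{(01\to11)}\,\tau_{-1}T$; for a standard $T$ of degree $n\ge 2$ in which $2$ precedes $1$, $\overset{*}{\mathbb B}{}_2^{(1)}T=(\overset{*}{\mathbb B}{}_2^{(0)}T^t)^t$. Both yield standard tableaux of degree $n-2$. *)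

theory Defs
  imports Main "HOL-Computational_Algebra.Polynomial" "HOL-Computational_Algebra.Fraction_Field"
begin

type_synonym K = "rat poly poly fract"

definition qq :: K where "qq = Fract [:[:0, 1:]:] 1"
definition tt :: K where "tt = Fract [:0, 1:] 1"

definition is_partition :: "nat list \<Rightarrow> bool" where
  "is_partition \<mu> \<longleftrightarrow> sorted_wrt (\<ge>) \<mu> \<and> (\<forall>x\<in>set \<mu>. 0 < x)"

definition parts :: "nat \<Rightarrow> nat list set" where
  "parts d = {\<mu>. is_partition \<mu> \<and> sum_list \<mu> = d}"

definition dominated :: "nat list \<Rightarrow> nat list \<Rightarrow> bool" where
  "dominated \<mu> la \<longleftrightarrow> (\<forall>k. sum_list (take k \<mu>) \<le> sum_list (take k la))"

definition zee :: "nat list \<Rightarrow> nat" where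
  "zee \<mu> = (\<Prod>i\<in>set \<mu>. i ^ count (mset \<mu>) i * fact (count (mset \<mu>) i))"

section \<open>Symmetric functions of degree d, as coefficient vectors in the power-sum basis\<close>

(* f represents  sum_{mu in parts d} f mu * p_mu *)
definition symf :: "nat \<Rightarrow> (nat list \<Rightarrow> K) \<Rightarrow> bool" where
  "symf d f \<longleftrightarrow> (\<forall>\<mu>. \<mu> \<notin> parts d \<longrightarrow> f \<mu> = 0)"

definition qt_inner :: "nat \<Rightarrow> (nat list \<Rightarrow> K) \<Rightarrow> (nat list \<Rightarrow> K) \<Rightarrow> K" where
  "qt_inner d f g = (\<Sum>\<mu>\<in>parts d. f \<mu> * g \<mu> * of_nat (zee \<mu>) *
      (\<Prod>i<length \<mu>. (1 - qq ^ (\<mu> ! i)) / (1 - tt ^ (\<mu> ! i))))"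

(* plethysm f[X(1-t)]:  p_k |-> p_k (1 - t^k) *)
definition pleth_Xt :: "(nat list \<Rightarrow> K) \<Rightarrow> (nat list \<Rightarrow> K)" where
  "pleth_Xt f = (\<lambda>\<mu>. f \<mu> * (\<Prod>i<length \<mu>. 1 - tt ^ (\<mu> ! i)))"

(* coefficient of the monomial x^alpha (variables x_0, x_1, ...) in p_mu *)
definition pcoeff :: "nat list \<Rightarrow> (nat \<Rightarrow> nat) \<Rightarrow> nat" where
  "pcoeff \<mu> \<alpha> = card {fs. length fs = length \<mu> \<and>
      (\<forall>j. sum_list [\<mu> ! i. i \<leftarrow> [0..<length \<mu>], fs ! i = j] = \<alpha> j)}"

(* tableaux as lists of rows, bottom row first (French), each row left to right *)
definition semistandard :: "nat list list \<Rightarrow> bool" where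
  "semistandard T \<longleftrightarrow> (\<forall>r\<in>set T. sorted r) \<and>
     (\<forall>i j. i + 1 < length T \<and> j < length (T ! (i + 1)) \<longrightarrow> T ! i ! j < T ! (i + 1) ! j)"

definition kostka :: "nat list \<Rightarrow> (nat \<Rightarrow> nat) \<Rightarrow> nat" where
  "kostka la \<alpha> = card {T. map length T = la \<and> semistandard T \<and>
      (\<forall>k. count (mset (concat T)) k = \<alpha> k)}"

(* Schur function S_lambda = sum over SSYT T of x^T, expressed in the power-sum basis *)
definition schur :: "nat list \<Rightarrow> (nat list \<Rightarrow> K)" where
  "schur la = (THE f. symf (sum_list la) f \<and>
      (\<forall>\<alpha>. (\<Sum>\<mu>\<in>parts (sum_list la). f \<mu> * of_nat (pcoeff \<mu> \<alpha>)) = of_nat (kostka la \<alpha>)))"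

definition arm :: "nat list \<Rightarrow> nat \<times> nat \<Rightarrow> nat" where
  "arm la s = la ! fst s - snd s - 1"

definition leg :: "nat list \<Rightarrow> nat \<times> nat \<Rightarrow> nat" where
  "leg la s = card {i. fst s < i \<and> i < length la \<and> snd s < la ! i}"

definition cells :: "nat list \<Rightarrow> (nat \<times> nat) set" where
  "cells la = {(i, j). i < length la \<and> j < la ! i}"

definition vlead :: "nat list \<Rightarrow> K" where
  "vlead la = (\<Prod>s\<in>cells la. 1 - qq ^ arm la s * tt ^ (leg la s + 1))"

definition macJ_family :: "nat \<Rightarrow> nat list \<Rightarrow> (nat list \<Rightarrow> K)" where
  "macJ_family d = (THE F.
     (\<forall>la. la \<notin> parts d \<longrightarrow> F la = (\<lambda>_. 0)) \<and>
     (\<forall>la\<in>parts d. \<forall>\<mu>\<in>parts d. la \<noteq> \<mu> \<longrightarrow> qt_inner d (F la) (F \<mu>) = 0) \<and>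
     (\<forall>la\<in>parts d. \<exists>v. F la = (\<lambda>\<nu>. \<Sum>\<mu>\<in>{\<mu>\<in>parts d. dominated \<mu> la}. v \<mu> * schur \<mu> \<nu>)
                        \<and> v la = vlead la))"

definition macJ :: "nat list \<Rightarrow> (nat list \<Rightarrow> K)" where
  "macJ la = macJ_family (sum_list la) la"

definition reading :: "nat list list \<Rightarrow> nat list" where
  "reading T = concat (rev T)"

definition shape :: "nat list list \<Rightarrow> nat list" where
  "shape T = map length T"

definition standard :: "nat \<Rightarrow> nat list list \<Rightarrow> bool" where
  "standard n T \<longleftrightarrow> is_partition (shape T) \<and> semistandard T \<and>
     mset (concat T) = mset [1..<n + 1]"

definition std_tableaux :: "nat \<Rightarrow> nat list list set" where
  "std_tableaux n = {T. standard n T}"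

fun split_lens :: "nat list \<Rightarrow> 'a list \<Rightarrow> 'a list list" where
  "split_lens [] w = []"
| "split_lens (k # ks) w = take k w # split_lens ks (drop k w)"

(* fill the diagram with row lengths lens (bottom first) so that the reading word is w *)
definition refill :: "nat list \<Rightarrow> nat list \<Rightarrow> nat list list" where
  "refill lens w = rev (split_lens (rev lens) w)"

definition on_word :: "(nat list \<Rightarrow> nat list) \<Rightarrow> nat list list \<Rightarrow> nat list list" where
  "on_word f T = refill (shape T) (f (reading T))"

definition positions :: "nat set \<Rightarrow> nat list \<Rightarrow> nat list" where
  "positions A w = filter (\<lambda>i. w ! i \<in> A) [0..<length w]"

definition put_at :: "nat list \<Rightarrow> nat list \<Rightarrow> nat list \<Rightarrow> nat list" where
  "put_at ps vs w = foldl (\<lambda>u (p, v). u[p := v]) w (zip ps vs)"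

definition tau_m1 :: "nat list \<Rightarrow> nat list" where
  "tau_m1 w = map (\<lambda>x. x - 1) w"

definition r_op :: "nat \<Rightarrow> nat \<Rightarrow> nat \<Rightarrow> nat \<Rightarrow> nat list \<Rightarrow> nat list" where
  "r_op a b c d w = (let ps = positions {a, b} w in
     if map (\<lambda>i. w ! i) ps = [a, b] then put_at ps [c, d] w else w)"

definition swap3 :: "nat \<Rightarrow> nat list \<Rightarrow> nat list" where
  "swap3 a s = (let b = a + 1 in
      if s = [a, a, b] then [a, b, b] else if s = [a, b, b] then [a, a, b]
      else if s = [a, b, a] then [b, b, a] else if s = [b, b, a] then [a, b, a]
      else if s = [b, a, a] then [b, a, b] else if s = [b, a, b] then [b, a, a]
      else s)"

definition sigma_op :: "nat \<Rightarrow> nat list \<Rightarrow> nat list" where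
  "sigma_op a w = (let ps = positions {a, a + 1} w in
      put_at ps (swap3 a (map (\<lambda>i. w ! i) ps)) w)"

definition del_cells :: "nat \<Rightarrow> nat list list \<Rightarrow> nat list list" where
  "del_cells a T = filter (\<lambda>r. r \<noteq> []) (map (filter (\<lambda>x. x \<noteq> a)) T)"

definition tab_transpose :: "nat list list \<Rightarrow> nat list list" where
  "tab_transpose T = transpose T"

definition B0 :: "nat list list \<Rightarrow> nat list list" where
  "B0 T = (let n = length (reading T) in
     del_cells (n - 1)
       (on_word (\<lambda>w. foldl (\<lambda>u a. sigma_op a u) (r_op 0 1 1 1 (tau_m1 w)) [1..<n - 1]) T))"

definition B1 :: "nat list list \<Rightarrow> nat list list" where
  "B1 T = tab_transpose (B0 (tab_transpose T))"

definition pos :: "nat list \<Rightarrow> nat \<Rightarrow> nat" where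
  "pos w x = length (takeWhile (\<lambda>y. y \<noteq> x) w)"

fun dv_aux :: "nat \<Rightarrow> nat list list \<Rightarrow> nat list" where
  "dv_aux 0 T = []"
| "dv_aux (Suc k) T =
     (if length (reading T) \<le> 1 then []
      else if pos (reading T) 1 < pos (reading T) 2 then 0 # dv_aux k (B0 T)
      else 1 # dv_aux k (B1 T))"

definition dv :: "nat list list \<Rightarrow> nat list" where
  "dv T = dv_aux (length (reading T)) T"

definition cocharge :: "nat list \<Rightarrow> nat" where
  "cocharge w = (\<Sum>i\<in>{1..length w}. card {j. 1 \<le> j \<and> j < i \<and> pos w (j + 1) < pos w j})"

definition vsum :: "nat \<Rightarrow> nat list \<Rightarrow> nat" where
  "vsum l v = sum_list (take l v)"

definition vn :: "nat \<Rightarrow> nat list \<Rightarrow> nat" where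
  "vn l v = (\<Sum>i<length (take l v). i * (take l v ! i))"

definition Stat :: "nat \<Rightarrow> nat list list \<Rightarrow> K" where
  "Stat l T = (let d = length (reading T); v = dv T in
     qq ^ cocharge (reading T) *
     qq powi ((1 - int d) * int (vsum l v) + 2 * int (vn l v)) *
     tt powi (int l - int (vsum l v)))"

end

theory Submission
  imports Defs "HOL-Combinatorics.Permutations" "HOL-Computational_Algebra.Formal_Power_Series"
    "HOL-Computational_Algebra.Polynomial_FPS" "HOL-Computational_Algebra.Polynomial_Factorial"
begin

text \<open>Encode a standard tableau by its lattice word, whose \<open>i\<close>-th letter is the row of the entry \<open>i\<close>. Dual Knuth moves turn both
  domino operators into one map on words, cocharge into a comajor index, and transposition into complementation of the domino
  vector. Extended to all words, domino vector and comajor index are constant on crystal components. Hence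
  \<open>A\<^sub>v = \<Sum> q\<^bsup>cocharge\<^esup> S\<^bsub>shape\<^esub>\<close>, summed over the tableaux with domino vector \<open>v\<close>, is the generating function of all words
  with domino vector \<open>v\<close>; peeling off two equal initial letters by Demazure operators gives \<open>A\<^bsub>0v\<^esub> = B\<^sub>0 A\<^sub>v\<close> for the vertex
  operator taking \<open>f\<close> to the coefficient of \<open>z\<^sup>2\<close> in \<open>f[qX + (1 - q)/z] \<Omega>[zX]\<close>. By the involution \<open>\<omega>\<close>, \<open>A\<^bsub>1v\<^esub> = q\<^bsup>n-1\<^esup> B\<^sub>1 A\<^sub>v\<close>, where
  \<open>B\<^sub>1\<close> uses \<open>f[X + (1 - q)/z] \<Omega>[-zX]\<close>. So the right-hand side arises from \<open>(q)\<^sub>m h\<^sub>m[X/(1 - q)]\<close> by applying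
  \<open>t B\<^sub>0 + B\<^sub>1\<close> \<open>l\<close> times. On the span of the products \<open>h\<^sub>a h\<^sub>b[X/(1 - q)]\<close> this operator commutes up to a factor \<open>q\<close> with
  (a plethystic conjugate of) the Macdonald operator, so the result is an eigenfunction; \<open>J\<close> is characterised among
  eigenfunctions by its leading coefficient, which is computed in two variables.\<close>

text \<open>The exponents in \<open>Stat\<close> are forced by the recursion. When the i-th bit of
  the domino vector is 1, the current degree is N = d - 2 (i - 1) and omega produces the factor
  \<open>q ^ (N - 1)\<close>; the exponent 1 - d + 2 (i - 1) cancels it. Bits beyond the first l
  carry no weight, so after l steps the unweighted sum over all tableaux of the remaining degree is
  left, a multiple of one complete function. The recursion is invisible on Schur functions, on which
  the domino operators do not act. On words it appears: a sum over words can be restricted by the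
  first letter, and the words \<open>0 # 0 # h\<close> are a rotated copy of all words h, which
  comes down to sliding a pair of letters past another pair (\<open>YB_outs\<close>). An initial
  ascent has no such normal form, hence omega. Symmetric functions are coefficient vectors over
  power sums, so identities between them are tested at points whose coordinates are powers of one
  parameter, where monomials stay independent.\<close>

instance fract :: (linordered_idom) field_char_0 ..

section \<open>Words, Knuth moves and crystal operators\<close>

text \<open>A standard tableau is encoded by the word of the rows of its entries \<open>1, 2, \<dots>\<close>. On such words \<open>K3\<close> is the elementary dual
  Knuth move and \<open>x # y # w \<mapsto> outs x y w\<close> is the effect of both domino operators, so that \<open>dvw\<close> is the domino vector and
  \<open>cmaj\<close> the cocharge.\<close>
definition K3 :: "nat => nat => nat => nat \<times> nat \<times> nat" where
 "K3 x y z = (if (y <= x & x < z) | (z <= x & x < y) then (x, z, y)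
   else if (y < z & z <= x) | (x < z & z <= y) then (y, x, z) else (x, y, z))"

fun outs :: "nat => nat => nat list => nat list" where
 "outs x y [] = []"
| "outs x y (z # w) = (case K3 x y z of (s, p, q) => s # outs p q w)"

lemma length_outs [simp]: "length (outs x y w) = length w"
 by (induction x y w rule: outs.induct) (auto split: prod.splits)

function dvw :: "nat list => nat list" where
 "dvw [] = []"
| "dvw [x] = []"
| "dvw (x # y # w) = (if x < y then 1 else 0) # dvw (outs x y w)"
 by pat_completeness auto
termination by (relation "measure length") auto

fun cmaj :: "nat list => nat" where
 "cmaj [] = 0"
| "cmaj [x] = 0"
| "cmaj (x # y # w) = (if x < y then length (y # w) else 0) + cmaj (y # w)"

text \<open>Signature rule, with \<open>j\<close> as opening and \<open>j + 1\<close> as closing bracket: \<open>aa\<close> and \<open>bb\<close> count the unmatched ones.\<close>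
fun bb :: "nat => nat list => nat" where
 "bb j [] = 0"
| "bb j (x # w) = (if x = j then bb j w - 1 else if x = Suc j then bb j w + 1 else bb j w)"

fun aa :: "nat => nat list => nat" where
 "aa j [] = 0"
| "aa j (x # w) = (if x = j & bb j w = 0 then aa j w + 1 else aa j w)"

fun fop :: "nat => nat list => nat list" where
 "fop j [] = []"
| "fop j (x # w) = (if x = j & bb j w = 0 then Suc j # w else x # fop j w)"

text \<open>Inverse to \<open>fop\<close> where \<open>0 < bb j w\<close>. On a word without an
  unmatched closing bracket it may lower a matched one, so that condition accompanies every
  use.\<close>

fun eop :: "nat => nat list => nat list" where
 "eop j [] = []"
| "eop j (x # w) = (if x = Suc j & bb j w = 0 then j # w else x # eop j w)"

lemma length_fop [simp]: "length (fop j w) = length w" by (induction w) auto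
lemma length_eop [simp]: "length (eop j w) = length w" by (induction w) auto

lemma aa_fop: "0 < aa j w ==> bb j (fop j w) = Suc (bb j w) & Suc (aa j (fop j w)) = aa j w"
 by (induction w) (auto split: if_splits)

lemma bb_eop: "0 < bb j w ==> Suc (bb j (eop j w)) = bb j w & aa j (eop j w) = Suc (aa j w)"
proof (induction w)
 case (Cons x w)
 show ?case
 proof (cases "0 < bb j w")
  case True
  with Cons.IH show ?thesis using Cons.prems by (auto split: if_splits)
 next
  case False
  with Cons.prems show ?thesis by (auto split: if_splits)
 qed
qed simp

lemma eop_fop: "0 < aa j w ==> eop j (fop j w) = w"
 using aa_fop[of j] by (induction w) (auto split: if_splits)

lemma fop_eop: "0 < bb j w ==> fop j (eop j w) = w"
proof (induction w)
 case (Cons x w)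
 show ?case
 proof (cases "0 < bb j w")
  case True
  with bb_eop[OF True] Cons show ?thesis by (auto split: if_splits)
 next
  case False
  with Cons.prems show ?thesis by (auto split: if_splits)
 qed
qed simp

lemma fop_id: "aa j w = 0 ==> fop j w = w"
 by (induction w) (auto split: if_splits)

lemma mset_fop: "0 < aa j w ==> mset (fop j w) + {#j#} = mset w + {#Suc j#}"
 by (induction w) (auto split: if_splits)

text \<open>Matched brackets come in pairs and contribute equally to both letter counts.\<close>

lemma aa_bb_count: "aa j w + count (mset w) (Suc j) = bb j w + count (mset w) j"
 by (induction w) auto

subsection \<open>Compatibility with Knuth moves\<close>

definition khd :: "nat list => nat list" where
 "khd u = (case u of x # y # z # w => (case K3 x y z of (s, p, q) => s # p # q # w) | _ => u)"

lemma khd_Cons3: "khd (x # y # z # w) =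
  (if (y <= x & x < z) | (z <= x & x < y) then x # z # y # w
  else if (y < z & z <= x) | (x < z & z <= y) then y # x # z # w else x # y # z # w)"
 by (simp add: khd_def K3_def)

lemma khd_short: "length u < 3 ==> khd u = u"
 by (auto simp: khd_def split: list.splits)

lemma bb_khd: "bb j (khd u) = bb j u"
proof (cases "length u < 3")
 case False
 then obtain x y z w where u: "u = x # y # z # w"
  by (auto simp: not_less Suc_le_length_iff numeral_3_eq_3)
 show ?thesis unfolding u khd_Cons3 by simp
qed (simp add: khd_short)

text \<open>Knuth relations respect the bracketing. The check is finite: what matters about the
  three letters is which of them equal \<open>j\<close> or \<open>Suc j\<close>, and about the tail
  whether it has no, one or more unmatched closing brackets.\<close>

lemma fop_khd: "fop j (khd u) = khd (fop j u)"
proof (cases "length u < 3")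
 case False
 then obtain x y z w where u: "u = x # y # z # w"
  by (auto simp: not_less Suc_le_length_iff numeral_3_eq_3)
 show ?thesis unfolding u 
  apply (cases "x = j"; cases "y = j"; cases "z = j"; cases "x = Suc j"; cases "y = Suc j"; cases "z = Suc j"; cases "bb j w = 0"; cases "bb j w = 1")
  apply (simp_all add: khd_Cons3)
  done
qed (simp add: khd_short)

text \<open>The sweep of \<open>outs\<close> with the final pair kept. This makes it length
  preserving and a composition of Knuth moves, so that crystal operators commute with it; for
  \<open>outs\<close> the changed letter may be lost in the truncation.\<close>

fun lam :: "nat => nat => nat list => nat list" where
 "lam x y [] = [x, y]"
| "lam x y (z # w) = (case K3 x y z of (s, p, q) => s # lam p q w)"

definition Lam :: "nat list => nat list" where
 "Lam u = (case u of x # y # w => lam x y w | _ => u)"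

text \<open>Exhibits the sweep as a Knuth move at the front followed by the sweep of the tail, so
  that whatever commutes with \<open>khd\<close> commutes with \<open>Lam\<close>.\<close>

lemma Lam_rec: "3 <= length u ==> Lam u = hd (khd u) # Lam (tl (khd u))"
 by (auto simp: Lam_def khd_def Suc_le_length_iff numeral_3_eq_3 split: prod.splits)

lemma Lam_short: "\<not> 3 <= length u ==> Lam u = u"
 by (auto simp: Lam_def not_le less_Suc_eq numeral_3_eq_3 split: list.splits)

lemma length_lam [simp]: "length (lam x y w) = length w + 2"
 by (induction x y w rule: lam.induct) (auto split: prod.splits)

lemma outs_lam: "outs x y w = take (length w) (lam x y w)"
 by (induction x y w rule: outs.induct) (auto split: prod.splits)

lemma length_khd [simp]: "length (khd u) = length u"
 by (auto simp: khd_def split: list.splits prod.splits)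

lemma khd_Cons_ex: "3 <= length u ==> \<exists>s v. khd u = s # v & length v + 1 = length u"
 by (metis Suc_eq_plus1 add_is_0 length_Suc_conv length_greater_0_conv length_khd list.exhaust list.size(3)
   list.size(4) not_less_eq_eq numeral_eq_Suc zero_le)

lemma bb_Lam: "bb j (Lam u) = bb j u"
proof (induction "length u" arbitrary: u rule: less_induct)
 case less
 show ?case
 proof (cases "3 <= length u")
  case True
  then obtain s v where k: "khd u = s # v" "length v + 1 = length u" using khd_Cons_ex by blast
  have "bb j (Lam v) = bb j v" using less k by auto
  hence "bb j (Lam u) = bb j (khd u)" using Lam_rec[OF True] k by simp
  thus ?thesis by (simp add: bb_khd)
 next
  case False
  thus ?thesis by (simp add: Lam_short)
 qed
qed

lemma fop_Lam: "fop j (Lam u) = Lam (fop j u)"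
proof (induction "length u" arbitrary: u rule: less_induct)
 case less
 show ?case
 proof (cases "3 <= length u")
  case True
  then obtain s v where k: "khd u = s # v" "length v + 1 = length u" using khd_Cons_ex by blast
  have IH: "fop j (Lam v) = Lam (fop j v)" using less k by auto
  have kf: "khd (fop j u) = fop j (s # v)" using fop_khd[of j u] k by simp
  have "Lam (fop j u) = hd (khd (fop j u)) # Lam (tl (khd (fop j u)))"
   using True by (simp add: Lam_rec)
  also have "... = fop j (s # Lam v)" unfolding kf using IH by (simp add: bb_Lam)
  finally show ?thesis using Lam_rec[OF True] k by simp
 next
  case False
  thus ?thesis by (simp add: Lam_short)
 qed
qed

lemma bb_take_le: "bb j (take k w) <= bb j w"
proof (induction w arbitrary: k)
 case (Cons x w)
 show ?case using Cons.IH[of "k - 1"] by (cases k) auto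
qed simp

text \<open>The raised letter lies either beyond the cut or before it. In the second case the cut
  changes no bracket count; recording this lets the induction pass one more letter on the
  left.\<close>

lemma take_fop: "take k (fop j w) = take k w \<or>
  (take k (fop j w) = fop j (take k w) & bb j (take k w) = bb j w)"
proof (induction w arbitrary: k)
 case (Cons x w)
 show ?case
 proof (cases k)
  case (Suc k')
  show ?thesis using Cons.IH[of k'] bb_take_le[of j k' w] Suc by auto
 qed simp
qed simp

lemma fop_hd_less: "hd (fop j (x # y # w)) < fop j (x # y # w) ! 1 \<longleftrightarrow> x < y"
 by (cases "bb j w") auto

lemma fop_Cons2_ex: "\<exists>x' y' w'. fop j (x # y # w) = x' # y' # w' & length w' = length w & (x' < y' \<longleftrightarrow> x < y)"
proof -
 have "length (fop j (x # y # w)) = Suc (Suc (length w))" by (metis length_Cons length_fop)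
 then obtain x' y' w' where *: "fop j (x # y # w) = x' # y' # w'" "length w' = length w"
  unfolding length_Suc_conv by blast
 thus ?thesis using fop_hd_less[of j x y w] by (auto simp del: fop.simps)
qed

text \<open>\<open>outs\<close> is a prefix of \<open>Lam u\<close> and \<open>Lam\<close> commutes
  with \<open>fop\<close>, so the word handed to the recursion is either unchanged or again an image
  under \<open>fop\<close>; the first comparison is unaffected by
  \<open>fop_hd_less\<close>.\<close>

lemma dvw_fop: "dvw (fop j u) = dvw u"
proof (induction "length u" arbitrary: u rule: less_induct)
 case less
 show ?case
 proof (cases u rule: dvw.cases)
  case (3 x y w)
  obtain x' y' w' where f: "fop j u = x' # y' # w'" "length w' = length w" "x' < y' \<longleftrightarrow> x < y"
   using fop_Cons2_ex[of j x y w] 3 by auto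
  have "outs x' y' w' = take (length w) (Lam (fop j u))"
   using f by (simp add: outs_lam Lam_def)
  also have "... = take (length w) (fop j (Lam u))" by (simp add: fop_Lam)
  finally have o: "outs x' y' w' = take (length w) (fop j (Lam u))" .
  have o2: "outs x y w = take (length w) (Lam u)" using 3 by (simp add: outs_lam Lam_def)
  from take_fop[of "length w" j "Lam u"] have "outs x' y' w' = outs x y w | outs x' y' w' = fop j (outs x y w)"
   by (auto simp: o o2)
  moreover have "dvw (fop j (outs x y w)) = dvw (outs x y w)" by (rule less) (simp add: 3)
  ultimately show ?thesis using f 3 by auto
 qed auto
qed

lemma cmaj_fop: "cmaj (fop j u) = cmaj u"
proof (induction u rule: cmaj.induct)
 case (3 x y w)
 thus ?case by (cases "bb j w") (auto split: if_splits)
qed auto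

lemma fop_letters: "set (fop j w) \<subseteq> insert (Suc j) (set w)"
 by (induction w) auto
lemma eop_letters: "set (eop j w) \<subseteq> insert j (set w)"
 by (induction w) auto

lemma dvw_eop: "0 < bb j u ==> dvw (eop j u) = dvw u"
 using dvw_fop[of j "eop j u"] fop_eop[of j u] by simp
subsection \<open>Strings\<close>

lemma aa_bb_funpow_fop:
 "i <= aa j u ==> aa j ((fop j ^^ i) u) = aa j u - i & bb j ((fop j ^^ i) u) = bb j u + i"
proof (induction i)
 case (Suc i)
 hence "0 < aa j ((fop j ^^ i) u)" by simp
 from aa_fop[OF this] Suc show ?case by auto
qed simp

lemma aa_bb_funpow_eop:
 "i <= bb j u ==> bb j ((eop j ^^ i) u) = bb j u - i & aa j ((eop j ^^ i) u) = aa j u + i"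
proof (induction i)
 case (Suc i)
 hence "0 < bb j ((eop j ^^ i) u)" by simp
 from bb_eop[OF this] Suc show ?case by auto
qed simp

lemma eop_funpow_fop: "i <= aa j u ==> (eop j ^^ i) ((fop j ^^ i) u) = u"
proof (induction i)
 case (Suc i)
 have "0 < aa j ((fop j ^^ i) u)" using aa_bb_funpow_fop[of i j u] Suc by simp
 from eop_fop[OF this] have "eop j ((fop j ^^ Suc i) u) = (fop j ^^ i) u" by simp
 thus ?case using Suc by (simp add: funpow_swap1)
qed simp

lemma fop_funpow_eop: "i <= bb j u ==> (fop j ^^ i) ((eop j ^^ i) u) = u"
proof (induction i)
 case (Suc i)
 have "0 < bb j ((eop j ^^ i) u)" using aa_bb_funpow_eop[of i j u] Suc by simp
 from fop_eop[OF this] have "fop j ((eop j ^^ Suc i) u) = (eop j ^^ i) u" by simp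
 thus ?case using Suc by (simp add: funpow_swap1)
qed simp

text \<open>Each string is parametrised by its highest element in \<open>R\<close>. The threshold
  \<open>k\<close> cuts off the first \<open>k\<close> elements of every string:
  \<open>k = 0\<close> treats complete strings, \<open>k = 1\<close> serves the words with a fixed
  first violation, where the string has lost its top.\<close>

lemma sum_strings:
 fixes g :: "nat list => 'a::comm_monoid_add"
 assumes fin: "finite R" and ge: "\<And>u. u \<in> R ==> k <= bb j u"
  and f: "\<And>u. u \<in> R ==> 0 < aa j u ==> fop j u \<in> R"
  and e: "\<And>u. u \<in> R ==> k < bb j u ==> eop j u \<in> R"
 shows "sum g R = (\<Sum>u\<in>{u\<in>R. bb j u = k}. \<Sum>i\<le>aa j u. g ((fop j ^^ i) u))"
proof -
 have fR: "(fop j ^^ i) u \<in> R" if "u \<in> R" "i <= aa j u" for u i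
  using that
 proof (induction i)
  case (Suc i)
  thus ?case using f[of "(fop j ^^ i) u"] aa_bb_funpow_fop[of i j u] by simp
 qed simp
 have eR: "(eop j ^^ i) u \<in> R" if "u \<in> R" "i <= bb j u - k" for u i
  using that
 proof (induction i)
  case (Suc i)
  thus ?case using e[of "(eop j ^^ i) u"] aa_bb_funpow_eop[of i j u] by simp
 qed simp
 have "(\<Sum>u\<in>{u\<in>R. bb j u = k}. \<Sum>i\<le>aa j u. g ((fop j ^^ i) u)) =
   (\<Sum>(u, i)\<in>Sigma {u\<in>R. bb j u = k} (%u. {..aa j u}). g ((fop j ^^ i) u))"
  using fin by (subst sum.Sigma) auto
 also have "... = sum g R"
 proof (rule sum.reindex_bij_witness[where j = "%(u, i). (fop j ^^ i) u"
    and i = "%v. ((eop j ^^ (bb j v - k)) v, bb j v - k)"], goal_cases)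
  case (1 a) thus ?case using eop_funpow_fop aa_bb_funpow_fop by (auto split: prod.splits)
 next
  case (2 a) thus ?case using fR by auto
 next
  case (3 b) thus ?case using fop_funpow_eop[of "bb j b - k" j b] by simp
 next
  case (4 b)
  thus ?case using eR[of b "bb j b - k"] aa_bb_funpow_eop[of "bb j b - k" j b] ge[of b] by auto
 qed auto
 finally show ?thesis by simp
qed

section \<open>Monomials along strings\<close>

definition mon :: "(nat => 'a::comm_monoid_mult) => nat list => 'a" where
 "mon x u = prod_list (map x u)"

lemma mon_simps [simp]: "mon x [] = 1" "mon x (a # u) = x a * mon x u" "mon x (u @ v) = mon x u * mon x v"
 by (simp_all add: mon_def)

lemma mon_fop:
 fixes x :: "nat => 'a::field"
 assumes "0 < aa j u" "x j ~= 0"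
 shows "mon x (fop j u) = mon x u * (x (Suc j) / x j)"
 using assms(1) by (induction u) (use assms(2) in \<open>auto split: if_splits simp: field_simps\<close>)

lemma mon_funpow_fop:
 fixes x :: "nat => 'a::field"
 assumes "x j ~= 0"
 shows "i <= aa j u ==> mon x ((fop j ^^ i) u) = mon x u * (x (Suc j) / x j) ^ i"
proof (induction i)
 case (Suc i)
 have "0 < aa j ((fop j ^^ i) u)" using aa_bb_funpow_fop[of i j u] Suc by simp
 from mon_fop[where x = x, OF this assms] show ?case using Suc by simp
qed simp

abbreviation (input) sx :: "nat => (nat => 'a) => nat => 'a" where
 "sx j x \<equiv> x \<circ> Transposition.transpose j (Suc j)"

lemma mon_sx_count:
 fixes x :: "nat => 'a::field"
 shows "mon (sx j x) u * (x j ^ count (mset u) j * x (Suc j) ^ count (mset u) (Suc j)) =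
   mon x u * (x (Suc j) ^ count (mset u) j * x j ^ count (mset u) (Suc j))"
proof (induction u)
 case (Cons a u)
 consider "a = j" | "a = Suc j" | "a ~= j" "a ~= Suc j" by blast
 thus ?case
 proof cases
  case 1
  thus ?thesis using Cons
   by (simp add: algebra_simps)
 next
  case 2
  thus ?thesis using Cons
   by (simp add: algebra_simps)
 next
  case 3
  thus ?thesis using Cons by (simp add: transpose_def algebra_simps)
 qed
qed simp

text \<open>Exchanging the two variables carries the monomial at the top of a string to the one at
  its bottom: at a top the letters \<open>j\<close> outnumber the letters \<open>Suc j\<close> by
  exactly the length \<open>aa j u\<close>.\<close>

lemma mon_sx_top:
 fixes x :: "nat => 'a::field"
 assumes b: "bb j u = 0" and nz: "x j ~= 0" "x (Suc j) ~= 0"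
 shows "mon (sx j x) u = mon x u * (x (Suc j) / x j) ^ aa j u"
proof -
 let ?c = "count (mset u) j" and ?d = "count (mset u) (Suc j)"
 have c: "?c = aa j u + ?d" using aa_bb_count[of j u] b by simp
 have "mon (sx j x) u * x j ^ aa j u * (x j ^ ?d * x (Suc j) ^ ?d)
   = mon x u * x (Suc j) ^ aa j u * (x j ^ ?d * x (Suc j) ^ ?d)"
  using mon_sx_count[where x = x and j = j and u = u] unfolding c by (simp add: power_add algebra_simps)
 hence "mon (sx j x) u * x j ^ aa j u = mon x u * x (Suc j) ^ aa j u" using nz by simp
 thus ?thesis using nz by (simp add: field_simps power_divide)
qed

lemma sum_geo_rev:
 fixes r :: "'a::field"
 shows "(\<Sum>i\<le>n. r ^ (n - i)) = (\<Sum>i\<le>n. r ^ i)"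
 by (rule sum.reindex_bij_witness[where i = "%i. n - i" and j = "%i. n - i"]) auto

text \<open>On a complete string the monomials form a geometric progression with ratio
  \<open>x (Suc j) / x j\<close>, and exchanging the variables runs through it backwards.\<close>

lemma string_set_sym:
 fixes x :: "nat => 'a::field"
 assumes fin: "finite R"
  and f: "\<And>u. u \<in> R ==> 0 < aa j u ==> fop j u \<in> R"
  and e: "\<And>u. u \<in> R ==> 0 < bb j u ==> eop j u \<in> R"
  and W: "\<And>u. W (fop j u) = W u"
  and nz: "x j ~= 0" "x (Suc j) ~= 0"
 shows "(\<Sum>u\<in>R. W u * mon (sx j x) u) = (\<Sum>u\<in>R. W u * mon x u)"
proof -
 have Wp: "W ((fop j ^^ i) u) = W u" for i u by (induction i) (auto simp: W)
 define r where "r = x (Suc j) / x j"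
 have r0: "r ~= 0" using nz by (simp add: r_def)
 have ri: "sx j x (Suc j) / sx j x j = 1 / r" using nz by (simp add: r_def)
 have "(\<Sum>u\<in>R. W u * mon (sx j x) u) =
   (\<Sum>u\<in>{u\<in>R. bb j u = 0}. \<Sum>i\<le>aa j u. W u * mon x u * r ^ (aa j u - i))"
 proof (subst sum_strings[where k = 0 and j = j], use fin f e in auto, intro sum.cong refl)
  fix u i assume u: "u \<in> {u \<in> R. bb j u = 0}" and i: "i \<in> {..aa j u}"
  have "mon (sx j x) ((fop j ^^ i) u) = mon (sx j x) u * (1 / r) ^ i"
   using mon_funpow_fop[where x = "sx j x" and j = j and i = i and u = u] nz i ri by simp
  also have "... = mon x u * r ^ aa j u * (1 / r) ^ i"
   using mon_sx_top[where x = x and j = j and u = u] u nz by (simp add: r_def)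
  also have "... = mon x u * r ^ (aa j u - i)" using i r0 by (simp add: power_diff power_one_over)
  finally show "W ((fop j ^^ i) u) * mon (sx j x) ((fop j ^^ i) u) = W u * mon x u * r ^ (aa j u - i)"
   by (simp add: Wp)
 qed
 also have "... = (\<Sum>u\<in>{u\<in>R. bb j u = 0}. \<Sum>i\<le>aa j u. W u * mon x u * r ^ i)"
  by (simp add: sum_distrib_left[symmetric] sum_geo_rev)
 also have "... = (\<Sum>u\<in>R. W u * mon x u)"
  by (subst sum_strings[where k = 0 and j = j and R = R], use fin f e in auto, intro sum.cong refl)
   (use nz in \<open>simp add: Wp mon_funpow_fop r_def\<close>)
 finally show ?thesis .
qed

text \<open>Summing the geometric progression of each string: the full set arises from its tops by
  the Demazure operator, the isobaric divided difference
  \<open>f \<mapsto> (x_j f - x_{j+1} s_j f) / (x_j - x_{j+1})\<close>, stated here without the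
  division.\<close>

lemma string_set_tops:
 fixes x :: "nat => 'a::field"
 assumes fin: "finite R"
  and f: "\<And>u. u \<in> R ==> 0 < aa j u ==> fop j u \<in> R"
  and e: "\<And>u. u \<in> R ==> 0 < bb j u ==> eop j u \<in> R"
  and W: "\<And>u. W (fop j u) = W u"
  and nz: "x j ~= 0" "x (Suc j) ~= 0"
 defines "Tp \<equiv> {u\<in>R. bb j u = 0}"
 shows "(x j - x (Suc j)) * (\<Sum>u\<in>R. W u * mon x u) =
  x j * (\<Sum>u\<in>Tp. W u * mon x u) - x (Suc j) * (\<Sum>u\<in>Tp. W u * mon (sx j x) u)"
proof -
 have Wp: "W ((fop j ^^ i) u) = W u" for i u by (induction i) (auto simp: W)
 define r where "r = x (Suc j) / x j"
 have xr: "x (Suc j) = r * x j" using nz by (simp add: r_def)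
 have "(x j - x (Suc j)) * (\<Sum>u\<in>R. W u * mon x u) =
   (\<Sum>u\<in>Tp. (x j - x (Suc j)) * (\<Sum>i\<le>aa j u. W u * mon x u * r ^ i))"
  unfolding sum_distrib_left[symmetric] Tp_def
  by (subst sum_strings[where k = 0 and j = j and R = R], use fin f e in auto)
   (use nz in \<open>simp add: Wp mon_funpow_fop r_def sum_distrib_left mult.assoc\<close>)
 also have "... = (\<Sum>u\<in>Tp. x j * (W u * mon x u) - x (Suc j) * (W u * mon (sx j x) u))"
 proof (intro sum.cong refl)
  fix u assume u: "u \<in> Tp"
  have m: "mon (sx j x) u = mon x u * r ^ aa j u"
   using mon_sx_top[where x = x and j = j and u = u] u nz by (simp add: r_def Tp_def)
  have "(x j - x (Suc j)) * (\<Sum>i\<le>aa j u. W u * mon x u * r ^ i) =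
    W u * mon x u * x j * ((1 - r) * (\<Sum>i\<le>aa j u. r ^ i))"
   unfolding sum_distrib_left[symmetric] xr by (simp only: left_diff_distrib right_diff_distrib mult_1 mult_ac)
  also have "(1 - r) * (\<Sum>i\<le>aa j u. r ^ i) = 1 - r ^ Suc (aa j u)"
   using sum_gp_basic[of r "aa j u"] by simp
  also have "W u * mon x u * x j * (1 - r ^ Suc (aa j u)) =
    x j * (W u * mon x u) - x (Suc j) * (W u * mon (sx j x) u)"
   by (simp add: m xr algebra_simps)
  finally show "(x j - x (Suc j)) * (\<Sum>i\<le>aa j u. W u * mon x u * r ^ i) =
    x j * (W u * mon x u) - x (Suc j) * (W u * mon (sx j x) u)" .
 qed
 finally show ?thesis by (simp add: sum_subtractf sum_distrib_left)
qed

section \<open>Crystals and Demazure operators\<close>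

definition crystal :: "nat => nat list set => bool" where
 "crystal N C \<longleftrightarrow> (\<forall>u\<in>C. set u \<subseteq> {..<N}) & (\<forall>u\<in>C. \<forall>j. Suc j < N -->
   (0 < aa j u --> fop j u \<in> C) & (0 < bb j u --> eop j u \<in> C))"

text \<open>Words whose first letter is below \<open>j\<close> or a matched \<open>j\<close> keep it
  along their strings; they form the set \<open>A\<close> of complete strings, which the Demazure
  operator fixes by symmetry. The remaining words form complete strings \<open>B\<close> in which
  the top is the only word starting with \<open>j\<close>, all others starting with
  \<open>Suc j\<close>; there the operator rebuilds the strings from their tops.\<close>

lemma demazure_step:
 fixes x :: "nat => 'a::field"
 assumes C: "crystal N C" and fin: "finite C" and j: "Suc j < N" and ne: "[] \<notin> C"
  and W: "\<And>u. W (fop j u) = W u"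
  and nz: "x j ~= 0" "x (Suc j) ~= 0"
 shows "(x j - x (Suc j)) * (\<Sum>u\<in>{u\<in>C. hd u <= Suc j}. W u * mon x u) =
  x j * (\<Sum>u\<in>{u\<in>C. hd u <= j}. W u * mon x u) - x (Suc j) * (\<Sum>u\<in>{u\<in>C. hd u <= j}. W u * mon (sx j x) u)"
proof -
 define A where "A = {u\<in>C. hd u < j | (hd u = j & 0 < bb j (tl u))}"
 define B where "B = {u\<in>C. hd u = Suc j | (hd u = j & bb j (tl u) = 0)}"
 define Tp where "Tp = {u\<in>B. bb j u = 0}"
 have cf: "fop j u \<in> C" if "u \<in> C" "0 < aa j u" for u using C that j by (auto simp: crystal_def)
 have ce: "eop j u \<in> C" if "u \<in> C" "0 < bb j u" for u using C that j by (auto simp: crystal_def)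
 have neC: "u ~= []" if "u \<in> C" for u using that ne by auto
 have Af: "fop j u \<in> A" if "u \<in> A" "0 < aa j u" for u
 proof -
  have uC: "u \<in> C" using that by (simp add: A_def)
  then obtain a v where u: "u = a # v" using neC by (cases u) auto
  show ?thesis using that cf[OF uC] aa_fop[of j v] unfolding A_def u by (auto split: if_splits)
 qed
 have Ae: "eop j u \<in> A" if "u \<in> A" "0 < bb j u" for u
 proof -
  have uC: "u \<in> C" using that by (simp add: A_def)
  then obtain a v where u: "u = a # v" using neC by (cases u) auto
  show ?thesis using that ce[OF uC] bb_eop[of j v] unfolding A_def u by (auto split: if_splits)
 qed
 have Bf: "fop j u \<in> B" if "u \<in> B" "0 < aa j u" for u
 proof -
  have uC: "u \<in> C" using that by (simp add: B_def)
  then obtain a v where u: "u = a # v" using neC by (cases u) auto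
  show ?thesis using that cf[OF uC] unfolding B_def u by (auto split: if_splits)
 qed
 have Be: "eop j u \<in> B" if "u \<in> B" "0 < bb j u" for u
 proof -
  have uC: "u \<in> C" using that by (simp add: B_def)
  then obtain a v where u: "u = a # v" using neC by (cases u) auto
  show ?thesis using that ce[OF uC] unfolding B_def u by (auto split: if_splits)
 qed
 have symA: "(\<Sum>u\<in>A. W u * mon (sx j x) u) = (\<Sum>u\<in>A. W u * mon x u)"
  by (rule string_set_sym) (use fin Af Ae W nz in \<open>auto simp: A_def\<close>)
 have topB: "(x j - x (Suc j)) * (\<Sum>u\<in>B. W u * mon x u) =
  x j * (\<Sum>u\<in>Tp. W u * mon x u) - x (Suc j) * (\<Sum>u\<in>Tp. W u * mon (sx j x) u)"
  unfolding Tp_def by (rule string_set_tops) (use fin Bf Be W nz in \<open>auto simp: B_def\<close>)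
 have s1: "{u\<in>C. hd u <= Suc j} = A \<union> B" "A \<inter> B = {}" by (auto simp: A_def B_def)
 have s2: "{u\<in>C. hd u <= j} = A \<union> Tp"
 proof -
  have "u \<in> A | u \<in> Tp" if "u \<in> C" "hd u <= j" for u
   using that neC[OF that(1)] by (cases u) (auto simp: A_def Tp_def B_def)
  moreover have "hd u <= j" if "u \<in> Tp" for u
   using that neC[of u] by (cases u) (auto simp: Tp_def B_def)
  moreover have "A \<subseteq> {u\<in>C. hd u <= j}" "Tp \<subseteq> C" by (auto simp: A_def Tp_def B_def)
  ultimately show ?thesis by blast
 qed
 have s3: "A \<inter> Tp = {}" using s1 by (auto simp: Tp_def)
 have finAB: "finite A" "finite B" "finite Tp" using fin by (auto simp: A_def B_def Tp_def)
 show ?thesis unfolding s1 s2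
  by (simp add: sum.union_disjoint finAB s1 s3 symA ring_distribs topB) (simp add: algebra_simps topB[symmetric])
qed

section \<open>A Yang-Baxter relation for sweeping pairs\<close>

lemma K3_row: "y <= x ==> K3 x y z = (if z <= y then (x, y, z) else if z <= x then (y, x, z) else (x, z, y))"
 by (auto simp: K3_def)
lemma K3_col: "x < y ==> K3 x y z = (if z <= x then (x, z, y) else if z <= y then (y, x, z) else (x, y, z))"
 by (auto simp: K3_def)

text \<open>Knuth moves at the letters 2 to 4, then 1 to 3, then 2 to 4. By this rule a weakly
  decreasing pair \<open>a b\<close> and a strictly increasing pair \<open>c d\<close> trade
  places.\<close>

definition R4 :: "nat => nat => nat => nat => nat \<times> nat \<times> nat \<times> nat" where
 "R4 a b c d = (case K3 b c d of (p, q, r) => case K3 a p q of (s, t, u) => case K3 t u r of (v, w, x) => (s, v, w, x))"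

lemma R4_form: "b <= a ==> c < d ==> R4 a b c d =
  (if d <= b then (c, a, b, d)
  else if c <= b then (if d <= a then (b, a, d, c) else (a, d, b, c))
  else if c <= a then (if d <= a then (b, c, a, d) else (b, a, d, c))
  else (a, c, d, b))"
 by (auto simp: R4_def K3_def)

definition YBl :: "nat => nat => nat => nat => nat => nat \<times> nat \<times> nat \<times> nat \<times> nat" where
 "YBl a b c d z = (case K3 c d z of (s1, c', d') => case K3 a b s1 of (e, a', b') => (e, R4 a' b' c' d'))"
definition YBr :: "nat => nat => nat => nat => nat => nat \<times> nat \<times> nat \<times> nat \<times> nat" where
 "YBr a b c d z = (case R4 a b c d of (c2, d2, a2, b2) => case K3 a2 b2 z of (s2, a2', b2') =>
   case K3 c2 d2 s2 of (e2, c2', d2') => (e2, c2', d2', a2', b2'))"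

text \<open>Only the relative order of five letters enters: there are six orders of
  \<open>a\<close>, \<open>b\<close>, \<open>c\<close>, \<open>d\<close> compatible with the
  hypotheses, and \<open>z\<close> is compared with each of them.\<close>

lemma YB:
 assumes "b <= a" "c < d"
 shows "YBl a b c d z = YBr a b c d z"
proof -
 consider "c < d" "d <= b" "b <= a" | "c <= b" "b < d" "d <= a" | "c <= b" "b <= a" "a < d" | "b < c" "c < d" "d <= a" | "b < c" "c <= a" "a < d" | "b <= a" "a < c" "c < d"
  using assms by linarith
 thus ?thesis
  by cases (cases "z <= c"; cases "z <= d"; cases "z <= b"; cases "z <= a"; simp add: YBl_def YBr_def R4_def K3_def)+
qed

lemma K3_row_inv: "K3 x y z = (s, p, q) ==> y <= x ==> q <= p"
 by (auto simp: K3_row split: if_splits)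
lemma K3_col_inv: "K3 x y z = (s, p, q) ==> x < y ==> p < q"
 by (auto simp: K3_col split: if_splits)

text \<open>Iterates \<open>YB\<close> along the word. The carried pairs keep their types, one
  weakly decreasing and one strictly increasing, so the relation applies again at the next
  letter.\<close>

lemma YB_outs:
 "b <= a ==> c < d ==> R4 a b c d = (c2, d2, a2, b2) ==>
  outs c2 d2 (outs a2 b2 w) = outs a b (outs c d w)"
proof (induction w arbitrary: a b c d c2 d2 a2 b2)
 case (Cons z w)
 obtain s1 c' d' where k1: "K3 c d z = (s1, c', d')" by (metis prod_cases3)
 obtain e a' b' where k2: "K3 a b s1 = (e, a', b')" by (metis prod_cases3)
 obtain s2 a2' b2' where k3: "K3 a2 b2 z = (s2, a2', b2')" by (metis prod_cases3)
 obtain e2 c2' d2' where k4: "K3 c2 d2 s2 = (e2, c2', d2')" by (metis prod_cases3)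
 have "YBl a b c d z = YBr a b c d z" by (rule YB) (use Cons.prems in auto)
 hence *: "e2 = e" "R4 a' b' c' d' = (c2', d2', a2', b2')"
  by (auto simp: YBl_def YBr_def k1 k2 k3 k4 Cons.prems(3))
 show ?case
  using Cons.IH[OF K3_row_inv[OF k2] K3_col_inv[OF k1] *(2)] Cons.prems by (simp add: k1 k2 k3 k4 *)
qed simp

subsection \<open>Rotation of the alphabet\<close>

definition rti :: "nat => nat => nat" where "rti N a = (if a = N then 0 else a)"
definition rt :: "nat => nat => nat" where "rt N a = (if a = 0 then N else a)"
text \<open>Renaming \<open>N\<close> to 0 spoils the order inside a carried pair;
  \<open>rowi\<close> and \<open>coli\<close> reorder it so that it is again weakly decreasing,
  respectively strictly increasing.\<close>

definition rowi :: "nat => nat => nat => nat \<times> nat" where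
 "rowi N x y = (if x = N then (rti N y, 0) else (x, y))"
definition coli :: "nat => nat => nat => nat \<times> nat" where
 "coli N x y = (if y = N then (0, x) else (x, y))"

lemma rot_row_step:
 assumes "y <= x" "x <= N" "0 < y" "0 < z" "z <= N" "K3 x y z = (s, p, q)"
 shows "q <= p & p <= N & 0 < q \<and>
  K3 (fst (rowi N x y)) (snd (rowi N x y)) (rti N z) = (rti N s, rowi N p q)"
 using assms(6) unfolding K3_row[OF assms(1)]
 by (cases "x = N"; cases "y = N"; cases "z = N"; cases "z <= y"; cases "z <= x")
  (use assms in \<open>auto simp: rowi_def rti_def K3_def\<close>)

lemma rot_col_step:
 assumes "x < y" "y <= N" "0 < x" "0 < z" "z <= N" "K3 x y z = (s, p, q)"
 shows "p < q & q <= N & 0 < p \<and>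
  K3 (fst (coli N x y)) (snd (coli N x y)) (rti N z) = (rti N s, coli N p q)"
 using assms(6) unfolding K3_col[OF assms(1)]
 by (cases "y = N"; cases "z = N"; cases "z <= y"; cases "z <= x")
  (use assms in \<open>auto simp: coli_def rti_def K3_def\<close>)

lemma rot_row_outs:
 "y <= x ==> x <= N ==> 0 < y ==> set w \<subseteq> {0<..N} ==>
  outs (fst (rowi N x y)) (snd (rowi N x y)) (map (rti N) w) = map (rti N) (outs x y w)"
proof (induction w arbitrary: x y)
 case (Cons z w)
 obtain s p q where k: "K3 x y z = (s, p, q)" by (metis prod_cases3)
 have *: "q <= p & p <= N & 0 < q \<and>
  K3 (fst (rowi N x y)) (snd (rowi N x y)) (rti N z) = (rti N s, rowi N p q)"
  by (rule rot_row_step[OF _ _ _ _ _ k]) (use Cons.prems in auto)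
 thus ?case using Cons.IH[of q p] Cons.prems k by (auto split: prod.splits)
qed simp

lemma rot_col_outs:
 "x < y ==> y <= N ==> 0 < x ==> set w \<subseteq> {0<..N} ==>
  outs (fst (coli N x y)) (snd (coli N x y)) (map (rti N) w) = map (rti N) (outs x y w)"
proof (induction w arbitrary: x y)
 case (Cons z w)
 obtain s p q where k: "K3 x y z = (s, p, q)" by (metis prod_cases3)
 have *: "p < q & q <= N & 0 < p \<and>
  K3 (fst (coli N x y)) (snd (coli N x y)) (rti N z) = (rti N s, coli N p q)"
  by (rule rot_col_step[OF _ _ _ _ _ k]) (use Cons.prems in auto)
 thus ?case using Cons.IH[of p q] Cons.prems k by (auto split: prod.splits)
qed simp

lemma K3_set: "K3 x y z = (s, p, q) ==> {s, p, q} = {x, y, z}"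
 by (auto simp: K3_def split: if_splits)

lemma set_outs: "set (outs x y w) \<subseteq> {x, y} \<union> set w"
proof (induction w arbitrary: x y)
 case (Cons z w)
 obtain s p q where k: "K3 x y z = (s, p, q)" by (metis prod_cases3)
 from Cons[of p q] K3_set[OF k] show ?case by (auto simp: k)
qed simp

text \<open>Induction two letters at a time. After an initial weak descent the sweep emits
  \<open>N\<close> twice, which becomes a pair \<open>0 0\<close>, and the claim recurs for the
  shorter word. After an initial ascent the sweep leaves a column pair in front of the row pair, and
  \<open>YB_outs\<close> restores the order in which the hypothesis applies.\<close>

lemma dvw_rot:
 "set s \<subseteq> {0<..N} ==> dvw (map (rti N) (outs N N s)) = dvw s"
proof (induction "length s" arbitrary: s rule: less_induct)
 case less
 show ?case
 proof (cases s rule: dvw.cases)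
  case (2 x)
  thus ?thesis by (cases "K3 N N x") auto
 next
  case (3 a b w)
  note s = 3
  have ab: "0 < a" "a <= N" "0 < b" "b <= N" "set w \<subseteq> {0<..N}" using less.prems s by auto
  let ?s' = "outs a b w"
  have s'set: "set ?s' \<subseteq> {0<..N}" using set_outs[of a b w] ab by auto
  have IH: "dvw (map (rti N) (outs N N ?s')) = dvw ?s'" by (rule less) (use s s'set in auto)
  have NN: "rowi N N N = (0, 0)" by (simp add: rowi_def rti_def)
  show ?thesis
  proof (cases "b <= a")
   case True
   have "outs N N s = N # N # ?s'" using ab True by (simp add: s K3_def)
   hence "dvw (map (rti N) (outs N N s)) = 0 # dvw (outs 0 0 (map (rti N) ?s'))"
    by (simp add: rti_def)
   also have "outs 0 0 (map (rti N) ?s') = map (rti N) (outs N N ?s')"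
    using rot_row_outs[of N N N ?s'] s'set ab NN by simp
   finally show ?thesis using IH True by (simp add: s)
  next
   case False
   hence lt: "a < b" by simp
   let ?X = "outs N b w"
   have Xset: "set ?X \<subseteq> {0<..N}" using set_outs[of N b w] ab by auto
   have "outs N N s = N # a # ?X" using ab lt by (simp add: s K3_def)
   hence "dvw (map (rti N) (outs N N s)) = 1 # dvw (outs 0 a (map (rti N) ?X))"
    using ab lt by (simp add: rti_def)
   also have "outs 0 a (map (rti N) ?X) = map (rti N) (outs a N ?X)"
    using rot_col_outs[of a N N ?X] Xset ab lt by (simp add: coli_def)
   also have "outs a N ?X = outs N N ?s'"
   proof (rule YB_outs)
    show "R4 N N a b = (a, N, N, b)" using ab lt by (subst R4_form) auto
   qed (use lt in auto)
   finally show ?thesis using IH lt by (simp add: s)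
  qed
 qed simp
qed

text \<open>The source of the recursion: after the prefix \<open>0 # 0\<close> the word
  \<open>h\<close> is arbitrary, and its dominoes are those of \<open>h\<close> with 0 made the
  largest letter. The sweep of \<open>0 0\<close> through \<open>h\<close> is, after renaming, the
  sweep of \<open>N N\<close> treated in \<open>dvw_rot\<close>.\<close>

theorem dvw_00:
 assumes "set h \<subseteq> {..<N}"
 shows "dvw (0 # 0 # h) = 0 # dvw (map (rt N) h)"
proof (cases "N = 0")
 case False
 let ?s = "map (rt N) h"
 have ss: "set ?s \<subseteq> {0<..N}" using assms False by (auto simp: rt_def)
 have h: "h = map (rti N) ?s"
  using assms False by (auto simp: rt_def rti_def map_idI intro!: map_idI[symmetric])
 have "outs 0 0 h = map (rti N) (outs N N ?s)"
  using rot_row_outs[of N N N ?s] ss False by (subst h) (simp add: rowi_def rti_def)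
 thus ?thesis using dvw_rot[OF ss] by simp
qed (use assms in simp)

text \<open>Making 0 the largest letter removes the ascents out of a 0 and creates ascents into a 0.
  Weighted by position, the changes telescope to the number of nonzero letters, up to a boundary
  term at the first letter.\<close>

lemma cmaj_rt:
 "set (a # h) \<subseteq> {..<N} ==> cmaj (a # h) + (if a ~= 0 then length (a # h) else 0) =
  cmaj (map (rt N) (a # h)) + length (filter (%a. a ~= 0) (a # h))"
proof (induction h arbitrary: a)
 case (Cons b h)
 show ?case using Cons.IH[of b] Cons.prems by (auto simp: rt_def)
qed (auto simp: rt_def)

lemma cmaj_00:
 assumes "set h \<subseteq> {..<N}"
 shows "cmaj (0 # 0 # h) = cmaj (map (rt N) h) + length (filter (%a. a ~= 0) h)"
proof (cases h)
 case (Cons a h')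
 thus ?thesis using cmaj_rt[of a h' N] assms by auto
qed simp

lemma K3_map: "strict_mono g ==> K3 (g x) (g y) (g z) = (case K3 x y z of (s, p, q) => (g s, g p, g q))"
 by (simp add: K3_def strict_mono_less strict_mono_less_eq)

lemma outs_map: "strict_mono g ==> outs (g x) (g y) (map g w) = map g (outs x y w)"
 by (induction w arbitrary: x y) (auto simp: K3_map split: prod.splits)

lemma dvw_map: "strict_mono g ==> dvw (map g u) = dvw u"
 by (induction u rule: dvw.induct) (simp_all add: outs_map strict_mono_less)

lemma cmaj_map: "strict_mono g ==> cmaj (map g u) = cmaj u"
 by (induction u rule: cmaj.induct) (simp_all add: strict_mono_less)

section \<open>Generic evaluation points\<close>

text \<open>Kronecker substitution: exponents below \<open>B\<close> become the base
  \<open>B\<close> digits of one exponent of \<open>s\<close>, so that identities in many variables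
  are tested with univariate polynomials.\<close>

definition pt :: "nat => 'a::comm_semiring_1 => nat => 'a" where
 "pt B s = (%l. s ^ (B ^ l))"

lemma digits_inj:
 "(\<And>l. l < N ==> f l < B & g l < (B::nat)) ==> (\<Sum>l<N. f l * B ^ l) = (\<Sum>l<N. g l * B ^ l) ==> l < N ==> f l = g l"
proof (induction N arbitrary: f g l)
 case (Suc N)
 have sh: "(\<Sum>l<Suc N. h l * B ^ l) = h 0 + B * (\<Sum>l<N. h (Suc l) * B ^ l)" for h :: "nat => nat"
  by (subst sum.lessThan_Suc_shift) (simp add: sum_distrib_left mult_ac)
 have lt: "f 0 < B" "g 0 < B" using Suc.prems(1)[of 0] by auto
 have eq: "f 0 + B * (\<Sum>l<N. f (Suc l) * B ^ l) = g 0 + B * (\<Sum>l<N. g (Suc l) * B ^ l)"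
  using Suc.prems(2) by (simp only: sh)
 have f0: "f 0 = g 0" using arg_cong[OF eq, of "%x. x mod B"] lt by simp
 have "(\<Sum>l<N. f (Suc l) * B ^ l) = (\<Sum>l<N. g (Suc l) * B ^ l)" using eq f0 lt by simp
 hence "f (Suc l') = g (Suc l')" if "l' < N" for l'
  using Suc.IH[of "%l. f (Suc l)" "%l. g (Suc l)" l'] Suc.prems(1) that by auto
 thus ?case using f0 Suc.prems(3) by (cases l) auto
qed simp

text \<open>A univariate polynomial with infinitely many roots is zero. Several indices may share an
  exponent vector, hence the sum in the conclusion.\<close>

lemma mono_indep:
 fixes c :: "'i => 'a::field_char_0"
 assumes fin: "finite I" and S: "infinite S"
  and B: "\<And>i l. i \<in> I ==> l < N ==> ex i l < B"
  and z: "\<And>s. s \<in> S ==> (\<Sum>i\<in>I. c i * (\<Prod>l<N. pt B s l ^ ex i l)) = 0"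
 shows "(\<Sum>i\<in>{i\<in>I. \<forall>l<N. ex i l = be l}. c i) = 0"
proof (cases "\<forall>l<N. be l < B")
 case True
 define cd where "cd f = (\<Sum>l<N. f l * B ^ l)" for f :: "nat => nat"
 define p where "p = (\<Sum>i\<in>I. monom (c i) (cd (ex i)))"
 have "poly p s = (\<Sum>i\<in>I. c i * (\<Prod>l<N. pt B s l ^ ex i l))" for s
  by (simp add: p_def poly_sum poly_monom pt_def cd_def power_sum power_mult[symmetric] mult.commute)
 with z have "poly p s = 0" if "s \<in> S" for s using that by simp
 hence "p = 0" using S by (metis (mono_tags, lifting) finite_subset mem_Collect_eq poly_roots_finite subsetI)
 hence "coeff p (cd be) = 0" by simp
 moreover have "coeff p (cd be) = (\<Sum>i\<in>{i\<in>I. \<forall>l<N. ex i l = be l}. c i)"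
 proof -
  have "coeff p (cd be) = (\<Sum>i\<in>I. if cd (ex i) = cd be then c i else 0)"
   by (simp add: p_def coeff_sum)
  also have "... = (\<Sum>i\<in>{i\<in>I. cd (ex i) = cd be}. c i)" using fin by (simp add: sum.inter_filter)
  also have "{i\<in>I. cd (ex i) = cd be} = {i\<in>I. \<forall>l<N. ex i l = be l}"
  proof (intro Collect_cong conj_cong refl iffI)
   fix i assume "i \<in> I" "cd (ex i) = cd be"
   thus "\<forall>l<N. ex i l = be l" using digits_inj[of N "ex i" B be] B True unfolding cd_def by blast
  qed (simp add: cd_def)
  finally show ?thesis .
 qed
 ultimately show ?thesis by simp
next
 case False
 hence "{i\<in>I. \<forall>l<N. ex i l = be l} = {}" using B by fastforce
 thus ?thesis by (metis sum.empty)
qed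

lemma mon_count:
 "set u \<subseteq> {..<N} ==> mon x u = (\<Prod>l<N. x l ^ count (mset u) l)"
proof (induction u)
 case (Cons a u)
 have "(\<Prod>l<N. x l ^ count (mset (a # u)) l) = (\<Prod>l<N. (if l = a then x l else 1) * x l ^ count (mset u) l)"
  by (intro prod.cong) auto
 also have "... = x a * (\<Prod>l<N. x l ^ count (mset u) l)"
  using Cons.prems by (simp add: prod.distrib prod.delta)
 finally show ?case using Cons by simp
qed simp

text \<open>Vanishing at enough Kronecker points means vanishing as a polynomial, hence everywhere.
  This removes the genericity conditions under which an equation was derived by division.\<close>

lemma word_poly_zero:
 fixes c :: "'i => 'a::field_char_0"
 assumes fin: "finite I" and S: "infinite S"
  and N: "\<And>i. i \<in> I ==> set (w i) \<subseteq> {..<N}" and B: "\<And>i. i \<in> I ==> length (w i) < B"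
  and z: "\<And>s. s \<in> S ==> (\<Sum>i\<in>I. c i * mon (pt B s) (w i)) = 0"
 shows "(\<Sum>i\<in>I. c i * mon x (w i)) = 0"
proof -
 let ?ct = "%i. restrict (count (mset (w i))) {..<N}"
 have "(\<Sum>i\<in>I. c i * mon x (w i)) = (\<Sum>i\<in>I. c i * (\<Prod>l<N. x l ^ ?ct i l))"
  using N by (intro sum.cong) (auto simp: mon_count[of _ N])
 also have "... = (\<Sum>al\<in>?ct ` I. \<Sum>i\<in>{i\<in>I. ?ct i = al}. c i * (\<Prod>l<N. x l ^ ?ct i l))"
  by (rule sum.image_gen[OF fin])
 also have "... = (\<Sum>al\<in>?ct ` I. (\<Sum>i\<in>{i\<in>I. \<forall>l<N. count (mset (w i)) l = al l}. c i) * (\<Prod>l<N. x l ^ al l))"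
 proof (intro sum.cong refl)
  fix al assume al: "al \<in> ?ct ` I"
  have eq: "{i\<in>I. ?ct i = al} = {i\<in>I. \<forall>l<N. count (mset (w i)) l = al l}"
   using al by (auto simp: restrict_def fun_eq_iff)
  show "(\<Sum>i\<in>{i\<in>I. ?ct i = al}. c i * (\<Prod>l<N. x l ^ ?ct i l)) =
   (\<Sum>i\<in>{i\<in>I. \<forall>l<N. count (mset (w i)) l = al l}. c i) * (\<Prod>l<N. x l ^ al l)"
   unfolding eq sum_distrib_right by (intro sum.cong refl arg_cong2[where f = "(*)"] prod.cong) auto
 qed
 also have "... = 0"
 proof (intro sum.neutral ballI)
  fix al assume "al \<in> ?ct ` I"
  have "(\<Sum>i\<in>{i\<in>I. \<forall>l<N. count (mset (w i)) l = al l}. c i) = 0"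
  proof (rule mono_indep[OF fin S])
   show "count (mset (w i)) l < B" if "i \<in> I" for i l
    using B[OF that] count_le_length[of "w i" l] by (simp add: count_mset)
   show "(\<Sum>i\<in>I. c i * (\<Prod>l<N. pt B s l ^ count (mset (w i)) l)) = 0" if "s \<in> S" for s
    using z[OF that] N by (simp add: mon_count[of _ N, OF N])
  qed
  thus "(\<Sum>i\<in>{i\<in>I. \<forall>l<N. count (mset (w i)) l = al l}. c i) * (\<Prod>l<N. x l ^ al l) = 0" by simp
 qed
 finally show ?thesis .
qed

section \<open>Alternants and crystal characters\<close>

text \<open>Transpositions are conjugates of adjacent ones. Nonvanishing of the coordinates is
  carried along because the string lemmas divide by them.\<close>

lemma sym_adjacent:
 assumes adj: "\<And>j x. Suc j < N ==> (\<And>i. i < N ==> x i ~= (0::'a::zero)) ==> F (sx j x) = F x"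
  and p: "p permutes {..<N}" and x: "\<And>i. i < N ==> x i ~= 0"
 shows "F (x \<circ> p) = F x"
proof -
 have tr: "F (x \<circ> Transposition.transpose a b) = F x" if "a < b" "b < N" "\<And>i. i < N ==> x i ~= 0" for a b x
  using that
 proof (induction b arbitrary: x)
  case (Suc b)
  show ?case
  proof (cases "a = b")
   case True
   have "F (sx b x) = F x" by (rule adj) (use Suc.prems in auto)
   thus ?thesis by (simp only: True)
  next
   case False
   let ?t = "Transposition.transpose b (Suc b)"
   have eq: "Transposition.transpose a (Suc b) = ?t \<circ> Transposition.transpose a b \<circ> ?t"
    using False Suc.prems(1) by (auto simp: fun_eq_iff transpose_def)
   have nz1: "(x \<circ> ?t) i ~= 0" if "i < N" for i
    using that Suc.prems by (auto simp: transpose_def)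
   have nz2: "(x \<circ> ?t \<circ> Transposition.transpose a b) i ~= 0" if "i < N" for i
    using that Suc.prems by (auto simp: transpose_def)
   have "F (x \<circ> Transposition.transpose a (Suc b)) = F (sx b (x \<circ> ?t \<circ> Transposition.transpose a b))"
    by (simp add: eq comp_assoc)
   also have "... = F (x \<circ> ?t \<circ> Transposition.transpose a b)" by (rule adj) (use Suc.prems nz2 in auto)
   also have "... = F (x \<circ> ?t)" by (rule Suc.IH) (use False Suc.prems nz1 in auto)
   also have "... = F x" by (rule adj) (use Suc.prems in auto)
   finally show ?thesis .
  qed
 qed simp
 have tr': "F (x \<circ> Transposition.transpose a b) = F x" if "a < N" "b < N" "\<And>i. i < N ==> x i ~= 0" for a b x
  using tr[of a b x] tr[of b a x] that by (cases a b rule: linorder_cases) (auto simp: transpose_commute)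
 show ?thesis using p finite_lessThan x
 proof (induction p arbitrary: x rule: permutes_induct)
  case id thus ?case by simp
 next
  case (swap a b q)
  have "F (x \<circ> (Transposition.transpose a b \<circ> q)) = F ((x \<circ> Transposition.transpose a b) \<circ> q)" by (simp add: comp_assoc)
  also have "... = F (x \<circ> Transposition.transpose a b)"
   by (rule swap.IH) (use swap in \<open>auto simp: transpose_def\<close>)
  also have "... = F x" by (rule tr') (use swap in auto)
  finally show ?case .
 qed
qed

definition alt :: "nat => (nat => nat) => (nat => 'a::field_char_0) => 'a" where
 "alt N be x = (\<Sum>p | p permutes {..<N}. of_int (sign p) * (\<Prod>i<N. x (p i) ^ be i))"

lemma alt_swap:
 assumes j: "Suc j < N"
 shows "alt N (be \<circ> Transposition.transpose j (Suc j)) x = - alt N be x"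
proof -
 let ?t = "Transposition.transpose j (Suc j)"
 have t: "?t permutes {..<N}" by (rule permutes_swap_id) (use j in auto)
 have "alt N (be \<circ> ?t) x = (\<Sum>p | p permutes {..<N}. of_int (sign (p \<circ> ?t)) * (\<Prod>i<N. x ((p \<circ> ?t) i) ^ (be \<circ> ?t) i))"
  unfolding alt_def by (rule sum_permutations_compose_right[OF t])
 also have "... = (\<Sum>p | p permutes {..<N}. - (of_int (sign p) * (\<Prod>i<N. x (p i) ^ be i)))"
 proof (intro sum.cong refl)
  fix p assume "p \<in> {p. p permutes {..<N}}"
  hence "permutation p" by (auto simp: permutation_permutes)
  hence s: "sign (p \<circ> ?t) = - sign p" by (simp add: sign_compose permutation_swap_id sign_swap_id)
  have "(\<Prod>i<N. x ((p \<circ> ?t) i) ^ (be \<circ> ?t) i) = (\<Prod>i<N. x (p i) ^ be i)"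
   using prod.permute[OF t, of "%i. x (p i) ^ be i"] by (simp add: comp_def)
  thus "of_int (sign (p \<circ> ?t)) * (\<Prod>i<N. x ((p \<circ> ?t) i) ^ (be \<circ> ?t) i) =
   - (of_int (sign p) * (\<Prod>i<N. x (p i) ^ be i))" by (simp add: s)
 qed
 finally show ?thesis by (simp add: alt_def sum_negf)
qed

definition yam :: "nat => nat list => bool" where
 "yam N u \<longleftrightarrow> (\<forall>j. Suc j < N --> bb j u = 0)"

text \<open>Position \<open>k\<close> and letter of the first prefix that fails to be Yamanouchi. A
  condition on a prefix is stable under crystal operators that act to its right.\<close>

definition viol :: "nat => nat => nat => nat list => bool" where
 "viol N k j u \<longleftrightarrow> k < length u & Suc j < N & bb j (take (Suc k) u) = 1 \<and>
   (\<forall>i. Suc i < N --> bb i (take k u) = 0) & u ! k = Suc j"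

lemma bb_snoc: "bb j (w @ [x]) = bb j w | (x = Suc j & bb j (w @ [x]) = Suc (bb j w))"
 by (induction w) auto

lemma bb_take_mono: "k <= k' ==> bb j (take k w) <= bb j (take k' w)"
 using bb_take_le[of j k "take k' w"] by (simp add: min_def)

lemma viol_unique: "viol N k j u ==> viol N k' j' u ==> k = k' & j = j'"
proof -
 assume v: "viol N k j u" "viol N k' j' u"
 have "\<not> k < k'" using v bb_take_mono[of "Suc k" k' j u] by (auto simp: viol_def)
 moreover have "\<not> k' < k" using v bb_take_mono[of "Suc k'" k j' u] by (auto simp: viol_def)
 ultimately have "k = k'" by simp
 thus ?thesis using v by (auto simp: viol_def)
qed

lemma viol_exists: assumes "\<not> yam N u" shows "\<exists>k j. viol N k j u"
proof -
 define P where "P k \<longleftrightarrow> (\<exists>j. Suc j < N & 0 < bb j (take k u))" for k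
 have "P (length u)" using assms by (auto simp: P_def yam_def)
 then obtain K where K: "P K" "\<And>k. k < K ==> \<not> P k"
  using LeastI[of P] not_less_Least[of _ P] by metis
 obtain j where j: "Suc j < N" "0 < bb j (take K u)" using K(1) by (auto simp: P_def)
 have "K ~= 0" using j by (cases K) auto
 then obtain k where k: "K = Suc k" by (cases K) auto
 have nPk: "\<And>i. Suc i < N ==> bb i (take k u) = 0" using K(2)[of k] k by (auto simp: P_def)
 have kl: "k < length u" using nPk[OF j(1)] j k by (cases "k < length u") auto
 have "take K u = take k u @ [u ! k]" using kl k by (simp add: take_Suc_conv_app_nth)
 hence "bb j (take K u) = 1 & u ! k = Suc j" using bb_snoc[of j "take k u" "u ! k"] nPk[OF j(1)] j by auto
 hence "viol N k j u" using kl j nPk k by (auto simp: viol_def)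
 thus ?thesis by blast
qed

lemma viol_not_yam: "viol N k j u ==> \<not> yam N u"
 using bb_take_le[of j "Suc k" u] by (auto simp: viol_def yam_def)

text \<open>\<open>fop\<close> raises an unmatched \<open>j\<close>, and these all lie to the right
  of every unmatched \<open>Suc j\<close>; the hypothesis says that the letter at \<open>k\<close>
  is such an unmatched \<open>Suc j\<close>.\<close>

lemma take_fop_fix:
 "k < length w ==> bb j (take k w) < bb j (take (Suc k) w) ==> take (Suc k) (fop j w) = take (Suc k) w"
proof (induction w arbitrary: k)
 case (Cons x w)
 show ?case
 proof (cases k)
  case 0
  thus ?thesis using Cons.prems by (auto split: if_splits)
 next
  case (Suc k')
  hence "bb j (take k' w) < bb j (take (Suc k') w)" using Cons.prems by (auto split: if_splits)
  hence IH: "take (Suc k') (fop j w) = take (Suc k') w" using Cons Suc by auto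
  have "\<not> (x = j & bb j w = 0)"
   using Cons.prems(2) bb_take_le[of j "Suc k'" w] Suc by auto
  thus ?thesis using IH Suc by auto
 qed
qed simp

text \<open>\<open>eop\<close> lowers the last unmatched \<open>Suc j\<close>, which lies beyond the
  prefix as soon as the prefix does not contain all of them.\<close>

lemma take_eop_fix: "bb j (take k w) < bb j w ==> take k (eop j w) = take k w"
proof (induction w arbitrary: k)
 case (Cons x w)
 show ?case
 proof (cases k)
  case (Suc k')
  have *: "bb j (take k' w) < bb j w" using Cons.prems Suc by (auto split: if_splits)
  thus ?thesis using Cons.IH[OF *] Suc by auto
 qed simp
qed simp

definition ct :: "nat list => nat => nat" where "ct u = count (mset u)"

lemma ct_funpow_fop:
 "i <= aa j u ==> ct ((fop j ^^ i) u) = (ct u)(j := ct u j - i, Suc j := ct u (Suc j) + i) & i <= ct u j"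
proof (induction i)
 case (Suc i)
 let ?v = "(fop j ^^ i) u"
 have a: "0 < aa j ?v" using aa_bb_funpow_fop[of i j u] Suc by simp
 have m: "mset (fop j ?v) + {#j#} = mset ?v + {#Suc j#}" by (rule mset_fop[OF a])
 have cv: "ct ?v = (ct u)(j := ct u j - i, Suc j := ct u (Suc j) + i)" "i <= ct u j" using Suc by auto
 have e: "ct (fop j ?v) l + (if l = j then 1 else 0) = ct ?v l + (if l = Suc j then 1 else 0)" for l
  using arg_cong[OF m, of "%M. count M l"] by (auto simp: ct_def split: if_splits)
 have "Suc i <= ct u j" using e[of j] cv by (auto split: if_splits)
 moreover have "ct (fop j ?v) l = ((ct u)(j := ct u j - Suc i, Suc j := ct u (Suc j) + Suc i)) l" for l
  using e[of l] cv by (auto split: if_splits)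
 ultimately show ?case by (auto simp: fun_eq_iff)
qed (auto simp: fun_eq_iff)

definition stair :: "nat => nat => nat" where "stair N i = N - 1 - i"

text \<open>Littlewood-Richardson cancellation. By symmetry of the crystal sum, multiplying by the
  alternant gives alternants indexed by the weights of words. Words with a given first violation
  form strings without their tops; reflecting such a string exchanges two exponents of the
  alternant, so these contributions cancel.\<close>

lemma crystal_alt:
 fixes x :: "nat => 'a::field_char_0"
 assumes C: "crystal N C" and fin: "finite C"
  and W: "\<And>j u. W (fop j u) = W u"
  and nz: "\<And>i. i < N ==> x i ~= 0"
 shows "alt N (stair N) x * (\<Sum>u\<in>C. W u * mon x u) =
  (\<Sum>u\<in>{u\<in>C. yam N u}. W u * alt N (%i. stair N i + ct u i) x)"
proof -
 let ?F = "%x. \<Sum>u\<in>C. W u * mon x u"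
 have letters: "set u \<subseteq> {..<N}" if "u \<in> C" for u using C that by (auto simp: crystal_def)
 have sym: "?F (x \<circ> p) = ?F x" if "p permutes {..<N}" for p
 proof (rule sym_adjacent[OF _ that nz, where F = ?F])
  fix j and x :: "nat => 'a" assume j: "Suc j < N" and "\<And>i. i < N ==> x i ~= 0"
  thus "?F (sx j x) = ?F x"
   by (intro string_set_sym) (use fin C W in \<open>auto simp: crystal_def\<close>)
 qed auto
 have "alt N (stair N) x * ?F x =
   (\<Sum>p | p permutes {..<N}. of_int (sign p) * (\<Prod>i<N. x (p i) ^ stair N i) * ?F (x \<circ> p))"
  by (simp add: alt_def sum_distrib_right sym)
 also have "... = (\<Sum>p | p permutes {..<N}. \<Sum>u\<in>C. W u * (of_int (sign p) * (\<Prod>i<N. x (p i) ^ (stair N i + ct u i))))"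
 proof (intro sum.cong refl)
  fix p
  have "mon (x \<circ> p) u = (\<Prod>i<N. x (p i) ^ ct u i)" if "u \<in> C" for u
   using mon_count[OF letters[OF that], of "x \<circ> p"] by (simp add: ct_def)
  thus "of_int (sign p) * (\<Prod>i<N. x (p i) ^ stair N i) * ?F (x \<circ> p) =
   (\<Sum>u\<in>C. W u * (of_int (sign p) * (\<Prod>i<N. x (p i) ^ (stair N i + ct u i))))"
   by (simp add: sum_distrib_left power_add prod.distrib mult_ac)
 qed
 also have "... = (\<Sum>u\<in>C. W u * alt N (%i. stair N i + ct u i) x)"
  by (subst sum.swap) (simp add: alt_def sum_distrib_left)
 finally have 1: "alt N (stair N) x * ?F x = (\<Sum>u\<in>C. W u * alt N (%i. stair N i + ct u i) x)" .
 define G where "G u = W u * alt N (%i. stair N i + ct u i) x" for u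
 define Bk where "Bk k j = {u\<in>C. viol N k j u}" for k j
 have zero: "sum G (Bk k j) = 0" if j: "Suc j < N" for k j
 proof -
  have Wp: "W ((fop j ^^ i) u) = W u" for i u by (induction i) (auto simp: W)
  have "sum G (Bk k j) = (\<Sum>u\<in>{u\<in>Bk k j. bb j u = 1}. \<Sum>i\<le>aa j u. G ((fop j ^^ i) u))"
  proof (rule sum_strings)
   show "finite (Bk k j)" using fin by (simp add: Bk_def)
   show "1 <= bb j u" if "u \<in> Bk k j" for u
    using that bb_take_le[of j "Suc k" u] by (auto simp: Bk_def viol_def)
   show "fop j u \<in> Bk k j" if u: "u \<in> Bk k j" "0 < aa j u" for u
   proof -
    have t: "take (Suc k) (fop j u) = take (Suc k) u"
     by (rule take_fop_fix) (use u j in \<open>auto simp: Bk_def viol_def\<close>)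
    have t2: "take k (fop j u) = take k u" using arg_cong[OF t, of "take k"] by (simp add: min_def)
    have t3: "fop j u ! k = u ! k" using arg_cong[OF t, of "%l. l ! k"] by simp
    show ?thesis using u C j t t2 t3 by (auto simp: Bk_def viol_def crystal_def)
   qed
   show "eop j u \<in> Bk k j" if u: "u \<in> Bk k j" "1 < bb j u" for u
   proof -
    have t: "take (Suc k) (eop j u) = take (Suc k) u"
     by (rule take_eop_fix) (use u in \<open>auto simp: Bk_def viol_def\<close>)
    have t2: "take k (eop j u) = take k u" using arg_cong[OF t, of "take k"] by (simp add: min_def)
    have t3: "eop j u ! k = u ! k" using arg_cong[OF t, of "%l. l ! k"] by simp
    show ?thesis using u C j t t2 t3 by (auto simp: Bk_def viol_def crystal_def)
   qed
  qed
  also have "... = 0"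
  proof (rule sum.neutral, rule ballI)
   fix u assume u: "u \<in> {u\<in>Bk k j. bb j u = 1}"
   let ?a = "aa j u"
   \<comment> \<open>The excess 1 comes from \<open>bb j u = 1\<close> and equals the difference of
     the staircase at \<open>j\<close> and \<open>Suc j\<close>; so reversing the string exchanges
     the two shifted exponents exactly.\<close>
   have cc: "ct u j + 1 = ?a + ct u (Suc j)" using aa_bb_count[of j u] u by (simp add: ct_def)
   have anti: "G ((fop j ^^ (?a - i)) u) = - G ((fop j ^^ i) u)" if i: "i <= ?a" for i
   proof -
    have "(%l. stair N l + ct ((fop j ^^ (?a - i)) u) l) =
      (%l. stair N l + ct ((fop j ^^ i) u) l) \<circ> Transposition.transpose j (Suc j)"
     using ct_funpow_fop[of "?a - i" j u] ct_funpow_fop[of i j u] i cc j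
     by (auto simp: fun_eq_iff transpose_def stair_def)
    thus ?thesis using alt_swap[OF j, of "%l. stair N l + ct ((fop j ^^ i) u) l" x] by (simp add: G_def Wp)
   qed
   have "(\<Sum>i\<le>?a. G ((fop j ^^ i) u)) = (\<Sum>i\<le>?a. G ((fop j ^^ (?a - i)) u))"
    by (rule sum.reindex_bij_witness[where i = "%i. ?a - i" and j = "%i. ?a - i"]) auto
   also have "... = - (\<Sum>i\<le>?a. G ((fop j ^^ i) u))" by (simp add: anti sum_negf[symmetric])
   finally show "(\<Sum>i\<le>?a. G ((fop j ^^ i) u)) = 0"
    by (simp add: eq_neg_iff_add_eq_0 mult_2[symmetric])
  qed
  finally show ?thesis .
 qed
 define X where "X = {(k, j). \<exists>u\<in>C. viol N k j u}"
 have finX: "finite X"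
 proof -
  have "X \<subseteq> (\<Union>u\<in>C. {..<length u}) \<times> {..<N}" by (auto simp: X_def viol_def) 
  thus ?thesis using fin by (meson finite_SigmaI finite_UN_I finite_lessThan finite_subset)
 qed
 have bad: "{u\<in>C. \<not> yam N u} = (\<Union>(k, j)\<in>X. Bk k j)"
  using viol_exists viol_not_yam by (fastforce simp: X_def Bk_def)
 have "sum G {u\<in>C. \<not> yam N u} = (\<Sum>x\<in>X. sum G (case x of (k, j) => Bk k j))"
  unfolding bad
 proof (rule sum.UNION_disjoint[OF finX])
  show "\<forall>i\<in>X. finite (case i of (k, j) => Bk k j)" using fin by (auto simp: Bk_def)
  show "\<forall>i\<in>X. \<forall>j\<in>X. i ~= j --> (case i of (k, j) => Bk k j) \<inter> (case j of (k, j) => Bk k j) = {}"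
   using viol_unique by (fastforce simp: Bk_def)
 qed
 also have "... = 0" by (intro sum.neutral) (auto simp: X_def viol_def intro!: zero)
 finally have badz: "sum G {u\<in>C. \<not> yam N u} = 0" .
 have "sum G C = sum G {u\<in>C. yam N u} + sum G {u\<in>C. \<not> yam N u}"
  using fin by (subst sum.union_disjoint[symmetric]) (auto intro: sum.cong)
 thus ?thesis using 1 badz by (simp add: G_def)
qed

section \<open>Semistandard tableaux as a crystal\<close>

definition colst :: "nat list => nat list => bool" where
 "colst R R2 \<longleftrightarrow> length R2 <= length R & (\<forall>c<length R2. R ! c < R2 ! c)"

fun ssyt :: "nat list list => bool" where
 "ssyt [] = True"
| "ssyt [R] = sorted R"
| "ssyt (R # R2 # T) = (sorted R & colst R R2 & ssyt (R2 # T))"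

text \<open>Rows are read backwards and the bottom row first. Then a letter \<open>j\<close> in a
  lower row precedes the letters \<open>Suc j\<close> above it and can open a bracket for
  them.\<close>

definition rw :: "nat list list => nat list" where "rw T = concat (map rev T)"

lemma rw_simps [simp]: "rw [] = []" "rw (R # T) = rev R @ rw T" by (simp_all add: rw_def)

lemma bb_append: "bb j (A @ B) = bb j A + (bb j B - aa j A)"
 by (induction A) auto
lemma aa_append: "aa j (A @ B) = aa j B + (aa j A - bb j B)"
 by (induction A) (auto simp: bb_append)
lemma fop_append: "fop j (A @ B) = (if bb j B < aa j A then fop j A @ B else A @ fop j B)"
 by (induction A) (auto simp: bb_append)
lemma eop_append: "0 < bb j (A @ B) ==> eop j (A @ B) = (if aa j A < bb j B then A @ eop j B else eop j A @ B)"
 by (induction A) (auto simp: bb_append split: if_splits)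

lemma bb_aa_none: "j \<notin> set w ==> Suc j \<notin> set w ==> bb j w = 0 & aa j w = 0"
 by (induction w) auto
lemma bb_aa_rep: "bb j (replicate c j) = 0 & aa j (replicate c j) = c"
 by (induction c) auto
lemma bb_aa_rep_Suc: "bb j (replicate d (Suc j)) = d & aa j (replicate d (Suc j)) = 0"
 by (induction d) auto
lemma fop_rep: "0 < c ==> fop j (replicate c j) = Suc j # replicate (c - 1) j"
 by (cases c) (auto simp: bb_aa_rep)
lemma eop_rep: "0 < d ==> eop j (replicate d (Suc j)) = replicate (d - 1) (Suc j) @ [j]"
proof (induction d)
 case (Suc d)
 thus ?case by (cases d) (auto simp: bb_aa_rep_Suc)
qed simp

lemma sorted_split:
 fixes R :: "nat list"
 assumes "sorted R"
 obtains L H where "R = L @ replicate (count (mset R) j) j @ replicate (count (mset R) (Suc j)) (Suc j) @ H"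
  "\<forall>x\<in>set L. x < j" "\<forall>x\<in>set H. Suc j < x"
  "rev R = rev H @ replicate (count (mset R) (Suc j)) (Suc j) @ replicate (count (mset R) j) j @ rev L"
  "bb j (rev L) = 0" "aa j (rev L) = 0" "bb j (rev H) = 0" "aa j (rev H) = 0"
proof -
 have "filter (%x. x < j) R @ filter (%x. x = j) R @ filter (%x. x = Suc j) R @ filter (%x. Suc j < x) R = R"
  using assms
 proof (induction R)
  case (Cons a R)
  have f: "filter (%x. x < j) R = [] " if "a \<ge> j" using Cons.prems that by (auto simp: filter_empty_conv)
  have g: "filter (%x. x = j) R = [] " if "a > j" using Cons.prems that by (auto simp: filter_empty_conv)
  have h: "filter (%x. x = Suc j) R = [] " if "a > Suc j" using Cons.prems that by (auto simp: filter_empty_conv)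
  have IH: "filter (%x. x < j) R @ filter (%x. x = j) R @ filter (%x. x = Suc j) R @ filter (%x. Suc j < x) R = R"
   using Cons by simp
  consider "a < j" | "a = j" | "a = Suc j" | "a > Suc j" by linarith
  thus ?case
  proof cases
   case 1 thus ?thesis using IH by simp
  next
   case 2 thus ?thesis using IH f by simp
  next
   case 3 thus ?thesis using IH f g by simp
  next
   case 4 thus ?thesis using IH f g h by simp
  qed
 qed simp
 note e = this
 have r: "filter (%x. x = v) R = replicate (count (mset R) v) v" for v
  by (induction R) auto
 have R: "R = filter (%x. x < j) R @ replicate (count (mset R) j) j @ replicate (count (mset R) (Suc j)) (Suc j) @ filter (%x. Suc j < x) R"
  using e[unfolded r] by simp
 show ?thesis
  by (rule that[OF R _ _ trans[OF arg_cong[OF R, of rev]]]) (auto simp: bb_aa_none)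
qed

text \<open>In a reversed row every \<open>Suc j\<close> precedes every \<open>j\<close>, so nothing
  is matched.\<close>

lemma row_bb_aa:
 assumes "sorted R"
 shows "bb j (rev R) = count (mset R) (Suc j) & aa j (rev R) = count (mset R) j"
proof -
 obtain L H where "rev R = rev H @ replicate (count (mset R) (Suc j)) (Suc j) @ replicate (count (mset R) j) j @ rev L"
  "bb j (rev L) = 0" "aa j (rev L) = 0" "bb j (rev H) = 0" "aa j (rev H) = 0" by (rule sorted_split[OF assms])
 thus ?thesis by (simp add: bb_append aa_append bb_aa_rep bb_aa_rep_Suc)
qed

text \<open>The last \<open>j\<close> of the row is raised. The block of letters \<open>j\<close>
  that ends there is recorded for the column argument in \<open>colst_up_lower\<close>.\<close>

lemma row_fop:
 assumes s: "sorted R" and c: "0 < count (mset R) j"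
 shows "\<exists>i<length R. fop j (rev R) = rev (R[i := Suc j]) & sorted (R[i := Suc j]) \<and>
  (\<forall>k. i < k + count (mset R) j & k <= i --> R ! k = j) & count (mset R) j <= Suc i"
proof -
 define c d where "c = count (mset R) j" and "d = count (mset R) (Suc j)"
 obtain L H where R: "R = L @ replicate c j @ replicate d (Suc j) @ H"
  "\<forall>x\<in>set L. x < j" "\<forall>x\<in>set H. Suc j < x" "rev R = rev H @ replicate d (Suc j) @ replicate c j @ rev L"
  "bb j (rev L) = 0" "aa j (rev L) = 0" "bb j (rev H) = 0" "aa j (rev H) = 0"
  by (rule sorted_split[OF s]) (auto simp: c_def d_def)
 obtain c' where c': "c = Suc c'" using c by (cases c) (auto simp: c_def)
 have rr: "replicate c j = replicate c' j @ [j]" by (simp add: c' replicate_append_same)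
 let ?i = "length L + c'"
 have up: "R[?i := Suc j] = L @ replicate c' j @ replicate (Suc d) (Suc j) @ H"
  by (simp add: R(1) rr list_update_append)
 have "fop j (rev R) = rev H @ replicate d (Suc j) @ (Suc j # replicate c' j) @ rev L"
  by (simp add: R(4-) fop_append bb_append aa_append bb_aa_rep bb_aa_rep_Suc fop_rep c' del: replicate_Suc)
 also have "... = rev (R[?i := Suc j])" unfolding up by (simp add: replicate_app_Cons_same)
 finally have f: "fop j (rev R) = rev (R[?i := Suc j])" .
 have srt: "sorted (R[?i := Suc j])" using s R unfolding up by (auto simp: sorted_append)
 have "R ! k = j" if "?i < k + c" "k <= ?i" for k
  using that unfolding R(1) c' by (auto simp: nth_append simp del: replicate_Suc)
 moreover have "?i < length R" by (simp add: R(1) c')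
 ultimately show ?thesis using f srt c' unfolding c_def[symmetric] by (intro exI[of _ ?i]) auto
qed

lemma row_eop:
 assumes s: "sorted R" and c: "0 < count (mset R) (Suc j)"
 shows "\<exists>i. i + count (mset R) (Suc j) <= length R & eop j (rev R) = rev (R[i := j]) & sorted (R[i := j]) \<and>
  (\<forall>k. i <= k & k < i + count (mset R) (Suc j) --> R ! k = Suc j)"
proof -
 define c d where "c = count (mset R) j" and "d = count (mset R) (Suc j)"
 obtain L H where R: "R = L @ replicate c j @ replicate d (Suc j) @ H"
  "\<forall>x\<in>set L. x < j" "\<forall>x\<in>set H. Suc j < x" "rev R = rev H @ replicate d (Suc j) @ replicate c j @ rev L"
  "bb j (rev L) = 0" "aa j (rev L) = 0" "bb j (rev H) = 0" "aa j (rev H) = 0"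
  by (rule sorted_split[OF s]) (auto simp: c_def d_def)
 obtain d' where d': "d = Suc d'" using c by (cases d) (auto simp: d_def)
 let ?i = "length L + c"
 have up: "R[?i := j] = L @ replicate c j @ j # replicate d' (Suc j) @ H"
  by (simp add: R(1) d' list_update_append)
 have "eop j (rev R) = rev H @ (replicate d' (Suc j) @ [j]) @ replicate c j @ rev L"
  by (simp add: R(4-) eop_append bb_append aa_append bb_aa_rep bb_aa_rep_Suc eop_rep d' del: replicate_Suc)
 also have "... = rev (R[?i := j])" unfolding up by simp
 finally have f: "eop j (rev R) = rev (R[?i := j])" .
 have srt: "sorted (R[?i := j])" using s R unfolding up by (auto simp: sorted_append)
 have "R ! k = Suc j" if "?i <= k" "k < ?i + d" for k
  using that by (simp add: R(1) nth_append) arith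
 thus ?thesis using f srt R(1) unfolding d_def[symmetric] by (intro exI[of _ ?i]) auto
qed

lemma card_le_count: "A \<subseteq> {k. k < length R & R ! k = v} ==> card A <= count (mset R) v"
proof -
 assume "A \<subseteq> {k. k < length R & R ! k = v}"
 hence "card A <= card {k. k < length R & R ! k = v}" by (intro card_mono) auto
 also have "... = count (mset R) v"
 proof -
  have "count (mset R) v = length (filter (%x. x = v) R)" by (induction R) auto
  thus ?thesis by (simp add: length_filter_conv_card)
 qed
 finally show ?thesis .
qed

text \<open>If raising the last \<open>j\<close> clashed with a \<open>Suc j\<close> above it, every
  \<open>j\<close> of the row would have a \<open>Suc j\<close> above it, too many for the bound on
  \<open>R2\<close>.\<close>

lemma colst_up_lower:
 assumes col: "colst R R2" and s2: "sorted R2" and i: "i < length R"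
  and b: "\<forall>k. i < k + c & k <= i --> R ! k = j" and ci: "c <= Suc i" and lt: "count (mset R2) (Suc j) < c"
 shows "colst (R[i := Suc j]) R2"
proof -
 have "Suc j < R2 ! i" if i2: "i < length R2"
 proof (rule ccontr)
  assume "\<not> Suc j < R2 ! i"
  have "{Suc i - c..i} \<subseteq> {k. k < length R2 & R2 ! k = Suc j}"
  proof
   fix k assume k: "k \<in> {Suc i - c..i}"
   hence "R ! k = j" using b lt by auto
   moreover have "R ! k < R2 ! k" using col k i2 by (auto simp: colst_def)
   moreover have "R2 ! k <= R2 ! i" using s2 k i2 by (auto simp: sorted_iff_nth_mono)
   ultimately show "k \<in> {k. k < length R2 & R2 ! k = Suc j}" using k i2 \<open>\<not> Suc j < R2 ! i\<close> by auto
  qed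
  from card_le_count[OF this] show False using lt ci by simp
 qed
 thus ?thesis using col i by (auto simp: colst_def nth_list_update)
qed

text \<open>Dual argument: a clash below the first \<open>Suc j\<close> of \<open>R2\<close> would
  put a \<open>j\<close> below each \<open>Suc j\<close> of the block, contradicting the bound on
  \<open>R\<close>.\<close>

lemma colst_dn_upper:
 assumes col: "colst R R2" and s: "sorted R" and i: "i + d <= length R2"
  and b: "\<forall>k. i <= k & k < i + d --> R2 ! k = Suc j" and lt: "count (mset R) j < d"
 shows "colst R (R2[i := j])"
proof -
 have "R ! i < j"
 proof (rule ccontr)
  assume "\<not> R ! i < j"
  have "{i..<i + d} \<subseteq> {k. k < length R & R ! k = j}"
  proof
   fix k assume k: "k \<in> {i..<i + d}"
   hence "R2 ! k = Suc j" using b by auto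
   moreover have "R ! k < R2 ! k" using col k i by (auto simp: colst_def)
   moreover have "R ! i <= R ! k" using s k i col by (auto simp: sorted_iff_nth_mono colst_def)
   ultimately show "k \<in> {k. k < length R & R ! k = j}" using k i col \<open>\<not> R ! i < j\<close> by (auto simp: colst_def)
  qed
  from card_le_count[OF this] show False using lt by simp
 qed
 thus ?thesis using col i lt by (auto simp: colst_def nth_list_update)
qed

lemma ssyt_sorted_hd: "ssyt (R # T) ==> sorted R" by (cases T) auto

text \<open>The entrywise comparison in the conclusion is what the next row below needs: raising
  entries above it cannot violate column strictness.\<close>

lemma ssyt_fop:
 "ssyt T ==> 0 < aa j (rw T) ==>
  \<exists>T'. ssyt T' & rw T' = fop j (rw T) & list_all2 (list_all2 (\<le>)) T T'"
proof (induction T rule: ssyt.induct)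
 case (2 R)
 hence c: "0 < count (mset R) j" using row_bb_aa[of R j] by simp
 obtain i where "i < length R" "fop j (rev R) = rev (R[i := Suc j])" "sorted (R[i := Suc j])"
  "\<forall>k. i < k + count (mset R) j & k <= i --> R ! k = j" using row_fop[OF _ c] 2 by auto
 thus ?case using c
  by (intro exI[of _ "[R[i := Suc j]]"]) (auto simp: list_all2_conv_all_nth nth_list_update)
next
 case (3 R R2 T)
 hence s: "sorted R" and col: "colst R R2" and st: "ssyt (R2 # T)" by auto
 note s2 = ssyt_sorted_hd[OF st]
 show ?case
 proof (cases "bb j (rw (R2 # T)) < aa j (rev R)")
  case True
  have c: "0 < count (mset R) j" using True row_bb_aa[OF s, of j] by (simp del: count_greater_zero_iff)
  obtain i where i: "i < length R" "fop j (rev R) = rev (R[i := Suc j])" "sorted (R[i := Suc j])"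
   "\<forall>k. i < k + count (mset R) j & k <= i --> R ! k = j" "count (mset R) j <= Suc i" using row_fop[OF s c] by auto
  have "count (mset R2) (Suc j) < count (mset R) j"
   using True row_bb_aa[OF s, of j] row_bb_aa[OF s2, of j] by (simp add: bb_append)
  hence "colst (R[i := Suc j]) R2" using colst_up_lower[OF col s2 i(1,4,5)] by simp
  moreover have "R ! i = j" using i c by auto
  ultimately have "colst (R[i := Suc j]) R2" "R ! i = j" by auto
  thus ?thesis using True i st c
   by (intro exI[of _ "R[i := Suc j] # R2 # T"])
    (auto simp: fop_append list_all2_conv_all_nth nth_list_update nth_Cons split: nat.splits)
 next
  case False
  hence "0 < aa j (rw (R2 # T))" using 3 by (simp add: aa_append)
  then obtain T' where T': "ssyt T'" "rw T' = fop j (rw (R2 # T))" "list_all2 (list_all2 (\<le>)) (R2 # T) T'"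
   using 3 st by blast
  then obtain R2' T2' where T2: "T' = R2' # T2'" "list_all2 (\<le>) R2 R2'" by (auto simp: list_all2_Cons1)
  have "colst R R2'" using col T2(2) by (fastforce simp: colst_def list_all2_conv_all_nth)
  thus ?thesis using False T' T2 s
   by (intro exI[of _ "R # T'"]) (auto simp: fop_append list_all2_refl)
 qed
qed simp

text \<open>Lowering an entry may violate column strictness with the row below, so the conclusion
  also tracks the bottom row: either it is untouched, or its first \<open>Suc j\<close> was lowered
  and all unmatched letters come from this row.\<close>

lemma ssyt_eop:
 "ssyt T ==> 0 < bb j (rw T) ==>
  \<exists>T'. ssyt T' & rw T' = eop j (rw T) & map length T' = map length T \<and>
   (hd T' = hd T | (bb j (rw T) = count (mset (hd T)) (Suc j) \<and>
     (\<exists>i. i + count (mset (hd T)) (Suc j) <= length (hd T) & hd T' = (hd T)[i := j] \<and>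
     (\<forall>k. i <= k & k < i + count (mset (hd T)) (Suc j) --> hd T ! k = Suc j))))"
proof (induction T rule: ssyt.induct)
 case (2 R)
 hence c: "0 < count (mset R) (Suc j)" using row_bb_aa[of R j] by simp
 obtain i where i: "i + count (mset R) (Suc j) <= length R" "eop j (rev R) = rev (R[i := j])" "sorted (R[i := j])"
  "\<forall>k. i <= k & k < i + count (mset R) (Suc j) --> R ! k = Suc j" using row_eop[OF _ c] 2 by auto
 have "bb j (rev R) = count (mset R) (Suc j)" using row_bb_aa[of R j] 2 by simp
 thus ?case using i by (intro exI[of _ "[R[i := j]]"]) auto
next
 case (3 R R2 T)
 hence s: "sorted R" and col: "colst R R2" and st: "ssyt (R2 # T)" by auto
 note s2 = ssyt_sorted_hd[OF st]
 show ?case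
 proof (cases "aa j (rev R) < bb j (rw (R2 # T))")
  case False
  hence bR: "bb j (rw (R # R2 # T)) = count (mset R) (Suc j)" using row_bb_aa[OF s, of j] by (simp add: bb_append)
  hence c: "0 < count (mset R) (Suc j)" using 3 by simp
  obtain i where i: "i + count (mset R) (Suc j) <= length R" "eop j (rev R) = rev (R[i := j])" "sorted (R[i := j])"
   "\<forall>k. i <= k & k < i + count (mset R) (Suc j) --> R ! k = Suc j" using row_eop[OF s c] by auto
  have "R ! i = Suc j" using i(4) c by auto
  moreover have "i < length R" using i(1) c by linarith
  ultimately have "colst (R[i := j]) R2" using col by (force simp: colst_def nth_list_update)
  moreover have "eop j (rw (R # R2 # T)) = eop j (rev R) @ rw (R2 # T)"
   using False eop_append[of j "rev R" "rw (R2 # T)"] 3 by simp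
  ultimately show ?thesis using i st bR by (intro exI[of _ "R[i := j] # R2 # T"]) auto
 next
  case True
  hence "0 < bb j (rw (R2 # T))" by simp
  then obtain T' where T': "ssyt T'" "rw T' = eop j (rw (R2 # T))" "map length T' = map length (R2 # T)"
   and h: "hd T' = R2 | (bb j (rw (R2 # T)) = count (mset R2) (Suc j) \<and>
     (\<exists>i. i + count (mset R2) (Suc j) <= length R2 & hd T' = R2[i := j] \<and>
     (\<forall>k. i <= k & k < i + count (mset R2) (Suc j) --> R2 ! k = Suc j)))"
   using 3 st by fastforce
  obtain R2' T2' where T2: "T' = R2' # T2'" using T'(3) by (cases T') auto
  have "colst R R2'"
  proof (cases "R2' = R2")
   case False
   then obtain i where "bb j (rw (R2 # T)) = count (mset R2) (Suc j)"
     "i + count (mset R2) (Suc j) <= length R2" "R2' = R2[i := j]"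
     "\<forall>k. i <= k & k < i + count (mset R2) (Suc j) --> R2 ! k = Suc j" using h T2 by auto
   thus ?thesis using colst_dn_upper[OF col s] True row_bb_aa[OF s, of j] by simp
  qed (use col in simp)
  moreover have "eop j (rw (R # R2 # T)) = rev R @ eop j (rw (R2 # T))"
   using True eop_append[of j "rev R" "rw (R2 # T)"] 3 by simp
  ultimately show ?thesis using T' T2 s by (intro exI[of _ "R # T'"]) auto
 qed
qed simp

definition ssw :: "nat => nat list => nat list set" where
 "ssw N la = {rw T | T. map length T = la & ssyt T & set (rw T) \<subseteq> {..<N}}"

lemma length_rw: "length (rw T) = sum_list (map length T)" by (induction T) auto

lemma finite_ssw [simp]: "finite (ssw N la)"
 by (rule finite_subset[OF _ finite_lists_length_eq[of "{..<N}" "sum_list la"]])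
  (auto simp: ssw_def length_rw)

lemma crystal_ssw: "crystal N (ssw N la)"
 unfolding crystal_def
proof (intro conjI ballI allI impI)
 fix u j assume u: "u \<in> ssw N la" and j: "Suc j < N"
 then obtain T where T: "u = rw T" "map length T = la" "ssyt T" "set (rw T) \<subseteq> {..<N}" by (auto simp: ssw_def)
 show "fop j u \<in> ssw N la" if a: "0 < aa j u"
 proof -
  obtain T' where T': "ssyt T'" "rw T' = fop j u" "list_all2 (list_all2 (\<le>)) T T'"
   using ssyt_fop[OF T(3)] a T(1) by auto
  have "map length T' = map length T" using T'(3)
   by (auto simp: list_all2_conv_all_nth intro!: nth_equalityI)
  moreover have "set (fop j u) \<subseteq> {..<N}" using fop_letters[of j u] T j by auto
  ultimately show ?thesis using T' T unfolding ssw_def by (intro CollectI exI[of _ T']) auto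
 qed
 show "eop j u \<in> ssw N la" if a: "0 < bb j u"
 proof -
  obtain T' where T': "ssyt T'" "rw T' = eop j u" "map length T' = map length T"
   using ssyt_eop[OF T(3)] a T(1) by auto
  moreover have "set (eop j u) \<subseteq> {..<N}" using eop_letters[of j u] T j by auto
  ultimately show ?thesis using T unfolding ssw_def by (intro CollectI exI[of _ T']) auto
 qed
qed (auto simp: ssw_def)

subsection \<open>Yamanouchi words\<close>

lemma yam_prefix:
 assumes "yam N (P @ Suc j # Q)" "Suc j < N"
 shows "count (mset P) (Suc j) < count (mset P) j"
proof -
 have "bb j (P @ [Suc j]) <= bb j (P @ Suc j # Q)"
  using bb_take_le[of j "Suc (length P)" "P @ Suc j # Q"] by simp
 hence "bb j (P @ [Suc j]) = 0" using assms by (simp add: yam_def)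
 thus ?thesis using aa_bb_count[of j "P @ [Suc j]"] by simp
qed

text \<open>The superstandard tableau with rows numbered from \<open>r\<close>; its word is the
  Yamanouchi word of the shape.\<close>

fun srow :: "nat => nat list => nat list list" where
 "srow r [] = []"
| "srow r (n # la) = replicate n r # srow (Suc r) la"

text \<open>The prefix \<open>P\<close> holds the rows already read, with letters below
  \<open>r\<close>. If the next row ended in a letter \<open>Suc j\<close> above \<open>r\<close>,
  this letter would be read first, without any \<open>j\<close> before it.\<close>

lemma yam_ssyt_unique:
 "ssyt T ==> (T ~= [] ==> \<forall>x\<in>set (hd T). r <= x) ==> set P \<subseteq> {..<r} ==> yam N (P @ rw T) ==>
  set (rw T) \<subseteq> {..<N} ==> T = srow r (map length T)"
proof (induction T arbitrary: r P)
 case (Cons R T)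
 have s: "sorted R" using Cons.prems(1) by (rule ssyt_sorted_hd)
 have R: "R = replicate (length R) r"
 proof (cases "R = []")
  case False
  have "last R <= r"
  proof (rule ccontr)
   assume "\<not> last R <= r"
   then obtain j where j: "last R = Suc j" "r <= j" by (cases "last R") auto
   have "rev R = last R # rev (butlast R)" using False
    by (metis append_butlast_last_id rev.simps(2) rev_rev_ident)
   hence "P @ rw (R # T) = P @ last R # (rev (butlast R) @ rw T)" by (simp only: rw_simps append_Cons)
   hence "yam N (P @ Suc j # (rev (butlast R) @ rw T))" using Cons.prems(4) j(1) by metis
   moreover have "Suc j < N" using Cons.prems(5) False j last_in_set[OF False] by auto
   ultimately have "count (mset P) (Suc j) < count (mset P) j" by (rule yam_prefix)
   hence "count (mset P) j ~= 0" by linarith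
   hence "j \<in> set P" by (metis count_eq_zero_iff set_mset_mset)
   thus False using Cons.prems(3) j by auto
  qed
  moreover have "x <= last R" if "x \<in> set R" for x
  proof -
   obtain i where "i < length R" "x = R ! i" using \<open>x \<in> set R\<close> by (metis in_set_conv_nth)
   thus ?thesis using s False by (simp add: last_conv_nth sorted_iff_nth_mono)
  qed
  ultimately have "\<forall>x\<in>set R. x = r" using Cons.prems(2) by fastforce
  thus ?thesis by (simp add: replicate_length_same)
 qed simp
 have "T = srow (Suc r) (map length T)"
 proof (rule Cons.IH)
  show "ssyt T" using Cons.prems(1) by (cases T) auto
  show "\<forall>x\<in>set (hd T). Suc r <= x" if "T ~= []"
  proof -
   obtain R2 T2 where T: "T = R2 # T2" using \<open>T ~= []\<close> by (cases T) auto
   have "colst R R2" using Cons.prems(1) T by simp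
   hence "r < R2 ! c" if "c < length R2" for c using that R
    by (metis colst_def le_eq_less_or_eq less_trans nth_replicate linorder_not_less order_less_le_trans)
   thus ?thesis by (auto simp: T in_set_conv_nth Suc_le_eq)
  qed
  show "set (P @ rev R) \<subseteq> {..<Suc r}" using Cons.prems(3) R by (metis Un_subset_iff insert_subset lessThan_Suc
    set_append set_replicate_conv_if set_rev subset_insertI2 subset_insertI empty_subsetI lessThan_iff less_Suc_eq)
  show "yam N ((P @ rev R) @ rw T)" using Cons.prems(4) by simp
  show "set (rw T) \<subseteq> {..<N}" using Cons.prems(5) by simp
 qed
 thus ?case using R by simp
qed simp

lemma ssyt_srow: "sorted_wrt (\<ge>) la ==> ssyt (srow r la)"
proof (induction r la rule: srow.induct)
 case (2 r n la)
 thus ?case by (cases la) (auto simp: colst_def)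
qed simp

lemma map_length_srow [simp]: "map length (srow r la) = la"
 by (induction r la rule: srow.induct) auto

lemma ct_srow: "ct (rw (srow r la)) i = (if r <= i & i - r < length la then la ! (i - r) else 0)"
 by (induction r la rule: srow.induct) (auto simp: ct_def nth_Cons')

lemma set_srow: "set (rw (srow r la)) \<subseteq> {..<r + length la}"
 by (induction r la rule: srow.induct) (auto simp: set_replicate_conv_if)

lemma bb_srow: "sorted_wrt (\<ge>) la ==>
  bb j (rw (srow r la)) <= (if Suc j = r & la ~= [] then hd la else 0)"
proof (induction r la rule: srow.induct)
 case (2 r n la)
 have IH: "bb j (rw (srow (Suc r) la)) <= (if Suc j = Suc r & la ~= [] then hd la else 0)"
  using 2 by simp
 have n: "la ~= [] ==> hd la <= n" using 2 by (cases la) auto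
 consider "r = j" | "r = Suc j" | "r ~= j" "r ~= Suc j" by blast
 thus ?case
 proof cases
  case 1
  thus ?thesis using IH n bb_aa_rep[of j n] by (auto simp: bb_append split: if_splits)
 next
  case 2
  thus ?thesis using IH bb_aa_rep_Suc[of j n] by (auto simp: bb_append)
 next
  case 3
  hence "bb j (replicate n r) = 0" "aa j (replicate n r) = 0"
   using bb_aa_none[of j "replicate n r"] by auto
  thus ?thesis using IH 3 by (auto simp: bb_append)
 qed
qed simp

lemma yam_ssw:
 assumes la: "sorted_wrt (\<ge>) la" and N: "length la <= N"
 shows "{u\<in>ssw N la. yam N u} = {rw (srow 0 la)}"
proof -
 have "rw (srow 0 la) \<in> ssw N la"
  unfolding ssw_def using ssyt_srow[OF la, of 0] set_srow[of 0 la] N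
  by (intro CollectI exI[of _ "srow 0 la"]) auto
 moreover have "yam N (rw (srow 0 la))" using bb_srow[OF la, of _ 0] by (auto simp: yam_def)
 moreover have "u = rw (srow 0 la)" if "u \<in> ssw N la" "yam N u" for u
  using that yam_ssyt_unique[of _ 0 "[]" N] by (auto simp: ssw_def)
 ultimately show ?thesis by blast
qed

definition shp :: "nat => nat list => nat list" where
 "shp N u = filter (%x. 0 < x) (map (ct u) [0..<N])"

lemma yam_mono: "yam N u ==> Suc j < N ==> ct u (Suc j) <= ct u j"
 using aa_bb_count[of j u] by (auto simp: yam_def ct_def)

text \<open>For a weakly decreasing function the zeros stand at the end, so dropping them shifts no
  position.\<close>

lemma filter_pos_decr:
 fixes f :: "nat => nat"
 assumes "\<And>j. Suc j < N ==> f (Suc j) <= f j"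
 shows "sorted_wrt (\<ge>) (filter (%x. 0 < x) (map f [0..<N])) \<and>
  (\<forall>i<N. (if i < length (filter (%x. 0 < x) (map f [0..<N])) then filter (%x. 0 < x) (map f [0..<N]) ! i else 0) = f i)"
 using assms
proof (induction N)
 case (Suc N)
 let ?F = "filter (%x. 0 < x) (map f [0..<N])"
 have IH: "sorted_wrt (\<ge>) ?F" "\<forall>i<N. (if i < length ?F then ?F ! i else 0) = f i" using Suc by auto
 have mono: "f N <= f i" if "i <= N" for i
  using that
 proof (induction rule: inc_induct)
  case (step k)
  thus ?case using Suc.prems[of k] by simp
 qed simp
 show ?case
 proof (cases "f N = 0")
  case True
  have "length ?F <= N" by (metis diff_zero length_filter_le length_map length_upt)
  hence "\<forall>i<length ?F. ?F ! i = f i" using IH(2) by (metis order_less_le_trans)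
  moreover have "\<forall>i<N. \<not> i < length ?F --> f i = 0" using IH(2) by metis
  moreover have "filter (%x. 0 < x) (map f [0..<Suc N]) = ?F" using True by simp
  ultimately show ?thesis using IH(1) True by (metis less_Suc_eq)
 next
  case False
  hence "?F = map f [0..<N]" using mono by (intro filter_True) (auto, metis le_zero_eq less_imp_le_nat neq0_conv)
  hence F: "filter (%x. 0 < x) (map f [0..<Suc N]) = map f [0..<Suc N]" using False by simp
  show ?thesis unfolding F
  proof
   show "sorted_wrt (\<ge>) (map f [0..<Suc N])" using IH(1) \<open>?F = map f [0..<N]\<close> mono
    by (auto simp: sorted_wrt_append)
   show "\<forall>i<Suc N. (if i < length (map f [0..<Suc N]) then map f [0..<Suc N] ! i else 0) = f i"
    by (auto simp del: upt_Suc)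
  qed
 qed
qed simp

lemma shp_props:
 assumes "yam N u"
 shows "sorted_wrt (\<ge>) (shp N u)" "length (shp N u) <= N" "\<forall>x\<in>set (shp N u). 0 < x"
  "i < N ==> ct (rw (srow 0 (shp N u))) i = ct u i"
 using filter_pos_decr[of N "ct u", OF yam_mono[OF assms]] length_filter_le[of "%x. 0 < x" "map (ct u) [0..<N]"]
 by (auto simp: shp_def ct_srow)

lemma alt_cong: "(\<And>i. i < N ==> f i = g i) ==> alt N f x = alt N g x"
 by (simp add: alt_def)

text \<open>As a polynomial in \<open>s\<close> the alternant contains the monomial of the identity
  permutation exactly once, so it is nonzero; at all but finitely many Kronecker points it can be
  cancelled.\<close>

lemma finite_alt_zero:
 assumes "N < B"
 shows "finite {s::'a::field_char_0. alt N (stair N) (pt B s) = 0}"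
proof (rule ccontr)
 assume inf: "infinite {s::'a. alt N (stair N) (pt B s) = 0}"
 define I where "I = {p. p permutes {..<N}}"
 define ex where "ex p l = stair N (inv p l)" for p :: "nat => nat" and l
 have e: "(\<Prod>i<N. x (p i) ^ stair N i) = (\<Prod>l<N. x l ^ ex p l)" if "p \<in> I" for p and x :: "nat => 'a"
  using prod.permute[of p "{..<N}" "%l. x l ^ ex p l"] that
  by (simp add: I_def ex_def comp_def permutes_inverses)
 have "(\<Sum>p\<in>{p\<in>I. \<forall>l<N. ex p l = stair N l}. of_int (sign p) :: 'a) = 0"
 proof (rule mono_indep[OF _ inf])
  show "finite I" by (simp add: I_def finite_permutations)
  show "ex p l < B" if "p \<in> I" "l < N" for p l using assms that by (simp add: ex_def stair_def)
  show "(\<Sum>p\<in>I. of_int (sign p) * (\<Prod>l<N. pt B s l ^ ex p l)) = 0"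
   if "s \<in> {s::'a. alt N (stair N) (pt B s) = 0}" for s
   using that e[of _ "pt B s"] by (simp add: alt_def I_def)
 qed
 moreover have "{p\<in>I. \<forall>l<N. ex p l = stair N l} = {id}"
 proof -
  have "p = id" if p: "p \<in> I" "\<forall>l<N. ex p l = stair N l" for p
  proof -
   have "inv p l = l" for l
   proof (cases "l < N")
    case True
    have "inv p permutes {..<N}" using p by (simp add: I_def permutes_inv)
    hence "inv p l < N" using True permutes_in_image by fastforce
    thus ?thesis using p(2) True by (force simp: ex_def stair_def)
   next
    case False
    thus ?thesis using p by (metis I_def lessThan_iff mem_Collect_eq permutes_inv permutes_not_in)
   qed
   hence "inv p = id" by auto
   thus ?thesis using p by (metis I_def inv_id mem_Collect_eq permutes_inv_inv)
  qed
  thus ?thesis by (auto simp: I_def ex_def permutes_id)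
 qed
 ultimately show False by simp
qed

lemma sum_list_filter_pos: "sum_list (filter (%x. 0 < x) xs) = sum_list (xs :: nat list)"
 by (induction xs) auto

lemma sum_ct: "set u \<subseteq> {..<N} ==> (\<Sum>i<N. ct u i) = length u"
proof (induction u)
 case (Cons a u)
 have "(\<Sum>i<N. ct (a # u) i) = (\<Sum>i<N. (if i = a then 1 else 0) + ct u i)"
  by (intro sum.cong) (auto simp: ct_def)
 also have "... = Suc (\<Sum>i<N. ct u i)" using Cons.prems by (simp add: sum.distrib sum.delta)
 finally show ?case using Cons by simp
qed (simp add: ct_def)

lemma sum_list_shp: "set u \<subseteq> {..<N} ==> sum_list (shp N u) = length u"
 unfolding shp_def sum_list_filter_pos
 by (simp add: sum_ct[symmetric] interv_sum_list_conv_sum_set_nat atLeast0LessThan)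

text \<open>Both sides have the same product with the staircase alternant, by
  \<open>crystal_alt\<close> for \<open>C\<close> and for the crystal of each shape, which has a
  single Yamanouchi word. The alternant is cancelled at generic points, and
  \<open>word_poly_zero\<close> extends the equation to all points.\<close>

theorem crystal_character:
 fixes x :: "nat => 'a::field_char_0"
 assumes C: "crystal N C" and fin: "finite C" and len: "\<And>u. u \<in> C ==> length u = n"
  and W: "\<And>j u. W (fop j u) = W u"
 shows "(\<Sum>u\<in>C. W u * mon x u) = (\<Sum>u\<in>{u\<in>C. yam N u}. W u * (\<Sum>w\<in>ssw N (shp N u). mon x w))"
proof -
 define Y where "Y = {u\<in>C. yam N u}"
 define B where "B = n + N + 1"
 define S where "S = {s::'a. s ~= 0 & alt N (stair N) (pt B s) ~= 0}"
 have letters: "set u \<subseteq> {..<N}" if "u \<in> C" for u using C that by (auto simp: crystal_def)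
 have lenY: "sum_list (shp N u) = n" if "u \<in> Y" for u
  using that len letters by (simp add: Y_def sum_list_shp)
 have S: "infinite S"
 proof -
  have "finite {s::'a. alt N (stair N) (pt B s) = 0}" by (rule finite_alt_zero) (simp add: B_def)
  hence "finite ({0} \<union> {s::'a. alt N (stair N) (pt B s) = 0})" by simp
  hence "infinite (UNIV - ({0} \<union> {s::'a. alt N (stair N) (pt B s) = 0}))"
   by (intro Diff_infinite_finite) (simp_all add: infinite_UNIV_char_0)
  moreover have "UNIV - ({0} \<union> {s::'a. alt N (stair N) (pt B s) = 0}) = S" by (auto simp: S_def)
  ultimately show ?thesis by metis
 qed
 \<comment> \<open>The difference of the two sides is written as one signed sum over words, the form
   required by \<open>word_poly_zero\<close>.\<close>
 define I where "I = C <+> Sigma Y (%u. ssw N (shp N u))"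
 define wd where "wd i = (case i of Inl u => u | Inr (u, w) => w)" for i :: "nat list + nat list \<times> nat list"
 define cf where "cf i = (case i of Inl u => W u | Inr (u, w) => - W u)" for i :: "nat list + nat list \<times> nat list"
 have finY: "finite Y" using fin by (simp add: Y_def)
 have sumI: "(\<Sum>i\<in>I. cf i * mon y (wd i)) = (\<Sum>u\<in>C. W u * mon y u) - (\<Sum>u\<in>Y. W u * (\<Sum>w\<in>ssw N (shp N u). mon y w))"
  for y :: "nat => 'a"
 proof -
  have sg: "(\<Sum>u\<in>Y. \<Sum>w\<in>ssw N (shp N u). W u * mon y w) =
    (\<Sum>(u, w)\<in>Sigma Y (%u. ssw N (shp N u)). W u * mon y w)"
   by (rule sum.Sigma) (use finY in auto)
  have "(\<Sum>i\<in>I. cf i * mon y (wd i)) = (\<Sum>u\<in>C. W u * mon y u) + (\<Sum>z\<in>Sigma Y (%u. ssw N (shp N u)). cf (Inr z) * mon y (wd (Inr z)))"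
   unfolding I_def using fin finY by (subst sum.Plus) (auto simp: cf_def wd_def)
  also have "(\<Sum>z\<in>Sigma Y (%u. ssw N (shp N u)). cf (Inr z) * mon y (wd (Inr z))) =
    - (\<Sum>u\<in>Y. W u * (\<Sum>w\<in>ssw N (shp N u). mon y w))"
   using sg by (simp add: cf_def wd_def sum_distrib_left sum_negf split_def)
  finally show ?thesis by simp
 qed
 have "(\<Sum>i\<in>I. cf i * mon x (wd i)) = 0"
 proof (rule word_poly_zero[OF _ S, where N = N and B = B])
  show "finite I" using fin finY by (simp add: I_def)
  show "set (wd i) \<subseteq> {..<N}" if "i \<in> I" for i
   using that by (auto simp: I_def wd_def ssw_def dest: subsetD[OF letters])
  show "length (wd i) < B" if "i \<in> I" for i
   using that len lenY by (auto simp: I_def wd_def B_def ssw_def length_rw)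
  show "(\<Sum>i\<in>I. cf i * mon (pt B s) (wd i)) = 0" if s: "s \<in> S" for s
  proof -
   let ?y = "pt B s"
   have nz: "?y i ~= 0" for i using s by (simp add: S_def pt_def)
   have a: "alt N (stair N) ?y * (\<Sum>u\<in>C. W u * mon ?y u) =
    (\<Sum>u\<in>Y. W u * alt N (%i. stair N i + ct u i) ?y)"
    unfolding Y_def by (rule crystal_alt[OF C fin W nz])
   have b: "alt N (stair N) ?y * (\<Sum>w\<in>ssw N (shp N u). mon ?y w) = alt N (%i. stair N i + ct u i) ?y"
    if u: "u \<in> Y" for u
   proof -
    have y: "yam N u" using u by (simp add: Y_def)
    have "alt N (stair N) ?y * (\<Sum>w\<in>ssw N (shp N u). 1 * mon ?y w) =
      (\<Sum>w\<in>{w\<in>ssw N (shp N u). yam N w}. 1 * alt N (%i. stair N i + ct w i) ?y)"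
     by (rule crystal_alt[OF crystal_ssw]) (use nz in auto)
    also have "{w\<in>ssw N (shp N u). yam N w} = {rw (srow 0 (shp N u))}"
     using yam_ssw shp_props[OF y] by blast
    also have "(\<Sum>w\<in>{rw (srow 0 (shp N u))}. 1 * alt N (%i. stair N i + ct w i) ?y) = alt N (%i. stair N i + ct u i) ?y"
     using shp_props(4)[OF y] by (simp cong: alt_cong)
    finally show ?thesis by simp
   qed
   have "alt N (stair N) ?y * (\<Sum>i\<in>I. cf i * mon ?y (wd i)) = 0"
    unfolding sumI right_diff_distrib a sum_distrib_left[of _ _ Y]
    by (simp add: mult.left_commute[of "alt N (stair N) ?y"] b)
   thus ?thesis using s by (simp add: S_def)
  qed
 qed
 thus ?thesis using sumI[of x] by (simp add: Y_def)
qed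

section \<open>Power sum expansions\<close>

lemma finite_parts [simp]: "finite (parts d)"
proof (rule finite_subset)
 show "parts d \<subseteq> {xs. set xs \<subseteq> {..d} & length xs <= d}"
 proof
  fix xs assume "xs \<in> parts d"
  hence p: "\<forall>x\<in>set xs. 0 < x" and s: "sum_list xs = d" by (auto simp: parts_def is_partition_def)
  have "length xs <= sum_list xs" using p by (induction xs) auto
  moreover have "x <= sum_list xs" if "x \<in> set xs" for x using that member_le_sum_list by blast
  ultimately show "xs \<in> {xs. set xs \<subseteq> {..d} & length xs <= d}" using s by auto
 qed
 show "finite {xs. set xs \<subseteq> {..d} & length xs <= d}" by (rule finite_lists_length_le) simp
qed

text \<open>\<open>P\<close> need not consist of power sums of variables: a plethysm is evaluated by
  modifying \<open>P\<close>.\<close>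

definition ev :: "nat => (nat list => 'a::comm_semiring_1) => (nat => 'a) => 'a" where
 "ev d f P = (\<Sum>mu\<in>parts d. f mu * prod_list (map P mu))"

definition psum :: "nat => (nat => 'a::comm_semiring_1) => nat => 'a" where
 "psum N x k = (\<Sum>i<N. x i ^ k)"

text \<open>Exponent of the variable \<open>j\<close> in the monomial of the power-sum product
  obtained by choosing the variables \<open>fs\<close> in its factors; a recursive form of the sum
  in \<open>pcoeff\<close>.\<close>

fun pex :: "nat list => nat list => nat => nat" where
 "pex (m # mu) (a # fs) j = (if a = j then m else 0) + pex mu fs j"
| "pex mu fs j = 0"

lemma pex_eq:
 "length fs = length mu ==> sum_list [mu ! i. i \<leftarrow> [0..<length mu], fs ! i = j] = pex mu fs j"
proof (induction mu fs j rule: pex.induct)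
 case (1 m mu a fs j)
 have "[(m # mu) ! i. i \<leftarrow> [0..<length (m # mu)], (a # fs) ! i = j] =
   (if a = j then [m] else []) @ [mu ! i. i \<leftarrow> [0..<length mu], fs ! i = j]"
  unfolding length_Cons upt_rec[of 0 "Suc (length mu)"] map_Suc_upt[symmetric]
  by (simp add: comp_def cong: if_cong)
 thus ?case using 1 by simp
qed auto

lemma pcoeff_pex: "pcoeff mu al = card {fs. length fs = length mu & (\<forall>j. pex mu fs j = al j)}"
 unfolding pcoeff_def by (rule arg_cong[where f = card]) (auto simp: pex_eq)

definition FS :: "nat => nat list => nat list set" where
 "FS N mu = {fs. set fs \<subseteq> {..<N} & length fs = length mu}"

lemma finite_FS [simp]: "finite (FS N mu)"
 unfolding FS_def by (rule finite_lists_length_eq) simp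

lemma FS_Cons: "FS N (m # mu) = (%(a, fs). a # fs) ` ({..<N} \<times> FS N mu)"
 unfolding FS_def by (auto simp: length_Suc_conv image_iff)

lemma prod_psum: "prod_list (map (psum N x) mu) = (\<Sum>fs\<in>FS N mu. \<Prod>l<N. x l ^ pex mu fs l)"
proof (induction mu)
 case Nil
 have "FS N [] = {[]}" by (auto simp: FS_def)
 thus ?case by simp
next
 case (Cons m mu)
 have "(\<Sum>fs\<in>FS N (m # mu). \<Prod>l<N. x l ^ pex (m # mu) fs l) =
   (\<Sum>(a, fs)\<in>{..<N} \<times> FS N mu. \<Prod>l<N. x l ^ pex (m # mu) (a # fs) l)"
  unfolding FS_Cons by (subst sum.reindex) (auto simp: inj_on_def split_def)
 also have "... = (\<Sum>(a, fs)\<in>{..<N} \<times> FS N mu. x a ^ m * (\<Prod>l<N. x l ^ pex mu fs l))"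
 proof (rule sum.cong[OF refl], goal_cases)
  case (1 z)
  obtain a fs where z: "z = (a, fs)" by (cases z)
  have "a \<in> {..<N}" using 1 z by simp
  have "(\<Prod>l<N. x l ^ pex (m # mu) (a # fs) l) = (\<Prod>l<N. (if l = a then x l ^ m else 1) * x l ^ pex mu fs l)"
   by (intro prod.cong) (auto simp: power_add)
  thus ?case unfolding z prod.case
   using \<open>a \<in> {..<N}\<close> by (simp add: prod.distrib prod.delta)
 qed
 also have "... = (\<Sum>a<N. x a ^ m) * (\<Sum>fs\<in>FS N mu. \<Prod>l<N. x l ^ pex mu fs l)"
  by (simp add: sum_product sum.cartesian_product)
 finally show ?case using Cons by (simp add: psum_def)
qed

lemma pex_sum: "length fs = length mu ==> set fs \<subseteq> {..<N} ==> (\<Sum>j<N. pex mu fs j) = sum_list mu"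
 by (induction mu fs "0::nat" rule: pex.induct) (auto simp: sum.distrib sum.delta)

lemma pex_le: "pex mu fs j <= sum_list mu"
 by (induction mu fs j rule: pex.induct) auto

lemma pex_0: "length fs = length mu ==> j \<notin> set fs ==> pex mu fs j = 0"
 by (induction mu fs j rule: pex.induct) auto

lemma pex_pos: "length fs = length mu ==> \<forall>x\<in>set mu. 0 < x ==> j \<in> set fs ==> 0 < pex mu fs j"
 by (induction mu fs j rule: pex.induct) auto

definition fn :: "nat list => nat => nat" where "fn la j = (if j < length la then la ! j else 0)"

lemma parts_pos: "mu \<in> parts d ==> \<forall>x\<in>set mu. 0 < x" by (auto simp: parts_def is_partition_def)
lemma parts_sorted: "mu \<in> parts d ==> sorted_wrt (\<ge>) mu" by (auto simp: parts_def is_partition_def)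
lemma parts_sum: "mu \<in> parts d ==> sum_list mu = d" by (auto simp: parts_def)

lemma parts_length: "mu \<in> parts d ==> length mu <= d"
proof -
 assume m: "mu \<in> parts d"
 have "length mu <= sum_list mu" using parts_pos[OF m] by (induction mu) auto
 thus ?thesis using parts_sum[OF m] by simp
qed

lemma sorted_ge_eq: "sorted_wrt (\<ge>) xs ==> sorted_wrt (\<ge>) ys ==> mset xs = mset ys ==> xs = (ys :: nat list)"
 by (metis mset_rev properties_for_sort rev_rev_ident sorted_wrt_rev)

lemma pex_distinct: "length fs = length mu ==> distinct fs ==> map (pex mu fs) fs = mu"
proof (induction mu arbitrary: fs)
 case (Cons m mu)
 then obtain a gs where fs: "fs = a # gs" "length gs = length mu" "a \<notin> set gs" "distinct gs"
  by (cases fs) auto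
 have "map (%b. (if a = b then m else 0) + pex mu gs b) gs = map (pex mu gs) gs" using fs by (intro map_cong) auto
 thus ?case using Cons.IH[OF fs(2,4)] fs pex_0[OF fs(2,3)] by simp
qed simp

text \<open>A monomial of the power-sum product arises by merging parts of \<open>mu\<close>, which
  lowers the number of parts unless nothing is merged. So the transition matrix is triangular with
  respect to length.\<close>

lemma pcoeff_tri:
 assumes mu: "mu \<in> parts d" and la: "la \<in> parts d" and nz: "pcoeff mu (fn la) ~= 0"
 shows "length la < length mu | mu = la"
proof -
 from nz have "{fs. length fs = length mu & (\<forall>j. pex mu fs j = fn la j)} ~= {}"
  unfolding pcoeff_pex by (intro notI) simp
 then obtain fs where fs: "length fs = length mu" "\<And>j. pex mu fs j = fn la j" by blast
 have "j \<in> set fs \<longleftrightarrow> j < length la" for j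
 proof
  assume "j \<in> set fs"
  from pex_pos[OF fs(1) parts_pos[OF mu] this] fs(2)[of j] show "j < length la" by (auto simp: fn_def split: if_splits)
 next
  assume j: "j < length la"
  hence "0 < fn la j" using parts_pos[OF la] by (simp add: fn_def)
  thus "j \<in> set fs" using pex_0[OF fs(1), of j] fs(2)[of j] by (cases "j \<in> set fs") auto
 qed
 hence s: "set fs = {..<length la}" by auto
 hence le: "length la <= length mu" using card_length[of fs] fs(1) by simp
 show ?thesis
 proof (cases "length la = length mu")
  case True
  hence d: "distinct fs" using s fs(1) by (metis card_distinct card_lessThan)
  have "mset fs = mset [0..<length la]" using d s by (metis atLeast_upt distinct_upt set_eq_iff_mset_eq_distinct)
  moreover have "mu = map (fn la) fs" using pex_distinct[OF fs(1) d] fs(2) by (metis map_eq_conv)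
  moreover have "la = map (fn la) [0..<length la]" by (rule nth_equalityI) (auto simp: fn_def)
  ultimately have "mset mu = mset la" by (metis mset_map)
  thus ?thesis using sorted_ge_eq parts_sorted mu la by blast
 qed (use le in simp)
qed

lemma pcoeff_finite: "\<forall>x\<in>set mu. 0 < x ==> (\<And>j. N <= j ==> al j = 0) ==>
  {fs. length fs = length mu & (\<forall>j. pex mu fs j = al j)} = {fs \<in> FS N mu. \<forall>j<N. pex mu fs j = al j}"
proof (intro set_eqI iffI)
 fix fs assume pos: "\<forall>x\<in>set mu. 0 < x" and z: "\<And>j. N <= j ==> al j = 0"
  and fs: "fs \<in> {fs. length fs = length mu & (\<forall>j. pex mu fs j = al j)}"
 have "x < N" if "x \<in> set fs" for x
 proof (rule ccontr)
  assume "\<not> x < N"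
  hence "pex mu fs x = 0" using z[of x] fs by simp
  moreover have "0 < pex mu fs x" by (rule pex_pos) (use fs pos that in auto)
  ultimately show False by simp
 qed
 thus "fs \<in> {fs \<in> FS N mu. \<forall>j<N. pex mu fs j = al j}" using fs by (auto simp: FS_def)
next
 fix fs assume z: "\<And>j. N <= j ==> al j = 0" and fs: "fs \<in> {fs \<in> FS N mu. \<forall>j<N. pex mu fs j = al j}"
 have "pex mu fs j = al j" for j
 proof (cases "j < N")
  case False
  hence "j \<notin> set fs" using fs by (auto simp: FS_def)
  thus ?thesis using pex_0[of fs mu j] z[of j] False fs by (auto simp: FS_def)
 qed (use fs in auto)
 thus "fs \<in> {fs. length fs = length mu & (\<forall>j. pex mu fs j = al j)}" using fs by (auto simp: FS_def)
qed

lemma pcoeff_diag: assumes "mu \<in> parts d" shows "pcoeff mu (fn mu) ~= 0"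
proof -
 have "pex mu [0..<length mu] j = fn mu j" for j
 proof (cases "j < length mu")
  case True
  have "map (pex mu [0..<length mu]) [0..<length mu] = mu" by (rule pex_distinct) auto
  from arg_cong[OF this, of "%l. l ! j"] True show ?thesis by (simp add: fn_def)
 next
  case False
  thus ?thesis using pex_0[of "[0..<length mu]" mu j] by (simp add: fn_def)
 qed
 hence "[0..<length mu] \<in> {fs. length fs = length mu & (\<forall>j. pex mu fs j = fn mu j)}" by simp
 moreover have "finite {fs. length fs = length mu & (\<forall>j. pex mu fs j = fn mu j)}"
  by (subst pcoeff_finite[of mu "length mu"]) (use parts_pos[OF assms] in \<open>auto simp: fn_def\<close>)
 ultimately show ?thesis unfolding pcoeff_pex by (simp only: card_eq_0_iff) blast
qed

text \<open>The row of an element of least rank meets no column but its own, so it can be split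
  off.\<close>

lemma tri_unique:
 fixes M :: "'i => 'i => 'a::field" and r :: "'i => nat"
 assumes "finite S" and "\<And>mu la. mu \<in> S ==> la \<in> S ==> M mu la ~= 0 ==> r la < r mu | mu = la"
  and "\<And>mu. mu \<in> S ==> M mu mu ~= 0" and "\<And>la. la \<in> S ==> (\<Sum>mu\<in>S. f mu * M mu la) = 0"
 shows "mu \<in> S ==> f mu = 0"
 using assms
proof (induction "card S" arbitrary: S mu)
 case (Suc n)
 obtain m where m: "m \<in> S" "\<And>s. s \<in> S ==> r m <= r s"
  using Suc.prems(1) arg_min_if_finite[OF Suc.prems(2), of r] by (metis empty_iff not_le)
 have mz: "M m la = 0" if "la \<in> S - {m}" for la using Suc.prems(3)[of m la] m that by force
 have split: "(\<Sum>mu\<in>S. f mu * M mu la) = f m * M m la + (\<Sum>mu\<in>S - {m}. f mu * M mu la)" for la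
  using Suc.prems(2) m by (simp add: sum.remove)
 have z: "f mu = 0" if "mu \<in> S - {m}" for mu
 proof (rule Suc.hyps(1)[OF _ that])
  show "n = card (S - {m})" using Suc.hyps(2) m Suc.prems(2) by simp
  show "(\<Sum>mu\<in>S - {m}. f mu * M mu la) = 0" if "la \<in> S - {m}" for la
   using Suc.prems(5)[of la] split[of la] mz[OF that] that by simp
 qed (use Suc.prems in auto)
 have "f m = 0" using Suc.prems(5)[OF m(1)] split[of m] z Suc.prems(4)[OF m(1)] by simp
 thus ?case using z Suc.prems(1) by (cases "mu = m") auto
qed simp

lemma tri_solve:
 fixes M :: "'i => 'i => 'a::field" and r :: "'i => nat"
 assumes "finite S" and "\<And>mu la. mu \<in> S ==> la \<in> S ==> M mu la ~= 0 ==> r la < r mu | mu = la"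
  and "\<And>mu. mu \<in> S ==> M mu mu ~= 0"
 shows "\<exists>f. \<forall>la\<in>S. (\<Sum>mu\<in>S. f mu * M mu la) = c la"
 using assms
proof (induction "card S" arbitrary: S)
 case (Suc n)
 hence "S ~= {}" by auto
 then obtain m where m: "m \<in> S" "\<And>s. s \<in> S ==> r m <= r s"
  using arg_min_if_finite[OF Suc.prems(1), of r] by (metis not_le)
 have mz: "M m la = 0" if "la \<in> S - {m}" for la using Suc.prems(2)[of m la] m that by force
 have "\<exists>f. \<forall>la\<in>S - {m}. (\<Sum>mu\<in>S - {m}. f mu * M mu la) = c la"
  by (rule Suc.hyps(1)) (use Suc m in auto)
 then obtain f where f: "\<And>la. la \<in> S - {m} ==> (\<Sum>mu\<in>S - {m}. f mu * M mu la) = c la" by blast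
 define g where "g = f(m := (c m - (\<Sum>mu\<in>S - {m}. f mu * M mu m)) / M m m)"
 have "(\<Sum>mu\<in>S. g mu * M mu la) = g m * M m la + (\<Sum>mu\<in>S - {m}. f mu * M mu la)" for la
  using Suc.prems(1) m by (subst sum.remove[of S m]) (auto simp: g_def intro!: sum.cong)
 hence "(\<Sum>mu\<in>S. g mu * M mu la) = c la" if "la \<in> S" for la
  using f[of la] mz[of la] that Suc.prems(3)[OF m(1)] by (cases "la = m") (auto simp: g_def)
 thus ?case by blast
qed simp

text \<open>With at least \<open>d\<close> variables every partition of \<open>d\<close> occurs as
  an exponent vector; Kronecker points give the coefficients there, and triangularity recovers the
  vector.\<close>

lemma ev_inj:
 fixes f g :: "nat list => 'a::field_char_0"
 assumes N: "d <= N" and B: "d < B" and S: "infinite S"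
  and eq: "\<And>s. s \<in> S ==> ev d f (psum N (pt B s)) = ev d g (psum N (pt B s))"
  and mu: "mu \<in> parts d"
 shows "f mu = g mu"
proof -
 define I where "I = Sigma (parts d) (FS N)"
 have ev: "ev d h (psum N x) = (\<Sum>(mu, fs)\<in>I. h mu * (\<Prod>l<N. x l ^ pex mu fs l))" for h and x :: "nat => 'a"
  unfolding ev_def I_def by (subst sum.Sigma[symmetric]) (auto simp: prod_psum sum_distrib_left)
 have c0: "(\<Sum>mu\<in>parts d. (f mu - g mu) * of_nat (pcoeff mu (fn la))) = 0" if la: "la \<in> parts d" for la
 proof -
  have "(\<Sum>i\<in>{i\<in>I. \<forall>l<N. pex (fst i) (snd i) l = fn la l}. f (fst i) - g (fst i)) = 0"
  proof (rule mono_indep[OF _ S])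
   show "finite I" by (simp add: I_def)
   show "pex (fst i) (snd i) l < B" if "i \<in> I" for i l
    using that pex_le[of "fst i" "snd i" l] B parts_sum[of "fst i" d] by (auto simp: I_def)
   show "(\<Sum>i\<in>I. (f (fst i) - g (fst i)) * (\<Prod>l<N. pt B s l ^ pex (fst i) (snd i) l)) = 0" if "s \<in> S" for s
    using eq[OF that] unfolding ev by (simp add: split_def left_diff_distrib sum_subtractf)
  qed
  moreover have "{i\<in>I. \<forall>l<N. pex (fst i) (snd i) l = fn la l} =
    Sigma (parts d) (%mu. {fs\<in>FS N mu. \<forall>j<N. pex mu fs j = fn la j})" by (auto simp: I_def)
  moreover have "(\<Sum>i\<in>Sigma (parts d) (%mu. {fs\<in>FS N mu. \<forall>j<N. pex mu fs j = fn la j}). f (fst i) - g (fst i)) =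
    (\<Sum>mu\<in>parts d. \<Sum>fs\<in>{fs\<in>FS N mu. \<forall>j<N. pex mu fs j = fn la j}. f mu - g mu)"
   by (subst sum.Sigma) (auto simp: split_def)
  moreover have "... = (\<Sum>mu\<in>parts d. (f mu - g mu) * of_nat (pcoeff mu (fn la)))"
  proof (intro sum.cong refl)
   fix mu assume m: "mu \<in> parts d"
   have "pcoeff mu (fn la) = card {fs\<in>FS N mu. \<forall>j<N. pex mu fs j = fn la j}"
    unfolding pcoeff_pex
    by (subst pcoeff_finite[of mu N]) (use parts_pos[OF m] parts_length[OF la] N in \<open>auto simp: fn_def\<close>)
   thus "(\<Sum>fs\<in>{fs\<in>FS N mu. \<forall>j<N. pex mu fs j = fn la j}. f mu - g mu) = (f mu - g mu) * of_nat (pcoeff mu (fn la))"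
    by (simp add: mult.commute)
  qed
  ultimately show ?thesis by simp
 qed
 have "f mu - g mu = 0"
 proof (rule tri_unique[where S = "parts d" and r = length and M = "%mu la. of_nat (pcoeff mu (fn la))"])
  show "length la < length mu | mu = la" if "mu \<in> parts d" "la \<in> parts d" "of_nat (pcoeff mu (fn la)) ~= (0::'a)" for mu la
   using pcoeff_tri[OF that(1,2)] that(3) by (metis of_nat_0)
 qed (use c0 mu pcoeff_diag in auto)
 thus ?thesis by simp
qed

section \<open>Schur functions\<close>

definition tot :: "nat => (nat => nat) => bool" where
 "tot d al \<longleftrightarrow> (\<exists>N. (\<forall>j\<ge>N. al j = 0) & (\<Sum>j<N. al j) = d)"

abbreviation (input) sw :: "nat => nat => nat" where "sw j \<equiv> Transposition.transpose j (Suc j)"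

lemma tot_ge: "tot d al ==> \<exists>N\<ge>M. (\<forall>j\<ge>N. al j = 0) & (\<Sum>j<N. al j) = d"
proof -
 assume "tot d al"
 then obtain N where N: "\<forall>j\<ge>N. al j = 0" "(\<Sum>j<N. al j) = d" by (auto simp: tot_def)
 have "(\<Sum>j<max M N. al j) = (\<Sum>j<N. al j)"
  by (rule sum.mono_neutral_right) (use N in auto)
 thus ?thesis using N by (intro exI[of _ "max M N"]) auto
qed

text \<open>Bubble sort: a swap that moves a larger entry forward lowers the sum of
  \<open>i * al i\<close>, and a vector without such a swap is a partition.\<close>

lemma tot_bubble:
 assumes base: "\<And>la. la \<in> parts d ==> P (fn la)"
  and swp: "\<And>al j. tot d al ==> P (al \<circ> sw j) ==> P al"
  and t: "tot d al"
 shows "P al"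
proof -
 obtain N where "\<forall>j\<ge>N. al j = 0" "(\<Sum>j<N. al j) = d" using t by (auto simp: tot_def)
 thus ?thesis
 proof (induction "\<Sum>i<N. i * al i" arbitrary: al rule: less_induct)
  case less
  hence t: "tot d al" by (auto simp: tot_def)
  show ?case
  proof (cases "\<exists>j. al j < al (Suc j)")
   case True
   then obtain j where j: "al j < al (Suc j)" by blast
   have jN: "Suc j < N" using j less.prems(1) by (metis less_nat_zero_code not_le)
   have sp: "(\<Sum>i<N. f i) = f j + (f (Suc j) + (\<Sum>i\<in>{..<N} - {j} - {Suc j}. f i))" for f :: "nat => nat"
    using jN by (simp add: sum.remove[of "{..<N}" j] sum.remove[of "{..<N} - {j}" "Suc j"])
   have rest: "(\<Sum>i\<in>{..<N} - {j} - {Suc j}. h i ((al \<circ> sw j) i)) = (\<Sum>i\<in>{..<N} - {j} - {Suc j}. h i (al i))" for h :: "nat => nat => nat"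
    by (intro sum.cong) (auto simp: transpose_def)
   have "P (al \<circ> sw j)"
   proof (rule less.hyps)
    show "(\<Sum>i<N. i * (al \<circ> sw j) i) < (\<Sum>i<N. i * al i)"
     unfolding sp[of "%i. i * (al \<circ> sw j) i"] sp[of "%i. i * al i"] rest[of "%i a. i * a"]
     using j by (simp add: algebra_simps)
    show "\<forall>i\<ge>N. (al \<circ> sw j) i = 0" using less.prems(1) jN by (auto simp: transpose_def)
    show "(\<Sum>i<N. (al \<circ> sw j) i) = d"
     unfolding sp[of "%i. (al \<circ> sw j) i"] rest[of "%i a. a"]
     using less.prems(2) unfolding sp[of al] by simp
   qed
   thus ?thesis by (rule swp[OF t])
  next
   case False
   hence mono: "al (Suc j) <= al j" for j by (simp add: not_less)
   define la where "la = filter (%x. 0 < x) (map al [0..<N])"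
   note fp = filter_pos_decr[of N al, OF mono, folded la_def]
   have len: "length la <= N" unfolding la_def
    by (metis diff_zero length_filter_le length_map length_upt)
   have "al j = fn la j" for j
    using fp len less.prems(1) by (cases "j < N") (simp_all add: fn_def)
   hence "al = fn la" by auto
   moreover have "la \<in> parts d"
   proof -
    have "sum_list la = d" using less.prems(2)
     by (simp add: la_def sum_list_filter_pos interv_sum_list_conv_sum_set_nat atLeast0LessThan)
    thus ?thesis using fp by (auto simp: parts_def is_partition_def la_def)
   qed
   ultimately show ?thesis using base by simp
  qed
 qed
qed

lemma pex_map: "length fs = length mu ==> pex mu (map (sw j) fs) i = pex mu fs (sw j i)"
 by (induction mu fs i rule: pex.induct) (auto simp: transpose_def)

lemma pcoeff_swap: "pcoeff mu (al \<circ> sw j) = pcoeff mu al"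
 unfolding pcoeff_pex
proof (rule bij_betw_same_card[where f = "map (sw j)"])
 show "bij_betw (map (sw j)) {fs. length fs = length mu & (\<forall>i. pex mu fs i = (al \<circ> sw j) i)}
   {fs. length fs = length mu & (\<forall>i. pex mu fs i = al i)}"
  by (rule bij_betw_byWitness[where f' = "map (sw j)"]) (auto simp: pex_map map_idI)
qed

text \<open>Solve the triangular system at partitions and spread the result by symmetry. Applied to
  Kostka numbers, this shows that the description defining \<open>schur\<close> has a
  solution.\<close>

lemma sym_pvec:
 fixes c :: "(nat => nat) => 'a::field_char_0"
 assumes "\<And>al j. tot d al ==> c (al \<circ> sw j) = c al"
 shows "\<exists>f. (\<forall>mu. mu \<notin> parts d --> f mu = 0) \<and>
  (\<forall>al. tot d al --> (\<Sum>mu\<in>parts d. f mu * of_nat (pcoeff mu al)) = c al)"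
proof -
 have "\<exists>f. \<forall>la\<in>parts d. (\<Sum>mu\<in>parts d. f mu * of_nat (pcoeff mu (fn la))) = c (fn la)"
 proof (rule tri_solve[where r = length])
  show "length la < length mu | mu = la" if "mu \<in> parts d" "la \<in> parts d" "of_nat (pcoeff mu (fn la)) ~= (0::'a)" for mu la
   using pcoeff_tri[OF that(1,2)] that(3) by (metis of_nat_0)
 qed (use pcoeff_diag in auto)
 then obtain f where f: "\<And>la. la \<in> parts d ==> (\<Sum>mu\<in>parts d. f mu * of_nat (pcoeff mu (fn la))) = c (fn la)" by blast
 define g where "g mu = (if mu \<in> parts d then f mu else 0)" for mu
 have "(\<Sum>mu\<in>parts d. g mu * of_nat (pcoeff mu al)) = c al" if "tot d al" for al
  using that
 proof (rule tot_bubble[rotated -1, where P = "%al. (\<Sum>mu\<in>parts d. g mu * of_nat (pcoeff mu al)) = c al"])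
  show "(\<Sum>mu\<in>parts d. g mu * of_nat (pcoeff mu (fn la))) = c (fn la)" if "la \<in> parts d" for la
   using f[OF that] by (simp add: g_def)
  show "(\<Sum>mu\<in>parts d. g mu * of_nat (pcoeff mu al)) = c al" if "tot d al"
   "(\<Sum>mu\<in>parts d. g mu * of_nat (pcoeff mu (al \<circ> sw j))) = c (al \<circ> sw j)" for al j
   using that(2) by (simp only: pcoeff_swap assms[OF that(1)])
 qed
 thus ?thesis by (intro exI[of _ g]) (auto simp: g_def)
qed

lemma pvec_unique:
 fixes f g :: "nat list => 'a::field_char_0"
 assumes eq: "\<And>la. la \<in> parts d ==> (\<Sum>mu\<in>parts d. f mu * of_nat (pcoeff mu (fn la))) = (\<Sum>mu\<in>parts d. g mu * of_nat (pcoeff mu (fn la)))"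
  and mu: "mu \<in> parts d"
 shows "f mu = g mu"
proof -
 have "f mu - g mu = 0"
 proof (rule tri_unique[where S = "parts d" and r = length and M = "%mu la. of_nat (pcoeff mu (fn la))"])
  show "length la < length mu | mu = la" if "mu \<in> parts d" "la \<in> parts d" "of_nat (pcoeff mu (fn la)) ~= (0::'a)" for mu la
   using pcoeff_tri[OF that(1,2)] that(3) by (metis of_nat_0)
  show "(\<Sum>mu\<in>parts d. (f mu - g mu) * of_nat (pcoeff mu (fn la))) = 0" if "la \<in> parts d" for la
   using eq[OF that] by (simp add: left_diff_distrib sum_subtractf)
 qed (use mu pcoeff_diag in auto)
 thus ?thesis by simp
qed

lemma ssyt_alt: "ssyt T \<longleftrightarrow> (\<forall>r\<in>set T. sorted r) & (\<forall>i. Suc i < length T --> colst (T ! i) (T ! Suc i))"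
proof (induction T rule: ssyt.induct)
 case (3 R R2 T)
 have "(\<forall>i. Suc i < length (R # R2 # T) --> colst ((R # R2 # T) ! i) ((R # R2 # T) ! Suc i)) \<longleftrightarrow>
  colst R R2 & (\<forall>i. Suc i < length (R2 # T) --> colst ((R2 # T) ! i) ((R2 # T) ! Suc i))"
  by (simp add: All_less_Suc2)
 thus ?case using 3 by auto
qed auto

lemma semistandard_ssyt:
 assumes "sorted_wrt (\<ge>) (map length T)"
 shows "semistandard T \<longleftrightarrow> ssyt T"
proof -
 have "length (T ! Suc i) <= length (T ! i)" if "Suc i < length T" for i
  using assms that by (auto simp: sorted_wrt_iff_nth_less)
 thus ?thesis unfolding ssyt_alt semistandard_def colst_def by auto
qed

lemma rw_inj: "map length T = map length T' ==> rw T = rw T' ==> T = T'"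
proof (induction T arbitrary: T')
 case (Cons R T)
 then obtain R' T'' where "T' = R' # T''" by (cases T') auto
 with Cons show ?case by auto
qed simp

lemma mset_rw: "mset (rw T) = mset (concat T)"
 by (induction T) auto

lemma ct_le: "ct w j <= length w"
 by (induction w) (auto simp: ct_def)

lemma kostka_ssw:
 assumes la: "sorted_wrt (\<ge>) la" and z: "\<And>j. N <= j ==> al j = 0"
 shows "kostka la al = card {w\<in>ssw N la. ct w = al}"
 unfolding kostka_def
proof (rule bij_betw_same_card[where f = rw], rule bij_betw_imageI)
 show "inj_on rw {T. map length T = la & semistandard T & (\<forall>k. count (mset (concat T)) k = al k)}"
  using rw_inj by (auto simp: inj_on_def)
 have s: "semistandard T \<longleftrightarrow> ssyt T" if "map length T = la" for T
  using semistandard_ssyt[of T] that la by simp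
 have l: "set (rw T) \<subseteq> {..<N}" if "\<forall>k. count (mset (concat T)) k = al k" for T
 proof
  fix k assume "k \<in> set (rw T)"
  hence "0 < al k" using that by (metis count_greater_zero_iff mset_rw set_mset_mset)
  thus "k \<in> {..<N}" using z[of k] by (cases "N <= k") auto
 qed
 show "rw ` {T. map length T = la & semistandard T & (\<forall>k. count (mset (concat T)) k = al k)} = {w\<in>ssw N la. ct w = al}"
 proof (intro set_eqI iffI)
  fix w assume "w \<in> rw ` {T. map length T = la & semistandard T & (\<forall>k. count (mset (concat T)) k = al k)}"
  thus "w \<in> {w\<in>ssw N la. ct w = al}" using s l by (auto simp: ssw_def ct_def mset_rw fun_eq_iff)
 next
  fix w assume "w \<in> {w\<in>ssw N la. ct w = al}"
  thus "w \<in> rw ` {T. map length T = la & semistandard T & (\<forall>k. count (mset (concat T)) k = al k)}"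
   using s by (auto simp: ssw_def ct_def mset_rw)
 qed
qed

lemma kostka_tot: "kostka la al ~= 0 ==> tot (sum_list la) al"
proof -
 assume "kostka la al ~= 0"
 hence "{T. map length T = la & semistandard T & (\<forall>k. count (mset (concat T)) k = al k)} ~= {}"
  unfolding kostka_def by (intro notI) simp
 then obtain T where T: "map length T = la" "\<And>k. count (mset (concat T)) k = al k" by auto
 obtain N where N: "set (concat T) \<subseteq> {..<N}"
  using finite_nat_iff_bounded finite_set by blast
 have "al j = 0" if "N <= j" for j
  using T(2)[of j] N that by (metis count_eq_zero_iff lessThan_iff not_le set_mset_mset subsetD)
 moreover have "(\<Sum>j<N. al j) = sum_list la"
  using sum_ct[OF N] T by (simp add: ct_def length_concat)
 ultimately show ?thesis by (auto simp: tot_def)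
qed

lemma pcoeff_tot: "mu \<in> parts d ==> pcoeff mu al ~= 0 ==> tot d al"
proof -
 assume m: "mu \<in> parts d" and "pcoeff mu al ~= 0"
 hence "{fs. length fs = length mu & (\<forall>j. pex mu fs j = al j)} ~= {}"
  unfolding pcoeff_pex by (intro notI) simp
 then obtain fs where fs: "length fs = length mu" "\<And>j. pex mu fs j = al j" by auto
 obtain N where N: "set fs \<subseteq> {..<N}" using finite_nat_iff_bounded finite_set by blast
 have "al j = 0" if "N <= j" for j
 proof -
  have "j \<notin> set fs" using N that by auto
  thus ?thesis using pex_0[OF fs(1), of j] fs(2)[of j] by simp
 qed
 moreover have "(\<Sum>j<N. al j) = d" using pex_sum[OF fs(1) N] fs parts_sum[OF m] by simp
 ultimately show ?thesis by (auto simp: tot_def)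
qed

lemma mon_sx_ct: "set w \<subseteq> {..<N} ==> Suc j < N ==> mon (sx j x) w = (\<Prod>l<N. x l ^ ct w (sw j l))"
 using mon_count[of w N "sx j x"] prod.permute[of "sw j" "{..<N}" "%l. x l ^ ct w (sw j l)"]
  permutes_swap_id[of j "{..<N}" "Suc j"]
 by (simp add: ct_def comp_def)

text \<open>The symmetry of Schur functions, taken from the string structure: the sum over the words
  of a shape is invariant under the exchange of two variables, and coefficients are compared on a
  signed union of two copies of these words.\<close>

lemma kostka_swap:
 assumes la: "sorted_wrt (\<ge>) la" and t: "tot d al"
 shows "kostka la (al \<circ> sw j) = kostka la al"
proof -
 obtain N where N: "N \<ge> Suc (Suc j)" "\<And>i. N <= i ==> al i = 0" using tot_ge[OF t] by blast
 have jN: "Suc j < N" using N(1) by simp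
 define B where "B = Suc (sum_list la)"
 define I where "I = ssw N la <+> ssw N la"
 define ex where "ex i = (case i of Inl w => ct w | Inr w => ct w \<circ> sw j)" for i :: "nat list + nat list"
 define cf where "cf i = (case i of Inl w => 1 | Inr w => (- 1 :: rat))" for i :: "nat list + nat list"
 have lt: "set w \<subseteq> {..<N}" "length w = sum_list la" if "w \<in> ssw N la" for w
  using that by (auto simp: ssw_def length_rw)
 have "(\<Sum>i\<in>{i\<in>I. \<forall>l<N. ex i l = al l}. cf i) = 0"
 proof (rule mono_indep)
  show "finite I" by (simp add: I_def)
  show "infinite (- {0::rat})" by (simp add: infinite_UNIV_char_0 Compl_eq_Diff_UNIV)
  show "ex i l < B" if "i \<in> I" "l < N" for i l
   using that lt ct_le by (auto simp: I_def ex_def B_def less_Suc_eq_le split: sum.splits) metis+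
  show "(\<Sum>i\<in>I. cf i * (\<Prod>l<N. pt B s l ^ ex i l)) = 0" if s: "s \<in> - {0}" for s :: rat
  proof -
   let ?x = "pt B s"
   have "(\<Sum>w\<in>ssw N la. 1 * mon (sx j ?x) w) = (\<Sum>w\<in>ssw N la. 1 * mon ?x w)"
   proof (rule string_set_sym)
    show "fop j u \<in> ssw N la" if "u \<in> ssw N la" "0 < aa j u" for u
     using crystal_ssw[of N la] that jN by (auto simp: crystal_def)
    show "eop j u \<in> ssw N la" if "u \<in> ssw N la" "0 < bb j u" for u
     using crystal_ssw[of N la] that jN by (auto simp: crystal_def)
   qed (use s in \<open>auto simp: pt_def\<close>)
   hence "(\<Sum>w\<in>ssw N la. \<Prod>l<N. ?x l ^ ct w (sw j l)) = (\<Sum>w\<in>ssw N la. \<Prod>l<N. ?x l ^ ct w l)"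
   proof -
    assume a: "(\<Sum>w\<in>ssw N la. 1 * mon (sx j ?x) w) = (\<Sum>w\<in>ssw N la. 1 * mon ?x w)"
    have "(\<Sum>w\<in>ssw N la. 1 * mon (sx j ?x) w) = (\<Sum>w\<in>ssw N la. \<Prod>l<N. ?x l ^ ct w (sw j l))"
     by (intro sum.cong refl) (simp only: mon_sx_ct[OF lt(1) jN] mult_1)
    moreover have "(\<Sum>w\<in>ssw N la. 1 * mon ?x w) = (\<Sum>w\<in>ssw N la. \<Prod>l<N. ?x l ^ ct w l)"
     by (intro sum.cong refl) (simp only: mon_count[OF lt(1)] mult_1 ct_def)
    ultimately show ?thesis using a by simp
   qed
   thus ?thesis unfolding I_def
    by (subst sum.Plus) (auto simp: cf_def ex_def sum_negf)
  qed
 qed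
 moreover have "{i\<in>I. \<forall>l<N. ex i l = al l} = {w\<in>ssw N la. ct w = al} <+> {w\<in>ssw N la. ct w = al \<circ> sw j}"
 proof -
  have c0: "ct w l = 0" if "w \<in> ssw N la" "N <= l" for w l
   using lt(1)[OF that(1)] that(2) by (auto simp: ct_def count_eq_zero_iff simp flip: set_mset_mset)
  have a: "(\<forall>l<N. ct w l = al l) \<longleftrightarrow> ct w = al" if "w \<in> ssw N la" for w
   using c0[OF that] N(2) by (auto simp: fun_eq_iff) (metis not_le)
  have b: "(\<forall>l<N. ct w (sw j l) = al l) \<longleftrightarrow> ct w = al \<circ> sw j" if "w \<in> ssw N la" for w
  proof
   assume *: "\<forall>l<N. ct w (sw j l) = al l"
   have "ct w (sw j l) = al l" for l
   proof (cases "l < N")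
    case False
    hence "sw j l = l" using jN by (auto simp: transpose_def)
    thus ?thesis using False c0[OF that, of l] N(2)[of l] by simp
   qed (use * in simp)
   hence "ct w l = al (sw j l)" for l by (metis transpose_involutory)
   thus "ct w = al \<circ> sw j" by auto
  qed (simp)
  show ?thesis unfolding I_def ex_def using a b by (auto simp: Plus_def image_iff comp_def)
 qed
 ultimately have "(\<Sum>i\<in>{w\<in>ssw N la. ct w = al} <+> {w\<in>ssw N la. ct w = al \<circ> sw j}. cf i) = 0" by simp
 hence "of_nat (card {w\<in>ssw N la. ct w = al}) = (of_nat (card {w\<in>ssw N la. ct w = al \<circ> sw j}) :: rat)"
  by (subst (asm) sum.Plus) (auto simp: cf_def)
 moreover have "kostka la (al \<circ> sw j) = card {w\<in>ssw N la. ct w = al \<circ> sw j}"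
  by (rule kostka_ssw[OF la]) (use N jN in \<open>auto simp: transpose_def\<close>)
 moreover have "kostka la al = card {w\<in>ssw N la. ct w = al}" by (rule kostka_ssw[OF la N(2)])
 ultimately show ?thesis by simp
qed

text \<open>Existence by \<open>sym_pvec\<close>, uniqueness by triangularity; for exponent vectors
  of another total both sides vanish.\<close>

lemma schur_spec:
 assumes la: "la \<in> parts d"
 shows "symf d (schur la)" "(\<Sum>mu\<in>parts d. schur la mu * of_nat (pcoeff mu al)) = of_nat (kostka la al)"
proof -
 have s: "sum_list la = d" by (rule parts_sum[OF la])
 let ?P = "%f. symf (sum_list la) f \<and>
   (\<forall>al. (\<Sum>mu\<in>parts (sum_list la). f mu * of_nat (pcoeff mu al)) = of_nat (kostka la al))"
 have "\<exists>f::nat list => K. (\<forall>mu. mu \<notin> parts d --> f mu = 0) \<and>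
  (\<forall>al. tot d al --> (\<Sum>mu\<in>parts d. f mu * of_nat (pcoeff mu al)) = of_nat (kostka la al))"
  by (rule sym_pvec) (simp add: kostka_swap[OF parts_sorted[OF la]])
 then obtain f :: "nat list => K" where f: "\<And>mu. mu \<notin> parts d ==> f mu = 0"
  "\<And>al. tot d al ==> (\<Sum>mu\<in>parts d. f mu * of_nat (pcoeff mu al)) = of_nat (kostka la al)" by blast
 have "(\<Sum>mu\<in>parts d. f mu * of_nat (pcoeff mu al)) = of_nat (kostka la al)" for al
 proof (cases "tot d al")
  case False
  hence "kostka la al = 0" using kostka_tot[of la al] s by auto
  moreover have "pcoeff mu al = 0" if "mu \<in> parts d" for mu using pcoeff_tot[OF that] False by blast
  ultimately show ?thesis by simp
 qed (rule f(2))
 hence Pf: "?P f" using f(1) by (auto simp: symf_def s)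
 have "g = f" if "?P g" for g
 proof
  fix mu
  show "g mu = f mu"
  proof (cases "mu \<in> parts d")
   case True
   thus ?thesis by (rule pvec_unique[rotated]) (use that Pf s in simp)
  next
   case False
   thus ?thesis using that Pf by (simp add: symf_def s)
  qed
 qed
 hence "?P (schur la)" unfolding schur_def using theI[of ?P f] Pf by blast
 thus "symf d (schur la)" "(\<Sum>mu\<in>parts d. schur la mu * of_nat (pcoeff mu al)) = of_nat (kostka la al)"
  using s by auto
qed

definition AN :: "nat => nat => (nat => nat) set" where
 "AN N d = {al. \<forall>j. (j \<in> {..<N} --> al j \<in> {..d}) & (j \<notin> {..<N} --> al j = 0)}"

lemma finite_AN [simp]: "finite (AN N d)"
 unfolding AN_def by (rule finite_set_of_finite_funs) auto

lemma sum_fibers: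
 fixes g :: "'b => 'a::comm_semiring_1"
 assumes "finite A" "finite B" "f ` A \<subseteq> B"
 shows "(\<Sum>a\<in>A. g (f a)) = (\<Sum>b\<in>B. of_nat (card {a\<in>A. f a = b}) * g b)"
proof -
 have "(\<Sum>a\<in>A. g (f a)) = (\<Sum>b\<in>B. \<Sum>a\<in>{a\<in>A. f a = b}. g (f a))"
  by (rule sum.group[symmetric]) (use assms in auto)
 thus ?thesis by simp
qed

lemma prod_psum_pcoeff:
 assumes mu: "mu \<in> parts d"
 shows "prod_list (map (psum N x) mu) = (\<Sum>al\<in>AN N d. of_nat (pcoeff mu al) * (\<Prod>l<N. x l ^ al l))"
proof -
 have "prod_list (map (psum N x) mu) = (\<Sum>al\<in>AN N d. of_nat (card {fs\<in>FS N mu. pex mu fs = al}) * (\<Prod>l<N. x l ^ al l))"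
  unfolding prod_psum
 proof (rule sum_fibers)
  show "pex mu ` FS N mu \<subseteq> AN N d"
  proof
   fix al assume "al \<in> pex mu ` FS N mu"
   then obtain fs where fs: "length fs = length mu" "set fs \<subseteq> {..<N}" "al = pex mu fs" by (auto simp: FS_def)
   have "pex mu fs j <= d" for j using pex_le[of mu fs j] parts_sum[OF mu] by simp
   moreover have "pex mu fs j = 0" if "\<not> j < N" for j using pex_0[OF fs(1), of j] fs(2) that by auto
   ultimately show "al \<in> AN N d" by (simp add: AN_def fs(3))
  qed
 qed auto
 also have "... = (\<Sum>al\<in>AN N d. of_nat (pcoeff mu al) * (\<Prod>l<N. x l ^ al l))"
 proof (intro sum.cong refl)
  fix al assume a: "al \<in> AN N d"
  have "pcoeff mu al = card {fs\<in>FS N mu. \<forall>j<N. pex mu fs j = al j}"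
   unfolding pcoeff_pex by (subst pcoeff_finite[of mu N]) (use parts_pos[OF mu] a in \<open>auto simp: AN_def\<close>)
  also have "{fs\<in>FS N mu. \<forall>j<N. pex mu fs j = al j} = {fs\<in>FS N mu. pex mu fs = al}"
  proof (intro Collect_cong conj_cong refl iffI)
   fix fs assume fs: "fs \<in> FS N mu" and e: "\<forall>j<N. pex mu fs j = al j"
   show "pex mu fs = al"
   proof
    fix j show "pex mu fs j = al j"
     using e a fs pex_0[of fs mu j] by (cases "j < N") (auto simp: AN_def FS_def)
   qed
  qed auto
  finally show "of_nat (card {fs\<in>FS N mu. pex mu fs = al}) * (\<Prod>l<N. x l ^ al l) =
   of_nat (pcoeff mu al) * (\<Prod>l<N. x l ^ al l)" by simp
 qed
 finally show ?thesis .
qed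

lemma ev_pcoeff:
 "ev d f (psum N x) = (\<Sum>al\<in>AN N d. (\<Sum>mu\<in>parts d. f mu * of_nat (pcoeff mu al)) * (\<Prod>l<N. x l ^ al l))"
 unfolding ev_def by (simp add: prod_psum_pcoeff sum_distrib_left sum_distrib_right mult.assoc sum.swap[of _ "parts d"])

lemma ev_schur:
 assumes la: "la \<in> parts d"
 shows "ev d (schur la) (psum N x) = (\<Sum>w\<in>ssw N la. mon x w)"
proof -
 have lt: "set w \<subseteq> {..<N}" "length w = d" if "w \<in> ssw N la" for w
  using that parts_sum[OF la] by (auto simp: ssw_def length_rw)
 have "(\<Sum>w\<in>ssw N la. mon x w) = (\<Sum>w\<in>ssw N la. \<Prod>l<N. x l ^ ct w l)"
  using lt by (simp add: mon_count[of _ N] ct_def)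
 also have "... = (\<Sum>al\<in>AN N d. of_nat (card {w\<in>ssw N la. ct w = al}) * (\<Prod>l<N. x l ^ al l))"
 proof (rule sum_fibers)
  show "ct ` ssw N la \<subseteq> AN N d"
  proof (clarsimp simp: AN_def, intro conjI impI)
   fix w j assume w: "w \<in> ssw N la"
   show "ct w j <= d" using lt(2)[OF w] ct_le[of w j] by simp
   show "ct w j = 0" if "\<not> j < N" using lt(1)[OF w] that
    by (auto simp: ct_def count_eq_zero_iff simp flip: set_mset_mset)
  qed
 qed auto
 also have "... = (\<Sum>al\<in>AN N d. of_nat (kostka la al) * (\<Prod>l<N. x l ^ al l))"
  by (intro sum.cong refl) (simp add: kostka_ssw[OF parts_sorted[OF la], of N] AN_def)
 finally show ?thesis by (simp add: ev_pcoeff schur_spec(2)[OF la])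
qed

section \<open>Generating functions of words\<close>

definition words :: "nat => nat => nat list set" where
 "words n N = {u. set u \<subseteq> {..<N} & length u = n}"

lemma finite_words [simp]: "finite (words n N)"
 unfolding words_def by (rule finite_lists_length_eq) simp

lemma crystal_words: "crystal N {u\<in>words n N. Q (dvw u)}"
 using fop_letters eop_letters dvw_fop dvw_eop
 by (fastforce simp: crystal_def words_def)

text \<open>Ballot condition in an unbounded alphabet: every \<open>Suc j\<close> is matched by an
  earlier \<open>j\<close>. These words list the rows of successive cells as a standard tableau
  grows.\<close>

definition lat :: "nat list => bool" where "lat u \<longleftrightarrow> (\<forall>j. bb j u = 0)"
definition LW :: "nat => nat list set" where "LW n = {u. length u = n & lat u}"
definition sh :: "nat list => nat list" where "sh u = shp (length u) u"

lemma lat_count: "lat u ==> ct u (Suc j) <= ct u j"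
 using aa_bb_count[of j u] by (auto simp: lat_def ct_def)

lemma ct_pos: "0 < ct u x \<longleftrightarrow> x \<in> set u" by (simp add: ct_def)

lemma lat_letters: assumes "lat u" "x \<in> set u" shows "x < length u"
proof -
 have "y <= x ==> y \<in> set u" for y
 proof (induction rule: inc_induct)
  case (step y)
  thus ?case using lat_count[OF assms(1), of y] ct_pos[of u y] ct_pos[of u "Suc y"] by linarith
 qed (rule assms(2))
 hence "{..x} \<subseteq> set u" by auto
 hence "card {..x} <= card (set u)" by (intro card_mono) auto
 thus ?thesis using card_length[of u] by simp
qed

lemma finite_LW [simp]: "finite (LW n)"
proof (rule finite_subset)
 show "LW n \<subseteq> words n n" by (auto simp: LW_def words_def dest: lat_letters)
qed simp

lemma LW_words: "n <= N ==> {u\<in>words n N. yam N u} = LW n"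
proof (intro set_eqI iffI)
 fix u assume u: "u \<in> {u\<in>words n N. yam N u}"
 have "bb j u = 0" for j
 proof (cases "Suc j < N")
  case False
  have "bb j w = 0" if "Suc j \<notin> set w" for w using that by (induction w) auto
  moreover have "Suc j \<notin> set u" using u False by (auto simp: words_def)
  ultimately show ?thesis by blast
 qed (use u in \<open>auto simp: yam_def\<close>)
 thus "u \<in> LW n" using u by (auto simp: LW_def lat_def words_def)
next
 fix u assume "n <= N" and u: "u \<in> LW n"
 hence "set u \<subseteq> {..<N}" by (auto simp: LW_def dest!: lat_letters)
 thus "u \<in> {u\<in>words n N. yam N u}" using u by (auto simp: LW_def lat_def words_def yam_def)
qed

lemma shp_sh: assumes "lat u" "length u <= N" shows "shp N u = sh u"
proof -
 have "[0..<N] = [0..<length u] @ [length u..<N]" using assms(2) by (metis le_add_diff_inverse upt_add_eq_append zero_le)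
 moreover have "filter (%x. 0 < x) (map (ct u) [length u..<N]) = []"
 proof -
  have "ct u a = 0" if "length u <= a" for a
   using lat_letters[OF assms(1), of a] ct_pos[of u a] that by (cases "ct u a") auto
  thus ?thesis by (simp add: filter_empty_conv)
 qed
 ultimately show ?thesis by (simp add: shp_def sh_def)
qed

lemma lat_yam: "lat u ==> yam N u" by (simp add: lat_def yam_def)

lemma sh_parts: "u \<in> LW n ==> sh u \<in> parts n"
 using shp_props[OF lat_yam, of u "length u"] sum_list_shp[of u "length u"] lat_letters[of u]
 by (auto simp: LW_def sh_def parts_def is_partition_def)

text \<open>The parameter \<open>r\<close> is kept free because omega replaces q by its
  inverse.\<close>

definition Ap :: "K => nat => (nat list => bool) => nat list => K" where
 "Ap r n Q = (%nu. \<Sum>u\<in>{u\<in>LW n. Q (dvw u)}. r ^ cmaj u * schur (sh u) nu)"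

definition Ws :: "'a::comm_semiring_1 => nat => nat => (nat list => bool) => (nat => 'a) => 'a" where
 "Ws r n N Q x = (\<Sum>u\<in>{u\<in>words n N. Q (dvw u)}. r ^ cmaj u * mon x u)"

lemma ev_sum: "ev d (%nu. \<Sum>u\<in>A. c u * f u nu) P = (\<Sum>u\<in>A. c u * ev d (f u) P)"
 by (simp add: ev_def sum_distrib_left sum_distrib_right sum.swap[of _ "parts d"] mult.assoc)

text \<open>Domino vector and \<open>cmaj\<close> are constant on crystal components, so summing
  Schur functions over lattice words is the same as summing monomials over all words.\<close>

lemma ev_Ap:
 assumes N: "n <= N"
 shows "ev n (Ap r n Q) (psum N x) = Ws r n N Q x"
proof -
 have "Ws r n N Q x = (\<Sum>u\<in>{u\<in>{u\<in>words n N. Q (dvw u)}. yam N u}. r ^ cmaj u * (\<Sum>w\<in>ssw N (shp N u). mon x w))"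
  unfolding Ws_def
  by (rule crystal_character[OF crystal_words, where n = n], rule finite_subset[OF _ finite_words[of n N]])
   (auto simp: cmaj_fop words_def)
 also have "{u\<in>{u\<in>words n N. Q (dvw u)}. yam N u} = {u\<in>LW n. Q (dvw u)}"
  using LW_words[OF N] by auto
 also have "(\<Sum>u\<in>{u\<in>LW n. Q (dvw u)}. r ^ cmaj u * (\<Sum>w\<in>ssw N (shp N u). mon x w)) =
   (\<Sum>u\<in>{u\<in>LW n. Q (dvw u)}. r ^ cmaj u * ev n (schur (sh u)) (psum N x))"
 proof (intro sum.cong refl)
  fix u assume "u \<in> {u\<in>LW n. Q (dvw u)}"
  hence u: "u \<in> LW n" by simp
  hence "shp N u = sh u" using shp_sh[of u N] N by (simp add: LW_def)
  thus "r ^ cmaj u * (\<Sum>w\<in>ssw N (shp N u). mon x w) = r ^ cmaj u * ev n (schur (sh u)) (psum N x)"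
   by (simp add: ev_schur[OF sh_parts[OF u]])
 qed
 finally show ?thesis by (simp add: Ap_def ev_sum)
qed

section \<open>Peeling off two equal initial letters\<close>

definition Q0 :: "(nat list => bool) => nat list => bool" where
 "Q0 Q v \<longleftrightarrow> (\<exists>v'. v = 0 # v' & Q v')"

lemma mon_map: "mon y (map g u) = mon (y \<circ> g) u" by (simp add: mon_def)

lemma mon_scaled: "mon (%l. if l = 0 then x 0 else r * x l) h = mon x h * r ^ length (filter (%a. a ~= 0) h)"
 for r :: "'a::comm_semiring_1"
 by (induction h) (auto simp: mult_ac)

text \<open>A first domino 0 with first letter 0 forces the prefix \<open>0 # 0\<close>; the rest is
  an arbitrary word, shifted by one and rotated. \<open>cmaj\<close> gains one for every nonzero
  letter of the rest, which is absorbed by scaling the variables.\<close>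

lemma Ws_first:
 fixes r :: "'a::comm_semiring_1"
 assumes N: "0 < N"
 shows "(\<Sum>u\<in>{u\<in>{u\<in>words (n + 2) N. Q0 Q (dvw u)}. hd u <= 0}. r ^ cmaj u * mon x u) =
  x 0 ^ 2 * Ws r n N Q (%l. if Suc l = N then x 0 else r * x (Suc l))"
proof -
 let ?y = "%l. if Suc l = N then x 0 else r * x (Suc l)"
 let ?g = "%s. 0 # 0 # map (rti N) (map Suc s)"
 let ?f = "%u. map (%a. a - 1) (map (rt N) (drop 2 u))"
 have *: "rt N (rti N (Suc a)) = Suc a" for a by (auto simp: rt_def rti_def)
 have dv: "dvw (?g s) = 0 # dvw s" and cm: "cmaj (?g s) = cmaj s + length (filter (%a. a ~= 0) (map (rti N) (map Suc s)))"
  if s: "s \<in> words n N" for s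
 proof -
  let ?h = "map (rti N) (map Suc s)"
  have l: "set ?h \<subseteq> {..<N}" using s N by (auto simp: words_def rti_def)
  have m: "map (rt N) ?h = map Suc s" by (simp add: comp_def *)
  have sm: "strict_mono Suc" by (simp add: strict_mono_def)
  show "dvw (?g s) = 0 # dvw s" using dvw_00[OF l] unfolding m dvw_map[OF sm] .
  show "cmaj (?g s) = cmaj s + length (filter (%a. a ~= 0) ?h)" using cmaj_00[OF l] unfolding m cmaj_map[OF sm] .
 qed
 have mn: "r ^ cmaj (?g s) * mon x (?g s) = x 0 ^ 2 * (r ^ cmaj s * mon ?y s)" if s: "s \<in> words n N" for s
 proof -
  let ?h = "map (rti N) (map Suc s)"
  have "mon ?y s = mon (%l. if l = 0 then x 0 else r * x l) ?h"
   unfolding mon_map by (intro arg_cong[where f = "%z. mon z s"]) (auto simp: rti_def fun_eq_iff)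
  hence "mon ?y s = mon x ?h * r ^ length (filter (%a. a ~= 0) ?h)" by (simp only: mon_scaled)
  thus ?thesis using cm[OF s] by (simp add: power_add power2_eq_square mult_ac)
 qed
 have "x 0 ^ 2 * Ws r n N Q ?y = (\<Sum>s\<in>{u\<in>words n N. Q (dvw u)}. r ^ cmaj (?g s) * mon x (?g s))"
  unfolding Ws_def sum_distrib_left by (intro sum.cong refl) (simp only: mem_Collect_eq mn)
 also have "... = (\<Sum>u\<in>{u\<in>{u\<in>words (n + 2) N. Q0 Q (dvw u)}. hd u <= 0}. r ^ cmaj u * mon x u)"
 proof (rule sum.reindex_bij_witness[where i = ?f and j = ?g])
  fix s assume s: "s \<in> {u\<in>words n N. Q (dvw u)}"
  have "a < N" if "a \<in> set s" for a using s that by (auto simp: words_def)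
  thus "?f (?g s) = s" by (simp add: comp_def * map_idI)
  show "?g s \<in> {u\<in>{u\<in>words (n + 2) N. Q0 Q (dvw u)}. hd u <= 0}"
   using s dv[of s] N by (auto simp: words_def Q0_def rti_def)
 next
  fix u assume u: "u \<in> {u\<in>{u\<in>words (n + 2) N. Q0 Q (dvw u)}. hd u <= 0}"
  then obtain a b h where ab: "u = a # b # h" "length h = n"
   by (auto simp: words_def length_Suc_conv numeral_2_eq_2)
  have "a = 0" "\<not> a < b" using u ab by (auto simp: Q0_def split: if_splits)
  hence u': "u = 0 # 0 # h" using ab by simp
  have hN: "set h \<subseteq> {..<N}" using u u' by (auto simp: words_def)
  have sc: "map Suc (?f u) = map (rt N) h"
   using N by (auto simp: u' rt_def)
  have "map (rti N) (map (rt N) h) = h" using hN by (auto simp: rt_def rti_def intro!: map_idI)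
  thus g: "?g (?f u) = u" unfolding sc by (simp add: u')
  have "rt N a - 1 < N" if "a \<in> set h" for a using hN N subsetD[OF hN that] by (auto simp: rt_def)
  hence w: "?f u \<in> words n N" using ab(2) by (auto simp: words_def u')
  thus "?f u \<in> {u\<in>words n N. Q (dvw u)}"
   using dv[OF w] u unfolding g by (auto simp: Q0_def)
 qed simp
 finally show ?thesis by simp
qed

lemma psum_sx: "Suc j < N ==> psum N (sx j x) = psum N x"
proof
 fix k assume "Suc j < N"
 thus "psum N (sx j x) k = psum N x k"
  using sum.permute[of "sw j" "{..<N}" "%i. x i ^ k"] permutes_swap_id[of j "{..<N}" "Suc j"]
  by (simp add: psum_def comp_def)
qed

text \<open>Induction on the bound \<open>j\<close> for the first letter: \<open>Ws_first\<close> is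
  the start and each \<open>demazure_step\<close> raises the bound. The closed form
  \<open>R j\<close> symmetrises the initial term over the variables 0 to \<open>j\<close>, with
  \<open>x i\<close> in the role of the distinguished variable.\<close>

lemma Ws_B0:
 fixes x :: "nat => K"
 assumes n: "n <= N" and N: "0 < N" and inj: "inj_on x {..<N}" and nz: "\<And>i. i < N ==> x i ~= 0"
 shows "Ws r (n + 2) N (Q0 Q) x = (\<Sum>i<N. x i ^ 2 *
   ev n (Ap r n Q) (%k. r ^ k * psum N x k + (1 - r ^ k) * x i ^ k) * (\<Prod>l\<in>{..<N} - {i}. x i / (x i - x l)))"
proof -
 define C where "C = {u\<in>words (n + 2) N. Q0 Q (dvw u)}"
 define Phi where "Phi x i = ev n (Ap r n Q) (%k. r ^ k * psum N x k + (1 - r ^ k) * x i ^ k)" for x :: "nat => K" and i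
 define T where "T j x = (\<Sum>u\<in>{u\<in>C. hd u <= j}. r ^ cmaj u * mon x u)" for j and x :: "nat => K"
 define R where "R j x = (\<Sum>i\<le>j. x i ^ 2 * Phi x i * (\<Prod>l\<in>{..j} - {i}. x i / (x i - x l)))" for j and x :: "nat => K"
 have crC: "crystal N C" unfolding C_def by (rule crystal_words)
 have finC: "finite C" unfolding C_def by (rule finite_subset[OF _ finite_words[of "n + 2" N]]) auto
 have "T j x = R j x" if "j < N" "inj_on x {..<N}" "\<And>i. i < N ==> x i ~= 0" for j x
  using that
 proof (induction j arbitrary: x)
  case 0
  let ?y = "%l. if Suc l = N then x 0 else r * x (Suc l)"
  \<comment> \<open>The modified variables form the alphabet r X + (1 - r) x_0.\<close>
  have "psum N ?y k = r ^ k * psum N x k + (1 - r ^ k) * x 0 ^ k" for k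
  proof -
   obtain M where M: "N = Suc M" using N by (cases N) auto
   have "psum N ?y k = (\<Sum>i<M. (r * x (Suc i)) ^ k) + x 0 ^ k" by (simp add: psum_def M)
   moreover have "psum N x k = x 0 ^ k + (\<Sum>i<M. x (Suc i) ^ k)"
    unfolding psum_def M by (rule sum.lessThan_Suc_shift)
   ultimately show ?thesis by (simp add: power_mult_distrib sum_distrib_left[symmetric] algebra_simps)
  qed
  hence "Phi x 0 = Ws r n N Q ?y" unfolding Phi_def ev_Ap[OF n, symmetric] by (metis (no_types, lifting) ext)
  thus ?case using Ws_first[OF N, where n = n and Q = Q and r = r and x = x] by (simp add: T_def R_def C_def)
 next
  case (Suc j)
  have ne: "x j ~= x (Suc j)" using inj_onD[OF Suc.prems(2), of j "Suc j"] Suc.prems(1) by auto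
  have "(x j - x (Suc j)) * T (Suc j) x = x j * T j x - x (Suc j) * T j (sx j x)"
   unfolding T_def
   by (rule demazure_step[OF crC finC]) (use Suc.prems in \<open>auto simp: C_def cmaj_fop words_def\<close>)
  also have "T j x = R j x" by (rule Suc.IH) (use Suc.prems in auto)
  also have "T j (sx j x) = R j (sx j x)"
  proof (rule Suc.IH)
   show "inj_on (sx j x) {..<N}"
    using Suc.prems by (intro comp_inj_on) (auto simp: inj_on_def transpose_def)
   show "sx j x i ~= 0" if "i < N" for i using Suc.prems that by (auto simp: transpose_def)
  qed (use Suc.prems in auto)
  also have "x j * R j x - x (Suc j) * R j (sx j x) = (x j - x (Suc j)) * R (Suc j) x"
  proof -
   define P where "P i = (\<Prod>l\<in>{..<j} - {i}. x i / (x i - x l))" for i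
   have Phi_sx: "Phi (sx j x) i = Phi x (sw j i)" for i
    using psum_sx[of j N x] Suc.prems by (simp add: Phi_def)
   have Rj: "R j x = (\<Sum>i<j. x i ^ 2 * Phi x i * (P i * (x i / (x i - x j)))) + x j ^ 2 * Phi x j * P j"
   proof -
    have "{..j} - {i} = insert j ({..<j} - {i})" if "i < j" for i using that by auto
    moreover have "{..j} - {j} = {..<j} - {j}" by auto
    ultimately show ?thesis unfolding R_def P_def lessThan_Suc_atMost[symmetric] sum.lessThan_Suc
     by (simp add: lessThan_Suc_atMost mult_ac)
   qed
   have Rj': "R j (sx j x) = (\<Sum>i<j. x i ^ 2 * Phi x i * (P i * (x i / (x i - x (Suc j))))) +
     x (Suc j) ^ 2 * Phi x (Suc j) * P (Suc j)"
   proof -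
    have pp: "(\<Prod>l\<in>{..<j} - {i}. x i / (x i - sx j x l)) = P i" for i
     unfolding P_def by (intro prod.cong) (auto simp: transpose_def)
    have eq: "{..j} - {i} = insert j ({..<j} - {i})" if "i < j" for i using that by auto
    have e1: "(\<Prod>l\<in>{..j} - {i}. sx j x i / (sx j x i - sx j x l)) = P i * (x i / (x i - x (Suc j)))" if "i < j" for i
     unfolding eq[OF that] using that pp[of i] by (simp add: transpose_def mult.commute)
    have e2: "(\<Prod>l\<in>{..j} - {j}. sx j x j / (sx j x j - sx j x l)) = P (Suc j)"
     unfolding P_def by (intro prod.cong) (auto simp: transpose_def)
    have "R j (sx j x) = (\<Sum>i<Suc j. (sx j x i) ^ 2 * Phi (sx j x) i * (\<Prod>l\<in>{..j} - {i}. sx j x i / (sx j x i - sx j x l)))"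
     by (simp only: R_def lessThan_Suc_atMost)
    also have "... = (\<Sum>i<j. (sx j x i) ^ 2 * Phi (sx j x) i * (\<Prod>l\<in>{..j} - {i}. sx j x i / (sx j x i - sx j x l))) +
     (sx j x j) ^ 2 * Phi (sx j x) j * P (Suc j)"
     by (simp only: sum.lessThan_Suc e2)
    also have "(\<Sum>i<j. (sx j x i) ^ 2 * Phi (sx j x) i * (\<Prod>l\<in>{..j} - {i}. sx j x i / (sx j x i - sx j x l))) =
     (\<Sum>i<j. x i ^ 2 * Phi x i * (P i * (x i / (x i - x (Suc j)))))"
    proof (intro sum.cong refl)
     fix i assume "i \<in> {..<j}"
     hence i: "i < j" and s: "sw j i = i" by (auto simp: transpose_def)
     show "(sx j x i) ^ 2 * Phi (sx j x) i * (\<Prod>l\<in>{..j} - {i}. sx j x i / (sx j x i - sx j x l)) =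
      x i ^ 2 * Phi x i * (P i * (x i / (x i - x (Suc j))))"
      unfolding e1[OF i] Phi_sx s by (simp add: s)
    qed
    finally show ?thesis by (simp only: comp_def Phi_sx[unfolded comp_def] transpose_apply_first)
   qed
   have RS: "R (Suc j) x = (\<Sum>i<j. x i ^ 2 * Phi x i * (P i * (x i / (x i - x j)) * (x i / (x i - x (Suc j))))) +
     x j ^ 2 * Phi x j * (P j * (x j / (x j - x (Suc j)))) +
     x (Suc j) ^ 2 * Phi x (Suc j) * (P (Suc j) * (x (Suc j) / (x (Suc j) - x j)))"
   proof -
    have "{..Suc j} - {i} = insert (Suc j) (insert j ({..<j} - {i}))" if "i < j" for i using that by auto
    moreover have "{..Suc j} - {j} = insert (Suc j) ({..<j} - {j})" by auto
    moreover have "{..Suc j} - {Suc j} = insert j ({..<j} - {Suc j})" by auto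
    ultimately show ?thesis unfolding R_def P_def
     by (simp add: atMost_Suc lessThan_Suc_atMost[symmetric] mult_ac)
   qed
   \<comment> \<open>The partial fraction identity that merges the two terms with the same
     distinguished variable \<open>b\<close>.\<close>
   have one: "x j * (a * (p * (b / (b - x j)))) - x (Suc j) * (a * (p * (b / (b - x (Suc j))))) =
     (x j - x (Suc j)) * (a * (p * (b / (b - x j)) * (b / (b - x (Suc j)))))"
    if "b ~= x j" "b ~= x (Suc j)" for a p b :: K using that by (simp add: field_simps)
   have nei: "x i ~= x j" "x i ~= x (Suc j)" if "i < j" for i
    using inj_onD[OF Suc.prems(2), of i j] inj_onD[OF Suc.prems(2), of i "Suc j"] Suc.prems(1) that by auto
   have s1: "x j * (\<Sum>i<j. x i ^ 2 * Phi x i * (P i * (x i / (x i - x j)))) -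
     x (Suc j) * (\<Sum>i<j. x i ^ 2 * Phi x i * (P i * (x i / (x i - x (Suc j))))) =
     (x j - x (Suc j)) * (\<Sum>i<j. x i ^ 2 * Phi x i * (P i * (x i / (x i - x j)) * (x i / (x i - x (Suc j)))))"
    unfolding sum_distrib_left sum_subtractf[symmetric]
    by (intro sum.cong refl one) (use nei in auto)
   have t2: "x j * (x j ^ 2 * Phi x j * P j) =
     (x j - x (Suc j)) * (x j ^ 2 * Phi x j * (P j * (x j / (x j - x (Suc j)))))"
    using ne by (simp add: field_simps)
   have t3: "- (x (Suc j) * (x (Suc j) ^ 2 * Phi x (Suc j) * P (Suc j))) =
     (x j - x (Suc j)) * (x (Suc j) ^ 2 * Phi x (Suc j) * (P (Suc j) * (x (Suc j) / (x (Suc j) - x j))))"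
    using ne by (simp add: field_simps)
   have comb: "a * (S + T) - b * (S' + T') = (a * S - b * S') + a * T + - (b * T')" for a b S T S' T' :: K
    by (simp add: algebra_simps)
   show ?thesis unfolding Rj Rj' RS comb s1 t2 t3 by (simp only: distrib_left)
  qed
  finally show ?case using ne by simp
 qed
 from this[of "N - 1" x] have "T (N - 1) x = R (N - 1) x" using N inj nz by simp
 moreover have "T (N - 1) x = Ws r (n + 2) N (Q0 Q) x"
 proof -
  have "{u\<in>C. hd u <= N - 1} = C"
  proof -
   have "hd u <= N - 1" if "u \<in> C" for u using that by (cases u) (auto simp: C_def words_def)
   thus ?thesis by auto
  qed
  thus ?thesis by (simp add: T_def C_def Ws_def)
 qed
 moreover have "{..N - 1} = {..<N}" using N by auto
 ultimately show ?thesis by (simp add: R_def Phi_def)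
qed

section \<open>Vertex operators in the power sum basis\<close>

definition zm :: "nat multiset => nat" where
 "zm M = (\<Prod>i\<in>set_mset M. i ^ count M i * fact (count M i))"

lemma zm_empty [simp]: "zm {#} = 1" by (simp add: zm_def)

lemma zm_add: "zm (add_mset x M) = x * Suc (count M x) * zm M"
proof -
 let ?f = "%M i. i ^ count M i * fact (count M i) :: nat"
 have e: "zm M = (\<Prod>i\<in>insert x (set_mset M). ?f M i)" for M
  unfolding zm_def by (rule prod.mono_neutral_left) (auto simp: not_in_iff)
 have "zm (add_mset x M) = ?f (add_mset x M) x * (\<Prod>i\<in>set_mset M - {x}. ?f (add_mset x M) i)"
  unfolding zm_def by (simp add: prod.insert_remove)
 also have "(\<Prod>i\<in>set_mset M - {x}. ?f (add_mset x M) i) = (\<Prod>i\<in>set_mset M - {x}. ?f M i)"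
  by (intro prod.cong) auto
 also have "?f (add_mset x M) x = x * Suc (count M x) * ?f M x" by (simp add: algebra_simps)
 finally show ?thesis unfolding e[of M] by (simp add: prod.insert_remove)
qed

lemma zee_zm: "zee mu = zm (mset mu)"
 by (simp add: zee_def zm_def)

lemma finite_submsets [simp]: "finite {K. K \<subseteq># M}"
proof (induction M)
 case (add x M)
 have "{K. K \<subseteq># add_mset x M} \<subseteq> {K. K \<subseteq># M} \<union> add_mset x ` {K. K \<subseteq># M}"
 proof
  fix K assume K: "K \<in> {K. K \<subseteq># add_mset x M}"
  show "K \<in> {K. K \<subseteq># M} \<union> add_mset x ` {K. K \<subseteq># M}"
  proof (cases "x \<in># K")
   case True
   hence "K = add_mset x (K - {#x#})" "K - {#x#} \<subseteq># M"
    using K by (auto simp: subset_eq_diff_conv)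
   thus ?thesis by blast
  next
   case False
   have "K \<subseteq># M"
   proof (rule mset_subset_eqI)
    fix a show "count K a <= count M a"
     using mset_subset_eq_count[of K "add_mset x M" a] K False by (cases "a = x") (auto simp: not_in_iff)
   qed
   thus ?thesis by blast
  qed
 qed
 thus ?case using add by (meson finite_UnI finite_imageI finite_subset)
qed simp

text \<open>Number of ways to choose positions of the list whose entries form \<open>K\<close>, a
  product of binomial coefficients; the recursion follows the head of the list.\<close>

fun Ncs :: "nat list => nat multiset => nat" where
 "Ncs [] K = (if K = {#} then 1 else 0)"
| "Ncs (x # mu) K = Ncs mu K + (if x \<in># K then Ncs mu (K - {#x#}) else 0)"

lemma Ncs_sub: "Ncs mu K ~= 0 ==> K \<subseteq># mset mu"
proof (induction mu arbitrary: K)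
 case (Cons x mu)
 show ?case
 proof (cases "Ncs mu K = 0")
  case True
  hence "x \<in># K" "Ncs mu (K - {#x#}) ~= 0" using Cons.prems by (auto split: if_splits)
  thus ?thesis using Cons.IH[of "K - {#x#}"] by (simp add: subset_eq_diff_conv)
 next
  case False
  hence "K \<subseteq># mset mu" by (rule Cons.IH)
  thus ?thesis by (intro mset_subset_eqI) (auto dest: mset_subset_eq_count le_SucI)
 qed
qed (auto split: if_splits)

lemma diff_sub_Cons: "K \<subseteq># mset mu ==> mset (x # mu) - K = add_mset x (mset mu - K)"
proof (rule multiset_eqI)
 fix y assume "K \<subseteq># mset mu"
 from mset_subset_eq_count[OF this, of y]
 show "count (mset (x # mu) - K) y = count (add_mset x (mset mu - K)) y" by (simp add: Suc_diff_le)
qed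

text \<open>Pascal's rule in weighted form: of the \<open>Suc n\<close> copies of the new part,
  those left out account for \<open>Suc n - c\<close> and those taken for \<open>c\<close>.\<close>

lemma Ncs_zm: "K \<subseteq># mset mu ==> Ncs mu K * zm K * zm (mset mu - K) = zm (mset mu)"
proof (induction mu arbitrary: K)
 case (Cons x mu)
 define c n where "c = count K x" and "n = count (mset mu) x"
 have cn: "c <= Suc n" using mset_subset_eq_count[OF Cons.prems, of x] by (simp add: c_def n_def)
 have A: "Ncs mu K * zm K * zm (mset (x # mu) - K) = x * (Suc n - c) * zm (mset mu)"
 proof (cases "c <= n")
  case True
  have sub: "K \<subseteq># mset mu"
  proof (rule mset_subset_eqI)
   fix a show "count K a <= count (mset mu) a"
    using mset_subset_eq_count[OF Cons.prems, of a] True by (cases "a = x") (auto simp: c_def n_def)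
  qed
  hence "mset (x # mu) - K = add_mset x (mset mu - K)" by (rule diff_sub_Cons)
  hence "zm (mset (x # mu) - K) = x * Suc (n - c) * zm (mset mu - K)"
   by (simp add: zm_add n_def c_def)
  thus ?thesis using Cons.IH[OF sub] True by (simp add: Suc_diff_le algebra_simps)
 next
  case False
  hence "c = Suc n" using cn by simp
  moreover have "Ncs mu K = 0"
  proof (rule ccontr)
   assume "Ncs mu K ~= 0"
   from mset_subset_eq_count[OF Ncs_sub[OF this], of x] False show False by (simp add: c_def n_def)
  qed
  ultimately show ?thesis by simp
 qed
 have B: "(if x \<in># K then Ncs mu (K - {#x#}) else 0) * zm K * zm (mset (x # mu) - K) = x * c * zm (mset mu)"
 proof (cases "x \<in># K")
  case True
  hence K: "K = add_mset x (K - {#x#})" by simp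
  have sub: "K - {#x#} \<subseteq># mset mu" using Cons.prems by (simp add: subset_eq_diff_conv)
  have "zm K = x * c * zm (K - {#x#})" by (subst K, subst zm_add) (use True in \<open>simp add: c_def\<close>)
  moreover have "mset (x # mu) - K = mset mu - (K - {#x#})" by (subst K) simp
  ultimately show ?thesis using Cons.IH[OF sub] True by (simp add: algebra_simps)
 next
  case False
  hence "c = 0" by (simp add: c_def not_in_iff)
  with False show ?thesis by simp
 qed
 have "Ncs (x # mu) K * zm K * zm (mset (x # mu) - K) = x * (Suc n - c) * zm (mset mu) + x * c * zm (mset mu)"
  unfolding A[symmetric] B[symmetric] by (simp only: Ncs.simps distrib_right)
 also have "... = x * Suc n * zm (mset mu)" using cn by (simp add: distrib_right[symmetric] distrib_left[symmetric])
 finally show ?case by (simp add: zm_add n_def)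
qed simp

abbreviation pm :: "(nat => 'a::comm_monoid_mult) => nat multiset => 'a" where
 "pm f M \<equiv> prod_mset (image_mset f M)"

lemma prod_list_add_expand:
 fixes A B :: "nat => 'a::comm_semiring_1"
 shows "prod_list (map (%i. A i + B i) mu) =
  (\<Sum>K | K \<subseteq># mset mu. of_nat (Ncs mu K) * pm A K * pm B (mset mu - K))"
proof (induction mu)
 case Nil
 have "{K. K = ({#}::nat multiset)} = {{#}}" by auto
 thus ?case by simp
next
 case (Cons x mu)
 let ?S = "{K. K \<subseteq># mset (x # mu)}" and ?S' = "{K. K \<subseteq># mset mu}"
 have fin: "finite ?S" "finite ?S'" using finite_submsets by blast+
 have sub: "?S' \<subseteq> ?S" by (auto intro: subset_mset.order_trans)
 have 1: "(\<Sum>K\<in>?S. of_nat (Ncs mu K) * pm A K * pm B (mset (x # mu) - K)) =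
   B x * (\<Sum>K\<in>?S'. of_nat (Ncs mu K) * pm A K * pm B (mset mu - K))"
 proof -
  have "(\<Sum>K\<in>?S. of_nat (Ncs mu K) * pm A K * pm B (mset (x # mu) - K)) =
   (\<Sum>K\<in>?S'. of_nat (Ncs mu K) * pm A K * pm B (mset (x # mu) - K))"
  proof (rule sum.mono_neutral_right[OF fin(1) sub], rule ballI)
   fix K assume "K \<in> ?S - ?S'"
   hence "Ncs mu K = 0" using Ncs_sub by blast
   thus "of_nat (Ncs mu K) * pm A K * pm B (mset (x # mu) - K) = 0" by simp
  qed
  also have "... = (\<Sum>K\<in>?S'. B x * (of_nat (Ncs mu K) * pm A K * pm B (mset mu - K)))"
  proof (intro sum.cong refl)
   fix K assume "K \<in> ?S'"
   hence "mset (x # mu) - K = add_mset x (mset mu - K)" by (intro diff_sub_Cons) simp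
   thus "of_nat (Ncs mu K) * pm A K * pm B (mset (x # mu) - K) = B x * (of_nat (Ncs mu K) * pm A K * pm B (mset mu - K))"
    by (simp add: mult_ac)
  qed
  finally show ?thesis by (simp add: sum_distrib_left)
 qed
 have 2: "(\<Sum>K\<in>?S. of_nat (if x \<in># K then Ncs mu (K - {#x#}) else 0) * pm A K * pm B (mset (x # mu) - K)) =
   A x * (\<Sum>K\<in>?S'. of_nat (Ncs mu K) * pm A K * pm B (mset mu - K))"
 proof -
  have "(\<Sum>K\<in>?S. of_nat (if x \<in># K then Ncs mu (K - {#x#}) else 0) * pm A K * pm B (mset (x # mu) - K)) =
   (\<Sum>K\<in>{K\<in>?S. x \<in># K}. of_nat (Ncs mu (K - {#x#})) * pm A K * pm B (mset (x # mu) - K))"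
   using fin(1) by (intro sum.mono_neutral_cong_right) auto
  also have "... = (\<Sum>K\<in>?S'. A x * (of_nat (Ncs mu K) * pm A K * pm B (mset mu - K)))"
  proof (rule sum.reindex_bij_witness[where i = "add_mset x" and j = "%K. K - {#x#}"])
   fix K assume K: "K \<in> {K\<in>?S. x \<in># K}"
   hence e: "K = add_mset x (K - {#x#})" by simp
   thus "add_mset x (K - {#x#}) = K" by simp
   show "K - {#x#} \<in> ?S'" using K by (auto simp: subset_eq_diff_conv)
   show "A x * (of_nat (Ncs mu (K - {#x#})) * pm A (K - {#x#}) * pm B (mset mu - (K - {#x#}))) =
    of_nat (Ncs mu (K - {#x#})) * pm A K * pm B (mset (x # mu) - K)"
    by (subst (3) e, subst (4) e) (simp add: mult_ac)
  qed auto
  finally show ?thesis by (simp add: sum_distrib_left)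
 qed
 have "(\<Sum>K\<in>?S. of_nat (Ncs (x # mu) K) * pm A K * pm B (mset (x # mu) - K)) =
  (\<Sum>K\<in>?S. of_nat (Ncs mu K) * pm A K * pm B (mset (x # mu) - K)) +
  (\<Sum>K\<in>?S. of_nat (if x \<in># K then Ncs mu (K - {#x#}) else 0) * pm A K * pm B (mset (x # mu) - K))"
  unfolding sum.distrib[symmetric] by (intro sum.cong refl) (simp only: Ncs.simps of_nat_add distrib_right)
 thus ?case unfolding 1 2 Cons[symmetric] by (simp add: distrib_right add.commute)
qed

definition mp :: "nat => nat multiset set" where
 "mp d = {M. 0 \<notin># M & \<Sum>\<^sub># M = d}"

lemma bij_mset_parts: "bij_betw mset (parts d) (mp d)"
proof (rule bij_betw_imageI)
 show "inj_on mset (parts d)" using sorted_ge_eq parts_sorted by (auto simp: inj_on_def)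
 show "mset ` parts d = mp d"
 proof (intro set_eqI iffI)
  fix M assume "M \<in> mset ` parts d"
  thus "M \<in> mp d" by (auto simp: mp_def parts_def is_partition_def sum_mset_sum_list)
 next
  fix M assume M: "M \<in> mp d"
  let ?l = "rev (sorted_list_of_multiset M)"
  have "mset ?l = M" by simp
  moreover have "?l \<in> parts d"
  proof -
   have "sum_list ?l = \<Sum>\<^sub># (mset ?l)" by (rule sum_mset_sum_list[symmetric])
   hence "sum_list ?l = d" using M by (simp add: mp_def)
   moreover have "sorted_wrt (\<ge>) ?l" by (simp add: sorted_wrt_rev sorted_sorted_list_of_multiset)
   moreover have "\<forall>x\<in>set ?l. 0 < x" using M by (auto simp: mp_def) (metis gr0I)
   ultimately show ?thesis by (simp add: parts_def is_partition_def)
  qed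
  ultimately show "M \<in> mset ` parts d" by (metis imageI)
 qed
qed

lemma finite_mp [simp]: "finite (mp d)" using bij_mset_parts[of d] bij_betw_finite by fastforce

lemma sum_parts_mp: "(\<Sum>\<rho>\<in>parts d. g (mset \<rho>)) = (\<Sum>M\<in>mp d. g M)"
 by (rule sum.reindex_bij_betw[OF bij_mset_parts])

lemma prod_list_pm: "prod_list (map P mu) = pm P (mset mu)"
 by (metis mset_map prod_mset_prod_list)

text \<open>\<open>Hh m Q\<close> is the complete symmetric function \<open>h\<^sub>m\<close> with \<open>p\<^sub>k\<close> replaced by \<open>Q k\<close>. In degree \<open>d\<close>, \<open>vop a b c d d'\<close> multiplies
  \<open>f[p\<^sub>k := a\<^sub>k p\<^sub>k + b\<^sub>k z\<^bsup>-k\<^esup>]\<close> by \<open>exp (\<Sum>k. c\<^sub>k p\<^sub>k z\<^bsup>k\<^esup> / k)\<close> and extracts the coefficient of \<open>z\<^bsup>d' - d\<^esup>\<close>; \<open>vme\<close> is its matrix.\<close>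
definition Hh :: "nat => (nat => 'a::field_char_0) => 'a" where
 "Hh m Q = (\<Sum>M\<in>mp m. pm Q M / of_nat (zm M))"

definition vme :: "(nat => 'a::field_char_0) => (nat => 'a) => (nat => 'a) => nat list => nat list => 'a" where
 "vme a b c nu mu = (\<Sum>K | K \<subseteq># mset mu & K \<subseteq># mset nu. of_nat (Ncs mu K) * pm a K * pm b (mset mu - K) *
   pm c (mset nu - K) / of_nat (zm (mset nu - K)))"

definition vop :: "(nat => 'a::field_char_0) => (nat => 'a) => (nat => 'a) => nat => nat => (nat list => 'a) => nat list => 'a" where
 "vop a b c d d' f = (%nu. if nu \<in> parts d' then \<Sum>mu\<in>parts d. vme a b c nu mu * f mu else 0)"

definition pw :: "(nat => 'a::field_char_0) => (nat => 'a) => (nat => 'a) => nat list => 'a poly" where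
 "pw a b P mu = prod_list (map (%k. [:a k * P k:] + monom (b k) k) mu)"

lemma pm_const_poly: "pm (%k. [:f k:]) M = [:pm f M:]"
 by (induction M) (auto simp: one_pCons mult.commute)

lemma pm_monom: "pm (%k. monom (b k) k) M = monom (pm b M) (\<Sum>\<^sub># M)"
 by (induction M) (auto simp: mult_monom)

lemma pm_mult: "pm (%k. f k * g k) M = pm f M * pm g M"
 by (induction M) (auto simp: mult_ac)

lemma mset_parts: "mu \<in> parts d ==> 0 \<notin># mset mu & \<Sum>\<^sub># (mset mu) = d"
 by (auto simp: parts_def is_partition_def sum_mset_sum_list)

text \<open>Resummation. Write the target as \<open>K + M\<close>, where \<open>K\<close> is kept
  from \<open>mu\<close> and \<open>M\<close> is created by the exponential. The sum over
  \<open>M\<close> is a complete function, and the sum over \<open>K\<close> expands a product of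
  binomials.\<close>

lemma ev_vop_pre:
 assumes d: "d <= d'" and mu: "mu \<in> parts d"
 shows "(\<Sum>nu\<in>parts d'. vme a b c nu mu * prod_list (map P nu)) =
  (\<Sum>i\<le>d. coeff (pw a b P mu) i * Hh (d' - d + i) (%k. c k * P k))"
proof -
 let ?S = "{K. K \<subseteq># mset mu}"
 let ?t = "%K. of_nat (Ncs mu K) * pm a K * pm b (mset mu - K)"
 have m: "0 \<notin># mset mu" "\<Sum>\<^sub># (mset mu) = d" using mset_parts[OF mu] by auto
 have fin: "finite ?S" by simp
 have sz: "\<Sum>\<^sub># K <= d & \<Sum>\<^sub># (mset mu - K) = d - \<Sum>\<^sub># K" if "K \<in> ?S" for K
 proof -
  have "mset mu = K + (mset mu - K)" using that by simp
  hence "d = \<Sum>\<^sub># K + \<Sum>\<^sub># (mset mu - K)" using m(2) by (metis sum_mset.union)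
  thus ?thesis by simp
 qed
 have "(\<Sum>nu\<in>parts d'. vme a b c nu mu * prod_list (map P nu)) =
  (\<Sum>N\<in>mp d'. (\<Sum>K | K \<subseteq># mset mu & K \<subseteq># N. ?t K * pm c (N - K) / of_nat (zm (N - K))) * pm P N)"
  unfolding vme_def prod_list_pm by (rule sum_parts_mp[of "%N. (\<Sum>K | K \<subseteq># mset mu & K \<subseteq># N. ?t K * pm c (N - K) / of_nat (zm (N - K))) * pm P N"])
 also have "... = (\<Sum>N\<in>mp d'. \<Sum>K\<in>?S. if K \<subseteq># N then ?t K * pm c (N - K) / of_nat (zm (N - K)) * pm P N else 0)"
 proof (intro sum.cong refl)
  fix N
  have "(\<Sum>K\<in>?S. if K \<subseteq># N then ?t K * pm c (N - K) / of_nat (zm (N - K)) * pm P N else 0) =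
   (\<Sum>K\<in>{K\<in>?S. K \<subseteq># N}. ?t K * pm c (N - K) / of_nat (zm (N - K)) * pm P N)"
   using fin by (rule sum.inter_filter[symmetric])
  moreover have "{K\<in>?S. K \<subseteq># N} = {K. K \<subseteq># mset mu & K \<subseteq># N}" by simp
  ultimately show "(\<Sum>K | K \<subseteq># mset mu & K \<subseteq># N. ?t K * pm c (N - K) / of_nat (zm (N - K))) * pm P N =
   (\<Sum>K\<in>?S. if K \<subseteq># N then ?t K * pm c (N - K) / of_nat (zm (N - K)) * pm P N else 0)"
   by (simp only: sum_distrib_right)
 qed
 also have "... = (\<Sum>K\<in>?S. \<Sum>N\<in>mp d'. if K \<subseteq># N then ?t K * pm c (N - K) / of_nat (zm (N - K)) * pm P N else 0)"
  by (rule sum.swap)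
 also have "... = (\<Sum>K\<in>?S. ?t K * pm P K * Hh (d' - \<Sum>\<^sub># K) (%k. c k * P k))"
 proof (intro sum.cong refl)
  fix K assume K: "K \<in> ?S"
  have K0: "0 \<notin># K" using K m(1) by (auto dest: mset_subset_eqD)
  have "(\<Sum>N\<in>mp d'. if K \<subseteq># N then ?t K * pm c (N - K) / of_nat (zm (N - K)) * pm P N else 0) =
   (\<Sum>N\<in>{N\<in>mp d'. K \<subseteq># N}. ?t K * pm c (N - K) / of_nat (zm (N - K)) * pm P N)"
   by (rule sum.inter_filter[symmetric]) simp
  also have "... = (\<Sum>M\<in>mp (d' - \<Sum>\<^sub># K). ?t K * pm P K * (pm (%k. c k * P k) M / of_nat (zm M)))"
  proof (rule sum.reindex_bij_witness[where i = "%M. M + K" and j = "%N. N - K"])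
   fix N assume N: "N \<in> {N\<in>mp d'. K \<subseteq># N}"
   hence e: "N = (N - K) + K" by simp
   thus "N - K + K = N" by simp
   have "\<Sum>\<^sub># N = \<Sum>\<^sub># (N - K + K)" using e by (rule arg_cong)
   hence "d' = \<Sum>\<^sub># (N - K) + \<Sum>\<^sub># K" using N by (simp add: mp_def)
   thus "N - K \<in> mp (d' - \<Sum>\<^sub># K)" using N by (auto simp: mp_def dest: in_diffD)
   have "pm P N = pm P (N - K) * pm P K" by (subst e) simp
   thus "?t K * pm P K * (pm (%k. c k * P k) (N - K) / of_nat (zm (N - K))) =
    ?t K * pm c (N - K) / of_nat (zm (N - K)) * pm P N" by (simp add: pm_mult)
  next
   fix M assume "M \<in> mp (d' - \<Sum>\<^sub># K)"
   thus "M + K \<in> {N\<in>mp d'. K \<subseteq># N}" using K0 sz[OF K] d by (auto simp: mp_def)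
  qed auto
  finally show "(\<Sum>N\<in>mp d'. if K \<subseteq># N then ?t K * pm c (N - K) / of_nat (zm (N - K)) * pm P N else 0) =
   ?t K * pm P K * Hh (d' - \<Sum>\<^sub># K) (%k. c k * P k)" by (simp add: Hh_def sum_distrib_left)
 qed
 also have "... = (\<Sum>K\<in>?S. \<Sum>i\<le>d. (if d - \<Sum>\<^sub># K = i then ?t K * pm P K else 0) * Hh (d' - d + i) (%k. c k * P k))"
 proof (intro sum.cong refl)
  fix K assume K: "K \<in> ?S"
  have "(\<Sum>i\<le>d. (if d - \<Sum>\<^sub># K = i then ?t K * pm P K else 0) * Hh (d' - d + i) (%k. c k * P k)) =
   (\<Sum>i\<le>d. if d - \<Sum>\<^sub># K = i then ?t K * pm P K * Hh (d' - d + i) (%k. c k * P k) else 0)"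
   by (intro sum.cong) auto
  also have "... = ?t K * pm P K * Hh (d' - d + (d - \<Sum>\<^sub># K)) (%k. c k * P k)" by (subst sum.delta') auto
  also have "d' - d + (d - \<Sum>\<^sub># K) = d' - \<Sum>\<^sub># K" using sz[OF K] d by simp
  finally show "?t K * pm P K * Hh (d' - \<Sum>\<^sub># K) (%k. c k * P k) =
   (\<Sum>i\<le>d. (if d - \<Sum>\<^sub># K = i then ?t K * pm P K else 0) * Hh (d' - d + i) (%k. c k * P k))" by simp
 qed
 also have "... = (\<Sum>i\<le>d. coeff (pw a b P mu) i * Hh (d' - d + i) (%k. c k * P k))"
 proof (subst sum.swap, intro sum.cong refl)
  fix i
  have "pw a b P mu = (\<Sum>K\<in>?S. monom (?t K * pm P K) (d - \<Sum>\<^sub># K))"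
   unfolding pw_def prod_list_add_expand
  proof (intro sum.cong refl)
   fix K assume K: "K \<in> ?S"
   show "of_nat (Ncs mu K) * pm (%k. [:a k * P k:]) K * pm (%k. monom (b k) k) (mset mu - K) =
    monom (?t K * pm P K) (d - \<Sum>\<^sub># K)"
    using sz[OF K] by (simp add: pm_const_poly pm_monom pm_mult of_nat_poly smult_monom mult_ac)
  qed
  hence "coeff (pw a b P mu) i = (\<Sum>K\<in>?S. if d - \<Sum>\<^sub># K = i then ?t K * pm P K else 0)"
   by (simp add: coeff_sum)
  thus "(\<Sum>K\<in>?S. (if d - \<Sum>\<^sub># K = i then ?t K * pm P K else 0) * Hh (d' - d + i) (%k. c k * P k)) =
   coeff (pw a b P mu) i * Hh (d' - d + i) (%k. c k * P k)"
   by (simp only: sum_distrib_right)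
 qed
 finally show ?thesis .
qed

text \<open>The substituted function as a polynomial in 1/z; extracting a coefficient of z pairs its
  coefficients with complete functions.\<close>

definition evp :: "(nat => 'a::field_char_0) => (nat => 'a) => nat => (nat list => 'a) => (nat => 'a) => 'a poly" where
 "evp a b d f P = (\<Sum>mu\<in>parts d. smult (f mu) (pw a b P mu))"

lemma poly_pw: "poly (pw a b P mu) w = prod_list (map (%k. a k * P k + b k * w ^ k) mu)"
 by (induction mu) (auto simp: pw_def poly_monom)

lemma poly_evp: "poly (evp a b d f P) w = ev d f (%k. a k * P k + b k * w ^ k)"
 by (simp add: evp_def ev_def poly_sum poly_pw)

lemma ev_vop:
 assumes d: "d <= d'"
 shows "ev d' (vop a b c d d' f) P = (\<Sum>i\<le>d. coeff (evp a b d f P) i * Hh (d' - d + i) (%k. c k * P k))"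
proof -
 have "ev d' (vop a b c d d' f) P = (\<Sum>nu\<in>parts d'. \<Sum>mu\<in>parts d. f mu * (vme a b c nu mu * prod_list (map P nu)))"
  by (simp add: ev_def vop_def sum_distrib_right sum_distrib_left mult_ac)
 also have "... = (\<Sum>mu\<in>parts d. f mu * (\<Sum>nu\<in>parts d'. vme a b c nu mu * prod_list (map P nu)))"
  by (subst sum.swap) (simp add: sum_distrib_left)
 also have "... = (\<Sum>mu\<in>parts d. \<Sum>i\<le>d. f mu * coeff (pw a b P mu) i * Hh (d' - d + i) (%k. c k * P k))"
  by (simp add: ev_vop_pre[OF d] sum_distrib_left mult.assoc)
 also have "... = (\<Sum>i\<le>d. coeff (evp a b d f P) i * Hh (d' - d + i) (%k. c k * P k))"
  by (subst sum.swap) (simp add: evp_def coeff_sum sum_distrib_right)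
 finally show ?thesis .
qed

lemma degree_evp: "degree (evp a b d f P) <= d"
proof -
 have "degree (pw a b P mu) <= d" if "mu \<in> parts d" for mu
 proof -
  have "degree (pw a b P mu) <= sum_list mu"
   unfolding pw_def
  proof (induction mu)
   case (Cons k mu)
   have "degree ([:a k * P k:] + monom (b k) k) <= k"
    by (rule degree_add_le) (auto simp: degree_monom_le)
   thus ?case using Cons degree_mult_le[of "[:a k * P k:] + monom (b k) k"] by (simp add: order_trans[OF degree_mult_le] add_mono)
  qed simp
  thus ?thesis using parts_sum[OF that] by simp
 qed
 thus ?thesis unfolding evp_def by (intro degree_sum_le) (auto intro: order_trans[OF degree_smult_le])
qed

section \<open>Generating series of complete functions\<close>

unbundle fps_syntax

lemma mp_0 [simp]: "mp 0 = {{#}}"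
 by (auto simp: mp_def intro!: multiset_eqI) (metis count_inI gr0I count_empty)

lemma Hh_0 [simp]: "Hh 0 Q = 1" by (simp add: Hh_def)

lemma zm_nz: "0 \<notin># M ==> zm M ~= 0"
proof (induction M)
 case (add x M)
 thus ?case by (simp add: zm_add)
qed simp

lemma sum_mset_count: "\<Sum>\<^sub># M = (\<Sum>k\<in>set_mset M. k * count M k)"
proof -
 obtain xs where M: "M = mset xs" by (metis ex_mset)
 show ?thesis using sum_list_map_eq_sum_count[of "%k. k" xs]
  by (simp add: M sum_mset_sum_list count_mset mult.commute)
qed

text \<open>Newton's identity: write \<open>m\<close> as the sum of the parts of the multiset,
  counted by size, and remove one part of that size.\<close>

lemma Hh_rec: "of_nat m * Hh m Q = (\<Sum>k\<in>{1..m}. Q k * Hh (m - k) Q)"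
proof -
 have fin: "finite {(M, k). M \<in> mp m & k \<in># M}"
  by (rule finite_subset[of _ "Sigma (mp m) set_mset"]) auto
 have "of_nat m * Hh m Q = (\<Sum>M\<in>mp m. \<Sum>k\<in>set_mset M. of_nat (k * count M k) * pm Q M / of_nat (zm M))"
 proof (unfold Hh_def sum_distrib_left, intro sum.cong refl)
  fix M assume "M \<in> mp m"
  hence "m = (\<Sum>k\<in>set_mset M. k * count M k)" by (simp add: mp_def sum_mset_count)
  thus "of_nat m * (pm Q M / of_nat (zm M)) = (\<Sum>k\<in>set_mset M. of_nat (k * count M k) * pm Q M / of_nat (zm M))"
   by (simp only: of_nat_sum sum_distrib_right sum_divide_distrib times_divide_eq_right)
 qed
 also have "... = (\<Sum>(M, k)\<in>Sigma (mp m) set_mset. of_nat (k * count M k) * pm Q M / of_nat (zm M))"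
  by (rule sum.Sigma) auto
 also have "... = (\<Sum>(k, M)\<in>Sigma {1..m} (%k. mp (m - k)). Q k * (pm Q M / of_nat (zm M)))"
 proof (rule sum.reindex_bij_witness[where i = "%(k, M). (add_mset k M, k)" and j = "%(M, k). (k, M - {#k#})"])
  fix p assume "p \<in> Sigma (mp m) set_mset"
  then obtain M k where p: "p = (M, k)" "M \<in> mp m" "k \<in># M" by auto
  define M' where "M' = M - {#k#}"
  have M: "M = add_mset k M'" using p(3) by (simp add: M'_def)
  have k: "0 < k" "k + \<Sum>\<^sub># M' = m" "0 \<notin># M'" using p(2,3) M by (auto simp: mp_def)
  show "(case case p of (M, k) => (k, M - {#k#}) of (k, M) => (add_mset k M, k)) = p" using p by simp
  show "(case p of (M, k) => (k, M - {#k#})) \<in> Sigma {1..m} (%k. mp (m - k))"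
   using k p(1) by (auto simp: M'_def[symmetric] mp_def)
  have "zm M' ~= 0" using k(3) by (rule zm_nz)
  moreover have "zm M = (k * count M k) * zm M'" "k * count M k ~= 0" using k(1) by (simp_all add: M zm_add)
  ultimately have "of_nat (k * count M k) * pm Q M / of_nat (zm M) = pm Q M / of_nat (zm M')"
   by (simp only: of_nat_mult[of "k * count M k"] of_nat_eq_0_iff mult_divide_mult_cancel_left not_False_eq_True)
  hence "Q k * (pm Q M' / of_nat (zm M')) = of_nat (k * count M k) * pm Q M / of_nat (zm M)"
   by (simp add: M)
  thus "(case case p of (M, k) => (k, M - {#k#}) of (k, M) => Q k * (pm Q M / of_nat (zm M))) =
   (case p of (M, k) => of_nat (k * count M k) * pm Q M / of_nat (zm M))" using p(1) by (simp add: M'_def)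
 qed (auto simp: mp_def)
 also have "... = (\<Sum>k\<in>{1..m}. \<Sum>M\<in>mp (m - k). Q k * (pm Q M / of_nat (zm M)))"
  by (rule sum.Sigma[symmetric]) auto
 finally show ?thesis by (simp add: Hh_def sum_distrib_left)
qed

lemma Hh_unique:
 assumes "a 0 = (1::'a::field_char_0)" "\<And>m. of_nat m * a m = (\<Sum>k\<in>{1..m}. Q k * a (m - k))"
 shows "Hh m Q = a m"
proof (induction m rule: less_induct)
 case (less m)
 show ?case
 proof (cases "m = 0")
  case False
  have "of_nat m * Hh m Q = of_nat m * a m" unfolding Hh_rec assms(2)
   by (intro sum.cong refl arg_cong2[where f = "(*)"] less) auto
  thus ?thesis using False by simp
 qed (simp add: assms)
qed

text \<open>The series exp of the sum of Q_k z^k / k. It is handled through its differential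
  equation, which determines it together with the constant term 1.\<close>

definition Hs :: "(nat => 'a::field_char_0) => 'a fps" where
 "Hs Q = Abs_fps (%m. Hh m Q)"

lemma Hh_Hs: "Hh m Q = Hs Q $ m" by (simp add: Hs_def)

lemma sum_shift1: "(\<Sum>k\<in>{1..Suc m}. f k) = (\<Sum>k\<le>m. f (Suc k))"
 using sum.shift_bounds_cl_Suc_ivl[of f 0 m] by (simp add: atMost_atLeast0)

lemma Hs_deriv: "fps_deriv (Hs Q) = Abs_fps (%k. Q (Suc k)) * Hs Q"
proof (rule fps_ext)
 fix m
 have "fps_deriv (Hs Q) $ m = of_nat (Suc m) * Hh (Suc m) Q" by (simp add: Hs_def)
 also have "... = (\<Sum>k\<le>m. Q (Suc k) * Hh (m - k) Q)" unfolding Hh_rec sum_shift1 by simp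
 finally show "fps_deriv (Hs Q) $ m = (Abs_fps (%k. Q (Suc k)) * Hs Q) $ m"
  by (simp add: fps_mult_nth Hs_def atMost_atLeast0)
qed

lemma Hs_0 [simp]: "Hs Q $ 0 = 1" by (simp add: Hs_def)

lemma Hs_eqI:
 assumes "F $ 0 = 1" "fps_deriv F = Abs_fps (%k. Q (Suc k)) * F"
 shows "Hs Q = F"
proof (rule fps_ext)
 fix m
 have "of_nat m * F $ m = (\<Sum>k\<in>{1..m}. Q k * F $ (m - k))" for m
 proof (cases m)
  case (Suc n)
  have "of_nat (Suc n) * F $ Suc n = (Abs_fps (%k. Q (Suc k)) * F) $ n"
   unfolding assms(2)[symmetric] by simp
  thus ?thesis unfolding Suc sum_shift1 by (simp add: fps_mult_nth atMost_atLeast0)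
 qed simp
 from Hh_unique[of "%m. F $ m", OF assms(1) this] show "Hs Q $ m = F $ m" by (simp add: Hs_def)
qed

lemma Hs_add: "Hs (%k. Q k + R k) = Hs Q * Hs R"
proof (rule Hs_eqI)
 have "Abs_fps (%k. Q (Suc k) + R (Suc k)) = Abs_fps (%k. Q (Suc k)) + Abs_fps (%k. R (Suc k))"
  by (rule fps_ext) simp
 thus "fps_deriv (Hs Q * Hs R) = Abs_fps (%k. Q (Suc k) + R (Suc k)) * (Hs Q * Hs R)"
  by (simp add: Hs_deriv algebra_simps)
qed simp

lemma Hs_zero: "Hs (%k. 0) = 1" by (rule Hs_eqI) (auto simp: fps_eq_iff fps_mult_nth)

lemma Hs_sum: "finite A ==> Hs (%k. \<Sum>i\<in>A. Q i k) = (\<Prod>i\<in>A. Hs (Q i))"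
 by (induction A rule: finite_induct) (simp_all add: Hs_zero Hs_add)

lemma Hs_minus: "Hs (%k. - Q k) * Hs Q = 1"
 unfolding Hs_add[symmetric] by (simp add: Hs_zero)

lemma Hs_pow: "Hs (%k. x ^ k) = Abs_fps (%n. x ^ n)"
proof -
 have "Hh m (%k. x ^ k) = x ^ m" for m
  by (rule Hh_unique) (simp_all add: power_add[symmetric])
 thus ?thesis by (simp add: Hs_def)
qed

lemma geo_fps: "Abs_fps (%n. x ^ n) * (1 - fps_const x * fps_X) = (1 :: 'a::field_char_0 fps)"
proof (rule fps_ext)
 fix n
 have "Abs_fps (%n. x ^ n) * (1 - fps_const x * fps_X) = Abs_fps (%n. x ^ n) - fps_const x * (fps_X * Abs_fps (%n. x ^ n))"
  by (simp only: right_diff_distrib mult_1_right) (simp only: mult_ac)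
 thus "(Abs_fps (%n. x ^ n) * (1 - fps_const x * fps_X)) $ n = (1 :: 'a fps) $ n"
  by (cases n) simp_all
qed

lemma Hs_neg_pow: "Hs (%k. - (x ^ k)) = 1 - fps_const x * fps_X"
proof -
 have "Hs (%k. - (x ^ k)) = Hs (%k. - (x ^ k)) * (Abs_fps (%n. x ^ n) * (1 - fps_const x * fps_X))"
  unfolding geo_fps by simp
 also have "... = (Hs (%k. - (x ^ k)) * Abs_fps (%n. x ^ n)) * (1 - fps_const x * fps_X)"
  by (rule mult.assoc[symmetric])
 finally show ?thesis using Hs_minus[of "%k. x ^ k"] unfolding Hs_pow by simp
qed

lemma Hh_scale: "Hh m (%k. s ^ k * Q k) = s ^ m * Hh m Q"
proof (rule Hh_unique[where a = "%m. s ^ m * Hh m Q"])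
 fix m
 show "of_nat m * (s ^ m * Hh m Q) = (\<Sum>k\<in>{1..m}. s ^ k * Q k * (s ^ (m - k) * Hh (m - k) Q))"
 proof -
  have "of_nat m * (s ^ m * Hh m Q) = s ^ m * (\<Sum>k\<in>{1..m}. Q k * Hh (m - k) Q)"
   unfolding Hh_rec[symmetric] by (rule mult.left_commute)
  also have "... = (\<Sum>k\<in>{1..m}. s ^ k * Q k * (s ^ (m - k) * Hh (m - k) Q))"
  proof (unfold sum_distrib_left, intro sum.cong refl)
   fix k assume "k \<in> {1..m}"
   hence "s ^ m = s ^ k * s ^ (m - k)" by (simp add: power_add[symmetric])
   thus "s ^ m * (Q k * Hh (m - k) Q) = s ^ k * Q k * (s ^ (m - k) * Hh (m - k) Q)" by (simp add: mult_ac)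
  qed
  finally show ?thesis .
 qed
qed simp

section \<open>Interpolation and partial fractions\<close>

definition linp :: "'a::field => 'a poly" where "linp a = [:1, - a:]"

lemma lin: "fps_of_poly (linp a) = 1 - fps_const a * fps_X" for a :: "'a::field"
 by (simp add: linp_def fps_of_poly_pCons)

text \<open>Interpolation at the nodes 1/x_i, with node polynomials written as products of factors 1
  - x_l z. Division by all N factors then leaves one geometric series per node.\<close>

lemma lagrange:
 fixes x :: "nat => 'a::field_char_0"
 assumes inj: "inj_on x {..<N}" and nz: "\<And>i. i < N ==> x i ~= 0" and deg: "degree p < N"
 shows "p = (\<Sum>i<N. smult (poly p (1 / x i) * (\<Prod>l\<in>{..<N}-{i}. x i / (x i - x l))) (\<Prod>l\<in>{..<N}-{i}. linp (x l)))"
proof -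
 let ?r = "\<Sum>i<N. smult (poly p (1 / x i) * (\<Prod>l\<in>{..<N}-{i}. x i / (x i - x l))) (\<Prod>l\<in>{..<N}-{i}. linp (x l))"
 have inj': "inj_on (%i. 1 / x i) {..<N}" using inj by (auto simp: inj_on_def)
 have ev: "poly ?r (1 / x j) = poly p (1 / x j)" if j: "j < N" for j
 proof -
  have z: "(\<Prod>l\<in>{..<N}-{i}. poly (linp (x l)) (1 / x j)) = 0" if "i ~= j" for i
   by (rule prod_zero) (use that j nz in \<open>auto simp: linp_def intro!: bexI[of _ j]\<close>)
  have "poly ?r (1 / x j) = (\<Sum>i<N. poly p (1 / x i) * (\<Prod>l\<in>{..<N}-{i}. x i / (x i - x l)) * (\<Prod>l\<in>{..<N}-{i}. poly (linp (x l)) (1 / x j)))"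
   by (simp add: poly_sum poly_prod)
  also have "... = (\<Sum>i\<in>{j}. poly p (1 / x i) * (\<Prod>l\<in>{..<N}-{i}. x i / (x i - x l)) * (\<Prod>l\<in>{..<N}-{i}. poly (linp (x l)) (1 / x j)))"
   by (rule sum.mono_neutral_right) (use j z in auto)
  also have "... = poly p (1 / x j) * (\<Prod>l\<in>{..<N}-{j}. x j / (x j - x l) * poly (linp (x l)) (1 / x j))"
   unfolding prod.distrib by simp
  also have "(\<Prod>l\<in>{..<N}-{j}. x j / (x j - x l) * poly (linp (x l)) (1 / x j)) = 1"
  proof (rule prod.neutral, rule ballI)
   fix l assume l: "l \<in> {..<N} - {j}"
   hence "x j - x l ~= 0" using inj j by (auto simp: inj_on_def)
   thus "x j / (x j - x l) * poly (linp (x l)) (1 / x j) = 1"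
    using nz[OF j] by (simp add: linp_def field_simps)
  qed
  finally show ?thesis by simp
 qed
 have degr: "degree ?r < N"
 proof -
  have "degree ?r <= N - 1"
  proof (rule degree_sum_le)
   fix i assume i: "i \<in> {..<N}"
   have "degree (\<Prod>l\<in>{..<N}-{i}. linp (x l)) <= (\<Sum>l\<in>{..<N}-{i}. degree (linp (x l)))"
    using degree_prod_sum_le[of "{..<N}-{i}" "%l. linp (x l)"] by (simp add: comp_def)
   also have "... <= (\<Sum>l\<in>{..<N}-{i}. 1)" by (rule sum_mono) (simp add: linp_def)
   also have "... = N - 1" using i by simp
   finally have "degree (\<Prod>l\<in>{..<N}-{i}. linp (x l)) <= N - 1" .
   thus "degree (smult (poly p (1 / x i) * (\<Prod>l\<in>{..<N}-{i}. x i / (x i - x l))) (\<Prod>l\<in>{..<N}-{i}. linp (x l))) <= N - 1"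
    using degree_smult_le order_trans by blast
  qed simp
  thus ?thesis using deg by simp
 qed
 have "p - ?r = 0"
 proof (rule ccontr)
  assume nz': "p - ?r ~= 0"
  have "(%i. 1 / x i) ` {..<N} \<subseteq> {y. poly (p - ?r) y = 0}" using ev by auto
  hence "card ((%i. 1 / x i) ` {..<N}) <= degree (p - ?r)"
   using poly_roots_finite[OF nz'] card_poly_roots_bound[OF nz'] card_mono order_trans by blast
  moreover have "degree (p - ?r) < N" using deg degr by (rule degree_diff_less)
  ultimately show False by (simp add: card_image[OF inj'])
 qed
 thus ?thesis by simp
qed

lemma partial_fractions:
 fixes x :: "nat => 'a::field_char_0"
 assumes inj: "inj_on x {..<N}" and nz: "\<And>i. i < N ==> x i ~= 0" and deg: "degree p < N"
 shows "(fps_of_poly p * Hs (psum N x)) $ m =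
  (\<Sum>i<N. poly p (1 / x i) * (\<Prod>l\<in>{..<N}-{i}. x i / (x i - x l)) * x i ^ m)"
proof -
 have H: "Hs (psum N x) = (\<Prod>i<N. Abs_fps (%n. x i ^ n))"
  unfolding psum_def[abs_def] by (simp add: Hs_sum Hs_pow)
 have one: "fps_of_poly (\<Prod>l\<in>{..<N}-{i}. linp (x l)) * Hs (psum N x) = Abs_fps (%n. x i ^ n)" if i: "i < N" for i
 proof -
  have "Hs (psum N x) = Abs_fps (%n. x i ^ n) * (\<Prod>i\<in>{..<N}-{i}. Abs_fps (%n. x i ^ n))"
   unfolding H by (rule prod.remove) (use i in auto)
  hence "fps_of_poly (\<Prod>l\<in>{..<N}-{i}. linp (x l)) * Hs (psum N x) =
   Abs_fps (%n. x i ^ n) * (\<Prod>l\<in>{..<N}-{i}. Abs_fps (%n. x l ^ n) * (1 - fps_const (x l) * fps_X))"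
   by (simp add: fps_of_poly_prod lin prod.distrib mult_ac)
  thus ?thesis by (simp add: geo_fps)
 qed
 have "fps_of_poly p * Hs (psum N x) = (\<Sum>i<N. fps_const (poly p (1 / x i) * (\<Prod>l\<in>{..<N}-{i}. x i / (x i - x l))) * Abs_fps (%n. x i ^ n))"
  by (subst lagrange[OF inj nz deg]) (simp_all add: fps_of_poly_sum fps_of_poly_smult sum_distrib_right mult.assoc one del: fps_const_mult fps_const_mult_left)
 thus ?thesis by (simp add: fps_sum_nth)
qed

lemma Hh_psum:
 fixes x :: "nat => 'a::field_char_0"
 assumes inj: "inj_on x {..<N}" and nz: "\<And>i. i < N ==> x i ~= 0" and N: "0 < N"
 shows "Hh m (psum N x) = (\<Sum>i<N. (\<Prod>l\<in>{..<N}-{i}. x i / (x i - x l)) * x i ^ m)"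
 using partial_fractions[OF inj nz, where p = 1 and m = m] N unfolding Hh_Hs by simp

text \<open>The series is a product of factors (1 - s x_i z) / (1 - x_i z). Numerator and
  denominator both have degree N, so \<open>s ^ N\<close> times the denominator is subtracted to
  make partial fractions applicable; it reappears as the extra term for
  \<open>m = 0\<close>.\<close>

lemma Hh_E:
 fixes x :: "nat => 'a::field_char_0"
 assumes inj: "inj_on x {..<N}" and nz: "\<And>i. i < N ==> x i ~= 0" and N: "0 < N"
 shows "Hh m (%k. (1 - s ^ k) * psum N x k) = (if m = 0 then s ^ N else 0) +
  (\<Sum>i<N. (1 - s) * (\<Prod>l\<in>{..<N}-{i}. (x i - s * x l) / (x i - x l)) * x i ^ m)"
proof -
 let ?a = "\<Prod>i<N. linp (s * x i)" and ?b = "\<Prod>i<N. linp (x i)"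
 define p where "p = ?a - smult (s ^ N) ?b"
 have deg: "degree p < N"
 proof -
  have d: "degree (\<Prod>i<n. linp (y i)) <= n & coeff (\<Prod>i<n. linp (y i)) n = (\<Prod>i<n. - y i)" for n and y :: "nat => 'a"
  proof (induction n)
   case (Suc n)
   let ?p = "\<Prod>i<n. linp (y i)"
   have "(\<Prod>i<Suc n. linp (y i)) = ?p + pCons 0 (smult (- y n) ?p)"
    by (simp add: linp_def mult.commute)
   moreover have "coeff ?p (Suc n) = 0" using Suc by (intro coeff_eq_0) simp
   ultimately show ?case using Suc
    by (auto intro!: degree_add_le order_trans[OF degree_pCons_le] order_trans[OF degree_smult_le] simp del: prod.lessThan_Suc simp: prod.lessThan_Suc[of "%i. - y i"])
  qed simp
  have "degree p <= N" unfolding p_def using d[of "%i. s * x i" N] d[of x N]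
   by (intro degree_diff_le order_trans[OF degree_smult_le]) auto
  moreover have "coeff p N = 0"
   using d[of "%i. s * x i" N] d[of x N] by (simp add: p_def prod.distrib prod_constant flip: mult_minus_right)
  ultimately show ?thesis using N by (metis degree_0 le_neq_implies_less leading_coeff_0_iff)
 qed
 have H: "Hs (psum N x) = (\<Prod>i<N. Abs_fps (%n. x i ^ n))"
  unfolding psum_def[abs_def] by (simp add: Hs_sum Hs_pow)
 have b: "fps_of_poly ?b * Hs (psum N x) = 1"
 proof -
  have "(\<Prod>i<N. (1 - fps_const (x i) * fps_X) * Abs_fps (%n. x i ^ n)) = (\<Prod>i<N. 1)"
   by (intro prod.cong refl) (simp only: mult.commute[of "1 - fps_const _ * fps_X"] geo_fps)
  thus ?thesis unfolding H fps_of_poly_prod lin prod.distrib[symmetric] by simp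
 qed
 have a: "Hs (%k. (1 - s ^ k) * psum N x k) = fps_of_poly ?a * Hs (psum N x)"
 proof -
  have "(%k. (1 - s ^ k) * psum N x k) = (%k. (\<Sum>i<N. - ((s * x i) ^ k)) + psum N x k)"
   by (rule ext) (simp add: psum_def sum_negf sum_subtractf algebra_simps power_mult_distrib sum_distrib_left)
  hence "Hs (%k. (1 - s ^ k) * psum N x k) = Hs (%k. \<Sum>i<N. - ((s * x i) ^ k)) * Hs (psum N x)"
   by (simp only: Hs_add)
  thus ?thesis by (simp add: Hs_sum Hs_neg_pow fps_of_poly_prod lin del: fps_const_mult)
 qed
 have "fps_of_poly ?a * Hs (psum N x) = fps_of_poly p * Hs (psum N x) + fps_const (s ^ N) * (fps_of_poly ?b * Hs (psum N x))"
  by (simp add: p_def fps_of_poly_diff fps_of_poly_smult algebra_simps)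
 hence "Hh m (%k. (1 - s ^ k) * psum N x k) = (fps_of_poly p * Hs (psum N x)) $ m + (if m = 0 then s ^ N else 0)"
  unfolding Hh_Hs a b by simp
 also have "(fps_of_poly p * Hs (psum N x)) $ m = (\<Sum>i<N. poly p (1 / x i) * (\<Prod>l\<in>{..<N}-{i}. x i / (x i - x l)) * x i ^ m)"
  by (rule partial_fractions[OF inj nz deg])
 also have "... = (\<Sum>i<N. (1 - s) * (\<Prod>l\<in>{..<N}-{i}. (x i - s * x l) / (x i - x l)) * x i ^ m)"
 proof (intro sum.cong refl)
  fix i assume i: "i \<in> {..<N}"
  hence xi: "x i ~= 0" using nz by simp
  have "poly ?b (1 / x i) = 0" unfolding poly_prod
   by (rule prod_zero) (use i xi in \<open>auto simp: linp_def intro!: bexI[of _ i]\<close>)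
  hence "poly p (1 / x i) = (\<Prod>l<N. 1 - s * x l / x i)"
   by (simp add: p_def poly_prod linp_def)
  also have "... = (1 - s) * (\<Prod>l\<in>{..<N}-{i}. 1 - s * x l / x i)"
   using i xi by (subst prod.remove[of _ i]) auto
  finally have "poly p (1 / x i) * (\<Prod>l\<in>{..<N}-{i}. x i / (x i - x l)) =
   (1 - s) * (\<Prod>l\<in>{..<N}-{i}. (1 - s * x l / x i) * (x i / (x i - x l)))"
   unfolding prod.distrib by (simp only: mult.assoc)
  also have "(\<Prod>l\<in>{..<N}-{i}. (1 - s * x l / x i) * (x i / (x i - x l))) = (\<Prod>l\<in>{..<N}-{i}. (x i - s * x l) / (x i - x l))"
  proof (intro prod.cong refl)
   fix l
   have "(1 - s * x l / x i) * x i = x i - s * x l" using xi by (simp add: left_diff_distrib)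
   thus "(1 - s * x l / x i) * (x i / (x i - x l)) = (x i - s * x l) / (x i - x l)"
    by (simp only: times_divide_eq_right)
  qed
  finally show "poly p (1 / x i) * (\<Prod>l\<in>{..<N}-{i}. x i / (x i - x l)) * x i ^ m =
   (1 - s) * (\<Prod>l\<in>{..<N}-{i}. (x i - s * x l) / (x i - x l)) * x i ^ m" by simp
 qed
 finally show ?thesis by (simp add: add.commute)
qed

lemma poly_coeff_le:
 fixes p :: "'a::field poly"
 assumes "degree p <= d" shows "poly p x = (\<Sum>i\<le>d. coeff p i * x ^ i)"
proof -
 have "(\<Sum>i\<le>degree p. coeff p i * x ^ i) = (\<Sum>i\<le>d. coeff p i * x ^ i)"
  by (rule sum.mono_neutral_left) (use assms in \<open>auto simp: coeff_eq_0\<close>)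
 thus ?thesis by (simp add: poly_altdef)
qed

text \<open>In finitely many variables, extracting a coefficient becomes a sum over the poles of the
  exponential factor. The outcome has the shape found for words in \<open>Ws_B0\<close>.\<close>

lemma ev_vop_B0:
 fixes x :: "nat => 'a::field_char_0"
 assumes inj: "inj_on x {..<N}" and nz: "\<And>i. i < N ==> x i ~= 0" and N: "0 < N"
 shows "ev (d + k) (vop a b (%k. 1) d (d + k) f) (psum N x) =
  (\<Sum>j<N. x j ^ k * ev d f (%i. a i * psum N x i + b i * x j ^ i) * (\<Prod>l\<in>{..<N}-{j}. x j / (x j - x l)))"
proof -
 let ?e = "evp a b d f (psum N x)" and ?L = "%j. \<Prod>l\<in>{..<N}-{j}. x j / (x j - x l)"
 have "ev (d + k) (vop a b (%k. 1) d (d + k) f) (psum N x) = (\<Sum>i\<le>d. coeff ?e i * (\<Sum>j<N. ?L j * x j ^ (k + i)))"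
  unfolding ev_vop[OF le_add1] by (simp add: Hh_psum[OF inj nz N])
 also have "... = (\<Sum>j<N. \<Sum>i\<le>d. coeff ?e i * (?L j * x j ^ (k + i)))"
  by (simp add: sum_distrib_left) (rule sum.swap)
 also have "... = (\<Sum>j<N. x j ^ k * poly ?e (x j) * ?L j)"
  by (intro sum.cong refl) (simp add: poly_coeff_le[OF degree_evp] sum_distrib_left sum_distrib_right power_add mult_ac)
 finally show ?thesis by (simp only: poly_evp)
qed

text \<open>A multiple of the first Macdonald q-difference operator plus a multiple of the identity,
  with s = 1/t in the application; the substitution in \<open>f\<close> turns into the shift of one
  variable by q.\<close>

lemma ev_vop_E:
 fixes x :: "nat => 'a::field_char_0"
 assumes inj: "inj_on x {..<N}" and nz: "\<And>i. i < N ==> x i ~= 0" and N: "0 < N"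
 shows "ev d (vop (%k. 1) (%k. - (1 - q ^ k)) (%k. 1 - s ^ k) d d f) (psum N x) = s ^ N * ev d f (psum N x) +
  (\<Sum>j<N. (1 - s) * (\<Prod>l\<in>{..<N}-{j}. (x j - s * x l) / (x j - x l)) * ev d f (psum N (x(j := q * x j))))"
proof -
 let ?e = "evp (%k. 1) (%k. - (1 - q ^ k)) d f (psum N x)"
 let ?A = "%j. (1 - s) * (\<Prod>l\<in>{..<N}-{j}. (x j - s * x l) / (x j - x l))"
 have "ev d (vop (%k. 1) (%k. - (1 - q ^ k)) (%k. 1 - s ^ k) d d f) (psum N x) =
  (\<Sum>i\<le>d. coeff ?e i * ((if i = 0 then s ^ N else 0) + (\<Sum>j<N. ?A j * x j ^ i)))"
  unfolding ev_vop[OF order_refl] by (simp add: Hh_E[OF inj nz N])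
 also have "... = (\<Sum>i\<le>d. if i = 0 then s ^ N * coeff ?e 0 else 0) + (\<Sum>i\<le>d. coeff ?e i * (\<Sum>j<N. ?A j * x j ^ i))"
  unfolding sum.distrib[symmetric] by (intro sum.cong refl) (simp add: algebra_simps)
 also have "(\<Sum>i\<le>d. if i = 0 then s ^ N * coeff ?e 0 else 0) = s ^ N * coeff ?e 0" by (simp add: sum.delta')
 also have "coeff ?e 0 = ev d f (psum N x)"
 proof -
  have "coeff ?e 0 = poly ?e 0" by (simp add: poly_0_coeff_0)
  also have "... = ev d f (%k. 1 * psum N x k + - (1 - q ^ k) * 0 ^ k)" by (rule poly_evp)
  also have "(%k. 1 * psum N x k + - (1 - q ^ k) * 0 ^ k) = psum N x" by (rule ext) (simp add: power_0_left)
  finally show ?thesis .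
 qed
 also have "(\<Sum>i\<le>d. coeff ?e i * (\<Sum>j<N. ?A j * x j ^ i)) = (\<Sum>j<N. ?A j * poly ?e (x j))"
  by (simp add: sum_distrib_left, subst sum.swap, simp add: poly_coeff_le[OF degree_evp] sum_distrib_left mult_ac)
 also have "... = (\<Sum>j<N. ?A j * ev d f (psum N (x(j := q * x j))))"
 proof (intro sum.cong refl arg_cong2[where f = "(*)"])
  fix j assume j: "j \<in> {..<N}"
  have "1 * psum N x k + - (1 - q ^ k) * x j ^ k = psum N (x(j := q * x j)) k" for k
   using j unfolding psum_def by (subst (1 2) sum.remove[of _ j]) (auto simp: algebra_simps power_mult_distrib)
  thus "poly ?e (x j) = ev d f (psum N (x(j := q * x j)))" by (simp add: poly_evp)
 qed
 finally show ?thesis .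
qed

lemma pt_generic:
 assumes "N < B" shows "infinite {s::K. inj_on (pt B s) {..<N} & (\<forall>i<N. pt B s i ~= 0)}"
proof -
 have "inj_on (pt B s) {..<N} & (\<forall>i<N. pt B s i ~= 0)" if s: "s = of_nat n" "2 <= n" for s :: K and n
 proof
  show "inj_on (pt B s) {..<N}"
  proof (rule inj_onI)
   fix i j assume ij: "i \<in> {..<N}" "j \<in> {..<N}" "pt B s i = pt B s j"
   have "(of_nat (n ^ (B ^ i)) :: K) = of_nat (n ^ (B ^ j))" using ij(3) s(1) by (simp add: pt_def)
   hence "n ^ (B ^ i) = n ^ (B ^ j)" by (simp only: of_nat_eq_iff)
   hence "B ^ i = B ^ j" using s(2) by (simp add: power_inject_exp)
   moreover have "2 <= B" using ij assms by simp
   ultimately show "i = j" using power_inject_exp[of B i j] by linarith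
  qed
  show "\<forall>i<N. pt B s i ~= 0" using s by (simp add: pt_def)
 qed
 hence "of_nat ` {2..} \<subseteq> {s::K. inj_on (pt B s) {..<N} & (\<forall>i<N. pt B s i ~= 0)}" by auto
 moreover have "infinite ((of_nat :: nat => K) ` {2..})"
  by (subst finite_image_iff) (auto simp: inj_on_def infinite_Ici)
 ultimately show ?thesis using infinite_super by blast
qed

text \<open>Words and vertex operator give the same symmetrised sum at every point with distinct
  nonzero coordinates, and \<open>n + 2\<close> variables determine a vector of this degree.\<close>

theorem Ap_Q0:
 assumes "nu \<in> parts (n + 2)"
 shows "Ap r (n + 2) (Q0 Q) nu = vop (%k. r ^ k) (%k. 1 - r ^ k) (%k. 1) n (n + 2) (Ap r n Q) nu"
proof (rule ev_inj[where N = "n + 2" and B = "n + 3", OF _ _ pt_generic _ assms])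
 fix s :: K assume "s \<in> {s. inj_on (pt (n + 3) s) {..<n + 2} & (\<forall>i<n + 2. pt (n + 3) s i ~= 0)}"
 hence i: "inj_on (pt (n + 3) s) {..<n + 2}" "\<And>i. i < n + 2 ==> pt (n + 3) s i ~= 0" by auto
 show "ev (n + 2) (Ap r (n + 2) (Q0 Q)) (psum (n + 2) (pt (n + 3) s)) =
  ev (n + 2) (vop (%k. r ^ k) (%k. 1 - r ^ k) (%k. 1) n (n + 2) (Ap r n Q)) (psum (n + 2) (pt (n + 3) s))"
  unfolding ev_Ap[OF order_refl]
  by (rule trans[OF Ws_B0[OF le_add1 _ i] ev_vop_B0[OF i, symmetric]]) auto
qed auto

section \<open>Powers of q and t in the coefficient field\<close>

lemma qt_to_fract: "qq ^ a * tt ^ b = to_fract (monom (monom 1 a) b)"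
proof -
 have q: "qq = to_fract (monom (monom 1 1) 0)" and t: "tt = to_fract (monom 1 1)"
  by (simp_all add: qq_def tt_def to_fract_def monom_altdef)
 have pow: "to_fract x ^ n = to_fract (x ^ n)" for x :: "rat poly poly" and n
  by (induction n) simp_all
 show ?thesis unfolding q t pow to_fract_mult[symmetric] by (simp add: monom_power mult_monom)
qed

lemma qt_inj: "qq ^ a * tt ^ b = qq ^ a' * tt ^ b' \<longleftrightarrow> a = a' & b = b'"
 unfolding qt_to_fract to_fract_eq_iff by (auto simp: monom_eq_iff' monom_eq_iff)

lemma qt_one: "qq ^ a * tt ^ b = 1 \<longleftrightarrow> a = 0 & b = 0"
 using qt_inj[of a b 0 0] by simp

lemma tt_pow1 [simp]: "tt ^ k = 1 \<longleftrightarrow> k = 0" using qt_one[of 0 k] by simp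
lemma qq_pow1 [simp]: "qq ^ k = 1 \<longleftrightarrow> k = 0" using qt_one[of k 0] by simp
lemma tt_gt1: "1 < tt" by (simp add: tt_def one_less_Fract_iff less_poly_def pos_poly_def one_pCons)
lemma qq_gt1: "1 < qq" by (simp add: qq_def one_less_Fract_iff less_poly_def pos_poly_def one_pCons)
lemma tt_nz [simp]: "tt ~= 0" using tt_gt1 by auto
lemma qq_nz [simp]: "qq ~= 0" using qq_gt1 by auto

section \<open>Monomial coefficients and the Vandermonde product\<close>

definition cf :: "nat => (nat list => 'a::comm_semiring_1) => (nat => nat) => 'a" where
 "cf d f al = (\<Sum>mu\<in>parts d. f mu * of_nat (pcoeff mu al))"

lemma cf_tot: "cf d f al ~= 0 ==> tot d al"
 unfolding cf_def by (metis (mono_tags, lifting) sum.neutral mult_zero_right of_nat_0 pcoeff_tot)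

lemma ev_cf: "ev d f (psum N x) = (\<Sum>al\<in>AN N d. cf d f al * (\<Prod>l<N. x l ^ al l))"
 by (simp add: ev_pcoeff cf_def)

lemma fn_subset_le:
 assumes la: "sorted_wrt (\<ge>) la" and S: "finite S"
 shows "sum (fn la) S <= sum_list (take (card S) la)"
 using S
proof (induction "card S" arbitrary: S)
 case (Suc n)
 hence "S ~= {}" by auto
 define m where "m = Max S"
 have m: "m \<in> S" using Suc \<open>S ~= {}\<close> by (simp add: m_def)
 have c: "card (S - {m}) = n" using Suc m by simp
 have "S \<subseteq> {..m}" using Suc by (auto simp: m_def)
 hence "card S <= Suc m" using card_mono[of "{..m}" S] by simp
 hence nm: "n <= m" using Suc by simp
 have "sum (fn la) S = fn la m + sum (fn la) (S - {m})" using Suc m by (simp add: sum.remove)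
 also have "... <= fn la m + sum_list (take n la)" using Suc(1)[of "S - {m}"] Suc c by simp
 also have "fn la m <= fn la n"
  using la nm by (auto simp: fn_def sorted_wrt_iff_nth_less le_less)
 also have "fn la n + sum_list (take n la) = sum_list (take (Suc n) la)"
  by (cases "n < length la") (simp_all add: take_Suc_conv_app_nth fn_def)
 finally show ?case using Suc by simp
qed simp

lemma sum_fn_take: "(\<Sum>j<k. fn la j) = sum_list (take k la)"
proof (induction k)
 case (Suc k)
 thus ?case by (cases "k < length la") (simp_all add: take_Suc_conv_app_nth fn_def)
qed simp

text \<open>An exponent vector has the coefficient of its sorted partition, whose initial sums bound
  the sum over any set of entries of the same size. This is where dominance enters.\<close>

lemma tot_sort:
 assumes "tot d al"
 shows "\<exists>kap\<in>parts d. (\<forall>f::nat list => 'a::comm_semiring_1. cf d f al = cf d f (fn kap)) \<and>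
  (\<forall>S. finite S --> sum al S <= sum_list (take (card S) kap))"
proof (rule tot_bubble[OF _ _ assms])
 fix la assume "la \<in> parts d"
 thus "\<exists>kap\<in>parts d. (\<forall>f::nat list => 'a::comm_semiring_1. cf d f (fn la) = cf d f (fn kap)) \<and>
  (\<forall>S. finite S --> sum (fn la) S <= sum_list (take (card S) kap))"
  using fn_subset_le parts_sorted by blast
next
 fix al j
 assume "\<exists>kap\<in>parts d. (\<forall>f::nat list => 'a::comm_semiring_1. cf d f (al \<circ> sw j) = cf d f (fn kap)) \<and>
  (\<forall>S. finite S --> sum (al \<circ> sw j) S <= sum_list (take (card S) kap))"
 then obtain kap where k: "kap \<in> parts d" "\<And>f::nat list => 'a. cf d f (al \<circ> sw j) = cf d f (fn kap)"
  "\<And>S. finite S ==> sum (al \<circ> sw j) S <= sum_list (take (card S) kap)" by blast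
 have "sum al S <= sum_list (take (card S) kap)" if "finite S" for S
 proof -
  have "sum (al \<circ> sw j) (sw j ` S) = sum al S"
   by (subst sum.reindex) (auto simp: comp_def)
  thus ?thesis using k(3)[of "sw j ` S"] that by (simp add: card_image)
 qed
 thus "\<exists>kap\<in>parts d. (\<forall>f::nat list => 'a::comm_semiring_1. cf d f al = cf d f (fn kap)) \<and>
  (\<forall>S. finite S --> sum al S <= sum_list (take (card S) kap))"
  using k(1,2) by (auto simp: cf_def pcoeff_swap intro!: bexI[of _ kap])
qed

definition Pr :: "nat => (nat \<times> nat) set" where "Pr N = {(i, j). i < j & j < N}"

lemma finite_Pr [simp]: "finite (Pr N)"
 by (rule finite_subset[of _ "{..<N} \<times> {..<N}"]) (auto simp: Pr_def)

text \<open>A subset \<open>X\<close> of the pairs \<open>i < j\<close> is a tournament: \<open>win X (i, j)\<close> is the winner, and the Vandermonde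
  product is the signed sum over tournaments of the monomials of their score sequences.\<close>
definition win :: "(nat \<times> nat) set => nat \<times> nat => nat" where
 "win X p = (if p \<in> X then fst p else snd p)"
definition score :: "nat => (nat \<times> nat) set => nat => nat" where
 "score N X l = card {p\<in>Pr N. win X p = l}"
definition sg :: "nat => (nat \<times> nat) set => 'a::comm_ring_1" where
 "sg N X = (-1) ^ card (Pr N - X)"
definition vand :: "nat => (nat => 'a::comm_ring_1) => 'a" where
 "vand N x = (\<Prod>(i, j)\<in>Pr N. x i - x j)"

lemma win_less: "p \<in> Pr N ==> win X p < N" by (auto simp: Pr_def win_def)

lemma score_out: "N <= l ==> score N X l = 0"
proof -
 assume "N <= l"
 hence "win X p ~= l" if "p \<in> Pr N" for p using win_less[OF that, of X] by simp
 hence "{p \<in> Pr N. win X p = l} = {}" by blast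
 thus ?thesis by (simp add: score_def)
qed

lemma prod_score: "(\<Prod>p\<in>Pr N. x (win X p)) = (\<Prod>l<N. x l ^ score N X l)"
proof -
 have "(\<Prod>p\<in>Pr N. x (win X p)) = (\<Prod>l<N. \<Prod>p\<in>{p\<in>Pr N. win X p = l}. x (win X p))"
  by (rule prod.group[symmetric]) (auto dest: win_less)
 also have "... = (\<Prod>l<N. x l ^ score N X l)" by (intro prod.cong refl) (simp add: score_def)
 finally show ?thesis .
qed

lemma sum_score: "(\<Sum>l<N. g l * score N X l) = (\<Sum>p\<in>Pr N. g (win X p))"
proof -
 have "(\<Sum>p\<in>Pr N. g (win X p)) = (\<Sum>l<N. \<Sum>p\<in>{p\<in>Pr N. win X p = l}. g (win X p))"
  by (rule sum.group[symmetric]) (auto dest: win_less)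
 also have "... = (\<Sum>l<N. g l * score N X l)" by (intro sum.cong refl) (simp add: score_def)
 finally show ?thesis by simp
qed

lemma vand_expand: "vand N x = (\<Sum>X\<in>Pow (Pr N). sg N X * (\<Prod>l<N. x l ^ score N X l))"
proof -
 have "vand N x = (\<Prod>p\<in>Pr N. x (fst p) + - x (snd p))" by (simp add: vand_def case_prod_beta)
 also have "... = (\<Sum>X\<in>Pow (Pr N). (\<Prod>p\<in>X. x (fst p)) * (\<Prod>p\<in>Pr N - X. - x (snd p)))"
  by (rule prod_add) simp
 also have "... = (\<Sum>X\<in>Pow (Pr N). sg N X * (\<Prod>l<N. x l ^ score N X l))"
 proof (intro sum.cong refl)
  fix X assume X: "X \<in> Pow (Pr N)"
  have "(\<Prod>l<N. x l ^ score N X l) = (\<Prod>p\<in>Pr N. x (win X p))" by (simp add: prod_score)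
  also have "... = (\<Prod>p\<in>Pr N - X. x (win X p)) * (\<Prod>p\<in>X. x (win X p))"
   using X by (intro prod.subset_diff) auto
  also have "... = (\<Prod>p\<in>Pr N - X. x (snd p)) * (\<Prod>p\<in>X. x (fst p))"
   by (intro arg_cong2[where f = "(*)"] prod.cong) (auto simp: win_def)
  finally have e: "(\<Prod>l<N. x l ^ score N X l) = (\<Prod>p\<in>Pr N - X. x (snd p)) * (\<Prod>p\<in>X. x (fst p))" .
  have "(\<Prod>p\<in>Pr N - X. - x (snd p)) = (\<Prod>p\<in>Pr N - X. (-1) * x (snd p))" by simp
  also have "... = sg N X * (\<Prod>p\<in>Pr N - X. x (snd p))" unfolding prod.distrib by (simp add: sg_def)
  finally show "(\<Prod>p\<in>X. x (fst p)) * (\<Prod>p\<in>Pr N - X. - x (snd p)) = sg N X * (\<Prod>l<N. x l ^ score N X l)"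
   unfolding e by (simp add: mult_ac)
 qed
 finally show ?thesis .
qed

text \<open>In one variable the Vandermonde product is a constant times the product of the
  differences. Hence scaling that variable turns these differences into the numerators of the
  Macdonald operator.\<close>

lemma vand_split:
 fixes x :: "nat => 'a::comm_ring_1"
 assumes j: "j < N"
 shows "\<exists>R. \<forall>y. vand N (x(j := y)) = R * (\<Prod>l\<in>{..<N}-{j}. y - x l)"
proof -
 define P0 P1 P2 where "P0 = {p\<in>Pr N. fst p ~= j & snd p ~= j}" and "P1 = (%l. (l, j)) ` {..<j}" and "P2 = (%l. (j, l)) ` {j<..<N}"
 have P: "Pr N = P0 \<union> (P1 \<union> P2)" using j by (auto simp: Pr_def P0_def P1_def P2_def)
 define R where "R = (\<Prod>(i, k)\<in>P0. x i - x k) * (-1) ^ j"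
 have "vand N (x(j := y)) = R * (\<Prod>l\<in>{..<N}-{j}. y - x l)" for y
 proof -
  let ?g = "%(i, k). (x(j := y)) i - (x(j := y)) k"
  have "vand N (x(j := y)) = prod ?g P0 * (prod ?g P1 * prod ?g P2)"
   unfolding vand_def P by (subst prod.union_disjoint; (subst prod.union_disjoint)?) (auto simp: P0_def P1_def P2_def)
  also have "prod ?g P0 = (\<Prod>(i, k)\<in>P0. x i - x k)" by (intro prod.cong) (auto simp: P0_def)
  also have "prod ?g P1 = (\<Prod>l<j. (-1) * (y - x l))"
   unfolding P1_def by (subst prod.reindex) (auto simp: inj_on_def intro!: prod.cong)
  also have "... = (-1) ^ j * (\<Prod>l<j. y - x l)" unfolding prod.distrib by simp
  also have "prod ?g P2 = (\<Prod>l\<in>{j<..<N}. y - x l)"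
   unfolding P2_def by (subst prod.reindex) (auto simp: inj_on_def intro!: prod.cong)
  finally have "vand N (x(j := y)) = R * ((\<Prod>l<j. y - x l) * (\<Prod>l\<in>{j<..<N}. y - x l))"
   unfolding R_def by (simp only: mult_ac)
  also have "(\<Prod>l<j. y - x l) * (\<Prod>l\<in>{j<..<N}. y - x l) = (\<Prod>l\<in>{..<j} \<union> {j<..<N}. y - x l)"
   by (subst prod.union_disjoint) auto
  also have "{..<j} \<union> {j<..<N} = {..<N} - {j}" using j by auto
  finally show ?thesis .
 qed
 thus ?thesis by blast
qed

definition Eop :: "nat => (nat list => K) => nat list => K" where
 "Eop d = vop (%k. 1) (%k. - (1 - qq ^ k)) (%k. 1 - inverse tt ^ k) d d"

text \<open>The factor by which the operator acts on a monomial with tournament scores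
  \<open>\<delta>\<close> and exponents \<open>al\<close>: the shift in the variable
  \<open>j\<close> contributes \<open>tt ^ \<delta> j * qq ^ al j\<close>.\<close>

definition eig :: "nat => (nat => nat) => (nat => nat) => K" where
 "eig N \<delta> al = inverse tt ^ N + (1 - inverse tt) * inverse tt ^ (N - 1) * (\<Sum>j<N. tt ^ \<delta> j * qq ^ al j)"

text \<open>The Vandermonde product clears the denominators: each coefficient of the operator
  becomes the Vandermonde product with one variable scaled by t. After expansion every monomial is
  an eigenvector.\<close>

lemma vand_E:
 fixes x :: "nat => K"
 assumes inj: "inj_on x {..<N}" and nz: "\<And>i. i < N ==> x i ~= 0" and N: "0 < N"
 shows "vand N x * ev d (Eop d f) (psum N x) =
  (\<Sum>X\<in>Pow (Pr N). \<Sum>al\<in>AN N d. sg N X * (eig N (score N X) al * cf d f al) * (\<Prod>l<N. x l ^ (score N X l + al l)))"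
proof -
 define s where "s = inverse tt"
 have st: "s * tt = 1" "tt * s = 1" by (simp_all add: s_def)
 have A: "vand N x * ((1 - s) * (\<Prod>l\<in>{..<N}-{j}. (x j - s * x l) / (x j - x l))) = (1 - s) * s ^ (N - 1) * vand N (x(j := tt * x j))"
  if j: "j < N" for j
 proof -
  obtain R where R: "\<And>y. vand N (x(j := y)) = R * (\<Prod>l\<in>{..<N}-{j}. y - x l)" using vand_split[OF j] by blast
  have 1: "vand N x = R * (\<Prod>l\<in>{..<N}-{j}. x j - x l)" using R[of "x j"] by simp
  have 2: "(\<Prod>l\<in>{..<N}-{j}. x j - x l) * (\<Prod>l\<in>{..<N}-{j}. (x j - s * x l) / (x j - x l)) = (\<Prod>l\<in>{..<N}-{j}. x j - s * x l)"
   unfolding prod.distrib[symmetric] by (intro prod.cong refl) (use inj j in \<open>auto simp: inj_on_def\<close>)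
  have "(\<Prod>l\<in>{..<N}-{j}. x j - s * x l) = (\<Prod>l\<in>{..<N}-{j}. s * (tt * x j - x l))"
   by (intro prod.cong refl) (simp add: right_diff_distrib mult.assoc[symmetric] st)
  also have "... = s ^ (N - 1) * (\<Prod>l\<in>{..<N}-{j}. tt * x j - x l)"
   unfolding prod.distrib using j by simp
  finally have 3: "(\<Prod>l\<in>{..<N}-{j}. x j - s * x l) = s ^ (N - 1) * (\<Prod>l\<in>{..<N}-{j}. tt * x j - x l)" .
  have "vand N x * ((1 - s) * (\<Prod>l\<in>{..<N}-{j}. (x j - s * x l) / (x j - x l))) =
   (1 - s) * (R * ((\<Prod>l\<in>{..<N}-{j}. x j - x l) * (\<Prod>l\<in>{..<N}-{j}. (x j - s * x l) / (x j - x l))))"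
   unfolding 1 by (simp only: mult_ac)
  also have "... = (1 - s) * (R * (s ^ (N - 1) * (\<Prod>l\<in>{..<N}-{j}. tt * x j - x l)))" unfolding 2 3 ..
  also have "... = (1 - s) * s ^ (N - 1) * vand N (x(j := tt * x j))" unfolding R by (simp only: mult_ac)
  finally show ?thesis .
 qed
 have scal: "(\<Prod>l<N. (x(j := c * x j)) l ^ e l) = c ^ e j * (\<Prod>l<N. x l ^ e l)" if "j < N" for j c and e :: "nat => nat"
 proof -
  have "(\<Prod>l<N. (x(j := c * x j)) l ^ e l) = (\<Prod>l<N. (if l = j then c ^ e j else 1) * x l ^ e l)"
   by (intro prod.cong refl) (simp add: power_mult_distrib)
  thus ?thesis unfolding prod.distrib using that by (simp add: prod.delta)
 qed
 define F where "F X al = sg N X * cf d f al * (\<Prod>l<N. x l ^ (score N X l + al l))" for X al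
 have FF: "F X al = (sg N X * (\<Prod>l<N. x l ^ score N X l)) * (cf d f al * (\<Prod>l<N. x l ^ al l))" for X al
  by (simp add: F_def power_add prod.distrib mult_ac)
 have VB: "vand N x * ev d f (psum N x) = (\<Sum>X\<in>Pow (Pr N). \<Sum>al\<in>AN N d. F X al)"
  unfolding vand_expand ev_cf sum_product FF ..
 have VJ: "vand N (x(j := tt * x j)) * ev d f (psum N (x(j := qq * x j))) =
  (\<Sum>X\<in>Pow (Pr N). \<Sum>al\<in>AN N d. tt ^ score N X j * qq ^ al j * F X al)" if j: "j < N" for j
  unfolding vand_expand ev_cf sum_product FF by (intro sum.cong refl) (simp only: scal[OF j] mult_ac)
 have "vand N x * ev d (Eop d f) (psum N x) = s ^ N * (vand N x * ev d f (psum N x)) +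
  (\<Sum>j<N. (vand N x * ((1 - s) * (\<Prod>l\<in>{..<N}-{j}. (x j - s * x l) / (x j - x l)))) * ev d f (psum N (x(j := qq * x j))))"
 proof -
  have "ev d (Eop d f) (psum N x) = s ^ N * ev d f (psum N x) +
   (\<Sum>j<N. (1 - s) * (\<Prod>l\<in>{..<N}-{j}. (x j - s * x l) / (x j - x l)) * ev d f (psum N (x(j := qq * x j))))"
   unfolding Eop_def s_def[symmetric] by (rule ev_vop_E[OF inj nz N])
  thus ?thesis by (simp only: distrib_left sum_distrib_left mult.left_commute[of "vand N x" "s ^ N"] mult.assoc[of "vand N x"])
 qed
 also have "... = s ^ N * (vand N x * ev d f (psum N x)) +
  (\<Sum>j<N. (1 - s) * s ^ (N - 1) * (vand N (x(j := tt * x j)) * ev d f (psum N (x(j := qq * x j)))))"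
  by (intro arg_cong2[where f = "(+)"] sum.cong refl) (simp only: A lessThan_iff mult.assoc)
 also have "... = s ^ N * (\<Sum>X\<in>Pow (Pr N). \<Sum>al\<in>AN N d. F X al) +
  (\<Sum>j<N. (1 - s) * s ^ (N - 1) * (\<Sum>X\<in>Pow (Pr N). \<Sum>al\<in>AN N d. tt ^ score N X j * qq ^ al j * F X al))"
  unfolding VB by (intro arg_cong2[where f = "(+)"] sum.cong refl) (simp only: VJ lessThan_iff)
 also have "(\<Sum>j<N. (1 - s) * s ^ (N - 1) * (\<Sum>X\<in>Pow (Pr N). \<Sum>al\<in>AN N d. tt ^ score N X j * qq ^ al j * F X al)) =
  (\<Sum>X\<in>Pow (Pr N). \<Sum>al\<in>AN N d. (1 - s) * s ^ (N - 1) * (\<Sum>j<N. tt ^ score N X j * qq ^ al j) * F X al)"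
  unfolding sum_distrib_left sum_distrib_right
  by (subst sum.swap, intro sum.cong refl, subst sum.swap) (simp only: mult.assoc)
 also have "s ^ N * (\<Sum>X\<in>Pow (Pr N). \<Sum>al\<in>AN N d. F X al) + ... =
  (\<Sum>X\<in>Pow (Pr N). \<Sum>al\<in>AN N d. eig N (score N X) al * F X al)"
  unfolding sum_distrib_left sum.distrib[symmetric] eig_def s_def[symmetric] distrib_right ..
 also have "... = (\<Sum>X\<in>Pow (Pr N). \<Sum>al\<in>AN N d. sg N X * (eig N (score N X) al * cf d f al) * (\<Prod>l<N. x l ^ (score N X l + al l)))"
  by (intro sum.cong refl) (simp only: F_def mult_ac)
 finally show ?thesis .
qed

text \<open>The tournament in which the smaller index always wins maximises all initial score sums.
  It is the only one with its scores, since any upset increases the sum of the winning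
  indices.\<close>

lemma score_top:
 assumes X: "X \<subseteq> Pr N"
 shows "(\<Sum>l<k. score N X l) <= (\<Sum>l<k. score N (Pr N) l)"
  and "(\<And>l. l < N ==> score N X l = score N (Pr N) l) ==> X = Pr N"
proof -
 have "(\<Sum>l<k. score N Y l) = (\<Sum>p\<in>Pr N. if win Y p < k then 1 else 0)" for Y
 proof -
  have "(\<Sum>p\<in>Pr N. if win Y p < k then 1 else 0) = (\<Sum>l<N. (if l < k then 1 else 0) * score N Y l)"
   by (rule sum_score[symmetric])
  also have "... = (\<Sum>l<N. if l < k then score N Y l else 0)" by (intro sum.cong) auto
  also have "... = (\<Sum>l\<in>{l\<in>{..<N}. l < k}. score N Y l)" by (rule sum.inter_filter[symmetric]) simp
  also have "... = (\<Sum>l<k. score N Y l)" by (rule sum.mono_neutral_left) (auto intro: ccontr simp: score_out not_less)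
  finally show ?thesis ..
 qed
 thus "(\<Sum>l<k. score N X l) <= (\<Sum>l<k. score N (Pr N) l)"
  by (auto intro!: sum_mono simp: win_def Pr_def)
 assume eq: "\<And>l. l < N ==> score N X l = score N (Pr N) l"
 show "X = Pr N"
 proof (rule ccontr)
  assume "X ~= Pr N"
  then obtain p where p: "p \<in> Pr N" "p \<notin> X" using X by auto
  have "(\<Sum>p\<in>Pr N. win X p) = (\<Sum>l<N. l * score N X l)" by (rule sum_score[symmetric])
  also have "... = (\<Sum>l<N. l * score N (Pr N) l)" by (simp add: eq)
  also have "... = (\<Sum>p\<in>Pr N. win (Pr N) p)" by (rule sum_score)
  also have "... < (\<Sum>p\<in>Pr N. win X p)"
   by (rule sum_strict_mono_ex1[OF finite_Pr]) (use p in \<open>auto simp: win_def Pr_def intro!: bexI[of _ p]\<close>)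
  finally show False by simp
 qed
qed

lemma score_le: "score N X l <= card (Pr N)"
 unfolding score_def by (rule card_mono) auto

lemma fn_inj: "la \<in> parts d ==> ka \<in> parts d ==> (\<And>l. l < N ==> fn la l = fn ka l) ==> d <= N ==> la = ka"
proof -
 assume a: "la \<in> parts d" "ka \<in> parts d" and e: "\<And>l. l < N ==> fn la l = fn ka l" and "d <= N"
 have l: "length la <= N" "length ka <= N" using a parts_length \<open>d <= N\<close> order_trans by blast+
 have P: "fn la i ~= 0 \<longleftrightarrow> i < length la" "fn ka i ~= 0 \<longleftrightarrow> i < length ka" for i
  using parts_pos[OF a(1)] parts_pos[OF a(2)] by (auto simp: fn_def)
 have "i < length la \<longleftrightarrow> i < length ka" for i
  using e[of i] P(1)[of i] P(2)[of i] l by (cases "i < N") auto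
 hence "length la = length ka" by (metis linorder_neqE_nat less_irrefl)
 thus "la = ka" using e l by (intro nth_equalityI) (auto simp: fn_def, metis order_less_le_trans)
qed

lemma dominated_antisym: "la \<in> parts d ==> ka \<in> parts d ==> dominated la ka ==> dominated ka la ==> la = ka"
proof (rule fn_inj[where N = d])
 assume a: "dominated la ka" "dominated ka la"
 fix l
 have s: "sum_list (take k la) = sum_list (take k ka)" for k using a by (simp add: dominated_def order_antisym)
 show "fn la l = fn ka l" using s[of l] s[of "Suc l"] unfolding sum_fn_take[symmetric] by simp
qed auto

text \<open>Compare the coefficients of \<open>x\<^bsup>\<delta> + \<lambda>\<^esup>\<close>: every other tournament pushes the exponent up in dominance order.\<close>
lemma E_coeff:
 assumes la: "la \<in> parts d"
  and up: "\<And>kap. kap \<in> parts d ==> dominated la kap ==> kap ~= la ==> cf d f (fn kap) = 0 & cf d (Eop d f) (fn kap) = 0"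
 shows "cf d (Eop d f) (fn la) = eig (Suc d) (score (Suc d) (Pr (Suc d))) (fn la) * cf d f (fn la)"
proof -
 \<comment> \<open>One variable more than the degree, so that there is a variable also in degree 0;
   \<open>B\<close> exceeds every exponent of a score sequence plus a weight.\<close>
 define N B where "N = Suc d" and "B = Suc (N + card (Pr N) + d)"
 define I where "I = Pow (Pr N) \<times> AN N d"
 define c where "c = (%(X, al). sg N X * (cf d (Eop d f) al - eig N (score N X) al * cf d f al))"
 define ex where "ex = (%(X, al) l. score N X l + al l)"
 let ?be = "%l. score N (Pr N) l + fn la l"
 have "(\<Sum>i\<in>{i\<in>I. \<forall>l<N. ex i l = ?be l}. c i) = 0"
 proof (rule mono_indep[where B = B, OF _ pt_generic[of N B]])
  show "finite I" by (simp add: I_def)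
  show "N < B" by (simp add: B_def)
  fix i l assume "i \<in> I" "l < N"
  hence "snd i l <= d" by (auto simp: I_def AN_def)
  thus "ex i l < B" using score_le[of N "fst i" l]
   by (simp add: ex_def B_def case_prod_beta)
 next
  fix s :: K assume "s \<in> {s. inj_on (pt B s) {..<N} & (\<forall>i<N. pt B s i ~= 0)}"
  hence i: "inj_on (pt B s) {..<N}" "\<And>i. i < N ==> pt B s i ~= 0" by auto
  have "vand N (pt B s) * ev d (Eop d f) (psum N (pt B s)) =
   (\<Sum>X\<in>Pow (Pr N). \<Sum>al\<in>AN N d. sg N X * cf d (Eop d f) al * (\<Prod>l<N. pt B s l ^ (score N X l + al l)))"
   unfolding vand_expand ev_cf sum_product by (intro sum.cong refl) (simp add: power_add prod.distrib mult_ac)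
  hence "(\<Sum>X\<in>Pow (Pr N). \<Sum>al\<in>AN N d. sg N X * cf d (Eop d f) al * (\<Prod>l<N. pt B s l ^ (score N X l + al l))) -
   (\<Sum>X\<in>Pow (Pr N). \<Sum>al\<in>AN N d. sg N X * (eig N (score N X) al * cf d f al) * (\<Prod>l<N. pt B s l ^ (score N X l + al l))) = 0"
   using vand_E[OF i, of d f] by (simp add: N_def)
  hence "(\<Sum>X\<in>Pow (Pr N). \<Sum>al\<in>AN N d. c (X, al) * (\<Prod>l<N. pt B s l ^ ex (X, al) l)) = 0"
   unfolding sum_subtractf[symmetric] by (simp add: c_def ex_def right_diff_distrib left_diff_distrib)
  thus "(\<Sum>i\<in>I. c i * (\<Prod>l<N. pt B s l ^ ex i l)) = 0"
   unfolding I_def sum.cartesian_product by (simp add: case_prod_unfold)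
 qed
 also have "(\<Sum>i\<in>{i\<in>I. \<forall>l<N. ex i l = ?be l}. c i) = (\<Sum>i\<in>{(Pr N, fn la)}. c i)"
 proof (rule sum.mono_neutral_right)
  show "finite {i\<in>I. \<forall>l<N. ex i l = ?be l}" by (simp add: I_def)
  have len: "length la <= d" using la by (rule parts_length)
  have "fn la \<in> AN N d"
   using len fn_subset_le[OF parts_sorted[OF la], of "{j}" for j] la parts_sum[OF la]
   by (auto simp: AN_def fn_def N_def member_le_sum_list)
  thus "{(Pr N, fn la)} \<subseteq> {i\<in>I. \<forall>l<N. ex i l = ?be l}" by (auto simp: I_def ex_def)
  show "\<forall>i\<in>{i\<in>I. \<forall>l<N. ex i l = ?be l} - {(Pr N, fn la)}. c i = 0"
  proof (rule ballI, rule ccontr)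
   fix i assume i: "i \<in> {i\<in>I. \<forall>l<N. ex i l = ?be l} - {(Pr N, fn la)}" and nz: "c i ~= 0"
   obtain X al where e: "i = (X, al)" by fastforce
   have X: "X \<subseteq> Pr N" and al: "al \<in> AN N d" and ex: "\<And>l. l < N ==> score N X l + al l = score N (Pr N) l + fn la l"
    and ne: "(X, al) ~= (Pr N, fn la)" using i by (auto simp: e I_def ex_def)
   have nz': "cf d (Eop d f) al ~= 0 | cf d f al ~= 0" using nz by (auto simp: e c_def)
   hence "tot d al" using cf_tot by blast
   then obtain kap where k: "kap \<in> parts d" "\<And>f::nat list => K. cf d f al = cf d f (fn kap)"
    "\<And>S. finite S ==> sum al S <= sum_list (take (card S) kap)" using tot_sort[where 'a = K] by blast
   have out: "al l = 0" "fn la l = 0" if "N <= l" for l using al that len by (auto simp: AN_def fn_def N_def)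
   have pre: "(\<Sum>l<k. fn la l) <= (\<Sum>l<k. al l)" for k
   proof -
    have "(\<Sum>l<k. fn la l) + (\<Sum>l<k. score N (Pr N) l) = (\<Sum>l<k. al l) + (\<Sum>l<k. score N X l)"
     unfolding sum.distrib[symmetric]
    proof (intro sum.cong refl)
     fix l
     show "fn la l + score N (Pr N) l = al l + score N X l"
      using ex[of l] out[of l] by (cases "l < N") (auto simp: score_out)
    qed
    thus ?thesis using score_top(1)[OF X, of k] by linarith
   qed
   have dom: "dominated la kap" unfolding dominated_def
   proof
    fix m
    have "sum_list (take m la) <= sum al {..<m}" using pre[of m] by (simp only: sum_fn_take)
    also have "... <= sum_list (take m kap)" using k(3)[of "{..<m}"] by simp
    finally show "sum_list (take m la) <= sum_list (take m kap)" .
   qed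
   show False
   proof (cases "kap = la")
    case True
    have s: "(\<Sum>l<m. fn la l) = (\<Sum>l<m. al l)" for m
     using pre[of m] k(3)[of "{..<m}"] True by (simp add: sum_fn_take)
    have a: "al = fn la"
    proof
     fix l show "al l = fn la l" using s[of l] s[of "Suc l"] by simp
    qed
    hence "X = Pr N" using ex by (intro score_top(2)[OF X]) simp
    with a ne show False by simp
   next
    case False
    from up[OF k(1) dom this] nz' k(2) show False by simp
   qed
  qed
 qed
 finally have "sg N (Pr N) * (cf d (Eop d f) (fn la) - eig N (score N (Pr N)) (fn la) * cf d f (fn la)) = 0"
  by (simp add: c_def)
 thus ?thesis by (simp add: sg_def N_def)
qed

lemma score_Pr: assumes "l < N" shows "score N (Pr N) l = N - 1 - l"
proof -
 have "{p \<in> Pr N. win (Pr N) p = l} = Pair l ` {l<..<N}"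
  by (auto simp: win_def) (auto simp: Pr_def)
 thus ?thesis by (simp add: score_def card_image inj_on_def)
qed

definition el :: "nat => nat list => K" where
 "el d la = eig (Suc d) (score (Suc d) (Pr (Suc d))) (fn la)"

lemma el_alt: "el d la = inverse tt ^ Suc d + (1 - inverse tt) * (\<Sum>j\<le>d. inverse tt ^ j * qq ^ fn la j)"
proof -
 have "inverse tt ^ d * (\<Sum>j<Suc d. tt ^ score (Suc d) (Pr (Suc d)) j * qq ^ fn la j) =
  (\<Sum>j<Suc d. inverse tt ^ j * qq ^ fn la j)"
 proof (unfold sum_distrib_left, intro sum.cong refl)
  fix j assume "j \<in> {..<Suc d}"
  hence s: "score (Suc d) (Pr (Suc d)) j = d - j" and "d = j + (d - j)" by (simp_all add: score_Pr)
  hence "inverse tt ^ d = inverse tt ^ j * inverse tt ^ (d - j)" by (metis power_add)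
  thus "inverse tt ^ d * (tt ^ score (Suc d) (Pr (Suc d)) j * qq ^ fn la j) = inverse tt ^ j * qq ^ fn la j"
   by (simp add: s power_mult_distrib[symmetric] mult.assoc[symmetric] power_inverse)
 qed
 thus ?thesis by (simp add: el_def eig_def mult.assoc lessThan_Suc_atMost)
qed

lemma to_fract_sum: "to_fract (\<Sum>i\<in>A. f i) = (\<Sum>i\<in>A. to_fract (f i))"
 by (induction A rule: infinite_finite_induct) simp_all

text \<open>The factor 1 - 1/t is nonzero, and the sum in \<open>el_alt\<close> multiplied by t^d is
  a polynomial in t whose coefficients are the powers of q given by the parts.\<close>

lemma el_inj:
 assumes "la \<in> parts d" "ka \<in> parts d" "el d la = el d ka"
 shows "la = ka"
proof (rule fn_inj[OF assms(1,2), where N = "Suc d"])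
 fix l assume l: "l < Suc d"
 have t1: "inverse tt ~= 1" using tt_gt1 by (metis inverse_1 inverse_inverse_eq less_irrefl)
 have "(\<Sum>j\<le>d. inverse tt ^ j * qq ^ fn la j) = (\<Sum>j\<le>d. inverse tt ^ j * qq ^ fn ka j)"
  using assms(3) t1 by (simp add: el_alt)
 hence "tt ^ d * (\<Sum>j\<le>d. inverse tt ^ j * qq ^ fn la j) = tt ^ d * (\<Sum>j\<le>d. inverse tt ^ j * qq ^ fn ka j)" by simp
 moreover have "tt ^ d * (\<Sum>j\<le>d. inverse tt ^ j * qq ^ f j) = to_fract (\<Sum>j\<le>d. monom (monom 1 (f j)) (d - j))" for f
  unfolding to_fract_sum qt_to_fract[symmetric] sum_distrib_left
 proof (intro sum.cong refl)
  fix j assume "j \<in> {..d}"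
  hence "d = (d - j) + j" by simp
  hence "tt ^ d = tt ^ (d - j) * tt ^ j" by (metis power_add)
  thus "tt ^ d * (inverse tt ^ j * qq ^ f j) = qq ^ f j * tt ^ (d - j)"
   by (simp add: power_inverse)
 qed
 ultimately have "(\<Sum>j\<le>d. monom (monom 1 (fn la j)) (d - j)) = (\<Sum>j\<le>d. monom (monom (1::rat) (fn ka j)) (d - j))"
  by (simp only: to_fract_eq_iff)
 hence "coeff (\<Sum>j\<le>d. monom (monom 1 (fn la j)) (d - j)) (d - l) = coeff (\<Sum>j\<le>d. monom (monom (1::rat) (fn ka j)) (d - j)) (d - l)"
  by simp
 moreover have "coeff (\<Sum>j\<le>d. monom (monom (1::rat) (f j)) (d - j)) (d - l) = monom 1 (f l)" for f
 proof -
  have "coeff (\<Sum>j\<le>d. monom (monom (1::rat) (f j)) (d - j)) (d - l) = (\<Sum>j\<le>d. if j = l then monom 1 (f j) else 0)"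
   unfolding coeff_sum using l by (intro sum.cong refl) auto
  thus ?thesis using l by (simp add: sum.delta)
 qed
 ultimately show "fn la l = fn ka l" by (simp add: monom_eq_iff')
qed simp

section \<open>Linearity, and triangularity in the dominance order\<close>

lemma vop_lin:
 "vop a b c d d' (%mu. \<Sum>i\<in>A. s i * f i mu) = (%nu. \<Sum>i\<in>A. s i * vop a b c d d' (f i) nu)"
 unfolding vop_def by (intro ext) (simp add: sum_distrib_left, subst sum.swap, simp add: mult_ac)

lemma vop_diff: "vop a b c d d' (%mu. f mu - s * g mu) = (%nu. vop a b c d d' f nu - s * vop a b c d d' g nu)"
 unfolding vop_def by (intro ext) (simp add: sum_distrib_left sum_subtractf algebra_simps)

lemma symf_vop: "symf d' (vop a b c d d' f)" by (simp add: symf_def vop_def)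

lemma cf_diff: "cf d (%mu. f mu - s * g mu) al = cf d f al - s * cf d g al" for s :: "'a::comm_ring_1"
 by (simp add: cf_def algebra_simps sum_subtractf sum_distrib_left)

lemma cf_lin: "cf d (%mu. \<Sum>i\<in>A. s i * f i mu) al = (\<Sum>i\<in>A. s i * cf d (f i) al)"
 unfolding cf_def by (simp add: sum_distrib_left sum_distrib_right mult.assoc, subst sum.swap, simp)

text \<open>Triangularity is expressed through monomial coefficients at partitions, because the
  power-sum vector itself does not reflect dominance.\<close>

definition supp :: "nat => nat list set => (nat list => K) => bool" where
 "supp d D f \<longleftrightarrow> symf d f & (\<forall>la\<in>parts d. cf d f (fn la) ~= 0 --> la \<in> D)"

definition dc :: "nat => nat list set => bool" where
 "dc d D \<longleftrightarrow> D \<subseteq> parts d & (\<forall>mu\<in>D. \<forall>kap\<in>parts d. dominated kap mu --> kap \<in> D)"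

definition dn :: "nat => nat list => nat list set" where "dn d la = {mu\<in>parts d. dominated mu la}"

lemma dominated_refl [simp]: "dominated la la" by (simp add: dominated_def)
lemma dominated_trans: "dominated a b ==> dominated b c ==> dominated a c"
 unfolding dominated_def using order_trans by blast

lemma dc_dn: "dc d (dn d la)" by (auto simp: dc_def dn_def intro: dominated_trans)
lemma dc_dn': "la \<in> parts d ==> dc d (dn d la - {la})"
 by (auto simp: dc_def dn_def intro: dominated_trans dominated_antisym)

text \<open>A numerical linear extension of the dominance order, see \<open>wt_less\<close>.\<close>

definition wt :: "nat => nat list => nat" where "wt d la = (\<Sum>k\<le>d. sum_list (take k la))"

lemma wt_less:
 assumes "la \<in> parts d" "ka \<in> parts d" "dominated la ka" "la ~= ka"
 shows "wt d la < wt d ka"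
proof -
 have "\<exists>k\<le>d. sum_list (take k la) ~= sum_list (take k ka)"
 proof (rule ccontr)
  assume "\<not> ?thesis"
  hence s: "sum_list (take k la) = sum_list (take k ka)" if "k <= d" for k using that by blast
  have "la = ka"
  proof (rule fn_inj[OF assms(1,2) _ order_refl])
   fix l assume "l < d"
   thus "fn la l = fn ka l" using s[of l] s[of "Suc l"] unfolding sum_fn_take[symmetric] by simp
  qed
  with assms(4) show False by simp
 qed
 then obtain k where "k <= d" "sum_list (take k la) < sum_list (take k ka)"
  using assms(3) by (auto simp: dominated_def le_less)
 thus ?thesis unfolding wt_def
  by (intro sum_strict_mono_ex1) (use assms(3) in \<open>auto simp: dominated_def\<close>)
qed

lemma finite_dc: "dc d D ==> finite D" by (auto simp: dc_def intro: finite_subset[OF _ finite_parts])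

text \<open>Every nonempty down-closed set has an element not dominated by another of its elements,
  namely one of largest \<open>wt\<close>. At such an element a triangular operator acts by its
  eigenvalue alone.\<close>

lemma dc_induct [consumes 1, case_names empty insert]:
 assumes "dc d D" and "P {}"
  and "\<And>D la. dc d D ==> la \<in> D ==> (\<And>kap. kap \<in> D ==> dominated la kap ==> kap = la) ==> dc d (D - {la}) ==> P (D - {la}) ==> P D"
 shows "P D"
 using assms(1)
proof (induction "card D" arbitrary: D rule: less_induct)
 case less
 note fin = finite_dc[OF less.prems]
 show ?case
 proof (cases "D = {}")
  case False
  obtain la where la: "la \<in> D" "\<And>kap. kap \<in> D ==> wt d kap <= wt d la"
  proof -
   have "Max (wt d ` D) \<in> wt d ` D" using False fin by simp
   then obtain la where "la \<in> D" "Max (wt d ` D) = wt d la" by auto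
   thus thesis using that[of la] fin by (metis Max_ge finite_imageI imageI)
  qed
  have mx: "kap = la" if "kap \<in> D" "dominated la kap" for kap
   using wt_less[of la d kap] la(2)[OF that(1)] that la(1) less.prems by (auto simp: dc_def)
  have d: "dc d (D - {la})"
   using less.prems mx by (auto simp: dc_def)
  have "P (D - {la})"
   by (rule less.hyps[OF _ d]) (intro psubset_card_mono fin, use la(1) in blast)
  thus ?thesis using assms(3)[OF less.prems la(1) mx d] by blast
 qed (use assms(2) in simp)
qed

lemma supp_empty: "supp d {} f ==> f = (%_. 0)"
proof
 fix mu assume s: "supp d {} f"
 show "f mu = 0"
 proof (cases "mu \<in> parts d")
  case True
  show ?thesis
   by (rule pvec_unique[OF _ True, where g = "%_. 0"]) (use s in \<open>auto simp: supp_def cf_def\<close>)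
 qed (use s in \<open>auto simp: supp_def symf_def\<close>)
qed

lemma supp_diff: "supp d D f ==> supp d D g ==> supp d D (%mu. f mu - s * g mu)"
 unfolding supp_def symf_def cf_diff by auto

lemma supp_mono: "supp d D f ==> D \<inter> parts d \<subseteq> D' ==> supp d D' f" by (auto simp: supp_def)

lemma supp_lin: "(\<And>i. i \<in> A ==> supp d D (f i)) ==> supp d D (%mu. \<Sum>i\<in>A. s i * f i mu)"
 unfolding supp_def symf_def cf_lin by (auto intro!: sum.neutral)

lemma supp_del: "supp d D f ==> cf d f (fn la) = 0 ==> supp d (D - {la}) f" by (auto simp: supp_def)

text \<open>Induction from the top of the dominance order downwards: once all coefficients above
  \<open>la\<close> vanish, \<open>E_coeff\<close> gives the coefficient at \<open>la\<close> as a
  multiple of one that is zero.\<close>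

lemma E_supp:
 assumes D: "dc d D" and f: "supp d D f"
 shows "supp d D (Eop d f)"
proof -
 have "cf d (Eop d f) (fn la) = 0" if "la \<in> parts d" "la \<notin> D" for la
  using that
 \<comment> \<open>\<open>Suc d * d\<close> bounds \<open>wt d\<close>, so this measure decreases
   when \<open>la\<close> rises.\<close>
 proof (induction "Suc d * d - wt d la" arbitrary: la rule: less_induct)
  case less
  have wl: "wt d ka <= Suc d * d" if "ka \<in> parts d" for ka
  proof -
   have "sum_list (take k ka) <= d" for k
    using parts_sum[OF that] sum_list_append[of "take k ka" "drop k ka"] by simp
   hence "wt d ka <= (\<Sum>k\<le>d. d)" unfolding wt_def by (intro sum_mono)
   thus ?thesis by simp
  qed
  have "cf d (Eop d f) (fn la) = eig (Suc d) (score (Suc d) (Pr (Suc d))) (fn la) * cf d f (fn la)"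
  proof (rule E_coeff[OF less.prems(1)])
   fix ka assume k: "ka \<in> parts d" "dominated la ka" "ka ~= la"
   have kD: "ka \<notin> D" using D k less.prems by (auto simp: dc_def)
   have "cf d (Eop d f) (fn ka) = 0"
   proof (rule less.hyps[OF diff_less_mono2 k(1) kD])
    show "wt d la < wt d ka" using wt_less[OF less.prems(1) k(1,2)] k(3) by auto
    thus "wt d la < Suc d * d" using wl[OF k(1)] by (rule less_le_trans)
   qed
   thus "cf d f (fn ka) = 0 & cf d (Eop d f) (fn ka) = 0"
    using f kD k(1) by (auto simp: supp_def)
  qed
  thus ?case using f less.prems by (auto simp: supp_def)
 qed
 thus ?thesis by (auto simp: supp_def Eop_def symf_vop)
qed

lemma E_max:
 assumes D: "dc d D" and f: "supp d D f" and la: "la \<in> D" "\<And>kap. kap \<in> D ==> dominated la kap ==> kap = la"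
 shows "cf d (Eop d f) (fn la) = el d la * cf d f (fn la)"
 unfolding el_def
proof (rule E_coeff)
 show "la \<in> parts d" using D la by (auto simp: dc_def)
 fix ka assume "ka \<in> parts d" "dominated la ka" "ka ~= la"
 thus "cf d f (fn ka) = 0 & cf d (Eop d f) (fn ka) = 0"
  using la f E_supp[OF D f] by (auto simp: supp_def)
qed

definition basis :: "nat => (nat list => nat list => K) => bool" where
 "basis d B \<longleftrightarrow> (\<forall>mu\<in>parts d. supp d (dn d mu) (B mu) & cf d (B mu) (fn mu) ~= 0)"

lemma span:
 assumes B: "basis d B" and D: "dc d D"
 shows "supp d D f ==> \<exists>v. f = (%nu. \<Sum>mu\<in>D. v mu * B mu nu)"
 using D
proof (induction arbitrary: f rule: dc_induct)
 case empty
 hence "f = (%_. 0)" by (intro supp_empty)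
 thus ?case by simp
next
 case (insert D la)
 have la: "la \<in> parts d" using insert(1,2) by (auto simp: dc_def)
 have sl: "dn d la \<subseteq> D" using insert(1,2) by (auto simp: dc_def dn_def)
 define c where "c = cf d f (fn la) / cf d (B la) (fn la)"
 have b: "supp d D (B la)" "cf d (B la) (fn la) ~= 0"
  using B la sl by (auto simp: basis_def intro: supp_mono)
 have "supp d (D - {la}) (%mu. f mu - c * B la mu)"
  by (intro supp_del supp_diff insert.prems b(1)) (unfold cf_diff, use b(2) in \<open>simp add: c_def\<close>)
 then obtain v where v: "(%mu. f mu - c * B la mu) = (%nu. \<Sum>mu\<in>D - {la}. v mu * B mu nu)" using insert.IH by blast
 have "f = (%nu. \<Sum>mu\<in>D. (v(la := c)) mu * B mu nu)"
 proof
  fix nu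
  have "(\<Sum>mu\<in>D. (v(la := c)) mu * B mu nu) = c * B la nu + (\<Sum>mu\<in>D - {la}. (v(la := c)) mu * B mu nu)"
   using finite_dc[OF insert(1)] insert(2) by (simp add: sum.remove)
  also have "(\<Sum>mu\<in>D - {la}. (v(la := c)) mu * B mu nu) = (\<Sum>mu\<in>D - {la}. v mu * B mu nu)"
   by (intro sum.cong) auto
  also have "... = f nu - c * B la nu" using fun_cong[OF v, of nu] by simp
  finally show "f nu = (\<Sum>mu\<in>D. (v(la := c)) mu * B mu nu)" by simp
 qed
 thus ?case by blast
qed

lemma Eop_diff: "Eop d (%mu. f mu - s * g mu) = (%nu. Eop d f nu - s * Eop d g nu)"
 unfolding Eop_def by (rule vop_diff)

text \<open>On a down-closed set where \<open>e\<close> is no eigenvalue, the operator minus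
  \<open>e\<close> is triangular with nonzero diagonal, hence onto; the equation is solved one
  maximal partition at a time.\<close>

lemma eig_solve:
 assumes B: "basis d B" and D: "dc d D" and e: "\<And>mu. mu \<in> D ==> el d mu ~= e"
 shows "supp d D h ==> \<exists>f. supp d D f & (%nu. Eop d f nu - e * f nu) = h"
 using D e
proof (induction arbitrary: h rule: dc_induct)
 case empty
 hence "h = (%_. 0)" by (intro supp_empty)
 moreover have "Eop d (%_. 0) = (%_. 0)" by (simp add: Eop_def vop_def fun_eq_iff)
 moreover have "supp d {} (%_. 0)" by (simp add: supp_def symf_def cf_def)
 ultimately show ?case by (intro exI[of _ "%_. 0"] conjI) simp_all
next
 case (insert D la)
 have la: "la \<in> parts d" using insert(1,2) by (auto simp: dc_def)
 have sl: "dn d la \<subseteq> D" using insert(1,2) by (auto simp: dc_def dn_def)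
 have b: "supp d D (B la)" "cf d (B la) (fn la) ~= 0"
  using B la sl by (auto simp: basis_def intro: supp_mono)
 \<comment> \<open>Chosen so that the image of \<open>c\<close> times \<open>B la\<close> matches
   \<open>h\<close> in the coefficient at \<open>la\<close>.\<close>
 define c where "c = cf d h (fn la) / ((el d la - e) * cf d (B la) (fn la))"
 define g where "g = (%mu. 0 - (- c) * B la mu)"
 have g: "supp d D g" unfolding g_def
  by (intro supp_diff b(1)) (simp add: supp_def symf_def cf_def)
 have cg: "cf d g (fn la) = c * cf d (B la) (fn la)" unfolding g_def cf_diff by (simp add: cf_def)
 have Eg: "supp d D (%nu. Eop d g nu - e * g nu)" by (intro supp_diff E_supp g insert(1))
 have "supp d (D - {la}) (%nu. h nu - 1 * (Eop d g nu - e * g nu))"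
 proof (intro supp_del supp_diff[OF insert.prems(1) Eg])
  have "cf d (Eop d g) (fn la) = el d la * cf d g (fn la)" by (rule E_max[OF insert(1) g insert(2,3)])
  hence "cf d (%nu. Eop d g nu - e * g nu) (fn la) = (el d la - e) * (c * cf d (B la) (fn la))"
   unfolding cf_diff cg by (simp add: algebra_simps)
  also have "... = cf d h (fn la)" using b(2) insert.prems(2)[OF insert(2)] by (simp add: c_def)
  finally show "cf d (%nu. h nu - 1 * (Eop d g nu - e * g nu)) (fn la) = 0" unfolding cf_diff[of d h] by simp
 qed
 then obtain f' where f': "supp d (D - {la}) f'" "(%nu. Eop d f' nu - e * f' nu) = (%nu. h nu - 1 * (Eop d g nu - e * g nu))"
  using insert.IH[of "%nu. h nu - 1 * (Eop d g nu - e * g nu)"] insert.prems(2) by blast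
 have "supp d D (%nu. f' nu - (-1) * g nu)"
  by (intro supp_diff g supp_mono[OF f'(1)]) auto
 moreover have "(%nu. Eop d (%nu. f' nu - (-1) * g nu) nu - e * (f' nu - (-1) * g nu)) = h"
 proof
  fix nu
  have "Eop d f' nu - e * f' nu = h nu - (Eop d g nu - e * g nu)" using fun_cong[OF f'(2), of nu] by simp
  thus "Eop d (%nu. f' nu - (-1) * g nu) nu - e * (f' nu - (-1) * g nu) = h nu"
   unfolding Eop_diff by (simp add: algebra_simps)
 qed
 ultimately show ?case by blast
qed

subsection \<open>Kostka numbers and the Schur basis\<close>

text \<open>The consequence of column strictness from which the triangularity of Kostka numbers is
  derived.\<close>

definition low :: "nat => nat list list => bool" where
 "low r T \<longleftrightarrow> (\<forall>i<length T. \<forall>x\<in>set (T ! i). r + i <= x)"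

lemma low_Cons: "low r (R # T) \<longleftrightarrow> (\<forall>x\<in>set R. r <= x) & low (Suc r) T"
 unfolding low_def by (auto simp: All_less_Suc2)

lemma low_semistandard:
 assumes s: "semistandard T" and p: "sorted_wrt (\<ge>) (map length T)"
 shows "low 0 T"
proof -
 have "i < length T ==> j < length (T ! i) ==> i <= T ! i ! j" for i j
 proof (induction i)
  case (Suc i)
  have "length (T ! Suc i) <= length (T ! i)"
   using p Suc.prems by (simp add: sorted_wrt_iff_nth_less)
  hence "i <= T ! i ! j" using Suc by simp
  moreover have "T ! i ! j < T ! Suc i ! j" using s Suc.prems by (simp add: semistandard_def)
  ultimately show ?case by simp
 qed simp
 thus ?thesis by (auto simp: low_def in_set_conv_nth)
qed

lemma low_filter: "low r T ==> length (filter (%x. x < k) (concat T)) <= sum_list (take (k - r) (map length T))"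
proof (induction T arbitrary: r)
 case (Cons R T)
 have IH: "length (filter (%x. x < k) (concat T)) <= sum_list (take (k - Suc r) (map length T))"
  using Cons by (simp add: low_Cons)
 show ?case
 proof (cases "k <= r")
  case True
  hence "filter (%x. x < k) R = []" using Cons.prems by (auto simp: low_Cons filter_empty_conv)
  thus ?thesis using IH True by simp
 next
  case False
  hence "k - r = Suc (k - Suc r)" by simp
  thus ?thesis using IH length_filter_le[of "%x. x < k" R] by (simp add: add_mono)
 qed
qed simp

text \<open>The least possible sum of entries for the given shape under \<open>low\<close>; by
  \<open>low_sum\<close> only the superstandard filling attains it.\<close>

fun rwt :: "nat => nat list => nat" where
 "rwt r [] = 0"
| "rwt r (n # la) = r * n + rwt (Suc r) la"

lemma sum_list_ge_replicate: "\<forall>x\<in>set R. r <= x ==> r * length R <= sum_list R & (sum_list R <= r * length R --> R = replicate (length R) (r::nat))"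
proof (induction R)
 case (Cons a R)
 thus ?case by auto
qed simp

lemma low_sum: "low r T ==> rwt r (map length T) <= sum_list (concat T) \<and>
  (sum_list (concat T) <= rwt r (map length T) --> T = srow r (map length T))"
proof (induction T arbitrary: r)
 case (Cons R T)
 hence "r * length R <= sum_list R & (sum_list R <= r * length R --> R = replicate (length R) r)"
  using sum_list_ge_replicate by (simp add: low_Cons)
 moreover have "rwt (Suc r) (map length T) <= sum_list (concat T) \<and>
  (sum_list (concat T) <= rwt (Suc r) (map length T) --> T = srow (Suc r) (map length T))"
  using Cons by (simp add: low_Cons)
 ultimately show ?case by auto
qed simp

lemma sum_srow: "sum_list (concat (srow r la)) = rwt r la"
 by (induction la arbitrary: r) (simp_all add: sum_list_replicate mult.commute)

lemma length_filter_less_count: "length (filter (%x. x < k) w) = (\<Sum>j<k::nat. count (mset w) j)"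
proof (induction k)
 case (Suc k)
 have "length (filter (%x. x < Suc k) w) = length (filter (%x. x < k) w) + count (mset w) k"
  by (induction w) auto
 thus ?case using Suc by simp
qed simp

lemma kostka_dominated:
 assumes la: "sorted_wrt (\<ge>) la" and k: "kostka la (fn ka) ~= 0"
 shows "dominated ka la"
proof -
 obtain T where T: "map length T = la" "semistandard T" "\<And>k. count (mset (concat T)) k = fn ka k"
  using k unfolding kostka_def by (metis (mono_tags, lifting) card.empty Collect_empty_eq)
 have "low 0 T" using T la by (intro low_semistandard) auto
 hence "(\<Sum>j<k. fn ka j) <= sum_list (take k la)" for k
  using low_filter[of 0 T k] T by (simp add: length_filter_less_count)
 thus ?thesis by (simp add: dominated_def sum_fn_take)
qed

text \<open>Content equal to the shape means a minimal sum of entries, which leaves only the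
  superstandard tableau.\<close>

lemma kostka_diag:
 assumes la: "sorted_wrt (\<ge>) la"
 shows "kostka la (fn la) = 1"
proof -
 let ?S = "srow 0 la"
 have c: "count (mset (concat ?S)) k = fn la k" for k
  using ct_srow[of 0 la k] by (simp add: mset_rw[symmetric] fn_def ct_def)
 have "{T. map length T = la & semistandard T & (\<forall>k. count (mset (concat T)) k = fn la k)} = {?S}"
 proof (intro set_eqI iffI)
  fix T assume "T \<in> {T. map length T = la & semistandard T & (\<forall>k. count (mset (concat T)) k = fn la k)}"
  hence T: "map length T = la" "semistandard T" "\<And>k. count (mset (concat T)) k = fn la k" by auto
  have "mset (concat T) = mset (concat ?S)" by (rule multiset_eqI) (simp only: T(3) c)
  hence "sum_list (concat T) = rwt 0 la" unfolding sum_srow[symmetric] by (metis sum_mset_sum_list)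
  thus "T \<in> {?S}" using low_sum[OF low_semistandard[of T]] T la by simp
 next
  fix T assume "T \<in> {?S}"
  thus "T \<in> {T. map length T = la & semistandard T & (\<forall>k. count (mset (concat T)) k = fn la k)}"
   using c la ssyt_srow[OF la, of 0] semistandard_ssyt[of ?S] by simp
 qed
 thus ?thesis by (simp add: kostka_def)
qed

lemma cf_schur: "la \<in> parts d ==> cf d (schur la) al = of_nat (kostka la al)"
 by (simp add: cf_def schur_spec)

lemma supp_schur: "mu \<in> parts d ==> supp d (dn d mu) (schur mu)"
 using kostka_dominated[OF parts_sorted] schur_spec(1) by (auto simp: supp_def cf_schur dn_def)

lemma basis_schur: "basis d schur"
 by (auto simp: basis_def supp_schur cf_schur kostka_diag parts_sorted)

subsection \<open>Characterisation of Macdonald polynomials by the operator\<close>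

definition qtw :: "nat => K" where "qtw k = (1 - qq ^ k) / (1 - tt ^ k)"

lemma qt_inner_pm: "qt_inner d f g = (\<Sum>mu\<in>parts d. f mu * g mu * (of_nat (zm (mset mu)) * pm qtw (mset mu)))"
proof -
 have "(\<Prod>i<length mu. (1 - qq ^ (mu ! i)) / (1 - tt ^ (mu ! i))) = prod_list (map qtw mu)" for mu
  by (simp add: prod.list_conv_set_nth qtw_def atLeast0LessThan)
 thus ?thesis unfolding qt_inner_def by (simp add: zee_zm prod_list_pm mult.assoc)
qed

text \<open>The factor 1 - t^(-k) of a created part times its weight (1 - q^k) / (1 - t^k) in the
  scalar product is t^(-k) times the factor of a destroyed part. So both sides reduce to
  \<open>G\<close>, symmetric up to a power of 1/t, and this power agrees because created and
  destroyed parts have the same total.\<close>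

lemma E_symmetric_entry:
 assumes "mu \<in> parts d" "nu \<in> parts d"
 defines "V \<equiv> vme (%k. 1) (%k. - (1 - qq ^ k)) (%k. 1 - inverse tt ^ k)"
 shows "V nu mu * (of_nat (zm (mset nu)) * pm qtw (mset nu)) = V mu nu * (of_nat (zm (mset mu)) * pm qtw (mset mu))"
proof -
 define G where "G = (%A B K. of_nat (zm A) * of_nat (zm B) / (of_nat (zm K) * of_nat (zm (A - K)) * of_nat (zm (B - K))) *
  pm qtw K * (pm (%k. - (1 - qq ^ k)) (A - K) * (inverse tt ^ \<Sum>\<^sub># (B - K) * pm (%k. - (1 - qq ^ k)) (B - K))) :: K)"
 have key: "V nu mu * (of_nat (zm (mset nu)) * pm qtw (mset nu)) =
  (\<Sum>K | K \<subseteq># mset mu & K \<subseteq># mset nu. G (mset mu) (mset nu) K)" if m: "mu \<in> parts d" "nu \<in> parts d" for mu nu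
  unfolding V_def vme_def sum_distrib_right
 proof (intro sum.cong refl)
  fix L assume "L \<in> {L. L \<subseteq># mset mu & L \<subseteq># mset nu}"
  hence L: "L \<subseteq># mset mu" "L \<subseteq># mset nu" by auto
  define A B where "A = mset mu - L" and "B = mset nu - L"
  have N0: "0 \<notin># L" "0 \<notin># A" "0 \<notin># B" using mset_parts[OF m(1)] mset_parts[OF m(2)] L
   by (auto simp: A_def B_def dest: in_diffD mset_subset_eqD)
  have nz: "of_nat (zm L) ~= (0::K)" "of_nat (zm A) ~= (0::K)" "of_nat (zm B) ~= (0::K)"
   using N0 zm_nz by auto
  have n: "of_nat (Ncs mu L) = of_nat (zm (mset mu)) / (of_nat (zm L) * of_nat (zm A) :: K)"
   using arg_cong[OF Ncs_zm[OF L(1)], of "of_nat :: nat => K"] nz by (simp add: A_def field_simps)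
  have "pm (%k. 1 - inverse tt ^ k) M * pm qtw M = inverse tt ^ \<Sum>\<^sub># M * pm (%k. - (1 - qq ^ k)) M"
   if "0 \<notin># M" for M
   using that
  proof (induction M)
   case (add k M)
   have "(1 - inverse tt ^ k) * qtw k = inverse tt ^ k * - (1 - qq ^ k)"
    using add.prems by (simp add: qtw_def field_simps power_inverse)
   moreover have "pm (%k. 1 - inverse tt ^ k) (add_mset k M) * pm qtw (add_mset k M) =
    (1 - inverse tt ^ k) * qtw k * (pm (%k. 1 - inverse tt ^ k) M * pm qtw M)" by (simp add: mult_ac)
   ultimately show ?case using add by (simp add: power_add mult_ac)
  qed simp
  note c = this[OF N0(3)]
  have "mset nu = L + B" using L(2) by (simp add: B_def)
  hence "pm qtw (mset nu) = pm qtw L * pm qtw B" by simp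
  hence "of_nat (Ncs mu L) * pm (%k. 1) L * pm (%k. - (1 - qq ^ k)) A * pm (%k. 1 - inverse tt ^ k) B / of_nat (zm B) *
   (of_nat (zm (mset nu)) * pm qtw (mset nu)) =
   of_nat (zm (mset mu)) * of_nat (zm (mset nu)) / (of_nat (zm L) * of_nat (zm A) * of_nat (zm B)) * pm qtw L *
   (pm (%k. - (1 - qq ^ k)) A * (pm (%k. 1 - inverse tt ^ k) B * pm qtw B))"
   using nz by (simp add: n)
  thus "of_nat (Ncs mu L) * pm (%k. 1) L * pm (%k. - (1 - qq ^ k)) (mset mu - L) * pm (%k. 1 - inverse tt ^ k) (mset nu - L) / of_nat (zm (mset nu - L)) *
   (of_nat (zm (mset nu)) * pm qtw (mset nu)) = G (mset mu) (mset nu) L"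
   unfolding G_def c[unfolded B_def] A_def B_def .
 qed
 have "G (mset mu) (mset nu) L = G (mset nu) (mset mu) L" if "L \<subseteq># mset mu & L \<subseteq># mset nu" for L
 proof -
  have "\<Sum>\<^sub># (mset mu - L) = \<Sum>\<^sub># (mset nu - L)"
   using that mset_parts[OF assms(1)] mset_parts[OF assms(2)] by (simp add: sum_mset_diff)
  thus ?thesis by (simp add: G_def mult_ac)
 qed
 thus ?thesis unfolding key[OF assms(1,2)] key[OF assms(2,1)] by (intro sum.cong) auto
qed

lemma E_selfadjoint: "qt_inner d (Eop d f) g = qt_inner d f (Eop d g)"
proof -
 let ?V = "vme (%k. 1) (%k. - (1 - qq ^ k)) (%k. 1 - inverse tt ^ k)"
 have "qt_inner d (Eop d f) g = (\<Sum>nu\<in>parts d. \<Sum>mu\<in>parts d. f mu * g nu * (?V nu mu * (of_nat (zm (mset nu)) * pm qtw (mset nu))))"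
  unfolding qt_inner_pm by (intro sum.cong refl) (simp add: Eop_def vop_def sum_distrib_left sum_distrib_right mult_ac)
 also have "... = (\<Sum>nu\<in>parts d. \<Sum>mu\<in>parts d. f mu * g nu * (?V mu nu * (of_nat (zm (mset mu)) * pm qtw (mset mu))))"
  by (intro sum.cong refl) (simp only: E_symmetric_entry)
 also have "... = (\<Sum>mu\<in>parts d. \<Sum>nu\<in>parts d. f mu * g nu * (?V mu nu * (of_nat (zm (mset mu)) * pm qtw (mset mu))))"
  by (rule sum.swap)
 also have "... = qt_inner d f (Eop d g)"
  unfolding qt_inner_pm by (intro sum.cong refl) (simp add: Eop_def vop_def sum_distrib_left sum_distrib_right mult_ac)
 finally show ?thesis .
qed

text \<open>The field is ordered with \<open>q, t > 1\<close>, which makes the scalar product positive definite.\<close>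
lemma qt_definite:
 assumes s: "symf d f" and z: "qt_inner d f f = 0"
 shows "f = (%_. 0)"
proof
 fix mu
 show "f mu = 0"
 proof (cases "mu \<in> parts d")
  case True
  have pos: "0 < of_nat (zm (mset nu)) * pm qtw (mset nu)" if "nu \<in> parts d" for nu
  proof -
   have "0 < pm qtw M" if "0 \<notin># M" for M using that
   proof (induction M)
    case (add k M)
    hence "1 < qq ^ k" "1 < tt ^ k" using qq_gt1 tt_gt1 by (auto intro: one_less_power)
    hence "0 < qtw k" by (simp add: qtw_def divide_neg_neg)
    thus ?case using add by simp
   qed simp
   moreover have "0 < zm (mset nu)" using mset_parts[OF that] zm_nz by blast
   ultimately show ?thesis using mset_parts[OF that] by simp
  qed
  have "\<forall>nu\<in>parts d. f nu * f nu * (of_nat (zm (mset nu)) * pm qtw (mset nu)) = 0"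
   using z unfolding qt_inner_pm by (subst (asm) sum_nonneg_eq_0_iff) (auto intro!: mult_nonneg_nonneg[OF zero_le_square] less_imp_le[OF pos])
  hence "f mu * f mu * (of_nat (zm (mset mu)) * pm qtw (mset mu)) = 0" using True by blast
  thus ?thesis using pos[OF True] by (metis less_irrefl mult_eq_0_iff)
 qed (use s in \<open>simp add: symf_def\<close>)
qed

lemma qt_lin: "qt_inner d (%mu. \<Sum>i\<in>A. s i * f i mu) g = (\<Sum>i\<in>A. s i * qt_inner d (f i) g)"
 unfolding qt_inner_def sum_distrib_left sum_distrib_right by (subst sum.swap) (simp only: mult_ac)

lemma qt_comm: "qt_inner d f g = qt_inner d g f"
 by (simp add: qt_inner_def mult_ac)

lemma qt_scale: "qt_inner d (%mu. s * f mu) g = s * qt_inner d f g"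
 by (simp add: qt_inner_def sum_distrib_left mult_ac)

lemma qt_diff: "qt_inner d (%mu. f mu - s * f' mu) g = qt_inner d f g - s * qt_inner d f' g"
 by (simp add: qt_inner_def sum_distrib_left sum_subtractf algebra_simps)

lemma finite_cells: "finite (cells la)"
proof -
 have "cells la = Sigma {..<length la} (%i. {..<la ! i})" by (auto simp: cells_def)
 thus ?thesis by simp
qed

lemma vlead_nz: "vlead la ~= 0"
 using qt_one by (auto simp: vlead_def finite_cells simp del: power_Suc)

text \<open>The Schur function is corrected: the operator minus the eigenvalue maps it strictly
  below \<open>la\<close>, where the eigenvalue does not occur, so \<open>eig_solve\<close> finds
  the correction.\<close>

lemma eigenfunction_ex:
 assumes la: "la \<in> parts d"
 shows "\<exists>f. supp d (dn d la) f & Eop d f = (%nu. el d la * f nu) & cf d f (fn la) = vlead la"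
proof -
 let ?S = "schur la" and ?e = "el d la"
 have la': "la \<in> dn d la" using la by (simp add: dn_def)
 have mx: "kap = la" if "kap \<in> dn d la" "dominated la kap" for kap
  using that la by (auto simp: dn_def intro: dominated_antisym)
 have "cf d (Eop d ?S) (fn la) = ?e * cf d ?S (fn la)"
  by (rule E_max[OF dc_dn supp_schur[OF la] la' mx])
 hence "supp d (dn d la - {la}) (%nu. Eop d ?S nu - ?e * ?S nu)"
  by (intro supp_del supp_diff E_supp dc_dn supp_schur la) (simp add: cf_diff)
 moreover have "el d mu ~= ?e" if "mu \<in> dn d la - {la}" for mu
  using that la el_inj by (auto simp: dn_def)
 ultimately obtain f where f: "supp d (dn d la - {la}) f" "(%nu. Eop d f nu - ?e * f nu) = (%nu. Eop d ?S nu - ?e * ?S nu)"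
  using eig_solve[OF basis_schur dc_dn'[OF la]] by blast
 define g where "g = (%nu. vlead la * (?S nu - 1 * f nu))"
 have gs: "g = (%nu. 0 - (- vlead la) * (?S nu - 1 * f nu))" by (simp add: g_def)
 have "supp d (dn d la) g" unfolding gs
  by (intro supp_diff supp_schur la supp_mono[OF f(1)]) (auto simp: supp_def symf_def cf_def)
 moreover have "Eop d g = (%nu. ?e * g nu)"
 proof
  fix nu
  have "Eop d g nu = Eop d (%_. 0) nu - (- vlead la) * (Eop d ?S nu - 1 * Eop d f nu)"
   unfolding gs Eop_diff ..
  also have "Eop d (%_. 0) nu = 0" by (simp add: Eop_def vop_def)
  finally have 1: "Eop d g nu = vlead la * (Eop d ?S nu - Eop d f nu)" by simp
  have "Eop d ?S nu - Eop d f nu = ?e * (?S nu - f nu)" using fun_cong[OF f(2), of nu] by (simp add: algebra_simps)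
  thus "Eop d g nu = ?e * g nu" unfolding 1 by (simp add: g_def)
 qed
 moreover have "cf d g (fn la) = vlead la"
 proof -
  have "cf d f (fn la) = 0" using f(1) la by (auto simp: supp_def)
  thus ?thesis unfolding gs cf_diff by (simp add: cf_schur[OF la] kostka_diag parts_sorted[OF la]) (simp add: cf_def)
 qed
 ultimately show ?thesis by blast
qed

definition Jf :: "nat => nat list => nat list => K" where
 "Jf d la = (if la \<in> parts d then (SOME f. supp d (dn d la) f & Eop d f = (%nu. el d la * f nu) & cf d f (fn la) = vlead la) else (%_. 0))"

lemma Jf: assumes "la \<in> parts d"
 shows "supp d (dn d la) (Jf d la)" "Eop d (Jf d la) = (%nu. el d la * Jf d la nu)" "cf d (Jf d la) (fn la) = vlead la"
 using someI_ex[OF eigenfunction_ex[OF assms]] assms by (auto simp: Jf_def)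

lemma basis_Jf: "basis d (Jf d)" by (simp add: basis_def Jf vlead_nz)

lemma Jf_orth: "la \<in> parts d ==> mu \<in> parts d ==> la ~= mu ==> qt_inner d (Jf d la) (Jf d mu) = 0"
proof -
 assume a: "la \<in> parts d" "mu \<in> parts d" "la ~= mu"
 have "el d la * qt_inner d (Jf d la) (Jf d mu) = el d mu * qt_inner d (Jf d la) (Jf d mu)"
  using E_selfadjoint[of d "Jf d la" "Jf d mu"] unfolding Jf(2)[OF a(1)] Jf(2)[OF a(2)] qt_scale
  by (subst (asm) (2) qt_comm) (simp add: qt_scale qt_comm[of d "Jf d mu"])
 thus ?thesis using el_inj[OF a(1,2)] a(3) by auto
qed

lemma schur_lead:
 assumes la: "la \<in> parts d" and F: "F = (%nu. \<Sum>mu\<in>dn d la. v mu * schur mu nu)"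
 shows "supp d (dn d la) F" "cf d F (fn la) = v la"
proof -
 have m: "mu \<in> parts d" if "mu \<in> dn d la" for mu using that by (simp add: dn_def)
 show "supp d (dn d la) F" unfolding F
 proof (rule supp_lin)
  fix mu assume mu: "mu \<in> dn d la"
  thus "supp d (dn d la) (schur mu)"
   by (intro supp_mono[OF supp_schur[OF m[OF mu]]]) (auto simp: dn_def intro: dominated_trans)
 qed
 have "cf d F (fn la) = (\<Sum>mu\<in>dn d la. v mu * cf d (schur mu) (fn la))" unfolding F by (rule cf_lin)
 also have "... = (\<Sum>mu\<in>{la}. v mu * cf d (schur mu) (fn la))"
 proof (rule sum.mono_neutral_right)
  show "\<forall>mu\<in>dn d la - {la}. v mu * cf d (schur mu) (fn la) = 0"
  proof
   fix mu assume "mu \<in> dn d la - {la}"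
   hence mu: "mu \<in> parts d" "dominated mu la" "mu ~= la" by (auto simp: dn_def)
   have "kostka mu (fn la) = 0"
    using kostka_dominated[OF parts_sorted[OF mu(1)], of la] dominated_antisym[OF mu(1) la mu(2)] mu(3) by blast
   thus "v mu * cf d (schur mu) (fn la) = 0" by (simp add: cf_schur mu(1))
  qed
 qed (use la in \<open>auto simp: dn_def\<close>)
 also have "... = v la" by (simp add: cf_schur[OF la] kostka_diag[OF parts_sorted[OF la]])
 finally show "cf d F (fn la) = v la" .
qed

text \<open>For uniqueness, induction along \<open>wt\<close>: the difference of two candidates at
  \<open>la\<close> is a combination of lower members, on which the families agree and to which it
  is orthogonal. So its norm is zero, and \<open>qt_definite\<close> applies.\<close>

lemma macJ_family_eq: "macJ_family d = Jf d"
 unfolding macJ_family_def dn_def[symmetric]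
proof (rule the_equality, intro conjI ballI allI impI)
 fix la assume la: "la \<in> parts d"
 obtain v where v: "Jf d la = (%nu. \<Sum>mu\<in>dn d la. v mu * schur mu nu)"
  using span[OF basis_schur dc_dn Jf(1)[OF la]] by blast
 with schur_lead(2)[OF la v] Jf(3)[OF la] show "\<exists>v. Jf d la = (%nu. \<Sum>mu\<in>dn d la. v mu * schur mu nu) & v la = vlead la"
  by (intro exI[of _ v]) simp
next
 fix G assume "(\<forall>la. la \<notin> parts d --> G la = (%_. 0)) \<and>
  (\<forall>la\<in>parts d. \<forall>mu\<in>parts d. la ~= mu --> qt_inner d (G la) (G mu) = 0) \<and>
  (\<forall>la\<in>parts d. \<exists>v. G la = (%nu. \<Sum>mu\<in>dn d la. v mu * schur mu nu) & v la = vlead la)"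
 hence G: "\<And>la. la \<notin> parts d ==> G la = (%_. 0)"
  "\<And>la mu. la \<in> parts d ==> mu \<in> parts d ==> la ~= mu ==> qt_inner d (G la) (G mu) = 0"
  "\<And>la. la \<in> parts d ==> \<exists>v. G la = (%nu. \<Sum>mu\<in>dn d la. v mu * schur mu nu) & v la = vlead la" by blast+
 have "G la = Jf d la" if "la \<in> parts d" for la
  using that
 proof (induction "wt d la" arbitrary: la rule: less_induct)
  case less
  note la = less.prems
  obtain v where v: "G la = (%nu. \<Sum>mu\<in>dn d la. v mu * schur mu nu)" "v la = vlead la" using G(3)[OF la] by blast
  define g where "g = (%nu. G la nu - 1 * Jf d la nu)"
  have sg: "supp d (dn d la - {la}) g" unfolding g_def
   by (intro supp_del supp_diff schur_lead(1)[OF la v(1)] Jf(1)[OF la])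
    (unfold cf_diff schur_lead(2)[OF la v(1)] v(2) Jf(3)[OF la], simp)
  then obtain c where c: "g = (%nu. \<Sum>mu\<in>dn d la - {la}. c mu * Jf d mu nu)"
   using span[OF basis_Jf dc_dn'[OF la]] by blast
  have z: "qt_inner d (Jf d mu) g = 0" if "mu \<in> dn d la - {la}" for mu
  proof -
   have mu: "mu \<in> parts d" "mu ~= la" "dominated mu la" using that by (auto simp: dn_def)
   have "qt_inner d g (Jf d mu) = qt_inner d (G la) (Jf d mu) - 1 * qt_inner d (Jf d la) (Jf d mu)"
    unfolding g_def by (rule qt_diff)
   also have "Jf d mu = G mu" using less.hyps[OF wt_less[OF mu(1) la mu(3,2)] mu(1)] by simp
   also have "qt_inner d (G la) (G mu) = 0" using G(2)[OF la mu(1)] mu(2) by auto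
   also have "qt_inner d (Jf d la) (G mu) = 0"
    using Jf_orth[OF la mu(1)] mu(2) less.hyps[OF wt_less[OF mu(1) la mu(3,2)] mu(1)] by auto
   finally show ?thesis using less.hyps[OF wt_less[OF mu(1) la mu(3,2)] mu(1)] by (simp add: qt_comm)
  qed
  have "qt_inner d g g = (\<Sum>mu\<in>dn d la - {la}. c mu * qt_inner d (Jf d mu) g)"
   by (subst c, rule qt_lin)
  also have "... = 0" by (simp add: z)
  finally have "g = (%_. 0)" using sg by (intro qt_definite) (auto simp: supp_def)
  thus ?case unfolding g_def fun_eq_iff by simp
 qed
 thus "G = Jf d" using G(1) by (auto simp: Jf_def fun_eq_iff)
qed (auto simp: Jf_orth, simp add: Jf_def)

text \<open>Self-adjointness and distinct eigenvalues make the difference from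
  \<open>Jf d la\<close> orthogonal to all other members, so it is a multiple of
  \<open>Jf d la\<close>; the coefficient at \<open>la\<close> shows that the multiple is
  zero.\<close>

theorem macJ_eqI:
 assumes la: "la \<in> parts d" and f: "symf d f" and E: "Eop d f = (%nu. el d la * f nu)"
  and c: "cf d f (fn la) = vlead la"
 shows "macJ la = f"
proof -
 have D: "dc d (parts d)" by (auto simp: dc_def)
 define g where "g = (%nu. f nu - 1 * Jf d la nu)"
 have Eg: "Eop d g = (%nu. el d la * g nu)"
  unfolding g_def Eop_diff by (simp add: E Jf(2)[OF la] algebra_simps)
 have s: "supp d (parts d) g" using f Jf(1)[OF la] by (auto simp: supp_def g_def symf_def)
 obtain v where v: "g = (%nu. \<Sum>mu\<in>parts d. v mu * Jf d mu nu)" using span[OF basis_Jf D s] by blast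
 have "v mu * qt_inner d (Jf d mu) (Jf d mu) = qt_inner d g (Jf d mu)" if mu: "mu \<in> parts d" for mu
 proof -
  have "qt_inner d g (Jf d mu) = (\<Sum>kap\<in>parts d. v kap * qt_inner d (Jf d kap) (Jf d mu))" by (subst v, rule qt_lin)
  also have "... = (\<Sum>kap\<in>{mu}. v kap * qt_inner d (Jf d kap) (Jf d mu))"
   by (rule sum.mono_neutral_right) (use mu Jf_orth in auto)
  finally show ?thesis by simp
 qed
 moreover have "qt_inner d g (Jf d mu) = 0" if mu: "mu \<in> parts d" "mu ~= la" for mu
 proof -
  have "el d la * qt_inner d g (Jf d mu) = el d mu * qt_inner d g (Jf d mu)"
   using E_selfadjoint[of d g "Jf d mu"] unfolding Eg Jf(2)[OF mu(1)] qt_scale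
   by (subst (asm) (2) qt_comm) (simp add: qt_scale qt_comm[of d "Jf d mu"])
  thus ?thesis using el_inj[OF la mu(1)] mu(2) by auto
 qed
 moreover have "qt_inner d (Jf d mu) (Jf d mu) ~= 0" if mu: "mu \<in> parts d" for mu
 proof
  assume "qt_inner d (Jf d mu) (Jf d mu) = 0"
  hence "Jf d mu = (%_. 0)" using Jf(1)[OF mu] by (intro qt_definite) (auto simp: supp_def)
  thus False using Jf(3)[OF mu] vlead_nz[of mu] by (simp add: cf_def)
 qed
 ultimately have v0: "v mu = 0" if "mu \<in> parts d" "mu ~= la" for mu using that by (metis mult_eq_0_iff)
 have gv: "g = (%nu. v la * Jf d la nu)"
 proof
  fix nu
  have "g nu = (\<Sum>mu\<in>parts d. v mu * Jf d mu nu)" by (subst v) (rule refl)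
  also have "... = (\<Sum>mu\<in>{la}. v mu * Jf d mu nu)" by (rule sum.mono_neutral_right) (use la v0 in auto)
  finally show "g nu = v la * Jf d la nu" by simp
 qed
 have "cf d g (fn la) = 0" unfolding g_def cf_diff by (simp add: c Jf(3)[OF la])
 moreover have "cf d g (fn la) = v la * vlead la"
  unfolding gv by (simp add: Jf(3)[OF la, symmetric] cf_def sum_distrib_left mult.assoc)
 ultimately have "g = (%_. 0)" using gv vlead_nz by simp
 thus ?thesis using parts_sum[OF la] unfolding g_def macJ_def macJ_family_eq fun_eq_iff by simp
qed

section \<open>Transposition of lattice words\<close>

text \<open>With \<open>c i\<close> the current number of letters \<open>i\<close>, i.e. the current length of row \<open>i\<close>, appending the letter \<open>x\<close>
 adds a cell in row \<open>x\<close> and column \<open>c x\<close>; \<open>trf\<close> records the columns.\<close>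

abbreviation inc :: "(nat => nat) => nat => nat => nat" where "inc c x \<equiv> c(x := Suc (c x))"

fun trf :: "(nat => nat) => nat list => nat list" where
 "trf c [] = []"
| "trf c (x # w) = c x # trf (inc c x) w"

fun latf :: "(nat => nat) => nat list => bool" where
 "latf c [] \<longleftrightarrow> True"
| "latf c (x # w) \<longleftrightarrow> (\<forall>i<x. c x < c i) & latf (inc c x) w"

definition tr :: "nat list => nat list" where "tr u = trf (%_. 0) u"

lemma antimono_inc:
 assumes c: "antimono c" and h: "\<forall>i<x. c x < c i" shows "antimono (inc c x)"
proof (rule antimonoI)
 fix i j :: nat assume "i <= j"
 thus "inc c x j <= inc c x i" using antimonoD[OF c, of i j] h by (cases "i = j"; cases "j = x") (auto simp: le_less)
qed

text \<open>The surplus of row \<open>j\<close> over row \<open>Suc j\<close> already present can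
  absorb that many unmatched letters \<open>Suc j\<close>.\<close>

lemma latf_bb: "antimono c ==> latf c w \<longleftrightarrow> (\<forall>j. bb j w <= c j - c (Suc j))"
proof (induction w arbitrary: c)
 case (Cons x w)
 have head: "(\<forall>i<x. c x < c i) \<longleftrightarrow> (\<forall>j. x = Suc j --> c (Suc j) < c j)"
 proof
  assume a: "\<forall>j. x = Suc j --> c (Suc j) < c j"
  show "\<forall>i<x. c x < c i"
  proof (intro allI impI)
   fix i assume "i < x"
   then obtain j where j: "x = Suc j" "i <= j" by (cases x) auto
   hence "c j <= c i" using Cons.prems by (simp add: antimonoD)
   thus "c x < c i" using a j by (simp add: order_less_le_trans)
  qed
 qed auto
 have step: "bb j (x # w) <= c j - c (Suc j) \<longleftrightarrow> (x = Suc j --> c (Suc j) < c j) & bb j w <= inc c x j - inc c x (Suc j)" for j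
  using antimonoD[OF Cons.prems, of j "Suc j"] by auto
 show ?case
 proof (cases "\<forall>i<x. c x < c i")
  case True
  from Cons.IH[OF antimono_inc[OF Cons.prems True]] step head True show ?thesis
   by (simp del: bb.simps fun_upd_apply)
 next
  case False
  then obtain j where "x = Suc j" "\<not> c (Suc j) < c j" using head by blast
  hence "\<not> bb j (x # w) <= c j - c (Suc j)" using step by blast
  with False show ?thesis by (auto simp del: bb.simps)
 qed
qed simp

lemma lat_latf: "lat u \<longleftrightarrow> latf (%_. 0) u"
 by (simp add: lat_def latf_bb antimono_def)

lemma length_trf [simp]: "length (trf c w) = length w" by (induction w arbitrary: c) auto

lemma cadd_count: "foldl inc c w = (%i. c i + ct w i)"
 by (induction w arbitrary: c) (auto simp: ct_def fun_eq_iff)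

lemma trf_append: "trf c (v @ w) = trf c v @ trf (foldl inc c v) w"
 by (induction v arbitrary: c) auto

lemma latf_append: "latf c (v @ w) \<longleftrightarrow> latf c v & latf (foldl inc c v) w"
 by (induction v arbitrary: c) auto

lemma take_trf: "take k (trf c w) = trf c (take k w)"
 by (induction w arbitrary: c k) (auto simp: take_Cons split: nat.split)

lemma tr_snoc: "tr (u @ [x]) = tr u @ [ct u x]"
 by (simp add: tr_def trf_append cadd_count)

lemma lat_snoc: "lat (u @ [x]) \<longleftrightarrow> lat u & (\<forall>i<x. ct u x < ct u i)"
 by (simp add: lat_latf latf_append cadd_count)

lemma ct_simps: "ct [] i = 0" "ct (u @ [x]) i = (if i = x then Suc (ct u i) else ct u i)"
 by (auto simp: ct_def)

lemma finite_ct: "finite {i. j < ct u i}"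
 by (rule finite_subset[of _ "set u"]) (auto simp: ct_def, metis count_mset_0_iff not_less_zero)

lemma ct_tr: "ct (tr u) j = card {i. j < ct u i}"
proof (induction u rule: rev_induct)
 case (snoc x u)
 show ?case
 proof (cases "ct u x = j")
  case True
  hence "{i. j < ct (u @ [x]) i} = insert x {i. j < ct u i}" by (auto simp: ct_simps)
  thus ?thesis using True finite_ct snoc by (simp add: tr_snoc ct_simps)
 next
  case False
  hence "{i. j < ct (u @ [x]) i} = {i. j < ct u i}" by (auto simp: ct_simps)
  thus ?thesis using False snoc by (simp add: tr_snoc ct_simps)
 qed
qed (simp add: tr_def ct_simps)

lemma lat_tr: "lat u ==> lat (tr u)"
proof (induction u rule: rev_induct)
 case (snoc x u)
 have "ct (tr u) (ct u x) < ct (tr u) i" if "i < ct u x" for i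
  unfolding ct_tr by (rule psubset_card_mono[OF finite_ct]) (use that in auto)
 thus ?case using snoc by (simp add: tr_snoc lat_snoc)
qed (simp add: tr_def lat_def)

lemma lat_antimono: "lat u ==> antimono (ct u)"
 by (rule antimono_iff_le_Suc[THEN iffD2]) (simp add: lat_count)

lemma tr_tr: "lat u ==> tr (tr u) = u"
proof (induction u rule: rev_induct)
 case (snoc x u)
 hence u: "lat u" "\<forall>i<x. ct u x < ct u i" by (auto simp: lat_snoc)
 have "{i. ct u x < ct u i} = {..<x}"
  using u antimonoD[OF lat_antimono[OF u(1)], of x] by (auto simp: not_less[symmetric])
 hence "ct (tr u) (ct u x) = x" by (simp add: ct_tr)
 thus ?case using snoc u by (simp add: tr_snoc)
qed (simp add: tr_def)

lemma length_tr [simp]: "length (tr u) = length u" by (simp add: tr_def)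

lemma tr_LW: "u \<in> LW n ==> tr u \<in> LW n" by (simp add: LW_def lat_tr)

text \<open>Of two cells added in succession, the later one is either in a higher row and weakly to
  the left, or in a weakly lower row and strictly to the right.\<close>

lemma trf_less:
 assumes c: "antimono c" and l: "latf c (x # y # w)"
 shows "c x < inc c x y \<longleftrightarrow> \<not> x < y"
proof (cases x y rule: linorder_cases)
 case less
 thus ?thesis using antimonoD[OF c, of x y] by simp
next
 case greater
 thus ?thesis using l by simp
qed simp

lemma trf_less2:
 assumes c: "antimono c" and l: "latf c [x, y, z]"
 shows "c x < inc (inc c x) y z \<longleftrightarrow> \<not> x < z"
proof -
 have z: "\<forall>i<z. inc (inc c x) y z < inc (inc c x) y i" using l by simp
 have y: "\<forall>i<y. inc c x y < inc c x i" using l by simp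
 have x: "\<forall>i<x. c x < c i" using l by simp
 show ?thesis
 proof (cases x z rule: linorder_cases)
  case less
  have "y = x | y ~= x" by simp
  thus ?thesis using z[rule_format, OF less] y less antimonoD[OF c, of x z] by (cases "y = z") (auto split: if_splits)
 next
  case equal
  thus ?thesis by simp
 next
  case greater
  thus ?thesis using x by (auto simp: less_Suc_eq)
 qed
qed

text \<open>Transposition negates all comparisons among the three letters, and the two conditions of
  \<open>K3\<close> are invariant under this negation. The remaining work is that the swapped
  letters can be added in the other order.\<close>

lemma K3_tr:
 assumes c: "antimono c" and l: "latf c [x, y, z]" and K: "K3 x y z = (s, p, q)"
 shows "latf c [s, p, q]" "foldl inc c [s, p, q] = foldl inc c [x, y, z]"
  "K3 (c x) (inc c x y) (inc (inc c x) y z) = (c s, inc c s p, inc (inc c s) p q)"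
proof -
 have c': "antimono (inc c x)" using l by (intro antimono_inc c) simp
 have xy: "c x < inc c x y \<longleftrightarrow> \<not> x < y" by (rule trf_less[OF c l])
 have yz: "inc c x y < inc (inc c x) y z \<longleftrightarrow> \<not> y < z" by (rule trf_less[OF c', of y z "[]"]) (use l in simp)
 have xz: "c x < inc (inc c x) y z \<longleftrightarrow> \<not> x < z" by (rule trf_less2[OF c l])
 have e: "(y <= x & x < z) | (z <= x & x < y) \<longleftrightarrow>
   (inc c x y <= c x & c x < inc (inc c x) y z) | (inc (inc c x) y z <= c x & c x < inc c x y)"
  "(y < z & z <= x) | (x < z & z <= y) \<longleftrightarrow>
   (inc c x y < inc (inc c x) y z & inc (inc c x) y z <= c x) | (c x < inc (inc c x) y z & inc (inc c x) y z <= inc c x y)"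
  using xy yz xz by linarith+
 have ez: "\<forall>i<z. inc (inc c x) y z < inc (inc c x) y i" and ey: "\<forall>i<y. inc c x y < inc c x i" and ex: "\<forall>i<x. c x < c i"
  using l by simp_all
 have k: "(s, p, q) = (if (y <= x & x < z) | (z <= x & x < y) then (x, z, y)
  else if (y < z & z <= x) | (x < z & z <= y) then (y, x, z) else (x, y, z))"
  using K by (simp only: K3_def)
 consider "(y <= x & x < z) | (z <= x & x < y)" "s = x" "p = z" "q = y" "y ~= z"
  | "\<not> ((y <= x & x < z) | (z <= x & x < y))" "(y < z & z <= x) | (x < z & z <= y)" "s = y" "p = x" "q = z" "x ~= y"
  | "\<not> ((y <= x & x < z) | (z <= x & x < y))" "\<not> ((y < z & z <= x) | (x < z & z <= y))" "s = x" "p = y" "q = z"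
 proof (cases "(y <= x & x < z) | (z <= x & x < y)")
  case True
  moreover have "y ~= z" using True by linarith
  ultimately show thesis using k that(1) by simp
 next
  case A: False
  show thesis
  proof (cases "(y < z & z <= x) | (x < z & z <= y)")
   case True
   moreover have "x ~= y" using True by linarith
   moreover have "(s, p, q) = (y, x, z)" using k unfolding if_not_P[OF A] if_P[OF True] .
   ultimately show thesis using that(2)[OF A True] by simp
  next
   case False
   have "(s, p, q) = (x, y, z)" using k unfolding if_not_P[OF A] if_not_P[OF False] .
   thus thesis using that(3)[OF A False] by simp
  qed
 qed
 hence "latf c [s, p, q] & foldl inc c [s, p, q] = foldl inc c [x, y, z] \<and>
  K3 (c x) (inc c x y) (inc (inc c x) y z) = (c s, inc c s p, inc (inc c s) p q)"
 proof cases
  case 1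
  have "K3 (c x) (inc c x y) (inc (inc c x) y z) = (c x, inc (inc c x) y z, inc c x y)"
   unfolding K3_def e[symmetric] if_P[OF 1(1)] ..
  moreover have "inc (inc c x) y z = inc c x z" "inc (inc c x) z y = inc c x y" using 1(5) by auto
  moreover have "\<forall>i<z. inc c x z < inc c x i"
  proof (intro allI impI)
   fix i assume i: "i < z"
   show "inc c x z < inc c x i"
   proof (cases "i = y")
    case True
    show ?thesis
    proof (cases "y < x")
     case True
     hence "c x < c y" using ex by simp
     moreover have "inc c x z <= c x" using xz 1(1) i \<open>i = y\<close> True 1(5) by auto
     ultimately show ?thesis using True \<open>i = y\<close> by simp
    next
     case False
     hence "y = x" using 1(1) i True by auto
     thus ?thesis using ez i True 1(5) xz by (auto split: if_splits)
    qed
   next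
    case False
    thus ?thesis using ez i 1(5) by auto
   qed
  qed
  moreover have "\<forall>i<y. inc (inc c x) z y < inc (inc c x) z i"
   using ey 1(5) by (auto simp: less_Suc_eq)
  ultimately show ?thesis using 1 ex by (auto simp: fun_upd_twist)
 next
  case 2
  have "K3 (c x) (inc c x y) (inc (inc c x) y z) = (inc c x y, c x, inc (inc c x) y z)"
   unfolding K3_def e[symmetric] if_not_P[OF 2(1)] if_P[OF 2(2)] ..
  moreover have "inc c x y = c y" "inc c y x = c x" "inc (inc c y) x = inc (inc c x) y"
   using 2(6) by (auto simp: fun_upd_twist)
  moreover have "\<forall>i<y. c y < c i"
  proof (intro allI impI)
   fix i assume i: "i < y"
   show "c y < c i"
   proof (cases "i = x")
    case True
    hence "x < z & z <= y" using 2(2) i by auto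
    thus ?thesis using xy yz xz True i 2(6) antimonoD[OF c, of x z] antimonoD[OF c, of z y] ez ey
     by (auto split: if_splits)
   next
    case False
    thus ?thesis using ey i 2(6) by auto
   qed
  qed
  moreover have "\<forall>i<x. inc c y x < inc c y i" using ex 2(6) by (auto simp: less_Suc_eq)
  ultimately show ?thesis using 2 ez by auto
 next
  case 3
  have "K3 (c x) (inc c x y) (inc (inc c x) y z) = (c x, inc c x y, inc (inc c x) y z)"
   unfolding K3_def e[symmetric] if_not_P[OF 3(1)] if_not_P[OF 3(2)] ..
  thus ?thesis using 3 l by simp
 qed
 thus "latf c [s, p, q]" "foldl inc c [s, p, q] = foldl inc c [x, y, z]"
  "K3 (c x) (inc c x y) (inc (inc c x) y z) = (c s, inc c s p, inc (inc c s) p q)" by auto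
qed

lemma lam_tr:
 "antimono c ==> latf c (x # y # w) ==>
  latf c (lam x y w) & trf c (lam x y w) = lam (c x) (inc c x y) (trf (inc (inc c x) y) w)"
proof (induction w arbitrary: x y c)
 case (Cons z w)
 obtain s p q where K: "K3 x y z = (s, p, q)" by (metis prod_cases3)
 have l3: "latf c [x, y, z]" using Cons.prems by simp
 note k = K3_tr[OF Cons.prems(1) l3 K]
 have f: "inc (inc (inc c s) p) q = inc (inc (inc c x) y) z" using k(2) by simp
 have c': "antimono (inc c s)" using k(1) by (intro antimono_inc Cons.prems) simp
 have l': "latf (inc c s) (p # q # w)" using k(1) Cons.prems(2) f by simp
 from Cons.IH[OF c' l'] show ?case using K k f by (simp del: fun_upd_apply)
qed simp

lemma Lam_tr: "lat u ==> lat (Lam u) & tr (Lam u) = Lam (tr u)"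
proof -
 assume "lat u"
 hence l: "latf (%_. 0) u" by (simp add: lat_latf)
 show ?thesis
 proof (cases u)
  case (Cons x v)
  show ?thesis
  proof (cases v)
   case Nil
   thus ?thesis using Cons \<open>lat u\<close> by (simp add: Lam_def tr_def)
  next
   case (Cons y w)
   with \<open>u = x # v\<close> have u: "u = x # y # w" by simp
   from lam_tr[of "%_. 0" x y w] l show ?thesis by (simp add: u Lam_def tr_def lat_latf antimono_def)
  qed
 qed (simp add: Lam_def tr_def lat_def)
qed

lemma lat_take: "lat u ==> lat (take k u)"
 using latf_append[of "%_. 0" "take k u" "drop k u"] by (simp add: lat_latf)

lemma dvw_Lam: "2 <= length u ==> dvw u = (if u ! 0 < u ! 1 then 1 else 0) # dvw (take (length u - 2) (Lam u))"
 by (cases u rule: dvw.cases) (simp_all add: Lam_def outs_lam)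

lemma dvw_tr: "lat u ==> dvw (tr u) = map (%b. 1 - b) (dvw u)"
proof (induction "length u" arbitrary: u rule: less_induct)
 case less
 show ?case
 proof (cases "2 <= length u")
  case True
  then obtain x y w where u: "u = x # y # w" by (cases u rule: dvw.cases) auto
  have l: "latf (%_. 0) (x # y # w)" using less.prems by (simp add: lat_latf u)
  have "tr u ! 0 < tr u ! 1 \<longleftrightarrow> \<not> u ! 0 < u ! 1"
   using trf_less[OF _ l] by (simp add: u tr_def antimono_def)
  moreover have "take (length u - 2) (Lam (tr u)) = tr (take (length u - 2) (Lam u))"
   using Lam_tr[OF less.prems] by (metis tr_def take_trf)
  moreover have "dvw (tr (take (length u - 2) (Lam u))) = map (%b. 1 - b) (dvw (take (length u - 2) (Lam u)))"
   by (rule less.hyps) (use True Lam_tr[OF less.prems] lat_take in auto)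
  ultimately show ?thesis using True dvw_Lam[of u] dvw_Lam[of "tr u"] by simp
 next
  case False
  thus ?thesis by (cases u rule: dvw.cases) (auto simp: tr_def)
 qed
qed

text \<open>Ascents and weak descents are exchanged, so every position gives its weight to exactly
  one of the two words.\<close>

lemma cmaj_trf: "antimono c ==> latf c u ==> cmaj (trf c u) + cmaj u = (\<Sum>i<length u. i)"
proof (induction u arbitrary: c rule: cmaj.induct)
 case (3 x y w)
 have "cmaj (trf (inc c x) (y # w)) + cmaj (y # w) = (\<Sum>i<length (y # w). i)"
  by (rule "3.IH") (use 3(2,3) antimono_inc[OF 3(2), of x] in \<open>simp_all del: fun_upd_apply\<close>)
 thus ?case using trf_less[OF 3(2,3)] by (auto simp del: fun_upd_apply)
qed auto

lemma cmaj_tr: "lat u ==> cmaj (tr u) + cmaj u = (\<Sum>i<length u. i)"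
 unfolding tr_def by (rule cmaj_trf) (auto simp: lat_latf antimono_def)

text \<open>The conjugate partition, by column heights; the size bounds the number of
  columns.\<close>

definition cj :: "nat list => nat list" where
 "cj la = filter (%x. 0 < x) (map (%j. card {i. j < fn la i}) [0..<sum_list la])"

lemma fn_sh: assumes "lat u" shows "fn (sh u) = ct u"
proof
 fix i
 have s: "fn (sh u) i = ct (rw (srow 0 (sh u))) i" by (simp add: ct_srow fn_def)
 show "fn (sh u) i = ct u i"
 proof (cases "i < length u")
  case True
  thus ?thesis using shp_props(4)[OF lat_yam[OF assms]] s by (simp add: sh_def)
 next
  case False
  hence "ct u i = 0" using lat_letters[OF assms] ct_pos by (metis gr0I)
  moreover have "length (sh u) <= length u" unfolding sh_def by (rule shp_props(2)[OF lat_yam[OF assms]])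
  ultimately show ?thesis using False by (simp add: fn_def)
 qed
qed

lemma sh_tr: assumes "lat u" shows "sh (tr u) = cj (sh u)"
proof -
 have "sum_list (sh u) = length u" using sh_parts[of u "length u"] assms by (simp add: LW_def parts_sum)
 moreover have "ct (tr u) = (%j. card {i. j < fn (sh u) i})" by (rule ext) (simp add: fn_sh[OF assms] ct_tr)
 ultimately show ?thesis by (simp add: sh_def[of "tr u"] shp_def cj_def)
qed

section \<open>The involution omega\<close>

fun asc :: "nat list => bool list" where
 "asc [] = []"
| "asc [x] = []"
| "asc (x # y # w) = (x < y) # asc (y # w)"

lemma asc_fop: "asc (fop j u) = asc u"
proof (induction u rule: asc.induct)
 case (3 x y w)
 thus ?case by (cases "bb j w") (auto split: if_splits)
qed auto

lemma asc_take: "asc (take k u) = take (k - 1) (asc u)"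
proof (induction u arbitrary: k rule: asc.induct)
 case (3 x y w)
 show ?case by (cases k; cases "k - 1") (use "3.IH"[of "k - 1"] in auto)
qed (auto simp: take_Cons')

lemma asc_drop: "asc (drop k u) = drop k (asc u)"
proof (induction u arbitrary: k rule: asc.induct)
 case (3 x y w)
 thus ?case by (cases k) auto
qed (auto simp: drop_Cons split: nat.split)

lemma asc_trf: "antimono c ==> latf c u ==> asc (trf c u) = map Not (asc u)"
proof (induction u arbitrary: c rule: asc.induct)
 case (3 x y w)
 have "asc (trf (inc c x) (y # w)) = map Not (asc (y # w))"
  by (rule "3.IH") (use 3(2,3) antimono_inc[OF 3(2), of x] in \<open>simp_all del: fun_upd_apply\<close>)
 thus ?case using trf_less[OF 3(2,3)] by (auto simp del: fun_upd_apply)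
qed auto

lemma asc_tr: "lat u ==> asc (tr u) = map Not (asc u)"
 unfolding tr_def by (rule asc_trf) (auto simp: lat_latf antimono_def)

text \<open>\<open>bl False \<mu>\<close> (\<open>bl True \<mu>\<close>) singles out the concatenations of weakly decreasing (strictly increasing) words of
  lengths \<open>\<mu>\<close>, whose generating function is \<open>h\<^sub>\<mu>\<close> (\<open>e\<^sub>\<mu>\<close>).\<close>
fun bl :: "bool => nat list => nat list => bool" where
 "bl b [] u \<longleftrightarrow> u = []"
| "bl b (m # mu) u \<longleftrightarrow> m <= length u & set (asc (take m u)) \<subseteq> {b} & bl b mu (drop m u)"

lemma bl_asc: "length u = length v ==> asc u = asc v ==> bl b mu u = bl b mu v"
proof (induction mu arbitrary: u v)
 case (Cons m mu)
 have "bl b mu (drop m u) = bl b mu (drop m v)" by (rule Cons.IH) (use Cons.prems in \<open>auto simp: asc_drop\<close>)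
 thus ?case using Cons.prems by (simp add: asc_take)
qed auto

lemma bl_asc_neg: "length u = length v ==> asc u = map Not (asc v) ==> bl (\<not> b) mu u = bl b mu v"
proof (induction mu arbitrary: u v)
 case (Cons m mu)
 have "bl (\<not> b) mu (drop m u) = bl b mu (drop m v)"
  by (rule Cons.IH) (use Cons.prems in \<open>auto simp: asc_drop drop_map\<close>)
 moreover have "set (asc (take m u)) \<subseteq> {\<not> b} \<longleftrightarrow> set (asc (take m v)) \<subseteq> {b}"
  using Cons.prems(2) by (auto simp: asc_take take_map)
 ultimately show ?case using Cons.prems by simp
qed auto

lemma bl_fop: "bl b mu (fop j u) = bl b mu u" by (rule bl_asc) (simp_all add: asc_fop)

definition Wd :: "bool => nat => nat => nat list set" where
 "Wd b m N = {u\<in>words m N. set (asc u) \<subseteq> {b}}"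

lemma asc_False: "set (asc u) \<subseteq> {False} \<longleftrightarrow> sorted_wrt (\<ge>) u"
 by (induction u rule: asc.induct) (auto simp: not_less intro: order_trans)

lemma asc_True: "set (asc u) \<subseteq> {True} \<longleftrightarrow> sorted_wrt (<) u"
 by (induction u rule: asc.induct) (auto intro: less_trans)

lemma Wd_False_iff: "u \<in> Wd False m N \<longleftrightarrow> length u = m & set u \<subseteq> {..<N} & sorted_wrt (\<ge>) u"
 unfolding Wd_def mem_Collect_eq asc_False by (auto simp: words_def)

lemma Wd_True_iff: "u \<in> Wd True m N \<longleftrightarrow> length u = m & set u \<subseteq> {..<N} & sorted_wrt (<) u"
 unfolding Wd_def mem_Collect_eq asc_True by (auto simp: words_def)

lemma finite_Wd [simp]: "finite (Wd b m N)" by (simp add: Wd_def)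

lemma Wd_0: "Wd b 0 N = {[]}" by (auto simp: Wd_def words_def)
lemma Wd_None: "Wd b (Suc m) 0 = {}" by (auto simp: Wd_def words_def)

lemma Wd_False_Suc: "Wd False (Suc m) (Suc N) = Wd False (Suc m) N \<union> (%u. N # u) ` Wd False m (Suc N)"
proof (intro set_eqI iffI)
 fix u assume "u \<in> Wd False (Suc m) (Suc N)"
 then obtain x w where u: "u = x # w" "length w = m" "set (x # w) \<subseteq> {..<Suc N}" "sorted_wrt (\<ge>) (x # w)"
  by (auto simp: Wd_False_iff length_Suc_conv)
 show "u \<in> Wd False (Suc m) N \<union> (%u. N # u) ` Wd False m (Suc N)"
 proof (cases "x = N")
  case False
  hence "set (x # w) \<subseteq> {..<N}" using u by fastforce
  thus ?thesis using u by (simp add: Wd_False_iff)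
 qed (use u in \<open>auto simp: Wd_False_iff\<close>)
qed (auto simp: Wd_False_iff less_Suc_eq_le subset_iff intro: less_imp_le)

lemma Wd_True_Suc: "Wd True (Suc m) (Suc N) = Wd True (Suc m) N \<union> (%u. u @ [N]) ` Wd True m N"
proof (intro set_eqI iffI)
 fix u assume "u \<in> Wd True (Suc m) (Suc N)"
 hence u': "length u = Suc m" "set u \<subseteq> {..<Suc N}" "sorted_wrt (<) u"
  by (auto simp: Wd_True_iff)
 then obtain x w where u: "u = w @ [x]" "length w = m" by (cases u rule: rev_cases) auto
 show "u \<in> Wd True (Suc m) N \<union> (%u. u @ [N]) ` Wd True m N"
 proof (cases "x = N")
  case True
  thus ?thesis using u u' by (auto simp: Wd_True_iff sorted_wrt_append intro!: imageI)
 next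
  case False
  hence "set u \<subseteq> {..<N}" using u u' by (fastforce simp: sorted_wrt_append)
  thus ?thesis using u' by (simp add: Wd_True_iff)
 qed
qed (auto simp: Wd_True_iff less_Suc_eq subset_iff sorted_wrt_append)

text \<open>Equals (-1)^(k - 1) for positive \<open>k\<close>, without truncated subtraction: the
  sign of omega on the k-th power sum.\<close>

definition eps :: "nat => 'a::comm_ring_1" where "eps k = - ((-1) ^ k)"

lemma psum_Suc: "psum (Suc N) x = (%k. psum N x k + x N ^ k)" by (rule ext) (simp add: psum_def)

lemma Hh_psum_Suc:
 fixes x :: "nat => 'a::field_char_0"
 shows "Hh (Suc m) (psum (Suc N) x) = Hh (Suc m) (psum N x) + x N * Hh m (psum (Suc N) x)"
proof -
 have "Hs (psum (Suc N) x) * (1 - fps_const (x N) * fps_X) = Hs (psum N x) * (Abs_fps (%n. x N ^ n) * (1 - fps_const (x N) * fps_X))"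
  unfolding psum_Suc Hs_add Hs_pow by (simp only: mult.assoc)
 hence "Hs (psum N x) = Hs (psum (Suc N) x) - fps_const (x N) * (fps_X * Hs (psum (Suc N) x))"
  unfolding geo_fps by (simp add: algebra_simps)
 from arg_cong[OF this, of "%F. F $ Suc m"] show ?thesis by (simp add: Hh_Hs)
qed

lemma Hh_eps_psum_Suc:
 fixes x :: "nat => 'a::field_char_0"
 shows "Hh (Suc m) (%k. eps k * psum (Suc N) x k) = Hh (Suc m) (%k. eps k * psum N x k) + x N * Hh m (%k. eps k * psum N x k)"
proof -
 have "(%k. eps k * psum (Suc N) x k) = (%k. eps k * psum N x k + - ((- x N) ^ k))"
  by (rule ext) (simp add: psum_Suc eps_def algebra_simps power_mult_distrib[symmetric])
 hence "Hs (%k. eps k * psum (Suc N) x k) = Hs (%k. eps k * psum N x k) * Hs (%k. - ((- x N) ^ k))"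
  by (simp only: Hs_add)
 hence "Hs (%k. eps k * psum (Suc N) x k) = Hs (%k. eps k * psum N x k) + fps_const (x N) * (fps_X * Hs (%k. eps k * psum N x k))"
  unfolding Hs_neg_pow fps_const_neg[symmetric] by (simp add: algebra_simps del: fps_const_neg)
 from arg_cong[OF this, of "%F. F $ Suc m"] show ?thesis by (simp add: Hh_Hs)
qed

lemma Hh_zero: "Hh m (%k. 0) = (if m = 0 then 1 else 0)"
 by (simp add: Hh_Hs Hs_zero)

text \<open>Split by the occurrence of the largest letter: in a weakly decreasing word it stands in
  front and may recur, in a strictly increasing word it stands once at the end. The complete and
  elementary functions obey the same recursions.\<close>

lemma Wd_sum:
 fixes x :: "nat => 'a::field_char_0"
 shows "(\<Sum>u\<in>Wd b m N. mon x u) = Hh m (%k. (if b then eps k else 1) * psum N x k)"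
proof (induction N arbitrary: m)
 case 0
 thus ?case by (cases m) (simp_all add: Wd_0 Wd_None psum_def Hh_zero)
next
 case (Suc N)
 note IHN = Suc.IH
 show ?case
 proof (induction m)
  case (Suc m)
  show ?case
  proof (cases b)
   case True
   have "(\<Sum>u\<in>Wd True (Suc m) (Suc N). mon x u) = (\<Sum>u\<in>Wd True (Suc m) N. mon x u) + (\<Sum>u\<in>Wd True m N. mon x (u @ [N]))"
    unfolding Wd_True_Suc
   proof (subst sum.union_disjoint)
    show "Wd True (Suc m) N \<inter> (%u. u @ [N]) ` Wd True m N = {}" by (auto simp: Wd_True_iff)
   qed (simp_all add: sum.reindex inj_on_def del: mon_simps)
   thus ?thesis using True IHN[of "Suc m"] IHN[of m]
    by (simp add: Hh_eps_psum_Suc sum_distrib_left[symmetric] mult.commute[of _ "x N"])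
  next
   case False
   have "(\<Sum>u\<in>Wd False (Suc m) (Suc N). mon x u) = (\<Sum>u\<in>Wd False (Suc m) N. mon x u) + (\<Sum>u\<in>Wd False m (Suc N). mon x (N # u))"
    unfolding Wd_False_Suc
   proof (subst sum.union_disjoint)
    show "Wd False (Suc m) N \<inter> (%u. N # u) ` Wd False m (Suc N) = {}" by (auto simp: Wd_False_iff)
   qed (simp_all add: sum.reindex inj_on_def del: mon_simps)
   thus ?thesis using False IHN[of "Suc m"] Suc.IH
    by (simp add: Hh_psum_Suc sum_distrib_left[symmetric])
  qed
 qed (simp add: Wd_0)
qed

definition Bl :: "bool => nat list => nat => nat list set" where
 "Bl b mu N = {u\<in>words (sum_list mu) N. bl b mu u}"

lemma Bl_Cons: "Bl b (m # mu) N = (%(a, v). a @ v) ` (Wd b m N \<times> Bl b mu N)"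
proof (intro set_eqI iffI)
 fix u assume u: "u \<in> Bl b (m # mu) N"
 hence "take m u \<in> Wd b m N" "drop m u \<in> Bl b mu N"
  by (auto simp: Bl_def Wd_def words_def dest: in_set_takeD in_set_dropD)
 thus "u \<in> (%(a, v). a @ v) ` (Wd b m N \<times> Bl b mu N)"
  by (intro image_eqI[of _ _ "(take m u, drop m u)"]) auto
qed (auto simp: Bl_def Wd_def words_def)

lemma Bl_sum:
 fixes x :: "nat => 'a::field_char_0"
 shows "(\<Sum>u\<in>Bl b mu N. mon x u) = prod_list (map (%m. Hh m (%k. (if b then eps k else 1) * psum N x k)) mu)"
proof (induction mu)
 case Nil
 have "Bl b [] N = {[]}" by (auto simp: Bl_def words_def)
 thus ?case by simp
next
 case (Cons m mu)
 have "inj_on (%(a, v). a @ v) (Wd b m N \<times> Bl b mu N)"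
  by (auto simp: inj_on_def Wd_def words_def)
 from sum.reindex[OF this, of "mon x"]
 have "(\<Sum>u\<in>Bl b (m # mu) N. mon x u) = (\<Sum>(a, v)\<in>Wd b m N \<times> Bl b mu N. mon x a * mon x v)"
  by (simp add: Bl_Cons comp_def case_prod_beta)
 also have "... = (\<Sum>u\<in>Wd b m N. mon x u) * (\<Sum>u\<in>Bl b mu N. mon x u)"
  by (simp add: sum_product sum.cartesian_product)
 finally show ?case by (simp add: Cons Wd_sum)
qed

lemma lattice_character:
 fixes x :: "nat => K"
 assumes R: "\<And>j u. R (fop j u) = R u" and N: "n <= N"
 shows "(\<Sum>u\<in>{u\<in>words n N. R u}. mon x u) = (\<Sum>u\<in>{u\<in>LW n. R u}. ev n (schur (sh u)) (psum N x))"
proof -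
 have Re: "R (eop j u) = R u" if "0 < bb j u" for j u
  using R[of j "eop j u"] fop_eop[OF that] by simp
 have cr: "crystal N {u\<in>words n N. R u}"
  using crystal_words[of N n "%_. True"] R Re by (auto simp: crystal_def)
 have "(\<Sum>u\<in>{u\<in>words n N. R u}. 1 * mon x u) =
  (\<Sum>u\<in>{u\<in>{u\<in>words n N. R u}. yam N u}. 1 * (\<Sum>w\<in>ssw N (shp N u). mon x w))"
  by (rule crystal_character[OF cr, where n = n]) (auto simp: words_def intro: finite_subset[OF _ finite_words[of n N]])
 also have "{u\<in>{u\<in>words n N. R u}. yam N u} = {u\<in>LW n. R u}"
  using LW_words[OF N] by auto
 also have "(\<Sum>u\<in>{u\<in>LW n. R u}. 1 * (\<Sum>w\<in>ssw N (shp N u). mon x w)) = (\<Sum>u\<in>{u\<in>LW n. R u}. ev n (schur (sh u)) (psum N x))"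
 proof (intro sum.cong refl)
  fix u assume "u \<in> {u\<in>LW n. R u}"
  hence u: "u \<in> LW n" by simp
  hence "shp N u = sh u" using shp_sh[of u N] N by (simp add: LW_def)
  thus "1 * (\<Sum>w\<in>ssw N (shp N u). mon x w) = ev n (schur (sh u)) (psum N x)"
   by (simp add: ev_schur[OF sh_parts[OF u]])
 qed
 finally show ?thesis by simp
qed

section \<open>Omega on Schur functions\<close>

fun hvec :: "nat list => nat list => 'a::field_char_0" where
 "hvec [] = (%nu. if nu = [] then 1 else 0)"
| "hvec (m # mu) = vop (%k. 1) (%k. 0) (%k. 1) (sum_list mu) (m + sum_list mu) (hvec mu)"

lemma parts_0: "parts 0 = {[]}"
 by (auto simp: parts_def is_partition_def) (metis list.set_intros(1) neq_Nil_conv not_less0 sum_list_eq_0_iff)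

lemma pw_const: "pw (%k. 1) (%k. 0) P mu = [:prod_list (map P mu):]"
 by (induction mu) (simp_all add: pw_def one_pCons)

lemma ev_mult_h:
 "d <= d' ==> ev d' (vop (%k. 1) (%k. 0) (%k. 1) d d' f) P = ev d f P * Hh (d' - d) P"
proof -
 assume d: "d <= d'"
 have e: "evp (%k. 1) (%k. 0) d f P = [:ev d f P:]"
  by (rule poly_eqI) (simp add: evp_def pw_const ev_def coeff_sum coeff_pCons split: nat.split)
 have "ev d' (vop (%k. 1) (%k. 0) (%k. 1) d d' f) P = (\<Sum>i\<le>d. if i = 0 then ev d f P * Hh (d' - d) P else 0)"
  unfolding ev_vop[OF d] e by (intro sum.cong refl) (auto simp: coeff_pCons split: nat.split)
 thus ?thesis by (simp add: sum.delta')
qed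

lemma ev_hvec: "ev (sum_list mu) (hvec mu) P = prod_list (map (%m. Hh m P) mu)"
proof (induction mu)
 case (Cons m mu)
 thus ?case by (simp add: ev_mult_h mult.commute)
qed (simp add: ev_def parts_0)

definition omg :: "(nat list => 'a::comm_ring_1) => nat list => 'a" where
 "omg f = (%mu. pm eps (mset mu) * f mu)"

lemma ev_omg: "ev d (omg f) P = ev d f (%k. eps k * P k)"
 by (simp add: ev_def omg_def prod_list_pm pm_mult mult_ac)

lemma eps_sq: "eps k * eps k = 1" by (simp add: eps_def power_mult_distrib[symmetric])

lemma pm_eps_sq: "pm eps M * pm eps M = 1" by (simp add: pm_mult[symmetric] eps_sq)

lemma omg_lin: "omg (%nu. \<Sum>u\<in>A. c u * f u nu) = (%nu. \<Sum>u\<in>A. c u * omg (f u) nu)"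
 by (simp add: omg_def sum_distrib_left mult_ac)

text \<open>\<open>bl\<close> depends only on the ascents and is therefore constant on crystals, so
  complete and elementary products expand in Schur functions over lattice words with complementary
  ascents.\<close>

lemma h_expand:
 assumes mu: "sum_list mu = d" and nu: "nu \<in> parts d"
 shows "(\<Sum>u\<in>{u\<in>LW d. bl b mu u}. schur (sh u) nu) = (if b then omg (hvec mu) else hvec mu) nu"
proof (rule ev_inj[where N = d and B = "Suc d" and S = UNIV, OF _ _ infinite_UNIV_char_0 _ nu])
 fix s :: K
 let ?P = "psum d (pt (Suc d) s)"
 have "ev d (%nu. \<Sum>u\<in>{u\<in>LW d. bl b mu u}. schur (sh u) nu) ?P = (\<Sum>u\<in>{u\<in>LW d. bl b mu u}. ev d (schur (sh u)) ?P)"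
  using ev_sum[of d "%u. 1" "%u. schur (sh u)"] by simp
 also have "... = (\<Sum>u\<in>{u\<in>words d d. bl b mu u}. mon (pt (Suc d) s) u)"
  by (rule lattice_character[symmetric]) (simp_all add: bl_fop)
 also have "{u\<in>words d d. bl b mu u} = Bl b mu d" by (simp add: Bl_def mu)
 also have "(\<Sum>u\<in>Bl b mu d. mon (pt (Suc d) s) u) = prod_list (map (%m. Hh m (%k. (if b then eps k else 1) * ?P k)) mu)"
  by (rule Bl_sum)
 also have "... = ev d (if b then omg (hvec mu) else hvec mu) ?P"
  using ev_hvec[of mu "%k. (if b then eps k else 1) * ?P k"] mu by (cases b) (simp_all add: ev_omg)
 finally show "ev d (%nu. \<Sum>u\<in>{u\<in>LW d. bl b mu u}. schur (sh u) nu) ?P = ev d (if b then omg (hvec mu) else hvec mu) ?P" .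
qed auto

lemma block_letters:
 "latf c u ==> bl False mu u ==> (\<And>j. k <= j ==> c j = 0) ==>
  sum_list (take i mu) <= length (filter (%x. x < k + i) u)"
proof (induction mu arbitrary: c u k i)
 case (Cons m mu)
 define a v where "a = take m u" and "v = drop m u"
 have u: "u = a @ v" by (simp add: a_def v_def)
 have la: "latf c a" and lv: "latf (foldl inc c a) v" using Cons.prems(1) by (simp_all add: u latf_append)
 have am: "length a = m" and ad: "sorted_wrt (\<ge>) a" and bv: "bl False mu v"
  using Cons.prems(2) by (simp_all add: asc_False[symmetric] a_def v_def)
 have ak: "x <= k" if "x \<in> set a" for x
 proof (cases a)
  case (Cons y w)
  have "y <= k"
  proof (rule ccontr)
   assume "\<not> y <= k"
   hence "c y < c k" using la Cons by simp
   thus False using Cons.prems(3)[of k] by simp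
  qed
  thus ?thesis using that ad Cons by auto
 qed (use that in simp)
 show ?case
 proof (cases i)
  case (Suc i')
  have z: "foldl inc c a j = 0" if "Suc k <= j" for j
   using that ak Cons.prems(3)[of j] by (auto simp: cadd_count ct_def intro!: count_inI) (metis count_mset_0_iff not_less_eq_eq)
  have "sum_list (take i' mu) <= length (filter (%x. x < Suc k + i') v)"
   by (rule Cons.IH[OF lv bv]) (rule z)
  moreover have "filter (%x. x < Suc k + i') a = a" using ak by (fastforce intro!: filter_True)
  ultimately show ?thesis by (simp add: Suc u am)
 qed simp
qed simp

lemma bl_dominated:
 assumes u: "u \<in> LW d" and b: "bl False mu u"
 shows "dominated mu (sh u)"
 unfolding dominated_def
proof
 fix i
 have l: "lat u" using u by (simp add: LW_def)
 have "sum_list (take i mu) <= length (filter (%x. x < 0 + i) u)"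
  by (rule block_letters[where c = "%_. 0", OF _ b]) (use l in \<open>simp_all add: lat_latf\<close>)
 also have "... = (\<Sum>j<i. fn (sh u) j)" by (simp add: length_filter_less_count fn_sh[OF l] ct_def)
 finally show "sum_list (take i mu) <= sum_list (take i (sh u))" by (simp add: sum_fn_take)
qed

lemma bl_srow: "bl False la (rw (srow r la))"
proof (induction la arbitrary: r)
 case (Cons n la)
 have "sorted_wrt (\<ge>) (replicate n r)" by (simp add: sorted_wrt_iff_nth_less)
 thus ?case using Cons by (simp add: rw_def asc_False)
qed (simp add: rw_def)

lemma srow_LW:
 assumes la: "la \<in> parts d"
 shows "rw (srow 0 la) \<in> LW d" "sh (rw (srow 0 la)) = la"
proof -
 have "bb j (rw (srow 0 la)) = 0" for j using bb_srow[OF parts_sorted[OF la], of j 0] by simp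
 hence l: "lat (rw (srow 0 la))" by (simp add: lat_def)
 thus L: "rw (srow 0 la) \<in> LW d" by (simp add: LW_def length_rw parts_sum[OF la])
 show "sh (rw (srow 0 la)) = la"
  by (rule fn_inj[OF sh_parts[OF L] la _ order_refl]) (simp add: fn_sh[OF l] ct_srow, simp add: fn_def)
qed

text \<open>The expansion of a complete product in Schur functions is triangular for dominance.
  Omega turns it into that of the elementary product, whose lattice words are the transposed ones;
  inverting the triangular matrix isolates a single shape.\<close>

theorem omg_schur:
 assumes la: "la \<in> parts d" and nu: "nu \<in> parts d"
 shows "omg (schur la) nu = schur (cj la) nu"
proof -
 define g where "g ka = omg (schur ka) nu - schur (cj ka) nu" for ka
 define M :: "nat list => nat list => K" where
  "M ka mu = of_nat (card {u\<in>{u\<in>LW d. bl False mu u}. sh u = ka})" for ka mu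
 have fin: "finite {u\<in>LW d. bl False mu u}" for mu by simp
 have "g la = 0"
 proof (rule tri_unique[where S = "parts d" and M = M and r = "%mu. wt d mu" and f = g, OF finite_parts _ _ _ la])
  fix ka mu assume km: "ka \<in> parts d" "mu \<in> parts d" "M ka mu ~= 0"
  hence "{u\<in>{u\<in>LW d. bl False mu u}. sh u = ka} ~= {}" unfolding M_def by (metis card.empty of_nat_0)
  then obtain u where "u \<in> LW d" "bl False mu u" "sh u = ka" by blast
  hence "dominated mu ka" using bl_dominated by blast
  thus "wt d mu < wt d ka | ka = mu" using wt_less[OF km(2,1)] by auto
 next
  fix mu assume mu: "mu \<in> parts d"
  have "rw (srow 0 mu) \<in> {u\<in>{u\<in>LW d. bl False mu u}. sh u = mu}" using srow_LW[OF mu] bl_srow by simp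
  moreover have "finite {u\<in>{u\<in>LW d. bl False mu u}. sh u = mu}" by simp
  ultimately have "card {u\<in>{u\<in>LW d. bl False mu u}. sh u = mu} ~= 0" using card_0_eq by blast
  thus "M mu mu ~= 0" by (simp add: M_def)
 next
  fix mu assume mu: "mu \<in> parts d"
  have "(\<Sum>ka\<in>parts d. g ka * M ka mu) = (\<Sum>u\<in>{u\<in>LW d. bl False mu u}. g (sh u))"
   unfolding M_def by (subst sum_fibers[OF fin finite_parts]) (auto intro: sh_parts simp: mult.commute)
  also have "... = (\<Sum>u\<in>{u\<in>LW d. bl False mu u}. omg (schur (sh u)) nu) - (\<Sum>u\<in>{u\<in>LW d. bl False mu u}. schur (cj (sh u)) nu)"
   by (simp add: g_def sum_subtractf)
  also have "(\<Sum>u\<in>{u\<in>LW d. bl False mu u}. omg (schur (sh u)) nu) = omg (hvec mu) nu"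
   using h_expand[OF parts_sum[OF mu] nu, of False] by (simp add: omg_def sum_distrib_left[symmetric])
  also have "... = (\<Sum>u\<in>{u\<in>LW d. bl True mu u}. schur (sh u) nu)"
   using h_expand[OF parts_sum[OF mu] nu, of True] by simp
  also have "... = (\<Sum>u\<in>{u\<in>LW d. bl False mu u}. schur (cj (sh u)) nu)"
  proof (rule sum.reindex_bij_witness[where i = tr and j = tr])
   fix u assume "u \<in> {u\<in>LW d. bl True mu u}"
   hence u: "u \<in> LW d" "bl True mu u" "lat u" by (auto simp: LW_def)
   show "tr (tr u) = u" using u tr_tr by blast
   have "bl (\<not> False) mu u = bl False mu (tr u)" by (rule bl_asc_neg) (use u in \<open>simp_all add: asc_tr comp_def\<close>)
   thus "tr u \<in> {u\<in>LW d. bl False mu u}" using u tr_LW by simp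
   show "schur (cj (sh (tr u))) nu = schur (sh u) nu" using sh_tr[of "tr u"] lat_tr[OF u(3)] tr_tr[OF u(3)] by simp
  next
   fix u assume "u \<in> {u\<in>LW d. bl False mu u}"
   hence u: "u \<in> LW d" "bl False mu u" "lat u" by (auto simp: LW_def)
   show "tr (tr u) = u" using u tr_tr by blast
   have "bl (\<not> False) mu (tr u) = bl False mu u" by (rule bl_asc_neg) (use u in \<open>simp_all add: asc_tr\<close>)
   thus "tr u \<in> {u\<in>LW d. bl True mu u}" using u tr_LW by simp
  qed
  finally show "(\<Sum>ka\<in>parts d. g ka * M ka mu) = 0" by simp
 qed
 thus ?thesis by (simp add: g_def)
qed

definition Q1 :: "(nat list => bool) => nat list => bool" where
 "Q1 Q v \<longleftrightarrow> (\<exists>v'. v = 1 # v' & Q v')"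

text \<open>Substitute \<open>tr u\<close> for \<open>u\<close>: the shape is conjugated, the
  dominoes are complemented, and \<open>cmaj\<close> becomes the full sum of weights minus itself,
  which inverts \<open>r\<close>.\<close>

lemma omg_Ap:
 assumes r: "r ~= 0" and nu: "nu \<in> parts n"
 shows "omg (Ap r n Q) nu = r ^ (\<Sum>i<n. i) * Ap (inverse r) n (%v. Q (map (%b. 1 - b) v)) nu"
proof -
 have "omg (Ap r n Q) nu = (\<Sum>u\<in>{u\<in>LW n. Q (dvw u)}. r ^ cmaj u * schur (cj (sh u)) nu)"
  unfolding Ap_def omg_lin by (intro sum.cong refl) (simp add: omg_schur[OF sh_parts nu])
 also have "... = (\<Sum>u\<in>{u\<in>LW n. Q (map (%b. 1 - b) (dvw u))}. r ^ (\<Sum>i<n. i) * (inverse r ^ cmaj u * schur (sh u) nu))"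
 proof (rule sum.reindex_bij_witness[where i = tr and j = tr])
  fix u assume "u \<in> {u\<in>LW n. Q (dvw u)}"
  hence u: "u \<in> LW n" "Q (dvw u)" "lat u" "length u = n" by (auto simp: LW_def)
  show t: "tr (tr u) = u" using u tr_tr by blast
  have "dvw u = map (%b. 1 - b) (dvw (tr u))" using dvw_tr[OF lat_tr[OF u(3)]] t by simp
  thus "tr u \<in> {u\<in>LW n. Q (map (%b. 1 - b) (dvw u))}" using u tr_LW by simp
  have "(\<Sum>i<n. i) = cmaj u + cmaj (tr u)" using cmaj_tr[OF u(3)] u(4) by simp
  hence "r ^ (\<Sum>i<n. i) * inverse r ^ cmaj (tr u) = r ^ cmaj u"
   using r by (simp add: power_add mult.assoc power_mult_distrib[symmetric] del: power_inverse)
  thus "r ^ (\<Sum>i<n. i) * (inverse r ^ cmaj (tr u) * schur (sh (tr u)) nu) = r ^ cmaj u * schur (cj (sh u)) nu"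
   by (simp add: mult.assoc[symmetric] sh_tr[OF u(3)])
 next
  fix u assume "u \<in> {u\<in>LW n. Q (map (%b. 1 - b) (dvw u))}"
  thus "tr (tr u) = u" "tr u \<in> {u\<in>LW n. Q (dvw u)}"
   using tr_tr tr_LW by (auto simp: LW_def dvw_tr lat_tr)
 qed
 finally show ?thesis by (simp add: Ap_def sum_distrib_left)
qed

text \<open>The factor \<open>r ^ n\<close> is distributed over the kept and the destroyed parts and
  turns inverse powers of \<open>r\<close> into powers. The signs cancel because created and
  destroyed parts differ in total by the even number 2.\<close>

lemma vme_omega:
 fixes r :: K
 assumes r: "r ~= 0" and mu: "mu \<in> parts n" and nu: "nu \<in> parts (n + 2)"
 shows "pm eps (mset nu) * vme (%k. inverse r ^ k) (%k. 1 - inverse r ^ k) (%k. 1) nu mu * pm eps (mset mu) * r ^ n =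
  vme (%k. 1) (%k. 1 - r ^ k) (%k. -1) nu mu"
 unfolding vme_def sum_distrib_left sum_distrib_right
proof (intro sum.cong refl)
 fix L assume "L \<in> {L. L \<subseteq># mset mu & L \<subseteq># mset nu}"
 hence L: "L \<subseteq># mset mu" "L \<subseteq># mset nu" by auto
 define A B where "A = mset mu - L" and "B = mset nu - L"
 have mm: "mset mu = L + A" "mset nu = L + B" using L by (simp_all add: A_def B_def)
 have n: "n = \<Sum>\<^sub># L + \<Sum>\<^sub># A" "n + 2 = \<Sum>\<^sub># L + \<Sum>\<^sub># B"
  using mset_parts[OF mu] mset_parts[OF nu] by (simp_all add: mm)
 have pmL: "pm (%k. inverse r ^ k) M * r ^ \<Sum>\<^sub># M = 1" for M
 proof (induction M)
  case (add k M)
  have e: "pm (%k. inverse r ^ k) (add_mset k M) * r ^ \<Sum>\<^sub># (add_mset k M) =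
   (inverse r ^ k * r ^ k) * (pm (%k. inverse r ^ k) M * r ^ \<Sum>\<^sub># M)"
   by (simp only: image_mset_add_mset prod_mset.add_mset sum_mset.add_mset power_add mult_ac)
  show ?case unfolding e add using r by (simp add: power_inverse)
 qed simp
 have pmA: "pm eps M * pm (%k. 1 - inverse r ^ k) M * r ^ \<Sum>\<^sub># M = (-1) ^ \<Sum>\<^sub># M * pm (%k. 1 - r ^ k) M" for M
 proof (induction M)
  case (add k M)
  have e1: "eps k * (1 - inverse r ^ k) * r ^ k = (-1) ^ k * (1 - r ^ k)"
   using r by (simp add: eps_def algebra_simps power_mult_distrib[symmetric] del: power_inverse)
  have e2: "pm eps (add_mset k M) * pm (%k. 1 - inverse r ^ k) (add_mset k M) * r ^ \<Sum>\<^sub># (add_mset k M) =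
   (eps k * (1 - inverse r ^ k) * r ^ k) * (pm eps M * pm (%k. 1 - inverse r ^ k) M * r ^ \<Sum>\<^sub># M)"
   by (simp add: power_add mult_ac)
  show ?case unfolding e2 e1 add by (simp add: power_add mult_ac)
 qed simp
 have pmB: "pm eps M = (-1) ^ \<Sum>\<^sub># M * pm (%k. -1) M" for M :: "nat multiset"
  by (induction M) (simp_all add: eps_def power_add mult_ac)
 have sgn: "(-1) ^ \<Sum>\<^sub># B * (-1) ^ \<Sum>\<^sub># A = (1::K)"
 proof -
  have "\<Sum>\<^sub># B = \<Sum>\<^sub># A + 2" using n by simp
  thus ?thesis by (simp add: power_add power_mult_distrib[symmetric])
 qed
 have one: "pm (%k. 1) M = (1::K)" for M by (induction M) auto
 have "pm eps (mset nu) * (of_nat (Ncs mu L) * pm (%k. inverse r ^ k) L * pm (%k. 1 - inverse r ^ k) A * pm (%k. 1) B / of_nat (zm B)) *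
  pm eps (mset mu) * r ^ n =
  of_nat (Ncs mu L) / of_nat (zm B) * (pm eps L * pm eps L) * (pm (%k. inverse r ^ k) L * r ^ \<Sum>\<^sub># L) *
  (pm eps A * pm (%k. 1 - inverse r ^ k) A * r ^ \<Sum>\<^sub># A) * pm eps B"
  unfolding n(1) by (simp add: mm one power_add mult_ac)
 also have "... = of_nat (Ncs mu L) / of_nat (zm B) * pm (%k. 1 - r ^ k) A * pm (%k. -1) B * ((-1) ^ \<Sum>\<^sub># B * (-1) ^ \<Sum>\<^sub># A)"
  unfolding pm_eps_sq pmL pmA pmB[of B] by (simp add: mult_ac)
 also have "... = of_nat (Ncs mu L) * pm (%k. 1) L * pm (%k. 1 - r ^ k) A * pm (%k. -1) B / of_nat (zm B)"
  unfolding sgn one by simp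
 finally show "pm eps (mset nu) * (of_nat (Ncs mu L) * pm (%k. inverse r ^ k) L * pm (%k. 1 - inverse r ^ k) (mset mu - L) * pm (%k. 1) (mset nu - L) / of_nat (zm (mset nu - L))) *
  pm eps (mset mu) * r ^ n =
  of_nat (Ncs mu L) * pm (%k. 1) L * pm (%k. 1 - r ^ k) (mset mu - L) * pm (%k. -1) (mset nu - L) / of_nat (zm (mset nu - L))"
  unfolding A_def B_def .
qed

text \<open>\<open>Ap_Q0\<close> transported through omega. With T(n) the sum of all positions below
  n, the exponent \<open>n + 1\<close> is T(n + 2) - T(n) - n, the last n being spent in
  \<open>vme_omega\<close>.\<close>

theorem Ap_Q1:
 assumes r: "r ~= 0" and nu: "nu \<in> parts (n + 2)"
 shows "Ap r (n + 2) (Q1 Q) nu = r ^ (n + 1) * vop (%k. 1) (%k. 1 - r ^ k) (%k. -1) n (n + 2) (Ap r n Q) nu"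
proof -
 let ?c = "map (%b::nat. 1 - b)" and ?T = "%n. \<Sum>i<n::nat. i"
 define F where "F = Ap (inverse r) n (%v. Q (?c v))"
 have r': "inverse r ~= 0" using r by simp
 have cc: "Ap r n (%v. Q (?c (?c v))) = Ap r n Q" for n
 proof -
  have "?c (?c (dvw u)) = dvw u" for u
  proof (induction u rule: dvw.induct)
  qed auto
  thus ?thesis by (simp add: Ap_def)
 qed
 have QQ: "(%v. Q1 Q (?c v)) = Q0 (%v. Q (?c v))"
 proof
  fix v show "Q1 Q (?c v) = Q0 (%v. Q (?c v)) v"
   by (cases v) (auto simp: Q1_def Q0_def)
 qed
 have F: "F mu = inverse r ^ ?T n * (pm eps (mset mu) * Ap r n Q mu)" if "mu \<in> parts n" for mu
 proof -
  have "omg (Ap r n Q) mu = r ^ ?T n * F mu" unfolding F_def by (rule omg_Ap[OF r that])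
  thus ?thesis using r by (simp add: omg_def mult.assoc[symmetric] power_mult_distrib[symmetric] del: power_inverse)
 qed
 have "Ap r (n + 2) (Q1 Q) nu = pm eps (mset nu) * omg (Ap r (n + 2) (Q1 Q)) nu"
  by (simp add: omg_def mult.assoc[symmetric] pm_eps_sq)
 also have "omg (Ap r (n + 2) (Q1 Q)) nu = r ^ ?T (n + 2) * Ap (inverse r) (n + 2) (Q0 (%v. Q (?c v))) nu"
  unfolding omg_Ap[OF r nu] QQ ..
 also have "Ap (inverse r) (n + 2) (Q0 (%v. Q (?c v))) nu =
  vop (%k. inverse r ^ k) (%k. 1 - inverse r ^ k) (%k. 1) n (n + 2) F nu"
  unfolding F_def by (rule Ap_Q0[OF nu])
 also have "... = (\<Sum>mu\<in>parts n. vme (%k. inverse r ^ k) (%k. 1 - inverse r ^ k) (%k. 1) nu mu * (inverse r ^ ?T n * (pm eps (mset mu) * Ap r n Q mu)))"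
  using nu by (simp add: vop_def F)
 also have "pm eps (mset nu) * (r ^ ?T (n + 2) * ...) = (\<Sum>mu\<in>parts n. r ^ (n + 1) * (vme (%k. 1) (%k. 1 - r ^ k) (%k. -1) nu mu * Ap r n Q mu))"
  unfolding sum_distrib_left
 proof (intro sum.cong refl)
  fix mu assume mu: "mu \<in> parts n"
  have "?T (n + 2) = ?T n + (n + (n + 1))" by simp
  hence "r ^ ?T (n + 2) = r ^ ?T n * (r ^ n * r ^ (n + 1))" by (simp only: power_add)
  hence T: "r ^ ?T (n + 2) * inverse r ^ ?T n = r ^ n * r ^ (n + 1)"
   using r by (simp add: mult.assoc mult.left_commute[of "r ^ _" "inverse r ^ _"] power_mult_distrib[symmetric] del: power_inverse)
  have "pm eps (mset nu) * (r ^ ?T (n + 2) * (vme (%k. inverse r ^ k) (%k. 1 - inverse r ^ k) (%k. 1) nu mu * (inverse r ^ ?T n * (pm eps (mset mu) * Ap r n Q mu)))) =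
   (r ^ ?T (n + 2) * inverse r ^ ?T n) * (pm eps (mset nu) * vme (%k. inverse r ^ k) (%k. 1 - inverse r ^ k) (%k. 1) nu mu * pm eps (mset mu)) * Ap r n Q mu"
   by (simp only: mult_ac)
  also have "... = r ^ (n + 1) * ((pm eps (mset nu) * vme (%k. inverse r ^ k) (%k. 1 - inverse r ^ k) (%k. 1) nu mu * pm eps (mset mu) * r ^ n) * Ap r n Q mu)"
   unfolding T by (simp only: mult_ac)
  finally show "pm eps (mset nu) * (r ^ ?T (n + 2) * (vme (%k. inverse r ^ k) (%k. 1 - inverse r ^ k) (%k. 1) nu mu * (inverse r ^ ?T n * (pm eps (mset mu) * Ap r n Q mu)))) =
   r ^ (n + 1) * (vme (%k. 1) (%k. 1 - r ^ k) (%k. -1) nu mu * Ap r n Q mu)"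
   unfolding vme_omega[OF r mu nu] .
 qed
 also have "... = r ^ (n + 1) * vop (%k. 1) (%k. 1 - r ^ k) (%k. -1) n (n + 2) (Ap r n Q) nu"
  using nu by (simp add: vop_def sum_distrib_left)
 finally show ?thesis .
qed

section \<open>Two-row eigenfunctions\<close>

lemma Hh_cong: "(\<And>k. 0 < k ==> Q k = R k) ==> Hh m Q = Hh m R"
 by (rule Hh_unique) (auto simp: Hh_rec intro!: sum.cong)

lemma Hh_add: "Hh m (%k. Q k + R k) = (\<Sum>i\<le>m. Hh (m - i) Q * Hh i R)"
proof -
 have "Hs (%k. Q k + R k) = Hs R * Hs Q" unfolding Hs_add by (rule mult.commute)
 hence "Hh m (%k. Q k + R k) = (\<Sum>i\<le>m. Hh i R * Hh (m - i) Q)"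
  by (simp add: fps_mult_nth Hh_Hs atMost_atLeast0)
 thus ?thesis by (simp add: mult.commute[of "Hh (m - _) Q"])
qed

text \<open>The complete function of the alphabet X/(1 - q). Its values at different degrees are
  linked by the alphabet identities \<open>hh_Ph\<close> and \<open>hh_Ps\<close>.\<close>

definition hh :: "(nat => K) => nat => K" where "hh P m = Hh m (%k. P k / (1 - qq ^ k))"

lemma hh_0 [simp]: "hh P 0 = 1" by (simp add: hh_def)

lemma evp_mult: "evp (%k. 1) (%k. 0) d f P = [:ev d f P:]"
 by (rule poly_eqI) (simp add: evp_def pw_const ev_def coeff_sum coeff_pCons split: nat.split)

lemma ev_mult: "d <= d' ==> ev d' (vop (%k. 1) (%k. 0) c d d' f) P = ev d f P * Hh (d' - d) (%k. c k * P k)"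
proof -
 assume d: "d <= d'"
 have "ev d' (vop (%k. 1) (%k. 0) c d d' f) P = (\<Sum>i\<le>d. if i = 0 then ev d f P * Hh (d' - d) (%k. c k * P k) else 0)"
  unfolding ev_vop[OF d] evp_mult by (intro sum.cong refl) (auto simp: coeff_pCons split: nat.split)
 thus ?thesis by (simp add: sum.delta')
qed

definition gv :: "nat => nat => nat list => K" where
 "gv a b = vop (%k. 1) (%k. 0) (%k. 1 / (1 - qq ^ k)) b (a + b)
   (vop (%k. 1) (%k. 0) (%k. 1 / (1 - qq ^ k)) 0 b (%nu. if nu = [] then 1 else 0))"

lemma ev_gv: "ev (a + b) (gv a b) P = hh P a * hh P b"
proof -
 have "ev 0 (%nu. if nu = [] then 1 else 0) P = 1" by (simp add: ev_def parts_0)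
 thus ?thesis by (simp add: gv_def ev_mult hh_def mult.commute)
qed

lemma symf_gv: "symf (a + b) (gv a b)" by (simp add: gv_def symf_vop)

lemma ev_eqI:
 fixes f g :: "nat list => K"
 assumes "\<And>P. ev d f P = ev d g P" "symf d f" "symf d g"
 shows "f = g"
proof
 fix nu
 show "f nu = g nu"
 proof (cases "nu \<in> parts d")
  case True
  show ?thesis
   by (rule ev_inj[where N = d and B = "Suc d" and S = UNIV, OF _ _ infinite_UNIV_char_0 _ True]) (simp_all add: assms(1))
 qed (use assms in \<open>simp add: symf_def\<close>)
qed

lemma ev_scale: "ev d (%nu. s * f nu) P = s * ev d f P"
 by (simp add: ev_def sum_distrib_left mult.assoc)
lemma ev_minus: "ev d (%nu. f nu - g nu) P = ev d f P - ev d g P" for P :: "nat => K"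
 by (simp add: ev_def left_diff_distrib sum_subtractf)
lemma ev_plus: "ev d (%nu. f nu + g nu) P = ev d f P + ev d g P"
 by (simp add: ev_def distrib_right sum.distrib)

text \<open>The substitution acts on each factor of the product separately. The hypothesis expands
  one factor in \<open>w\<close>; the term of total degree \<open>i + j\<close> meets the
  coefficient \<open>r + (i + j)\<close> of the exponential.\<close>

lemma ev_vop_gv:
 assumes A: "\<And>m w. Hh m (%k. (al k * P k + be k * w ^ k) / (1 - qq ^ k)) = (\<Sum>i\<le>m. A (m - i) * (th i * w ^ i))"
 shows "ev (a + b + r) (vop al be \<gamma> (a + b) (a + b + r) (gv a b)) P =
  (\<Sum>i\<le>a. \<Sum>j\<le>b. A (a - i) * th i * (A (b - j) * th j) * Hh (r + (i + j)) (%k. \<gamma> k * P k))"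
proof -
 define S where "S m = (\<Sum>i\<le>m. monom (A (m - i) * th i) i)" for m
 have "evp al be (a + b) (gv a b) P = S a * S b"
 proof (rule iffD1[OF poly_eq_poly_eq_iff], rule ext)
  fix w
  have "poly (S m) w = Hh m (%k. (al k * P k + be k * w ^ k) / (1 - qq ^ k))" for m
   by (simp add: S_def poly_sum poly_monom A mult.assoc)
  thus "poly (evp al be (a + b) (gv a b) P) w = poly (S a * S b) w"
   by (simp add: poly_evp ev_gv hh_def)
 qed
 also have "S a * S b = (\<Sum>i\<le>a. \<Sum>j\<le>b. monom (A (a - i) * th i * (A (b - j) * th j)) (i + j))"
  by (simp add: S_def sum_product mult_monom)
 finally have e: "evp al be (a + b) (gv a b) P = (\<Sum>i\<le>a. \<Sum>j\<le>b. monom (A (a - i) * th i * (A (b - j) * th j)) (i + j))" .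
 have "ev (a + b + r) (vop al be \<gamma> (a + b) (a + b + r) (gv a b)) P =
  (\<Sum>l\<le>a + b. (\<Sum>i\<le>a. \<Sum>j\<le>b. if i + j = l then A (a - i) * th i * (A (b - j) * th j) * Hh (r + l) (%k. \<gamma> k * P k) else 0))"
  unfolding ev_vop[OF le_add1] e by (simp add: coeff_sum sum_distrib_right if_distrib[of "%x. x * _"] cong: if_cong)
 also have "... = (\<Sum>i\<le>a. \<Sum>j\<le>b. \<Sum>l\<le>a + b. if i + j = l then A (a - i) * th i * (A (b - j) * th j) * Hh (r + l) (%k. \<gamma> k * P k) else 0)"
  by (rule trans[OF sum.swap], rule sum.cong[OF refl], rule sum.swap)
 also have "... = (\<Sum>i\<le>a. \<Sum>j\<le>b. A (a - i) * th i * (A (b - j) * th j) * Hh (r + (i + j)) (%k. \<gamma> k * P k))"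
  by (intro sum.cong refl, subst sum.delta') auto
 finally show ?thesis .
qed

section \<open>Convolution identities\<close>

definition Ph :: "(nat => K) => nat => K" where "Ph P m = Hh m (%k. - P k)"
definition Ps :: "(nat => K) => nat => K" where "Ps P m = Hh m P"

text \<open>The alphabet identity X/(1 - q) - X = q X/(1 - q); \<open>hh_Ps\<close> reads it
  backwards.\<close>

lemma hh_Ph: "(\<Sum>i\<le>m. Ph P i * hh P (m - i)) = qq ^ m * hh P m"
proof -
 have "qq ^ m * hh P m = Hh m (%k. P k / (1 - qq ^ k) + - P k)"
  unfolding hh_def Hh_scale[symmetric] by (rule Hh_cong) (simp add: field_simps)
 thus ?thesis unfolding Hh_add by (simp add: hh_def Ph_def mult.commute)
qed

lemma hh_Ps: "(\<Sum>i\<le>m. Ps P i * (qq ^ (m - i) * hh P (m - i))) = hh P m"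
proof -
 have "hh P m = Hh m (%k. qq ^ k * (P k / (1 - qq ^ k)) + P k)"
  unfolding hh_def by (rule Hh_cong) (simp add: field_simps)
 thus ?thesis unfolding Hh_add Hh_scale by (simp add: hh_def Ps_def mult.commute)
qed

lemma conv_split: "(\<Sum>i\<le>Suc m. f i * g (Suc m - i)) = f 0 * g (Suc m) + (\<Sum>i\<le>m. f (Suc i) * g (m - i))"
 by (simp add: sum.atMost_Suc_shift del: sum.atMost_Suc)

text \<open>The double convolution delivered by \<open>ev_vop_gv\<close>; \<open>r\<close> is the
  degree added by the operator.\<close>

definition ZZ :: "(nat => K) => (nat => K) => nat => nat => nat => K" where
 "ZZ F g r a b = (\<Sum>i\<le>a. \<Sum>j\<le>b. F (r + (i + j)) * g (a - i) * g (b - j))"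

lemma ZZ_Suc1: "ZZ F g r (Suc a) b = g (Suc a) * (\<Sum>j\<le>b. F (r + j) * g (b - j)) + ZZ F g (Suc r) a b"
 by (simp add: ZZ_def sum.atMost_Suc_shift sum_distrib_left mult_ac del: sum.atMost_Suc)

lemma ZZ_sym: "ZZ F g r a b = ZZ F g r b a"
 unfolding ZZ_def by (subst sum.swap) (simp add: add.commute mult_ac)

lemma ZZ_Suc2: "ZZ F g r a (Suc b) = g (Suc b) * (\<Sum>j\<le>a. F (r + j) * g (a - j)) + ZZ F g (Suc r) a b"
 by (subst (1 2) ZZ_sym) (rule ZZ_Suc1)

lemma ZZ_00: "ZZ F g r 0 b = g 0 * (\<Sum>j\<le>b. F (r + j) * g (b - j))"
 by (simp add: ZZ_def sum_distrib_left mult_ac)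

abbreviation Z :: "(nat => K) => nat => nat => K" where "Z P \<equiv> ZZ (Ph P) (hh P) 0"

text \<open>Raising either index leaves the same remainder, the convolution with shift 1; the two
  boundary rows are single convolutions, summed by \<open>hh_Ph\<close>.\<close>

lemma Z_rec: "Z P (Suc a) b = Z P a (Suc b) + qq ^ b * hh P (Suc a) * hh P b - qq ^ a * hh P a * hh P (Suc b)"
 by (simp add: ZZ_Suc1 ZZ_Suc2 hh_Ph)

lemma Z_0: "Z P 0 b = qq ^ b * hh P b" by (simp add: ZZ_00 hh_Ph)

definition ep :: "(nat => K) => nat => nat => K" where
 "ep P a b = (qq ^ a + qq ^ b) * hh P a * hh P b + (tt - 1) * Z P a b"

lemma ep_rec: "ep P (Suc a) b = ep P a (Suc b) + (qq ^ Suc a + tt * qq ^ b) * (hh P (Suc a) * hh P b) - (tt * qq ^ a + qq ^ Suc b) * (hh P a * hh P (Suc b))"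
 unfolding ep_def Z_rec by (simp add: algebra_simps)

lemma ep_0: "ep P 0 b = (1 + tt * qq ^ b) * hh P b"
 by (simp add: ep_def Z_0 algebra_simps)

lemma Z_second: "Z P (Suc a) (Suc b) = ZZ (Ph P) (hh P) 2 a b + (qq ^ Suc a + qq ^ Suc b - 1) * hh P (Suc a) * hh P (Suc b)"
proof -
 have "Ph P 0 = 1" by (simp add: Ph_def)
 hence s: "(\<Sum>j\<le>a. Ph P (Suc j) * hh P (a - j)) = (qq ^ Suc a - 1) * hh P (Suc a)"
  using conv_split[of "Ph P" "hh P" a] hh_Ph[of P "Suc a"] by (simp add: algebra_simps)
 thus ?thesis unfolding ZZ_Suc1[of _ _ 0] ZZ_Suc2[of _ _ "Suc 0"] by (simp add: s hh_Ph numeral_2_eq_2 del: sum.atMost_Suc) (simp add: algebra_simps)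
qed

abbreviation kk :: "(nat => K) => nat => K" where "kk P m \<equiv> qq ^ m * hh P m"

text \<open>Connects the convolutions of the two vertex operators, so that both are expressed
  through \<open>Z\<close>. Added together, their recursions in the two indices telescope.\<close>

lemma Z'_eq: "ZZ (Ps P) (kk P) 0 a b + Z P a b = (qq ^ a + qq ^ b) * hh P a * hh P b"
proof (induction a arbitrary: b)
 case 0
 thus ?case by (simp add: ZZ_00 hh_Ps hh_Ph) (simp add: algebra_simps)
next
 case (Suc a)
 have "ZZ (Ps P) (kk P) 0 (Suc a) b = ZZ (Ps P) (kk P) 0 a (Suc b) + kk P (Suc a) * hh P b - kk P (Suc b) * hh P a"
  by (simp add: ZZ_Suc1 ZZ_Suc2 hh_Ps)
 thus ?case using Suc[of "Suc b"] by (simp add: Z_rec algebra_simps)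
qed

lemma Z'_second: "ZZ (Ps P) (kk P) 0 (Suc a) (Suc b) = ZZ (Ps P) (kk P) 2 a b +
 (qq ^ Suc a + qq ^ Suc b - qq ^ (Suc a + Suc b)) * hh P (Suc a) * hh P (Suc b)"
proof -
 have "Ps P 0 = 1" by (simp add: Ps_def)
 hence s: "(\<Sum>j\<le>a. Ps P (Suc j) * kk P (a - j)) = (1 - qq ^ Suc a) * hh P (Suc a)"
  using conv_split[of "Ps P" "kk P" a] hh_Ps[of P "Suc a"] by (simp add: algebra_simps)
 thus ?thesis unfolding ZZ_Suc1[of _ _ 0] ZZ_Suc2[of _ _ "Suc 0"]
  by (simp add: s hh_Ps numeral_2_eq_2 del: sum.atMost_Suc) (simp add: algebra_simps power_add)
qed

definition B0v :: "nat => (nat list => K) => nat list => K" where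
 "B0v n = vop (%k. qq ^ k) (%k. 1 - qq ^ k) (%k. 1) n (n + 2)"
definition B1v :: "nat => (nat list => K) => nat list => K" where
 "B1v n = vop (%k. 1) (%k. 1 - qq ^ k) (%k. -1) n (n + 2)"
text \<open>The Macdonald operator conjugated by the plethysm X -> X (1 - t), see
  \<open>Eop_pleth\<close>.\<close>

definition EH :: "nat => (nat list => K) => nat list => K" where
 "EH n = vop (%k. 1) (%k. - ((1 - qq ^ k) * (1 - tt ^ k))) (%k. - (inverse tt ^ k)) n n"

lemma ev_B0_gv: "ev (a + b + 2) (B0v (a + b) (gv a b)) P =
 qq ^ (a + b + 2) * hh P (Suc a) * hh P (Suc b) - Z P (Suc a) (Suc b)"
proof -
 have "Hh m (%k. (qq ^ k * P k + (1 - qq ^ k) * w ^ k) / (1 - qq ^ k)) = (\<Sum>i\<le>m. kk P (m - i) * (1 * w ^ i))" for m w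
 proof -
  have "Hh m (%k. (qq ^ k * P k + (1 - qq ^ k) * w ^ k) / (1 - qq ^ k)) = Hh m (%k. qq ^ k * (P k / (1 - qq ^ k)) + w ^ k)"
   by (rule Hh_cong) (simp add: field_simps)
  thus ?thesis unfolding Hh_add Hh_scale by (simp add: hh_def Hh_Hs[of _ "%k. w ^ k"] Hs_pow)
 qed
 from ev_vop_gv[OF this, of a b 2 "%k. 1"]
 have "ev (a + b + 2) (B0v (a + b) (gv a b)) P = ZZ (Ps P) (kk P) 2 a b"
  by (simp add: B0v_def ZZ_def Ps_def mult_ac)
 thus ?thesis using Z'_second[of P a b] Z'_eq[of P "Suc a" "Suc b"] by (simp add: algebra_simps)
qed

lemma ev_B1_gv: "ev (a + b + 2) (B1v (a + b) (gv a b)) P =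
 Z P (Suc a) (Suc b) - (qq ^ Suc a + qq ^ Suc b - 1) * hh P (Suc a) * hh P (Suc b)"
proof -
 have "Hh m (%k. (1 * P k + (1 - qq ^ k) * w ^ k) / (1 - qq ^ k)) = (\<Sum>i\<le>m. hh P (m - i) * (1 * w ^ i))" for m w
 proof -
  have "Hh m (%k. (1 * P k + (1 - qq ^ k) * w ^ k) / (1 - qq ^ k)) = Hh m (%k. P k / (1 - qq ^ k) + w ^ k)"
   by (rule Hh_cong) (simp add: field_simps)
  thus ?thesis unfolding Hh_add by (simp add: hh_def Hh_Hs[of _ "%k. w ^ k"] Hs_pow)
 qed
 from ev_vop_gv[OF this, of a b 2 "%k. -1"]
 have "ev (a + b + 2) (B1v (a + b) (gv a b)) P = ZZ (Ph P) (hh P) 2 a b"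
  by (simp add: B1v_def ZZ_def Ph_def mult_ac)
 thus ?thesis using Z_second[of P a b] by simp
qed

lemma double_sum_delta:
 fixes F :: "nat => K"
 shows "(\<Sum>i\<le>a. \<Sum>j\<le>b. ((if i = 0 then s else 0) + (1 - s) * tt ^ i) * ((if j = 0 then s else 0) + (1 - s) * tt ^ j) * G i j) =
  s * s * G 0 0 + s * (1 - s) * ((\<Sum>j\<le>b. tt ^ j * G 0 j) + (\<Sum>i\<le>a. tt ^ i * G i 0)) +
  (1 - s) * (1 - s) * (\<Sum>i\<le>a. \<Sum>j\<le>b. tt ^ (i + j) * G i j)"
proof -
 have inner: "(\<Sum>j\<le>b. ((if j = 0 then s else 0) + (1 - s) * tt ^ j) * H j) = s * H 0 + (1 - s) * (\<Sum>j\<le>b. tt ^ j * H j)" for b H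
 proof -
  have "(\<Sum>j\<le>b. ((if j = 0 then s else 0) + (1 - s) * tt ^ j) * H j) = (\<Sum>j\<le>b. (if j = 0 then s * H 0 else 0) + (1 - s) * (tt ^ j * H j))"
   by (intro sum.cong refl) (simp add: distrib_right mult.assoc)
  thus ?thesis by (simp add: sum.distrib sum_distrib_left sum.delta')
 qed
 have "(\<Sum>i\<le>a. \<Sum>j\<le>b. ((if i = 0 then s else 0) + (1 - s) * tt ^ i) * ((if j = 0 then s else 0) + (1 - s) * tt ^ j) * G i j) =
  (\<Sum>i\<le>a. ((if i = 0 then s else 0) + (1 - s) * tt ^ i) * (s * G i 0 + (1 - s) * (\<Sum>j\<le>b. tt ^ j * G i j)))"
  unfolding inner[symmetric] by (simp only: sum_distrib_left mult.assoc)
 also have "... = s * (s * G 0 0 + (1 - s) * (\<Sum>j\<le>b. tt ^ j * G 0 j)) + (1 - s) * (\<Sum>i\<le>a. tt ^ i * (s * G i 0 + (1 - s) * (\<Sum>j\<le>b. tt ^ j * G i j)))"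
  by (rule inner)
 also have "(\<Sum>i\<le>a. tt ^ i * (s * G i 0 + (1 - s) * (\<Sum>j\<le>b. tt ^ j * G i j))) = s * (\<Sum>i\<le>a. tt ^ i * G i 0) + (1 - s) * (\<Sum>i\<le>a. \<Sum>j\<le>b. tt ^ (i + j) * G i j)"
  by (simp add: sum_distrib_left distrib_left sum.distrib power_add mult_ac)
 finally show ?thesis by (simp add: algebra_simps)
qed

lemma ev_EH_gv: "ev (a + b) (EH (a + b) (gv a b)) P =
 inverse tt * inverse tt * (hh P a * hh P b) + inverse tt * (1 - inverse tt) * ep P a b"
proof -
 define s where "s = inverse tt"
 have st: "s * tt = 1" by (simp add: s_def)
 \<comment> \<open>The value h_i[t - 1], written as (1 - s) t^i with a correction \<open>s\<close>
   at \<open>i = 0\<close>; with this form the double sum falls into a constant, two single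
   convolutions and \<open>Z\<close>.\<close>
 define th where "th i = (if i = 0 then s else 0) + (1 - s) * tt ^ i" for i :: nat
 have th: "Hh i (%k. (tt * w) ^ k + - (w ^ k)) = th i * w ^ i" for i w
 proof -
  have "Hs (%k. (tt * w) ^ k + - (w ^ k)) = Abs_fps (%n. (tt * w) ^ n) * (1 - fps_const w * fps_X)"
   unfolding Hs_add Hs_pow Hs_neg_pow ..
  also have "... = Abs_fps (%n. (tt * w) ^ n) - fps_const w * (fps_X * Abs_fps (%n. (tt * w) ^ n))"
   by (simp only: right_diff_distrib mult_1_right) (simp only: mult_ac)
  finally have H: "Hh i (%k. (tt * w) ^ k + - (w ^ k)) = (tt * w) ^ i - w * (if i = 0 then 0 else (tt * w) ^ (i - 1))"
   by (simp add: Hh_Hs)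
  have S: "th (Suc n) = tt ^ Suc n - tt ^ n" for n by (simp add: th_def s_def left_diff_distrib)
  have "th 0 = 1" by (simp add: th_def)
  thus ?thesis unfolding H by (cases i) (simp_all add: S algebra_simps power_mult_distrib)
 qed
 have "Hh m (%k. (1 * P k + - ((1 - qq ^ k) * (1 - tt ^ k)) * w ^ k) / (1 - qq ^ k)) = (\<Sum>i\<le>m. hh P (m - i) * (th i * w ^ i))" for m w
 proof -
  have "Hh m (%k. (1 * P k + - ((1 - qq ^ k) * (1 - tt ^ k)) * w ^ k) / (1 - qq ^ k)) = Hh m (%k. P k / (1 - qq ^ k) + ((tt * w) ^ k + - (w ^ k)))"
   by (rule Hh_cong) (simp add: field_simps power_mult_distrib)
  thus ?thesis
   unfolding Hh_add[of m "%k. P k / (1 - qq ^ k)" "%k. (tt * w) ^ k + - (w ^ k)"] th hh_def[symmetric] .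
 qed
 from ev_vop_gv[OF this, of a b 0 "%k. - (inverse tt ^ k)"]
 have "ev (a + b) (EH (a + b) (gv a b)) P =
  (\<Sum>i\<le>a. \<Sum>j\<le>b. th i * th j * (hh P (a - i) * hh P (b - j) * Hh (i + j) (%k. inverse tt ^ k * - P k)))"
  by (simp add: EH_def mult_ac)
 also have "... = (\<Sum>i\<le>a. \<Sum>j\<le>b. th i * th j * (hh P (a - i) * hh P (b - j) * (s ^ (i + j) * Ph P (i + j))))"
  unfolding Hh_scale Ph_def s_def ..
 also have "... = s * s * (hh P a * hh P b) + s * (1 - s) * ((\<Sum>j\<le>b. tt ^ j * (hh P a * hh P (b - j) * (s ^ j * Ph P j))) + (\<Sum>i\<le>a. tt ^ i * (hh P (a - i) * hh P b * (s ^ i * Ph P i)))) +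
  (1 - s) * (1 - s) * (\<Sum>i\<le>a. \<Sum>j\<le>b. tt ^ (i + j) * (hh P (a - i) * hh P (b - j) * (s ^ (i + j) * Ph P (i + j))))"
  unfolding th_def using double_sum_delta[of s "%i j. hh P (a - i) * hh P (b - j) * (s ^ (i + j) * Ph P (i + j))" b a]
  by (simp add: Ph_def)
 also have "(\<Sum>j\<le>b. tt ^ j * (hh P a * hh P (b - j) * (s ^ j * Ph P j))) = qq ^ b * hh P a * hh P b"
 proof -
  have e: "tt ^ j * (hh P a * hh P (b - j) * (s ^ j * Ph P j)) = hh P a * (Ph P j * hh P (b - j))" for j
  proof -
   have "tt ^ j * s ^ j = 1" using st by (simp add: power_mult_distrib[symmetric] mult.commute)
   moreover have "tt ^ j * (hh P a * hh P (b - j) * (s ^ j * Ph P j)) = (tt ^ j * s ^ j) * (hh P a * (Ph P j * hh P (b - j)))" by (simp only: mult_ac)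
   ultimately show ?thesis by simp
  qed
  show ?thesis unfolding e by (simp add: sum_distrib_left[symmetric] hh_Ph)
 qed
 also have "(\<Sum>i\<le>a. tt ^ i * (hh P (a - i) * hh P b * (s ^ i * Ph P i))) = qq ^ a * hh P a * hh P b"
 proof -
  have e: "tt ^ i * (hh P (a - i) * hh P b * (s ^ i * Ph P i)) = hh P b * (Ph P i * hh P (a - i))" for i
  proof -
   have "tt ^ i * s ^ i = 1" using st by (simp add: power_mult_distrib[symmetric] mult.commute)
   moreover have "tt ^ i * (hh P (a - i) * hh P b * (s ^ i * Ph P i)) = (tt ^ i * s ^ i) * (hh P b * (Ph P i * hh P (a - i)))" by (simp only: mult_ac)
   ultimately show ?thesis by simp
  qed
  show ?thesis unfolding e by (simp add: sum_distrib_left[symmetric] hh_Ph)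
 qed
 also have "(\<Sum>i\<le>a. \<Sum>j\<le>b. tt ^ (i + j) * (hh P (a - i) * hh P (b - j) * (s ^ (i + j) * Ph P (i + j)))) = Z P a b"
  unfolding ZZ_def
 proof (intro sum.cong refl)
  fix i j
  have "tt ^ (i + j) * s ^ (i + j) = 1" using st by (simp add: power_mult_distrib[symmetric] mult.commute)
  moreover have "tt ^ (i + j) * (hh P (a - i) * hh P (b - j) * (s ^ (i + j) * Ph P (i + j))) = (tt ^ (i + j) * s ^ (i + j)) * (Ph P (i + j) * hh P (a - i) * hh P (b - j))"
   by (simp only: mult_ac)
  ultimately show "tt ^ (i + j) * (hh P (a - i) * hh P (b - j) * (s ^ (i + j) * Ph P (i + j))) = Ph P (0 + (i + j)) * hh P (a - i) * hh P (b - j)" by simp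
 qed
 also have "s * s * (hh P a * hh P b) + s * (1 - s) * (qq ^ b * hh P a * hh P b + qq ^ a * hh P a * hh P b) + (1 - s) * (1 - s) * Z P a b =
  s * s * (hh P a * hh P b) + s * (1 - s) * ep P a b"
 proof -
  have "(1 - s) = s * (tt - 1)" using st by (simp add: right_diff_distrib)
  hence "(1 - s) * (1 - s) * Z P a b = s * (1 - s) * ((tt - 1) * Z P a b)" by (simp add: mult_ac)
  thus ?thesis by (simp add: ep_def algebra_simps)
 qed
 finally show ?thesis by (simp add: s_def)
qed

text \<open>Affine normalisation: it strips the eigenvalue of a partition with at most two rows down
  to t q^a + q^b, with a and b the two row lengths.\<close>

definition Ev :: "nat => (nat list => K) => nat list => K" where
 "Ev n f = (%nu. (EH n f nu - inverse tt * inverse tt * f nu) / (inverse tt * (1 - inverse tt)))"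
definition Opv :: "nat => (nat list => K) => nat list => K" where
 "Opv n f = (%nu. tt * B0v n f nu + B1v n f nu)"

lemma tt_inv: "inverse tt * (1 - inverse tt) ~= 0"
 using tt_gt1 by (metis inverse_1 inverse_inverse_eq less_irrefl mult_eq_0_iff nonzero_imp_inverse_nonzero right_minus_eq tt_nz)

lemma EH_lin: "EH n (%nu. \<Sum>i\<in>A. s i * f i nu) = (%nu. \<Sum>i\<in>A. s i * EH n (f i) nu)"
 unfolding EH_def by (rule vop_lin)
lemma Ev_lin: "Ev n (%nu. \<Sum>i\<in>A. s i * f i nu) = (%nu. \<Sum>i\<in>A. s i * Ev n (f i) nu)"
 unfolding Ev_def EH_lin
 by (rule ext) (simp add: sum_distrib_left sum_subtractf[symmetric] sum_divide_distrib right_diff_distrib mult_ac)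
lemma Opv_lin: "Opv n (%nu. \<Sum>i\<in>A. s i * f i nu) = (%nu. \<Sum>i\<in>A. s i * Opv n (f i) nu)"
 unfolding Opv_def B0v_def B1v_def vop_lin
 by (rule ext) (simp add: sum_distrib_left sum.distrib[symmetric] distrib_left mult_ac)

lemma Ev_diff: "Ev n (%nu. s * f nu - s' * g nu) = (%nu. s * Ev n f nu - s' * Ev n g nu)"
proof -
 have "Ev n (%nu. \<Sum>i\<in>{True, False}. (if i then s else - s') * (if i then f nu else g nu)) =
  (%nu. \<Sum>i\<in>{True, False}. (if i then s else - s') * Ev n (%nu. if i then f nu else g nu) nu)"
  by (rule Ev_lin)
 thus ?thesis by simp
qed

lemma Ev_scale: "Ev n (%nu. s * f nu) = (%nu. s * Ev n f nu)"
 using Ev_lin[of n "%_. s" "%_. f" "{()}"] by simp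
lemma Opv_scale: "Opv n (%nu. s * f nu) = (%nu. s * Opv n f nu)"
 using Opv_lin[of n "%_. s" "%_. f" "{()}"] by simp

lemma symf_Ev: "symf n f ==> symf n (Ev n f)" by (simp add: symf_def Ev_def EH_def vop_def)
lemma symf_Opv: "symf (n + 2) (Opv n f)" by (simp add: symf_def Opv_def B0v_def B1v_def vop_def)

lemma ev_Ev: "ev n (Ev n f) P = (ev n (EH n f) P - inverse tt * inverse tt * ev n f P) / (inverse tt * (1 - inverse tt))"
 unfolding ev_def Ev_def
 by (simp add: sum_distrib_left sum_subtractf[symmetric] sum_divide_distrib left_diff_distrib mult.assoc)

lemma ev_Ev_gv: "ev (a + b) (Ev (a + b) (gv a b)) P = ep P a b"
 unfolding ev_Ev ev_EH_gv ev_gv using tt_inv by simp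

text \<open>The convolutions of the two vertex operators combine with total coefficient -(t - 1), as
  in \<open>ep\<close>. So creation on a product is expressed by \<open>Ev\<close> on the product
  with both indices raised.\<close>

lemma ev_Opv_gv: "ev (a + b + 2) (Opv (a + b) (gv a b)) P =
  (1 + tt * qq ^ (a + b + 2)) * (hh P (Suc a) * hh P (Suc b)) - ep P (Suc a) (Suc b)"
 unfolding Opv_def ev_plus ev_scale ev_B0_gv ev_B1_gv ep_def by (simp add: algebra_simps)

lemma symf_lin: "(\<And>i. i \<in> A ==> symf n (f i)) ==> symf n (%nu. \<Sum>i\<in>A. s i * f i nu)"
 by (simp add: symf_def)

lemma Ev_gv_rec: "Ev (Suc a + b) (gv (Suc a) b) = (%nu. Ev (Suc a + b) (gv a (Suc b)) nu +
  ((qq ^ Suc a + tt * qq ^ b) * gv (Suc a) b nu + (- (tt * qq ^ a + qq ^ Suc b)) * gv a (Suc b) nu))"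
proof (rule ev_eqI)
 have g: "symf (Suc a + b) (gv (Suc a) b)" "symf (Suc a + b) (gv a (Suc b))"
  using symf_gv[of "Suc a" b] symf_gv[of a "Suc b"] by simp_all
 show "symf (Suc a + b) (Ev (Suc a + b) (gv (Suc a) b))" using g by (intro symf_Ev)
 show "symf (Suc a + b) (%nu. Ev (Suc a + b) (gv a (Suc b)) nu +
  ((qq ^ Suc a + tt * qq ^ b) * gv (Suc a) b nu + (- (tt * qq ^ a + qq ^ Suc b)) * gv a (Suc b) nu))"
  using g symf_Ev[OF g(2)] by (simp add: symf_def)
 fix P
 have e: "ev (Suc a + b) (gv a (Suc b)) P = hh P a * hh P (Suc b)" "ev (Suc a + b) (Ev (Suc a + b) (gv a (Suc b))) P = ep P a (Suc b)"
  using ev_gv[of a "Suc b" P] ev_Ev_gv[of a "Suc b" P] by simp_all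
 show "ev (Suc a + b) (Ev (Suc a + b) (gv (Suc a) b)) P = ev (Suc a + b) (%nu. Ev (Suc a + b) (gv a (Suc b)) nu +
  ((qq ^ Suc a + tt * qq ^ b) * gv (Suc a) b nu + (- (tt * qq ^ a + qq ^ Suc b)) * gv a (Suc b) nu)) P"
  unfolding ev_plus ev_scale ev_Ev_gv e ev_gv ep_rec by (simp add: algebra_simps)
qed

lemma Ev_gv_0: "Ev b (gv 0 b) = (%nu. (1 + tt * qq ^ b) * gv 0 b nu)"
proof (rule ev_eqI)
 have g: "symf b (gv 0 b)" using symf_gv[of 0 b] by simp
 show "symf b (Ev b (gv 0 b))" "symf b (%nu. (1 + tt * qq ^ b) * gv 0 b nu)" using g symf_Ev[OF g] by (simp_all add: symf_def)
 fix P show "ev b (Ev b (gv 0 b)) P = ev b (%nu. (1 + tt * qq ^ b) * gv 0 b nu) P"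
  using ev_Ev_gv[of 0 b P] ev_gv[of 0 b P] by (simp add: ev_scale ep_0)
qed

lemma Opv_gv: "Opv (a + b) (gv a b) = (%nu. (1 + tt * qq ^ (a + b + 2)) * gv (Suc a) (Suc b) nu - 1 * Ev (a + b + 2) (gv (Suc a) (Suc b)) nu)"
proof (rule ev_eqI[OF _ symf_Opv])
 have g: "symf (a + b + 2) (gv (Suc a) (Suc b))" using symf_gv[of "Suc a" "Suc b"] by simp
 show "symf (a + b + 2) (%nu. (1 + tt * qq ^ (a + b + 2)) * gv (Suc a) (Suc b) nu - 1 * Ev (a + b + 2) (gv (Suc a) (Suc b)) nu)"
  using g symf_Ev[OF g] by (simp add: symf_def)
 fix P
 show "ev (a + b + 2) (Opv (a + b) (gv a b)) P = ev (a + b + 2) (%nu. (1 + tt * qq ^ (a + b + 2)) * gv (Suc a) (Suc b) nu - 1 * Ev (a + b + 2) (gv (Suc a) (Suc b)) nu) P"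
  unfolding ev_minus ev_scale ev_Opv_gv using ev_gv[of "Suc a" "Suc b" P] ev_Ev_gv[of "Suc a" "Suc b" P] by simp
qed

text \<open>\<open>Rel n x y\<close>: some expansion of \<open>x\<close> in the products \<open>gv a b\<close> turns into \<open>y\<close> when both indices are raised.
  On such pairs the creation operator is \<open>x \<mapsto> (1 + t q\<^bsup>n+2\<^esup> - Ev) y\<close>, and \<open>Ev\<close> itself is compatible with raising up to a factor
  \<open>q\<close> and multiples of \<open>gv 0 (n + 2)\<close>, which that operator kills; hence \<open>Ev Opv = q Opv Ev\<close>.\<close>
definition Rel :: "nat => (nat list => K) => (nat list => K) => bool" where
 "Rel n x y \<longleftrightarrow> (\<exists>c. x = (%nu. \<Sum>a\<le>n. c a * gv a (n - a) nu) & y = (%nu. \<Sum>a\<le>n. c a * gv (Suc a) (Suc (n - a)) nu))"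

lemma Rel_gv: "Rel (a + b) (gv a b) (gv (Suc a) (Suc b))"
 unfolding Rel_def
 by (rule exI[of _ "%i. if i = a then 1 else 0"]) (auto simp: fun_eq_iff if_distrib[of "%x. x * _"] sum.delta cong: if_cong)

lemma Rel_add: "Rel n x y ==> Rel n x' y' ==> Rel n (%nu. s * x nu + s' * x' nu) (%nu. s * y nu + s' * y' nu)"
proof -
 assume "Rel n x y" "Rel n x' y'"
 then obtain c c' where c: "x = (%nu. \<Sum>a\<le>n. c a * gv a (n - a) nu)" "y = (%nu. \<Sum>a\<le>n. c a * gv (Suc a) (Suc (n - a)) nu)"
  "x' = (%nu. \<Sum>a\<le>n. c' a * gv a (n - a) nu)" "y' = (%nu. \<Sum>a\<le>n. c' a * gv (Suc a) (Suc (n - a)) nu)" unfolding Rel_def by blast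
 show ?thesis unfolding Rel_def c
  by (rule exI[of _ "%a. s * c a + s' * c' a"]) (simp add: sum_distrib_left sum.distrib[symmetric] distrib_right mult.assoc)
qed

lemma Rel_zero: "Rel n (%nu. 0) (%nu. 0)"
 unfolding Rel_def by (rule exI[of _ "%_. 0"]) simp

lemma Rel_sum: "finite A ==> (\<And>i. i \<in> A ==> Rel n (x i) (y i)) ==> Rel n (%nu. \<Sum>i\<in>A. s i * x i nu) (%nu. \<Sum>i\<in>A. s i * y i nu)"
proof (induction A rule: finite_induct)
 case (insert i A)
 have "Rel n (x i) (y i)" and "Rel n (%nu. \<Sum>i\<in>A. s i * x i nu) (%nu. \<Sum>i\<in>A. s i * y i nu)" using insert by auto
 from Rel_add[OF this, of "s i" 1] show ?case using insert by simp
qed (simp add: Rel_zero)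

lemma Rel_Opv: "Rel n x y ==> Opv n x = (%nu. (1 + tt * qq ^ (n + 2)) * y nu - 1 * Ev (n + 2) y nu)"
proof -
 assume "Rel n x y"
 then obtain c where c: "x = (%nu. \<Sum>a\<le>n. c a * gv a (n - a) nu)" "y = (%nu. \<Sum>a\<le>n. c a * gv (Suc a) (Suc (n - a)) nu)" unfolding Rel_def by blast
 have "Opv n (gv a (n - a)) nu = (1 + tt * qq ^ (n + 2)) * gv (Suc a) (Suc (n - a)) nu - 1 * Ev (n + 2) (gv (Suc a) (Suc (n - a))) nu" if "a <= n" for a nu
  using fun_cong[OF Opv_gv[of a "n - a"], of nu] that by simp
 thus ?thesis unfolding c Opv_lin Ev_lin
  by (intro ext) (simp add: sum_distrib_left sum_subtractf[symmetric] right_diff_distrib mult.left_commute del: power_Suc power_Suc2)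
qed

text \<open>Induction by \<open>Ev_gv_rec\<close>, whose coefficients gain exactly one factor q when
  both indices are raised. A defect arises only at the start, as a multiple of \<open>gv 0\<close>,
  and is passed on unchanged.\<close>

lemma Ev_gv_Rel: "\<exists>y kap. Rel (a + b) (Ev (a + b) (gv a b)) y \<and>
  (%nu. qq * y nu) = (%nu. Ev (a + b + 2) (gv (Suc a) (Suc b)) nu - kap * gv 0 (a + b + 2) nu)"
proof (induction a arbitrary: b)
 case 0
 let ?y = "%nu. (1 + tt * qq ^ b) * gv (Suc 0) (Suc b) nu + 0 * gv (Suc 0) (Suc b) nu"
 have "Rel (0 + b) (%nu. (1 + tt * qq ^ b) * gv 0 b nu + 0 * gv 0 b nu) ?y" by (intro Rel_add Rel_gv)
 hence "Rel (0 + b) (Ev (0 + b) (gv 0 b)) ?y" by (simp add: Ev_gv_0)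
 \<comment> \<open>The constant is the eigenvalue of \<open>gv 0 (b + 2)\<close> minus its
   coefficient in \<open>Ev_gv_rec\<close>.\<close>
 moreover have "(%nu. qq * ?y nu) = (%nu. Ev (0 + b + 2) (gv (Suc 0) (Suc b)) nu - (1 + tt * qq ^ (b + 2) - (tt + qq ^ (b + 2))) * gv 0 (0 + b + 2) nu)"
 proof
  fix nu
  have "Ev (b + 2) (gv (Suc 0) (Suc b)) nu = Ev (b + 2) (gv 0 (b + 2)) nu + ((qq + tt * qq ^ Suc b) * gv (Suc 0) (Suc b) nu - (tt + qq ^ (b + 2)) * gv 0 (b + 2) nu)"
   using fun_cong[OF Ev_gv_rec[of 0 "Suc b"], of nu] by (simp add: algebra_simps)
  thus "qq * ?y nu = Ev (0 + b + 2) (gv (Suc 0) (Suc b)) nu - (1 + tt * qq ^ (b + 2) - (tt + qq ^ (b + 2))) * gv 0 (0 + b + 2) nu"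
   by (simp add: Ev_gv_0[of "b + 2", simplified] Ev_gv_0 algebra_simps)
 qed
 ultimately show ?case by blast
next
 case (Suc a)
 obtain y kap where y: "Rel (a + Suc b) (Ev (a + Suc b) (gv a (Suc b))) y"
  "(%nu. qq * y nu) = (%nu. Ev (a + Suc b + 2) (gv (Suc a) (Suc (Suc b))) nu - kap * gv 0 (a + Suc b + 2) nu)"
  using Suc.IH by blast
 let ?c = "qq ^ Suc a + tt * qq ^ b" and ?d = "- (tt * qq ^ a + qq ^ Suc b)"
 define y' where "y' = (%nu. 1 * y nu + 1 * (?c * gv (Suc (Suc a)) (Suc b) nu + ?d * gv (Suc a) (Suc (Suc b)) nu))"
 have "Rel (Suc a + b) (%nu. 1 * Ev (Suc a + b) (gv a (Suc b)) nu + 1 * (?c * gv (Suc a) b nu + ?d * gv a (Suc b) nu)) y'"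
  unfolding y'_def using y(1) Rel_gv[of a "Suc b"] by (intro Rel_add Rel_gv) simp_all
 hence 1: "Rel (Suc a + b) (Ev (Suc a + b) (gv (Suc a) b)) y'" unfolding Ev_gv_rec by simp
 have 2: "(%nu. qq * y' nu) = (%nu. Ev (Suc a + b + 2) (gv (Suc (Suc a)) (Suc b)) nu - kap * gv 0 (Suc a + b + 2) nu)"
 proof
  fix nu
  have "Ev (Suc a + b + 2) (gv (Suc (Suc a)) (Suc b)) nu = Ev (Suc a + b + 2) (gv (Suc a) (Suc (Suc b))) nu +
   qq * (?c * gv (Suc (Suc a)) (Suc b) nu + ?d * gv (Suc a) (Suc (Suc b)) nu)"
   using fun_cong[OF Ev_gv_rec[of "Suc a" "Suc b"], of nu] by (simp add: algebra_simps)
  moreover have "qq * y nu = Ev (Suc a + b + 2) (gv (Suc a) (Suc (Suc b))) nu - kap * gv 0 (Suc a + b + 2) nu"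
   using fun_cong[OF y(2), of nu] by simp
  ultimately show "qq * y' nu = Ev (Suc a + b + 2) (gv (Suc (Suc a)) (Suc b)) nu - kap * gv 0 (Suc a + b + 2) nu"
   by (simp add: y'_def distrib_left)
 qed
 show ?case using 1 2 by blast
qed

lemma Rel_Ev:
 assumes "Rel n x y"
 shows "\<exists>y' kap. Rel n (Ev n x) y' & (%nu. qq * y' nu) = (%nu. Ev (n + 2) y nu - kap * gv 0 (n + 2) nu)"
proof -
 obtain c where c: "x = (%nu. \<Sum>a\<le>n. c a * gv a (n - a) nu)" "y = (%nu. \<Sum>a\<le>n. c a * gv (Suc a) (Suc (n - a)) nu)"
  using assms unfolding Rel_def by blast
 have "\<forall>a. \<exists>y kap. a <= n --> Rel n (Ev n (gv a (n - a))) y \<and>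
  (%nu. qq * y nu) = (%nu. Ev (n + 2) (gv (Suc a) (Suc (n - a))) nu - kap * gv 0 (n + 2) nu)"
 proof
  fix a show "\<exists>y kap. a <= n --> Rel n (Ev n (gv a (n - a))) y \<and>
   (%nu. qq * y nu) = (%nu. Ev (n + 2) (gv (Suc a) (Suc (n - a))) nu - kap * gv 0 (n + 2) nu)"
   using Ev_gv_Rel[of a "n - a"] by (cases "a <= n") auto
 qed
 from choice[OF this] obtain Y where "\<forall>a. \<exists>kap. a <= n --> Rel n (Ev n (gv a (n - a))) (Y a) \<and>
  (%nu. qq * Y a nu) = (%nu. Ev (n + 2) (gv (Suc a) (Suc (n - a))) nu - kap * gv 0 (n + 2) nu)" ..
 from choice[OF this] obtain k where "\<forall>a. a <= n --> Rel n (Ev n (gv a (n - a))) (Y a) \<and>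
  (%nu. qq * Y a nu) = (%nu. Ev (n + 2) (gv (Suc a) (Suc (n - a))) nu - k a * gv 0 (n + 2) nu)" ..
 hence Y: "\<And>a. a <= n ==> Rel n (Ev n (gv a (n - a))) (Y a)"
  "\<And>a. a <= n ==> (%nu. qq * Y a nu) = (%nu. Ev (n + 2) (gv (Suc a) (Suc (n - a))) nu - k a * gv 0 (n + 2) nu)"
  by blast+
 have "Rel n (Ev n x) (%nu. \<Sum>a\<le>n. c a * Y a nu)"
  unfolding c Ev_lin by (rule Rel_sum) (use Y(1) in auto)
 moreover have "(%nu. qq * (\<Sum>a\<le>n. c a * Y a nu)) = (%nu. Ev (n + 2) y nu - (\<Sum>a\<le>n. c a * k a) * gv 0 (n + 2) nu)"
 proof
  fix nu
  have "qq * (\<Sum>a\<le>n. c a * Y a nu) = (\<Sum>a\<le>n. c a * (qq * Y a nu))" by (simp add: sum_distrib_left mult_ac)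
  also have "... = (\<Sum>a\<le>n. c a * (Ev (n + 2) (gv (Suc a) (Suc (n - a))) nu - k a * gv 0 (n + 2) nu))"
   by (intro sum.cong refl arg_cong2[where f = "(*)"] fun_cong[OF Y(2)]) simp
  also have "... = Ev (n + 2) y nu - (\<Sum>a\<le>n. c a * k a) * gv 0 (n + 2) nu"
   unfolding c Ev_lin by (simp add: right_diff_distrib sum_subtractf sum_distrib_right mult.assoc)
  finally show "qq * (\<Sum>a\<le>n. c a * Y a nu) = Ev (n + 2) y nu - (\<Sum>a\<le>n. c a * k a) * gv 0 (n + 2) nu" .
 qed
 ultimately show ?thesis by blast
qed

lemma Ev_Opv:
 assumes R: "Rel n x y"
 shows "Ev (n + 2) (Opv n x) = (%nu. qq * Opv n (Ev n x) nu)"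
proof
 fix nu
 let ?N = "n + 2" and ?c = "1 + tt * qq ^ (n + 2)"
 obtain y' kap where y': "Rel n (Ev n x) y'" "(%nu. qq * y' nu) = (%nu. 1 * Ev ?N y nu - kap * gv 0 ?N nu)"
  using Rel_Ev[OF R] by auto
 have "qq * Opv n (Ev n x) nu = ?c * (qq * y' nu) - qq * Ev ?N y' nu"
  unfolding Rel_Opv[OF y'(1)] by (simp add: algebra_simps)
 also have "qq * Ev ?N y' nu = Ev ?N (%nu. qq * y' nu) nu" by (simp add: Ev_scale)
 also have "... = Ev ?N (Ev ?N y) nu - kap * (?c * gv 0 ?N nu)" unfolding y'(2) Ev_diff Ev_gv_0 by simp
 also have "qq * y' nu = Ev ?N y nu - kap * gv 0 ?N nu" using fun_cong[OF y'(2), of nu] by simp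
 finally have "qq * Opv n (Ev n x) nu = ?c * Ev ?N y nu - 1 * Ev ?N (Ev ?N y) nu" by (simp add: algebra_simps)
 thus "Ev ?N (Opv n x) nu = qq * Opv n (Ev n x) nu" unfolding Rel_Opv[OF R] Ev_diff by simp
qed

definition Sp :: "nat => (nat list => K) => bool" where "Sp n x \<longleftrightarrow> (\<exists>y. Rel n x y)"

lemma Rel_Sp: "Rel n x y ==> Sp (n + 2) y"
proof -
 assume "Rel n x y"
 then obtain c where c: "y = (%nu. \<Sum>a\<le>n. c a * gv (Suc a) (Suc (n - a)) nu)" unfolding Rel_def by blast
 have "Rel (n + 2) (%nu. \<Sum>a\<le>n. c a * gv (Suc a) (Suc (n - a)) nu) (%nu. \<Sum>a\<le>n. c a * gv (Suc (Suc a)) (Suc (Suc (n - a))) nu)"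
 proof (rule Rel_sum)
  fix a assume "a \<in> {..n}"
  thus "Rel (n + 2) (gv (Suc a) (Suc (n - a))) (gv (Suc (Suc a)) (Suc (Suc (n - a))))"
   using Rel_gv[of "Suc a" "Suc (n - a)"] by simp
 qed simp
 thus ?thesis unfolding Sp_def c by blast
qed

lemma Sp_Opv: "Sp n x ==> Sp (n + 2) (Opv n x)"
proof -
 assume "Sp n x"
 then obtain y where y: "Rel n x y" by (auto simp: Sp_def)
 obtain z where z: "Rel (n + 2) y z" using Rel_Sp[OF y] by (auto simp: Sp_def)
 obtain z' where z': "Rel (n + 2) (Ev (n + 2) y) z'" using Rel_Ev[OF z] by blast
 from Rel_add[OF z z', of "1 + tt * qq ^ (n + 2)" "-1"] show ?thesis unfolding Rel_Opv[OF y] Sp_def by auto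
qed

definition qpoch :: "nat => K" where "qpoch m = (\<Prod>i<m. 1 - qq ^ Suc i)"

fun KV :: "nat => nat => nat list => K" where
 "KV 0 m = (%nu. qpoch m * gv 0 m nu)"
| "KV (Suc l) m = Opv (m + 2 * l) (KV l m)"

lemma KV_Sp: "Sp (m + 2 * l) (KV l m)"
proof (induction l)
 case 0
 show ?case using Rel_add[OF Rel_gv[of 0 m] Rel_zero, of "qpoch m" 0] by (auto simp: Sp_def)
next
 case (Suc l)
 thus ?case using Sp_Opv[OF Suc] by simp
qed

text \<open>The initial complete function has eigenvalue t q^m + 1, and every creation step
  multiplies the eigenvalue by q.\<close>

lemma KV_eigen: "Ev (m + 2 * l) (KV l m) = (%nu. (tt * qq ^ (m + l) + qq ^ l) * KV l m nu)"
proof (induction l)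
 case 0
 show ?case by (rule ext) (simp add: Ev_scale Ev_gv_0 algebra_simps)
next
 case (Suc l)
 obtain y where y: "Rel (m + 2 * l) (KV l m) y" using KV_Sp by (auto simp: Sp_def)
 have "Ev (m + 2 * l + 2) (Opv (m + 2 * l) (KV l m)) = (%nu. (tt * qq ^ (m + Suc l) + qq ^ Suc l) * Opv (m + 2 * l) (KV l m) nu)"
  unfolding Ev_Opv[OF y] Suc Opv_scale by (rule ext) (simp add: algebra_simps)
 thus ?case by simp
qed

lemma symf_KV: "symf (m + 2 * l) (KV l m)"
proof (cases l)
 case 0
 thus ?thesis using symf_gv[of 0 m] by (simp add: symf_def)
next
 case (Suc l')
 thus ?thesis using symf_Opv[of "m + 2 * l'" "KV l' m"] by simp
qed

section \<open>Two-row Macdonald polynomials\<close>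

lemma pleth_pm: "pleth_Xt f = (%mu. f mu * pm (%k. 1 - tt ^ k) (mset mu))"
proof -
 have "(\<Prod>i<length mu. 1 - tt ^ (mu ! i)) = prod_list (map (%k. 1 - tt ^ k) mu)" for mu
  by (simp add: prod.list_conv_set_nth atLeast0LessThan)
 thus ?thesis by (simp add: pleth_Xt_def prod_list_pm)
qed

lemma ev_pleth: "ev d (pleth_Xt f) P = ev d f (%k. (1 - tt ^ k) * P k)"
 by (simp add: ev_def pleth_pm prod_list_pm pm_mult mult_ac)

text \<open>The factors 1 - t^k of the kept parts are common to both sides; destroyed parts acquire
  them and created parts give them up, which changes the one operator into the other entry by
  entry.\<close>

lemma Eop_pleth: "Eop d (pleth_Xt f) = pleth_Xt (EH d f)"
proof
 fix nu
 let ?s = "%k. 1 - tt ^ k"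
 have entry: "vme (%k. 1) (%k. - (1 - qq ^ k)) (%k. 1 - inverse tt ^ k) nu mu * pm ?s (mset mu) =
  vme (%k. 1) (%k. - ((1 - qq ^ k) * (1 - tt ^ k))) (%k. - (inverse tt ^ k)) nu mu * pm ?s (mset nu)" for mu
  unfolding vme_def sum_distrib_right
 proof (intro sum.cong refl)
  fix L assume "L \<in> {L. L \<subseteq># mset mu & L \<subseteq># mset nu}"
  hence L: "L \<subseteq># mset mu" "L \<subseteq># mset nu" by auto
  define A B where "A = mset mu - L" and "B = mset nu - L"
  have mm: "mset mu = L + A" "mset nu = L + B" using L by (simp_all add: A_def B_def)
  have "(%k. 1 - inverse tt ^ k) = (%k. ?s k * - (inverse tt ^ k))"
   by (rule ext) (simp add: left_diff_distrib power_mult_distrib[symmetric])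
  hence c: "pm (%k. 1 - inverse tt ^ k) B = pm ?s B * pm (%k. - (inverse tt ^ k)) B"
   by (simp only: pm_mult)
  have "(%k. - ((1 - qq ^ k) * (1 - tt ^ k))) = (%k. - (1 - qq ^ k) * ?s k)" by (rule ext) (simp only: mult_minus_left)
  hence b: "pm (%k. - ((1 - qq ^ k) * (1 - tt ^ k))) A = pm (%k. - (1 - qq ^ k)) A * pm ?s A"
   by (simp only: pm_mult)
  have "of_nat (Ncs mu L) * pm (%k. 1) L * pm (%k. - (1 - qq ^ k)) A * pm (%k. 1 - inverse tt ^ k) B / of_nat (zm B) * pm ?s (mset mu) =
   of_nat (Ncs mu L) * pm (%k. 1) L * pm (%k. - ((1 - qq ^ k) * (1 - tt ^ k))) A * pm (%k. - (inverse tt ^ k)) B / of_nat (zm B) * pm ?s (mset nu)"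
   unfolding b c by (simp add: mm mult_ac)
  thus "of_nat (Ncs mu L) * pm (%k. 1) L * pm (%k. - (1 - qq ^ k)) (mset mu - L) * pm (%k. 1 - inverse tt ^ k) (mset nu - L) / of_nat (zm (mset nu - L)) * pm ?s (mset mu) =
   of_nat (Ncs mu L) * pm (%k. 1) L * pm (%k. - ((1 - qq ^ k) * (1 - tt ^ k))) (mset mu - L) * pm (%k. - (inverse tt ^ k)) (mset nu - L) / of_nat (zm (mset nu - L)) * pm ?s (mset nu)"
   unfolding A_def B_def .
 qed
 show "Eop d (pleth_Xt f) nu = pleth_Xt (EH d f) nu"
 proof (cases "nu \<in> parts d")
  case True
  have "Eop d (pleth_Xt f) nu = (\<Sum>mu\<in>parts d. (vme (%k. 1) (%k. - (1 - qq ^ k)) (%k. 1 - inverse tt ^ k) nu mu * pm ?s (mset mu)) * f mu)"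
   using True unfolding Eop_def vop_def pleth_pm by (simp add: mult_ac)
  also have "... = pleth_Xt (EH d f) nu"
   unfolding entry using True unfolding EH_def vop_def pleth_pm by (simp add: sum_distrib_left mult_ac)
  finally show ?thesis .
 qed (simp add: Eop_def EH_def vop_def pleth_pm)
qed

text \<open>For two variables the series F of the \<open>hh P m\<close> satisfies the q-difference
  equation (1 - t x z)(1 - t y z) F(qz) = (1 - x z)(1 - y z) F(z); its coefficients are
  compared.\<close>

lemma three_term:
 assumes P: "P = (%k. (1 - tt ^ k) * (x ^ k + y ^ k))"
 shows "(1 - qq ^ (m + 2)) * hh P (m + 2) = (x + y) * (1 - tt * qq ^ (m + 1)) * hh P (m + 1) - x * y * (1 - tt ^ 2 * qq ^ m) * hh P m" (is ?A)
  and "(1 - qq) * hh P 1 = (x + y) * (1 - tt)" (is ?B)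
proof -
 define F G where "F = Abs_fps (%m. hh P m)" and "G = Abs_fps (%m. qq ^ m * hh P m)"
 have FH: "F = Hs (%k. P k / (1 - qq ^ k))" by (simp add: F_def Hs_def hh_def)
 have GF: "G = Hs (%k. - P k) * F"
  by (rule fps_ext) (simp add: F_def G_def fps_mult_nth hh_Ph[symmetric] Ph_def Hh_Hs atMost_atLeast0)
 let ?l = "%a. 1 - fps_const a * fps_X :: K fps"
 have "(%k. - P k) = (%k. ((tt * x) ^ k + (tt * y) ^ k) + (- (x ^ k) + - (y ^ k)))"
  by (rule ext) (simp add: P algebra_simps power_mult_distrib)
 hence "Hs (%k. - P k) = (Abs_fps (%n. (tt * x) ^ n) * Abs_fps (%n. (tt * y) ^ n)) * (?l x * ?l y)"
  by (simp only: Hs_add Hs_pow Hs_neg_pow)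
 hence "(?l (tt * x) * ?l (tt * y)) * Hs (%k. - P k) =
  (Abs_fps (%n. (tt * x) ^ n) * ?l (tt * x)) * (Abs_fps (%n. (tt * y) ^ n) * ?l (tt * y)) * (?l x * ?l y)"
  by (simp only: mult_ac)
 hence "(?l (tt * x) * ?l (tt * y)) * Hs (%k. - P k) = ?l x * ?l y" unfolding geo_fps by simp
 hence "(?l (tt * x) * ?l (tt * y)) * G = (?l x * ?l y) * F" unfolding GF by (simp only: mult.assoc[symmetric])
 moreover have "(?l a * ?l b) * F = F - fps_const (a + b) * (fps_X * F) + fps_const (a * b) * (fps_X * (fps_X * F))" for a b F
  unfolding fps_const_add[symmetric] fps_const_mult[symmetric] by (simp add: algebra_simps del: fps_const_add fps_const_mult)
 ultimately have e: "G - fps_const (tt * x + tt * y) * (fps_X * G) + fps_const (tt * x * (tt * y)) * (fps_X * (fps_X * G)) =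
  F - fps_const (x + y) * (fps_X * F) + fps_const (x * y) * (fps_X * (fps_X * F))" by simp
 from arg_cong[OF e, of "%F. F $ (m + 2)"] show ?A
  by (simp add: F_def G_def algebra_simps power2_eq_square del: fps_const_add fps_const_mult)
 from arg_cong[OF e, of "%F. F $ 1"] show ?B
  by (simp add: F_def G_def algebra_simps del: fps_const_add fps_const_mult)
qed

text \<open>In two variables creation is x y times an expression in \<open>Ev\<close> on the
  unraised product, so on eigenfunctions it becomes a scalar. Induction by \<open>ep_rec\<close>;
  the terms with raised indices are removed by \<open>three_term\<close>.\<close>

lemma ep_two:
 assumes P: "P = (%k. (1 - tt ^ k) * (x ^ k + y ^ k))"
 shows "(1 + tt * qq ^ (a + b + 2)) * (hh P (Suc a) * hh P (Suc b)) - ep P (Suc a) (Suc b) =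
  x * y * ((1 + tt ^ 3 * qq ^ (a + b)) * (hh P a * hh P b) - tt * ep P a b)"
proof (induction a arbitrary: b)
 case 0
 have A: "(1 - qq ^ (b + 2)) * hh P (b + 2) = (x + y) * (1 - tt * qq ^ (b + 1)) * hh P (b + 1) - x * y * (1 - tt ^ 2 * qq ^ b) * hh P b"
  and B: "(1 - qq) * hh P 1 = (x + y) * (1 - tt)" using three_term[OF P] by blast+
 have e1: "ep P 1 (b + 1) = (1 + tt * qq ^ (b + 2) - tt - qq ^ (b + 2)) * hh P (b + 2) + (qq + tt * qq ^ (b + 1)) * (hh P 1 * hh P (b + 1))"
  using ep_rec[of P 0 "Suc b"] by (simp add: ep_0 algebra_simps)
 have "(1 + tt * qq ^ (b + 2)) * (hh P 1 * hh P (b + 1)) - ep P 1 (b + 1) =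
  (1 - tt * qq ^ (b + 1)) * ((1 - qq) * hh P 1) * hh P (b + 1) - (1 - tt) * ((1 - qq ^ (b + 2)) * hh P (b + 2))"
  unfolding e1 by (simp add: algebra_simps)
 also have "... = (1 - tt) * (x * y * (1 - tt ^ 2 * qq ^ b) * hh P b)"
  unfolding A B by (simp add: algebra_simps)
 also have "... = x * y * ((1 + tt ^ 3 * qq ^ b) * hh P b - tt * ep P 0 b)"
  unfolding ep_0 by (simp add: algebra_simps power2_eq_square power3_eq_cube)
 finally show ?case by simp
next
 case (Suc a)
 have A: "(1 - qq ^ (m + 2)) * hh P (m + 2) = (x + y) * (1 - tt * qq ^ (m + 1)) * hh P (m + 1) - x * y * (1 - tt ^ 2 * qq ^ m) * hh P m" for m
  using three_term[OF P] by blast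
 let ?N = "Suc a + b + 2"
 have "(1 + tt * qq ^ ?N) * (hh P (Suc (Suc a)) * hh P (Suc b)) - ep P (Suc (Suc a)) (Suc b) =
  ((1 + tt * qq ^ ?N) * (hh P (Suc a) * hh P (Suc (Suc b))) - ep P (Suc a) (Suc (Suc b))) +
  (1 - tt * qq ^ (b + 1)) * hh P (b + 1) * ((1 - qq ^ (a + 2)) * hh P (a + 2)) - (1 - tt * qq ^ (a + 1)) * hh P (a + 1) * ((1 - qq ^ (b + 2)) * hh P (b + 2))"
  unfolding ep_rec[of P "Suc a" "Suc b"] by (simp add: algebra_simps power_add)
 also have "(1 + tt * qq ^ ?N) * (hh P (Suc a) * hh P (Suc (Suc b))) - ep P (Suc a) (Suc (Suc b)) =
  x * y * ((1 + tt ^ 3 * qq ^ (a + Suc b)) * (hh P a * hh P (Suc b)) - tt * ep P a (Suc b))"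
  using Suc.IH[of "Suc b"] by simp
 also have "x * y * ((1 + tt ^ 3 * qq ^ (a + Suc b)) * (hh P a * hh P (Suc b)) - tt * ep P a (Suc b)) +
  (1 - tt * qq ^ (b + 1)) * hh P (b + 1) * ((1 - qq ^ (a + 2)) * hh P (a + 2)) - (1 - tt * qq ^ (a + 1)) * hh P (a + 1) * ((1 - qq ^ (b + 2)) * hh P (b + 2)) =
  x * y * ((1 + tt ^ 3 * qq ^ (Suc a + b)) * (hh P (Suc a) * hh P b) - tt * ep P (Suc a) b)"
  unfolding A ep_rec[of P a b] by (simp add: algebra_simps power_add power2_eq_square power3_eq_cube)
 finally show ?case .
qed

lemma ev_Opv_two:
 assumes P: "P = (%k. (1 - tt ^ k) * (x ^ k + y ^ k))" and S: "Sp n f"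
 shows "ev (n + 2) (Opv n f) P = x * y * ((1 + tt ^ 3 * qq ^ n) * ev n f P - tt * ev n (Ev n f) P)"
proof -
 obtain c where c: "f = (%nu. \<Sum>a\<le>n. c a * gv a (n - a) nu)" using S unfolding Sp_def Rel_def by blast
 have g: "ev (n + 2) (Opv n (gv a (n - a))) P = x * y * ((1 + tt ^ 3 * qq ^ n) * ev n (gv a (n - a)) P - tt * ev n (Ev n (gv a (n - a))) P)"
  if "a <= n" for a
  using ev_Opv_gv[of a "n - a" P] ev_gv[of a "n - a" P] ev_Ev_gv[of a "n - a" P] ep_two[OF P, of a "n - a"] that by simp
 have "ev (n + 2) (Opv n f) P = (\<Sum>a\<le>n. c a * ev (n + 2) (Opv n (gv a (n - a))) P)"
  unfolding c Opv_lin by (rule ev_sum)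
 also have "... = (\<Sum>a\<le>n. c a * (x * y * ((1 + tt ^ 3 * qq ^ n) * ev n (gv a (n - a)) P - tt * ev n (Ev n (gv a (n - a))) P)))"
 proof (intro sum.cong refl)
  fix a assume "a \<in> {..n}"
  hence a: "a <= n" by simp
  show "c a * ev (n + 2) (Opv n (gv a (n - a))) P =
   c a * (x * y * ((1 + tt ^ 3 * qq ^ n) * ev n (gv a (n - a)) P - tt * ev n (Ev n (gv a (n - a))) P))"
   unfolding g[OF a] ..
 qed
 also have "... = x * y * ((1 + tt ^ 3 * qq ^ n) * ev n f P - tt * ev n (Ev n f) P)"
  unfolding c Ev_lin ev_sum by (simp add: sum_distrib_left sum_subtractf right_diff_distrib mult_ac)
 finally show ?thesis .
qed

text \<open>The scalar of each creation step factors: 1 + t^3 q^(m + 2l) - t (t q^(m + l) + q^l) =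
  (1 - t q^l)(1 - t^2 q^(m + l)).\<close>

lemma ev_KV_two:
 assumes P: "P = (%k. (1 - tt ^ k) * (x ^ k + y ^ k))"
 shows "ev (m + 2 * l) (KV l m) P = (\<Prod>j<l. (1 - tt * qq ^ j) * (1 - tt ^ 2 * qq ^ (m + j))) * (x * y) ^ l * qpoch m * hh P m"
proof (induction l)
 case 0
 thus ?case using ev_gv[of 0 m P] by (simp add: ev_scale)
next
 case (Suc l)
 have q2: "qq ^ (m + 2 * l) = qq ^ m * qq ^ l * qq ^ l" by (simp add: power_add mult_2)
 have "ev (m + 2 * l + 2) (KV (Suc l) m) P = x * y * ((1 + tt ^ 3 * qq ^ (m + 2 * l)) * ev (m + 2 * l) (KV l m) P -
   tt * ((tt * qq ^ (m + l) + qq ^ l) * ev (m + 2 * l) (KV l m) P))"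
  unfolding KV.simps ev_Opv_two[OF P KV_Sp] KV_eigen ev_scale ..
 also have "... = x * y * ((1 - tt * qq ^ l) * (1 - tt ^ 2 * qq ^ (m + l))) * ev (m + 2 * l) (KV l m) P"
  unfolding q2 by (simp add: algebra_simps power_add power2_eq_square power3_eq_cube mult_2)
 finally show ?case unfolding Suc by (simp add: mult_ac)
qed

definition c1 :: "nat => K" where "c1 = hh (%k. 1 - tt ^ k)"

text \<open>The q-binomial theorem, obtained from \<open>three_term\<close> at x = 1, y = 0.\<close>

lemma qpoch_c1: "qpoch m * c1 m = (\<Prod>j<m. 1 - tt * qq ^ j)"
proof (induction m)
 case (Suc m)
 \<comment> \<open>\<open>Hh\<close> depends only on positive \<open>k\<close>, so the value
   \<open>0 ^ 0 = 1\<close> does not disturb the specialisation.\<close>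
 have z: "hh (%k. (1 - tt ^ k) * (1 ^ k + 0 ^ k)) = c1"
  unfolding hh_def c1_def by (intro ext Hh_cong) simp
 have "(1 - qq ^ Suc m) * c1 (Suc m) = (1 - tt * qq ^ m) * c1 m"
 proof (cases m)
  case 0
  thus ?thesis using three_term(2)[OF refl, where x = 1 and y = 0] unfolding z by (simp add: c1_def)
 next
  case (Suc n)
  thus ?thesis using three_term(1)[OF refl, where x = 1 and y = 0 and m = n] unfolding z by simp
 qed
 hence "qpoch (Suc m) * c1 (Suc m) = (1 - tt * qq ^ m) * (qpoch m * c1 m)"
  by (simp only: qpoch_def prod.lessThan_Suc mult.assoc mult.left_commute[of "\<Prod>i<m. _ i"])
 thus ?case using Suc by (simp add: mult.commute)
qed (simp add: qpoch_def c1_def)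

lemma hh_two: "hh (%k. (1 - tt ^ k) * (1 ^ k + y ^ k)) m = (\<Sum>i\<le>m. c1 (m - i) * (y ^ i * c1 i))"
proof -
 have "(%k. (1 - tt ^ k) * (1 ^ k + y ^ k) / (1 - qq ^ k)) = (%k. (1 - tt ^ k) / (1 - qq ^ k) + y ^ k * ((1 - tt ^ k) / (1 - qq ^ k)))"
  by (rule ext) (simp add: distrib_left add_divide_distrib mult.commute)
 thus ?thesis unfolding hh_def c1_def by (simp only: Hh_add Hh_scale)
qed

definition two :: "nat => nat => nat list" where "two m l = filter (%x. 0 < x) [m + l, l]"

lemma two_parts: "two m l \<in> parts (m + 2 * l)"
 by (auto simp: two_def parts_def is_partition_def)

lemma fn_two: "fn (two m l) j = (if j = 0 then m + l else if j = 1 then l else 0)"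
 by (auto simp: two_def fn_def)

text \<open>Evaluate at the two variables 1 and y. By homogeneity the power of y determines the
  weight, so the coefficient of y^l is the one at the weight (m + l, l).\<close>

lemma cf_KV: "cf (m + 2 * l) (pleth_Xt (KV l m)) (fn (two m l)) =
  (\<Prod>j<l. (1 - tt * qq ^ j) * (1 - tt ^ 2 * qq ^ (m + j))) * (\<Prod>j<m. 1 - tt * qq ^ j)"
proof -
 define d f C where "d = m + 2 * l" and "f = pleth_Xt (KV l m)" and
  "C = (\<Prod>j<l. (1 - tt * qq ^ j) * (1 - tt ^ 2 * qq ^ (m + j)))"
 define L where "L = (\<Sum>al\<in>AN 2 d. monom (cf d f al) (al 1))"
 define R where "R = (\<Sum>i\<le>m. monom (C * qpoch m * c1 (m - i) * c1 i) (l + i))"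
 have "L = R"
 proof (rule iffD1[OF poly_eq_poly_eq_iff], rule ext)
  fix y
  define x :: "nat => K" where "x i = (if i = 0 then 1 else y)" for i
  have ps: "psum 2 x = (%k. 1 ^ k + y ^ k)" by (rule ext) (simp add: psum_def x_def numeral_2_eq_2)
  have "poly L y = ev d f (psum 2 x)"
   unfolding ev_cf L_def poly_sum poly_monom by (simp add: numeral_2_eq_2 x_def)
  also have "... = C * (1 * y) ^ l * qpoch m * (\<Sum>i\<le>m. c1 (m - i) * (y ^ i * c1 i))"
   unfolding f_def ev_pleth ps d_def ev_KV_two[OF refl] hh_two C_def ..
  also have "... = poly R y"
   by (simp add: R_def poly_sum poly_monom sum_distrib_left power_add mult_ac)
  finally show "poly L y = poly R y" .
 qed
 hence "coeff L l = coeff R l" by simp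
 moreover have "coeff R l = C * qpoch m * c1 m"
 proof -
  have "coeff R l = (\<Sum>i\<le>m. if i = 0 then C * qpoch m * c1 m * c1 0 else 0)"
   unfolding R_def coeff_sum by (intro sum.cong refl) auto
  thus ?thesis by (simp add: sum.delta' c1_def)
 qed
 moreover have "coeff L l = cf d f (fn (two m l))"
 proof -
  have "coeff L l = (\<Sum>al\<in>AN 2 d. if al 1 = l then cf d f al else 0)"
   unfolding L_def coeff_sum by simp
  also have "... = (\<Sum>al\<in>{fn (two m l)}. if al 1 = l then cf d f al else 0)"
  proof (rule sum.mono_neutral_right[OF finite_AN])
   show "{fn (two m l)} \<subseteq> AN 2 d" by (auto simp: AN_def fn_two d_def)
   show "\<forall>al\<in>AN 2 d - {fn (two m l)}. (if al 1 = l then cf d f al else 0) = 0"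
   proof (rule ballI, rule ccontr)
    fix al assume a: "al \<in> AN 2 d - {fn (two m l)}" and nz: "(if al 1 = l then cf d f al else 0) ~= 0"
    hence l: "al 1 = l" and "cf d f al ~= 0" by (auto split: if_splits)
    hence "tot d al" using cf_tot by blast
    then obtain N where N: "2 <= N" "(\<Sum>j<N. al j) = d" using tot_ge by blast
    have z: "al j = 0" if "2 <= j" for j using a that by (simp add: AN_def)
    have "(\<Sum>j<N. al j) = (\<Sum>j<2. al j)" by (rule sum.mono_neutral_right) (use N z in auto)
    hence "al 0 = m + l" using N l by (simp add: numeral_2_eq_2 d_def)
    hence "al = fn (two m l)" using l z by (auto simp: fun_eq_iff fn_two)
    with a show False by simp
   qed
  qed
  also have "... = cf d f (fn (two m l))" by (simp add: fn_two)
  finally show ?thesis .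
 qed
 ultimately show ?thesis using qpoch_c1[of m] by (simp add: C_def d_def f_def mult.assoc)
qed

lemma prod_split: "(\<Prod>i<m + l. g i) = (\<Prod>i<m. g i) * (\<Prod>i<l. g (m + i))" for m l :: nat
 by (induction l) (simp_all add: mult.assoc)

lemma vlead_two: "vlead (two m l) = (\<Prod>j<l. (1 - tt * qq ^ j) * (1 - tt ^ 2 * qq ^ (m + j))) * (\<Prod>j<m. 1 - tt * qq ^ j)"
proof -
 have rev1: "(\<Prod>j<n. 1 - qq ^ (n - Suc j) * tt) = (\<Prod>j<n. 1 - tt * qq ^ j)" for n
  using prod.nat_diff_reindex[of "%j. 1 - tt * qq ^ j" n] by (simp add: mult.commute)
 show ?thesis
 proof (cases "l = 0")
  case True
  show ?thesis
  proof (cases "m = 0")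
   case True
   thus ?thesis using \<open>l = 0\<close> by (simp add: two_def vlead_def cells_def)
  next
   case False
   hence t: "two m l = [m]" using True by (simp add: two_def)
   have c: "cells [m] = Pair 0 ` {..<m}" by (auto simp: cells_def)
   have g: "leg [m] (0, j) = 0" for j by (auto simp: leg_def)
   have "vlead [m] = (\<Prod>j<m. 1 - qq ^ (m - j - 1) * tt)"
    unfolding vlead_def c by (subst prod.reindex) (auto simp: inj_on_def arm_def g)
   thus ?thesis using True t by (simp add: rev1)
  qed
 next
  case False
  hence t: "two m l = [m + l, l]" by (simp add: two_def)
  have c: "cells [m + l, l] = Pair 0 ` {..<m + l} \<union> Pair 1 ` {..<l}"
   by (auto simp: cells_def less_Suc_eq)
  have g1: "leg [m + l, l] (1, j) = 0" for j
   by (simp add: leg_def)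
  have g0: "leg [m + l, l] (0, j) = (if j < l then 1 else 0)" for j
  proof -
   have "{i. fst (0::nat, j) < i & i < length [m + l, l] & snd (0::nat, j) < [m + l, l] ! i} = (if j < l then {1} else {})"
    by (auto simp: less_Suc_eq)
   thus ?thesis by (simp add: leg_def)
  qed
  have "vlead [m + l, l] = (\<Prod>j<m + l. 1 - qq ^ (m + l - j - 1) * tt ^ ((if j < l then 1 else 0) + 1)) * (\<Prod>j<l. 1 - qq ^ (l - j - 1) * tt)"
  proof -
   have d: "Pair 0 ` {..<m + l} \<inter> Pair (1::nat) ` {..<l} = {}" by auto
   show ?thesis
    unfolding vlead_def c prod.union_disjoint[OF finite_imageI finite_imageI d, OF finite_lessThan finite_lessThan]
    by (subst (1 2) prod.reindex) (simp_all add: inj_on_def arm_def g0 g1[simplified])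
  qed
  \<comment> \<open>Read from the right, the cells of the bottom row have their arm as index, and
    those with a cell above them are the ones of index at least \<open>m\<close>.\<close>
  also have "(\<Prod>j<m + l. 1 - qq ^ (m + l - j - 1) * tt ^ ((if j < l then 1 else 0) + 1)) =
   (\<Prod>i<m + l. 1 - qq ^ i * tt ^ ((if m <= i then 1 else 0) + 1))"
   by (rule prod.reindex_bij_witness[where i = "%i. m + l - Suc i" and j = "%i. m + l - Suc i"]) auto
  also have "... = (\<Prod>i<m. 1 - qq ^ i * tt ^ ((if m <= i then 1 else 0) + 1)) * (\<Prod>i<l. 1 - qq ^ (m + i) * tt ^ ((if m <= m + i then 1 else 0) + 1))"
   by (rule prod_split)
  also have "... = (\<Prod>i<m. 1 - tt * qq ^ i) * (\<Prod>i<l. 1 - tt ^ 2 * qq ^ (m + i))"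
   by (simp add: mult.commute power2_eq_square)
  finally show ?thesis by (simp add: t rev1 rev1[unfolded mult.commute[of _ tt]] prod.distrib mult_ac)
 qed
qed

lemma el_two: "el (m + 2 * l) (two m l) = inverse tt * inverse tt + inverse tt * (1 - inverse tt) * (tt * qq ^ (m + l) + qq ^ l)"
proof -
 define s d where "s = inverse tt" and "d = m + 2 * l"
 have g: "(1 - s) * (\<Sum>j\<le>d. s ^ j) = 1 - s ^ Suc d" for d
 proof (induction d)
  case (Suc d)
  have "(1 - s) * (\<Sum>j\<le>Suc d. s ^ j) = (1 - s) * (\<Sum>j\<le>d. s ^ j) + (1 - s) * s ^ Suc d" by (simp add: distrib_left)
  also have "... = 1 - s ^ Suc (Suc d)" unfolding Suc by (simp add: algebra_simps)
  finally show ?case .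
 qed simp
 have "(\<Sum>j\<le>d. s ^ j * qq ^ fn (two m l) j) = (\<Sum>j\<le>d. s ^ j + ((if j = 0 then qq ^ (m + l) - 1 else 0) + (if j = 1 then s * (qq ^ l - 1) else 0)))"
  by (intro sum.cong refl) (simp add: fn_two algebra_simps)
 also have "... = (\<Sum>j\<le>d. s ^ j) + ((qq ^ (m + l) - 1) + s * (qq ^ l - 1))"
  unfolding sum.distrib by (cases "d = 0") (simp_all add: sum.delta sum.delta' d_def)
 finally have "(1 - s) * (\<Sum>j\<le>d. s ^ j * qq ^ fn (two m l) j) = 1 - s ^ Suc d + (1 - s) * ((qq ^ (m + l) - 1) + s * (qq ^ l - 1))"
  by (simp add: distrib_left g)
 hence "el d (two m l) = 1 + (1 - s) * ((qq ^ (m + l) - 1) + s * (qq ^ l - 1))"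
  unfolding el_alt s_def[symmetric] by simp
 also have "... = s * s + (1 - s) * (qq ^ (m + l) + s * qq ^ l)" by (simp add: algebra_simps)
 also have "qq ^ (m + l) + s * qq ^ l = s * (tt * qq ^ (m + l) + qq ^ l)" by (simp add: s_def distrib_left)
 finally show ?thesis by (simp add: s_def d_def mult_ac)
qed

theorem macJ_KV: "macJ (two m l) = pleth_Xt (KV l m)"
proof (rule macJ_eqI[OF two_parts])
 show "symf (m + 2 * l) (pleth_Xt (KV l m))" using symf_KV by (simp add: symf_def pleth_pm)
 show "cf (m + 2 * l) (pleth_Xt (KV l m)) (fn (two m l)) = vlead (two m l)"
  unfolding cf_KV vlead_two ..
 have "EH (m + 2 * l) (KV l m) = (%nu. el (m + 2 * l) (two m l) * KV l m nu)"
 proof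
  fix nu
  have "(EH (m + 2 * l) (KV l m) nu - inverse tt * inverse tt * KV l m nu) / (inverse tt * (1 - inverse tt)) = (tt * qq ^ (m + l) + qq ^ l) * KV l m nu"
   using fun_cong[OF KV_eigen[of m l], of nu] by (simp only: Ev_def)
  hence "EH (m + 2 * l) (KV l m) nu - inverse tt * inverse tt * KV l m nu = (tt * qq ^ (m + l) + qq ^ l) * KV l m nu * (inverse tt * (1 - inverse tt))"
   using tt_inv by (simp only: nonzero_divide_eq_eq not_False_eq_True)
  thus "EH (m + 2 * l) (KV l m) nu = el (m + 2 * l) (two m l) * KV l m nu"
   unfolding el_two by (simp add: algebra_simps)
 qed
 thus "Eop (m + 2 * l) (pleth_Xt (KV l m)) = (%nu. el (m + 2 * l) (two m l) * pleth_Xt (KV l m) nu)"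
  unfolding Eop_pleth by (simp add: pleth_pm mult.assoc)
qed

subsection \<open>The expansion over lattice words\<close>

lemma symf_Ap: "symf n (Ap r n Q)"
 unfolding Ap_def by (rule symf_lin) (use schur_spec(1) sh_parts in blast)

definition VV :: "nat => nat list set" where "VV n = {v. set v \<subseteq> {0, 1} & length v = n div 2}"

lemma finite_VV [simp]: "finite (VV n)" unfolding VV_def by (rule finite_lists_length_eq) simp

lemma VV_Suc: "VV (n + 2) = (%v. 0 # v) ` VV n \<union> (%v. 1 # v) ` VV n"
 by (auto simp: VV_def length_Suc_conv)

lemma dvw_VV: "dvw u \<in> VV (length u)"
 by (induction u rule: dvw.induct) (auto simp: VV_def)

text \<open>An arbitrary weight on domino vectors replaces the selection by a predicate, so that the
  recursion can consume the weight bit by bit.\<close>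

definition ApW :: "(nat list => K) => nat => nat list => K" where
 "ApW W n = (%nu. \<Sum>u\<in>LW n. qq ^ cmaj u * W (dvw u) * schur (sh u) nu)"

lemma ApW_Ap: "ApW W n = (%nu. \<Sum>v\<in>VV n. W v * Ap qq n (%x. x = v) nu)"
proof
 fix nu
 have "(\<Sum>v\<in>VV n. W v * Ap qq n (%x. x = v) nu) = (\<Sum>v\<in>VV n. \<Sum>u\<in>{u\<in>LW n. dvw u = v}. qq ^ cmaj u * W (dvw u) * schur (sh u) nu)"
  unfolding Ap_def sum_distrib_left by (intro sum.cong refl) auto
 also have "... = (\<Sum>u\<in>LW n. qq ^ cmaj u * W (dvw u) * schur (sh u) nu)"
  by (rule sum.group[OF finite_LW finite_VV]) (use dvw_VV in \<open>auto simp: LW_def\<close>)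
 finally show "ApW W n nu = (\<Sum>v\<in>VV n. W v * Ap qq n (%x. x = v) nu)" by (simp add: ApW_def)
qed

lemma ApW_rec: "ApW W (n + 2) = (%nu. B0v n (ApW (%v. W (0 # v)) n) nu + qq ^ (n + 1) * B1v n (ApW (%v. W (1 # v)) n) nu)"
proof
 fix nu
 have 0: "Ap qq (n + 2) (%x. x = 0 # v) nu = B0v n (Ap qq n (%x. x = v)) nu"
  and 1: "Ap qq (n + 2) (%x. x = 1 # v) nu = qq ^ (n + 1) * B1v n (Ap qq n (%x. x = v)) nu" for v
 proof -
  have Q: "(%x. x = 0 # v) = Q0 (%x. x = v)" "(%x. x = 1 # v) = Q1 (%x. x = v)" by (auto simp: Q0_def Q1_def)
  show "Ap qq (n + 2) (%x. x = 0 # v) nu = B0v n (Ap qq n (%x. x = v)) nu"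
  proof (cases "nu \<in> parts (n + 2)")
   case True
   thus ?thesis unfolding Q B0v_def by (rule Ap_Q0)
  qed (use symf_Ap in \<open>simp add: symf_def B0v_def vop_def\<close>)
  show "Ap qq (n + 2) (%x. x = 1 # v) nu = qq ^ (n + 1) * B1v n (Ap qq n (%x. x = v)) nu"
  proof (cases "nu \<in> parts (n + 2)")
   case True
   thus ?thesis unfolding Q B1v_def by (rule Ap_Q1[OF qq_nz])
  qed (use symf_Ap in \<open>simp add: symf_def B1v_def vop_def\<close>)
 qed
 have "ApW W (n + 2) nu = (\<Sum>v\<in>VV n. W (0 # v) * Ap qq (n + 2) (%x. x = 0 # v) nu) + (\<Sum>v\<in>VV n. W (1 # v) * Ap qq (n + 2) (%x. x = 1 # v) nu)"
 proof -
  have "(%v. (0::nat) # v) ` VV n \<inter> (%v. 1 # v) ` VV n = {}" by auto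
  thus ?thesis unfolding ApW_Ap VV_Suc
   by (subst sum.union_disjoint) (simp_all add: sum.reindex)
 qed
 also have "(\<Sum>v\<in>VV n. W (0 # v) * Ap qq (n + 2) (%x. x = 0 # v) nu) = B0v n (ApW (%v. W (0 # v)) n) nu"
  unfolding 0 ApW_Ap B0v_def vop_lin ..
 also have "(\<Sum>v\<in>VV n. W (1 # v) * Ap qq (n + 2) (%x. x = 1 # v) nu) = qq ^ (n + 1) * B1v n (ApW (%v. W (1 # v)) n) nu"
  unfolding 1 ApW_Ap B1v_def vop_lin by (simp add: sum_distrib_left mult_ac)
 finally show "ApW W (n + 2) nu = B0v n (ApW (%v. W (0 # v)) n) nu + qq ^ (n + 1) * B1v n (ApW (%v. W (1 # v)) n) nu" .
qed

lemma ApW_scale: "ApW (%v. s * W v) n = (%nu. s * ApW W n nu)"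
 by (simp add: ApW_def sum_distrib_left mult_ac)

lemma vop_scale: "vop a b c d d' (%nu. s * f nu) = (%nu. s * vop a b c d d' f nu)"
 by (simp add: vop_def fun_eq_iff sum_distrib_left mult_ac)

definition wgt :: "nat => nat => nat list => K" where
 "wgt l n v = qq powi ((1 - int n) * int (vsum l v) + 2 * int (vn l v)) * tt powi (int l - int (vsum l v))"

lemma vsum_Cons: "vsum (Suc l) (b # v) = b + vsum l v" by (simp add: vsum_def)

lemma vn_Cons: "vn (Suc l) (b # v) = vn l v + vsum l v"
proof -
 have "sum_list (take l v) = (\<Sum>i<length (take l v). take l v ! i)"
  by (simp add: sum_list_sum_nth atLeast0LessThan)
 thus ?thesis unfolding vn_def vsum_def
  by (simp add: sum.lessThan_Suc_shift sum.distrib del: length_take sum.lessThan_Suc)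
qed

lemma wgt_0: "wgt (Suc l) (n + 2) (0 # v) = tt * wgt l n v"
proof -
 have "(1 - int (n + 2)) * int (vsum (Suc l) (0 # v)) + 2 * int (vn (Suc l) (0 # v)) = (1 - int n) * int (vsum l v) + 2 * int (vn l v)"
  by (simp add: vsum_Cons vn_Cons algebra_simps)
 moreover have "tt powi (int (Suc l) - int (vsum (Suc l) (0 # v))) = tt * tt powi (int l - int (vsum l v))"
  using power_int_add[of tt 1 "int l - int (vsum l v)"] by (simp add: vsum_Cons algebra_simps)
 ultimately show ?thesis by (simp add: wgt_def)
qed

lemma wgt_1: "qq ^ (n + 1) * wgt (Suc l) (n + 2) (1 # v) = wgt l n v"
proof -
 have e: "(1 - int (n + 2)) * int (vsum (Suc l) (1 # v)) + 2 * int (vn (Suc l) (1 # v)) = - int (n + 1) + ((1 - int n) * int (vsum l v) + 2 * int (vn l v))"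
  by (simp add: vsum_Cons vn_Cons algebra_simps)
 have t: "int (Suc l) - int (vsum (Suc l) (1 # v)) = int l - int (vsum l v)" by (simp add: vsum_Cons)
 have "qq ^ (n + 1) * qq powi (- int (n + 1)) = 1"
  by (simp only: power_int_minus power_int_of_nat) (rule right_inverse, simp)
 thus ?thesis unfolding wgt_def e t using power_int_add[of qq "- int (n + 1)" "(1 - int n) * int (vsum l v) + 2 * int (vn l v)"]
  by (simp only: qq_nz simp_thms mult.assoc[symmetric] mult_1_left)
qed

text \<open>The recursion when both values of the first bit have weight 1: it stays within multiples
  of one complete function, and the two new factors extend \<open>qpoch\<close> by two
  steps.\<close>

lemma gv_step: "B0v n (gv 0 n) nu + qq ^ (n + 1) * B1v n (gv 0 n) nu = (1 - qq ^ (n + 1)) * (1 - qq ^ (n + 2)) * gv 0 (n + 2) nu"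
proof -
 have "(%nu. B0v n (gv 0 n) nu + qq ^ (n + 1) * B1v n (gv 0 n) nu) = (%nu. (1 - qq ^ (n + 1)) * (1 - qq ^ (n + 2)) * gv 0 (n + 2) nu)"
 proof (rule ev_eqI)
  show "symf (n + 2) (%nu. B0v n (gv 0 n) nu + qq ^ (n + 1) * B1v n (gv 0 n) nu)" by (simp add: symf_def B0v_def B1v_def vop_def)
  show "symf (n + 2) (%nu. (1 - qq ^ (n + 1)) * (1 - qq ^ (n + 2)) * gv 0 (n + 2) nu)" using symf_gv[of 0 "n + 2"] by (simp add: symf_def)
  fix P
  have Z: "Z P (Suc 0) (Suc n) = (qq ^ (n + 2) - 1) * hh P (n + 2) + qq ^ (n + 1) * hh P 1 * hh P (n + 1)"
   unfolding Z_rec Z_0 by (simp add: algebra_simps)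
  show "ev (n + 2) (%nu. B0v n (gv 0 n) nu + qq ^ (n + 1) * B1v n (gv 0 n) nu) P = ev (n + 2) (%nu. (1 - qq ^ (n + 1)) * (1 - qq ^ (n + 2)) * gv 0 (n + 2) nu) P"
   unfolding ev_plus ev_scale ev_B0_gv[of 0 n P, unfolded add_0] ev_B1_gv[of 0 n P, unfolded add_0]
    ev_gv[of 0 "n + 2" P, unfolded add_0] Z by (simp add: algebra_simps)
 qed
 thus ?thesis by (rule fun_cong)
qed

lemma Hh_1: "Hh 1 Q = Q 1" using Hh_rec[of 1 Q] by simp

lemma ApW_base:
 assumes n: "n < 2" shows "ApW (%_. 1) n = KV 0 n"
proof
 fix nu
 have A: "ApW (%_. 1) n = Ap qq n (%_. True)" by (simp add: ApW_def Ap_def)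
 show "ApW (%_. 1) n nu = KV 0 n nu"
 proof (cases "nu \<in> parts n")
  case True
  show ?thesis
  proof (rule ev_inj[where N = 1 and B = 2 and S = UNIV, OF _ n infinite_UNIV_char_0 _ True])
   fix s :: K
   let ?x = "pt 2 s" and ?P = "psum 1 (pt 2 s)"
   have W: "ev n (ApW (%_. 1) n) ?P = (\<Sum>u\<in>words n 1. qq ^ cmaj u * mon ?x u)"
    unfolding A by (subst ev_Ap) (use n in \<open>simp_all add: Ws_def\<close>)
   have K: "ev n (KV 0 n) ?P = qpoch n * hh ?P n" using ev_gv[of 0 n ?P] by (simp add: ev_scale)
   consider "n = 0" | "n = 1" using n by linarith
   thus "ev n (ApW (%_. 1) n) ?P = ev n (KV 0 n) ?P"
   proof cases
    case 1
    have "words 0 1 = {[]}" by (auto simp: words_def)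
    thus ?thesis using W K 1 by (simp add: qpoch_def)
   next
    case 2
    have "words 1 1 = {[0]}" by (auto simp: words_def length_Suc_conv)
    moreover have "qpoch 1 * hh ?P 1 = ?x 0" using qq_pow1[of 1] by (simp add: qpoch_def hh_def Hh_1[simplified] psum_def)
    ultimately show ?thesis using W K 2 by simp
   qed
  qed (use n in auto)
 next
  case False
  thus ?thesis using symf_Ap[of n qq "%_. True"] symf_KV[of n 0] unfolding A by (simp add: symf_def)
 qed
qed

lemma ApW_one: "ApW (%_. 1) n = KV 0 n"
proof (induction n rule: less_induct)
 case (less n)
 show ?case
 proof (cases "n < 2")
  case False
  define k where "k = n - 2"
  have 3: "n = k + 2" using False by (simp add: k_def)
  have e: "ApW (%_. 1) k = (%nu. qpoch k * gv 0 k nu)" using less[of k] 3 by simp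
  show ?thesis
  proof
   fix nu
   have "ApW (%_. 1) (k + 2) nu = qpoch k * (B0v k (gv 0 k) nu + qq ^ (k + 1) * B1v k (gv 0 k) nu)"
    unfolding ApW_rec e B0v_def B1v_def vop_scale by (simp only: distrib_left mult_ac)
   also have "... = qpoch (k + 2) * gv 0 (k + 2) nu" unfolding gv_step by (simp add: qpoch_def mult_ac)
   finally show "ApW (%_. 1) n nu = KV 0 n nu" by (simp add: 3)
  qed
 qed (rule ApW_base)
qed

theorem ApW_KV: "ApW (wgt l (m + 2 * l)) (m + 2 * l) = KV l m"
proof (induction l)
 case 0
 have "wgt 0 m = (%_. 1)" by (rule ext) (simp add: wgt_def vsum_def vn_def)
 thus ?case using ApW_one by simp
next
 case (Suc l)
 let ?n = "m + 2 * l"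
 have w0: "(%v. wgt (Suc l) (?n + 2) (0 # v)) = (%v. tt * wgt l ?n v)" by (simp only: wgt_0)
 have w1: "(%v. wgt (Suc l) (?n + 2) (1 # v)) = (%v. inverse (qq ^ (?n + 1)) * wgt l ?n v)"
 proof
  fix v
  have "inverse (qq ^ (?n + 1)) * qq ^ (?n + 1) = 1" by (rule left_inverse) simp
  hence "wgt (Suc l) (?n + 2) (1 # v) = inverse (qq ^ (?n + 1)) * (qq ^ (?n + 1) * wgt (Suc l) (?n + 2) (1 # v))"
   by (simp only: mult.assoc[symmetric] mult_1_left)
  thus "wgt (Suc l) (?n + 2) (1 # v) = inverse (qq ^ (?n + 1)) * wgt l ?n v" by (simp only: wgt_1)
 qed
 have "ApW (wgt (Suc l) (?n + 2)) (?n + 2) = (%nu. B0v ?n (ApW (%v. tt * wgt l ?n v) ?n) nu + qq ^ (?n + 1) * B1v ?n (ApW (%v. inverse (qq ^ (?n + 1)) * wgt l ?n v) ?n) nu)"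
  unfolding ApW_rec w0 w1 ..
 also have "... = Opv ?n (KV l m)"
 proof -
  have "qq ^ (?n + 1) * inverse (qq ^ (?n + 1)) = 1" by (rule right_inverse) simp
  thus ?thesis unfolding ApW_scale Suc Opv_def B0v_def B1v_def vop_scale
   by (intro ext) (simp only: mult.assoc[symmetric] mult_1_left)
 qed
 finally show ?case by simp
qed

theorem macJ_lattice: "macJ (two m l) = (%nu. \<Sum>u\<in>LW (m + 2 * l). qq ^ cmaj u * wgt l (m + 2 * l) (dvw u) * pleth_Xt (schur (sh u)) nu)"
 unfolding macJ_KV ApW_KV[symmetric] pleth_pm ApW_def by (rule ext) (simp add: sum_distrib_right mult.assoc)

section \<open>Standard tableaux and lattice words\<close>

text \<open>A tableau is built from a list of pairs (entry, row), taken in the order in which the cells of each row appear.\<close>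
definition row :: "(nat \<times> nat) list => nat => nat list" where "row ps j = map fst (filter (%p. snd p = j) ps)"
definition tbl :: "nat => (nat \<times> nat) list => nat list list" where "tbl R ps = map (row ps) [0..<R]"
definition rd :: "nat => (nat \<times> nat) list => nat list" where "rd R ps = concat (map (row ps) (rev [0..<R]))"

lemma reading_tbl: "reading (tbl R ps) = rd R ps" by (simp add: reading_def tbl_def rd_def rev_map)

lemma row_append: "row (ps @ qs) j = row ps j @ row qs j" by (simp add: row_def)
lemma row_simps: "row [] j = []" "row (p # ps) j = (if snd p = j then fst p # row ps j else row ps j)" by (simp_all add: row_def)

lemma rd_Suc: "rd (Suc R) ps = row ps R @ rd R ps" by (simp add: rd_def)

lemma rd_0 [simp]: "rd 0 ps = []" by (simp add: rd_def)

lemma rd_swap: "snd p ~= snd q ==> rd R (A @ p # q # B) = rd R (A @ q # p # B)"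
proof -
 assume "snd p ~= snd q"
 hence "row (A @ p # q # B) = row (A @ q # p # B)" by (auto simp: row_def fun_eq_iff)
 thus ?thesis by (simp add: rd_def)
qed

lemma rd_sorted: "sorted_wrt (%p q. snd q <= snd p) ps ==> \<forall>p\<in>set ps. snd p < R ==> rd R ps = map fst ps"
proof (induction R arbitrary: ps)
 case (Suc R)
 show ?case using Suc.prems
 proof (induction ps)
  case Nil
  thus ?case by (simp add: rd_def row_def)
 next
  case (Cons p ps)
  show ?case
  proof (cases "snd p = R")
   case True
   have "row (p # ps) j = row ps j" if "j < R" for j using True that by (simp add: row_simps)
   hence "rd R (p # ps) = rd R ps" by (auto simp: rd_def intro!: arg_cong[of _ _ concat])
   thus ?thesis using Cons True by (simp add: rd_Suc row_simps)
  next
   case False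
   hence "\<forall>q\<in>set (p # ps). snd q < R" using Cons.prems by fastforce
   moreover from this have "row (p # ps) R = []" by (auto simp: row_def filter_empty_conv)
   ultimately show ?thesis using Suc.IH[of "p # ps"] Cons.prems by (simp add: rd_Suc)
  qed
 qed
next
 case 0
 thus ?case by (cases ps) auto
qed

section \<open>Word operators through the positions of letters\<close>

lemma positions_Cons: "positions A (x # w) = (if x \<in> A then [0] else []) @ map Suc (positions A w)"
proof -
 have "[0..<length (x # w)] = 0 # map Suc [0..<length w]" by (simp add: upt_conv_Cons map_Suc_upt del: upt_Suc)
 thus ?thesis by (simp add: positions_def filter_map comp_def)
qed

lemma map_positions: "map ((!) w) (positions A w) = filter (%x. x \<in> A) w"
 by (induction w) (auto simp: positions_def[of A "[]"] positions_Cons comp_def)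

lemma put_at_Suc: "put_at (map Suc ps) vs (x # w) = x # put_at ps vs w"
proof (induction ps arbitrary: vs w)
 case (Cons p ps)
 thus ?case by (cases vs) (simp_all add: put_at_def)
qed (simp add: put_at_def)

lemma put_at_positions:
 "list_all2 (%x y. (x \<in> A \<longleftrightarrow> y \<in> A) & (x \<notin> A --> x = y)) w w' ==>
  put_at (positions A w) (filter (%x. x \<in> A) w') w = w'"
proof (induction w w' rule: list_all2_induct)
 case (Cons x w y w')
 note s = put_at_Suc[of "positions A w" "filter (%x. x \<in> A) w'"]
 have z: "put_at (0 # ps) (v # vs) (x # w) = put_at ps vs (v # w)" for ps v vs by (simp add: put_at_def)
 show ?case
 proof (cases "x \<in> A")
  case True
  hence "y \<in> A" using Cons by simp
  thus ?thesis using True Cons.IH by (simp only: positions_Cons if_True append_Cons append_Nil filter.simps z s)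
 next
  case False
  hence "y \<notin> A" "x = y" using Cons by auto
  thus ?thesis using False Cons.IH by (simp only: positions_Cons if_False append_Nil filter.simps s)
 qed
qed (simp add: positions_def put_at_def)

text \<open>The map \<open>g\<close> identifies letters of \<open>A\<close> only. Words with the
  same image therefore have their letters of \<open>A\<close> in the same places and agree
  elsewhere.\<close>

lemma list_all2_collapse:
 assumes "map g w = map g w'" "\<And>x y. g x = g y ==> (x \<in> A \<longleftrightarrow> y \<in> A) & (x \<notin> A --> x = y)"
 shows "list_all2 (%x y. (x \<in> A \<longleftrightarrow> y \<in> A) & (x \<notin> A --> x = y)) w w'"
proof (rule list_all2_all_nthI)
 show l: "length w = length w'" using map_eq_imp_length_eq[OF assms(1)] .
 fix i assume i: "i < length w"
 have "g (w ! i) = map g w ! i" using i by simp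
 also have "... = g (w' ! i)" unfolding assms(1) using i l by simp
 finally show "(w ! i \<in> A \<longleftrightarrow> w' ! i \<in> A) & (w ! i \<notin> A --> w ! i = w' ! i)" by (rule assms(2))
qed

lemma row_const:
 "length vs = length u ==> (\<And>v. v \<in> set vs ==> g v = a) ==> map g (row (zip vs u) j) = replicate (count (mset u) j) a"
proof (induction vs u rule: list_induct2)
qed (auto simp: row_simps)

lemma row_filter_all: "(\<And>p. p \<in> set ps ==> P (fst p)) ==> filter P (row ps j) = row ps j"
 by (auto simp: row_def intro!: filter_True)
lemma row_filter_none: "(\<And>p. p \<in> set ps ==> \<not> P (fst p)) ==> filter P (row ps j) = []"
 by (auto simp: row_def filter_empty_conv)

lemma rd_collapse:
 assumes m: "length vs = length u" "length vs' = length u'" "mset u = mset u'"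
  and g: "\<And>v. v \<in> set vs ==> g v = a" "\<And>v. v \<in> set vs' ==> g v = a"
 shows "map g (rd R (A @ zip vs u @ B)) = map g (rd R (A @ zip vs' u' @ B))"
proof -
 have "map g (row (A @ zip vs u @ B) j) = map g (row (A @ zip vs' u' @ B) j)" for j
  using row_const[of vs u g a] row_const[of vs' u' g a] m g by (simp add: row_append)
 thus ?thesis by (simp add: rd_def map_concat comp_def)
qed

lemma rd_filter_mid:
 assumes "\<And>p. p \<in> set M ==> P (fst p)" "\<And>p. p \<in> set A ==> \<not> P (fst p)" "\<And>p. p \<in> set B ==> \<not> P (fst p)"
 shows "filter P (rd R (A @ M @ B)) = rd R M"
proof -
 have "filter P (row (A @ M @ B) j) = row M j" for j
  using row_filter_all[of M P j] row_filter_none[of A P j] row_filter_none[of B P j] assms by (simp add: row_append)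
 thus ?thesis by (simp add: rd_def filter_concat comp_def)
qed

text \<open>On entries, \<open>swap3\<close> keeps the cells and changes the letters; on the list of
  rows this is a Knuth move. The three cases are the positions of \<open>z\<close> relative to the
  row pair, and the reading order follows by listing cells by decreasing row.\<close>

lemma swap3_rd:
 assumes xy: "y <= x" and R: "x < R" "y < R" "z < R" and K: "K3 x y z = (s, p, q)"
 shows "swap3 a (rd R [(a, x), (a, y), (Suc a, z)]) = rd R [(a, s), (Suc a, p), (Suc a, q)]"
proof -
 consider "z <= y" | "y < z" "z <= x" | "x < z" by linarith
 thus ?thesis
 proof cases
  case 1
  hence e: "s = x" "p = y" "q = z" using K xy by (auto simp: K3_row)
  have "rd R [(a, x), (a, y), (Suc a, z)] = [a, a, Suc a]" by (subst rd_sorted) (use 1 xy R in auto)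
  moreover have "rd R [(a, s), (Suc a, p), (Suc a, q)] = [a, Suc a, Suc a]" by (subst rd_sorted) (use 1 xy R e in auto)
  ultimately show ?thesis by (simp add: swap3_def)
 next
  case 2
  hence e: "s = y" "p = x" "q = z" using K xy by (auto simp: K3_row)
  have "rd R [(a, x), (a, y), (Suc a, z)] = rd R [(a, x), (Suc a, z), (a, y)]"
   using rd_swap[of "(a, y)" "(Suc a, z)" R "[(a, x)]" "[]"] 2 by simp
  also have "... = [a, Suc a, a]" by (subst rd_sorted) (use 2 R in auto)
  finally have 1: "rd R [(a, x), (a, y), (Suc a, z)] = [a, Suc a, a]" .
  have "rd R [(a, y), (Suc a, x), (Suc a, z)] = rd R [(Suc a, x), (a, y), (Suc a, z)]"
   using rd_swap[of "(a, y)" "(Suc a, x)" R "[]"] 2 by simp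
  also have "... = rd R [(Suc a, x), (Suc a, z), (a, y)]"
   using rd_swap[of "(a, y)" "(Suc a, z)" R "[(Suc a, x)]" "[]"] 2 by simp
  also have "... = [Suc a, Suc a, a]" by (subst rd_sorted) (use 2 R in auto)
  finally show ?thesis unfolding e 1 by (simp add: swap3_def)
 next
  case 3
  hence e: "s = x" "p = z" "q = y" using K xy by (auto simp: K3_row)
  have "rd R [(a, x), (a, y), (Suc a, z)] = rd R [(a, x), (Suc a, z), (a, y)]"
   using rd_swap[of "(a, y)" "(Suc a, z)" R "[(a, x)]" "[]"] 3 xy by simp
  also have "... = rd R [(Suc a, z), (a, x), (a, y)]"
   using rd_swap[of "(a, x)" "(Suc a, z)" R "[]"] 3 by simp
  also have "... = [Suc a, a, a]" by (subst rd_sorted) (use 3 xy R in auto)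
  finally have 1: "rd R [(a, x), (a, y), (Suc a, z)] = [Suc a, a, a]" .
  have "rd R [(a, x), (Suc a, z), (Suc a, y)] = rd R [(Suc a, z), (a, x), (Suc a, y)]"
   using rd_swap[of "(a, x)" "(Suc a, z)" R "[]"] 3 by simp
  also have "... = [Suc a, a, Suc a]" by (subst rd_sorted) (use 3 xy R in auto)
  finally show ?thesis unfolding e 1 by (simp add: swap3_def)
 qed
qed

lemma sigma_op_eqI:
 assumes "map g w = map g w'" "\<And>x y. g x = g y ==> (x \<in> {a, a + 1} \<longleftrightarrow> y \<in> {a, a + 1}) & (x \<notin> {a, a + 1} --> x = y)"
  and "filter (%x. x \<in> {a, a + 1}) w' = swap3 a (filter (%x. x \<in> {a, a + 1}) w)"
 shows "sigma_op a w = w'"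
 unfolding sigma_op_def Let_def map_positions[of w] assms(3)[symmetric]
 by (rule put_at_positions[OF list_all2_collapse[OF assms(1,2)]])

text \<open>The sorted entries at the moment when \<open>sigma_op a\<close> is about to act: the
  repeated letter has wandered from 1 up to \<open>a\<close>.\<close>

definition vseq :: "nat => nat => nat list" where "vseq a n = [1..<a] @ [a, a] @ [Suc a..<n]"

text \<open>The two cells with entry \<open>a\<close> hold the carried pair \<open>x y\<close>, and
  the cell with entry \<open>Suc a\<close> holds \<open>z\<close>; after the operator the repeated
  entry \<open>Suc a\<close> holds the new pair.\<close>

lemma sigma_step:
 assumes xy: "y <= x" and R: "x < R" "y < R" "z < R" and K: "K3 x y z = (s, p, q)"
  and l: "length h = a - 1" "1 <= a" "length h + 3 + length w = n"
 shows "sigma_op a (rd R (zip (vseq a n) (h @ [x, y, z] @ w))) = rd R (zip (vseq (Suc a) n) (h @ [s, p, q] @ w))"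
proof -
 define A B where "A = zip [1..<a] h" and "B = zip [a + 2..<n] w"
 have lw: "length w = n - (a + 2)" "a + 1 < n" using l by linarith+
 have v1: "vseq a n = [1..<a] @ [a, a, Suc a] @ [a + 2..<n]" using lw by (simp add: vseq_def upt_conv_Cons[of "Suc a"])
 have v2: "vseq (Suc a) n = [1..<a] @ [a, Suc a, Suc a] @ [a + 2..<n]" using l(2) by (simp add: vseq_def upt_Suc_append)
 have z1: "zip (vseq a n) (h @ [x, y, z] @ w) = A @ zip [a, a, Suc a] [x, y, z] @ B"
  unfolding v1 A_def B_def using l by (subst zip_append) simp_all
 have z2: "zip (vseq (Suc a) n) (h @ [s, p, q] @ w) = A @ zip [a, Suc a, Suc a] [s, p, q] @ B"
  unfolding v2 A_def B_def using l by (subst zip_append) simp_all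
 have ms: "mset [x, y, z] = mset [s, p, q]"
  using K xy by (auto simp: K3_row split: if_splits)
 let ?g = "%v. if v = Suc a then a else v"
 have A: "fst p \<notin> {a, a + 1}" if "p \<in> set A" for p
 proof -
  have "fst p \<in> set [1..<a]" using that unfolding A_def by (metis prod.collapse set_zip_leftD)
  thus ?thesis by auto
 qed
 have B: "fst p \<notin> {a, a + 1}" if "p \<in> set B" for p
 proof -
  have "fst p \<in> set [a + 2..<n]" using that unfolding B_def by (metis prod.collapse set_zip_leftD)
  thus ?thesis by auto
 qed
 have f1: "filter (%x. x \<in> {a, a + 1}) (rd R (A @ zip [a, a, Suc a] [x, y, z] @ B)) = rd R (zip [a, a, Suc a] [x, y, z])"
  by (rule rd_filter_mid) (use A B in auto)
 have f2: "filter (%x. x \<in> {a, a + 1}) (rd R (A @ zip [a, Suc a, Suc a] [s, p, q] @ B)) = rd R (zip [a, Suc a, Suc a] [s, p, q])"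
  by (rule rd_filter_mid) (use A B in auto)
 show ?thesis unfolding z1 z2
 proof (rule sigma_op_eqI)
  show "map ?g (rd R (A @ zip [a, a, Suc a] [x, y, z] @ B)) = map ?g (rd R (A @ zip [a, Suc a, Suc a] [s, p, q] @ B))"
   by (rule rd_collapse[where a = a]) (use ms in auto)
  show "filter (%x. x \<in> {a, a + 1}) (rd R (A @ zip [a, Suc a, Suc a] [s, p, q] @ B)) =
   swap3 a (filter (%x. x \<in> {a, a + 1}) (rd R (A @ zip [a, a, Suc a] [x, y, z] @ B)))"
   unfolding f1 f2 using swap3_rd[OF xy R K, of a] by simp
 qed (auto split: if_splits)
qed

lemma sigma_fold:
 assumes "y <= x" "\<forall>i\<in>set (x # y # w). i < R" "length h = a - 1" "1 <= a" "length h + 2 + length w = n"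
 shows "foldl (%u a. sigma_op a u) (rd R (zip (vseq a n) (h @ x # y # w))) [a..<n - 1] = rd R (zip (vseq (n - 1) n) (h @ lam x y w))"
 using assms
proof (induction w arbitrary: x y h a)
 case Nil
 hence "n - 1 = a" by simp
 thus ?case by simp
next
 case (Cons z w)
 obtain s p q where K: "K3 x y z = (s, p, q)" by (metis prod_cases3)
 have set: "{s, p, q} = {x, y, z}" using K3_set[OF K] .
 have up: "[a..<n - 1] = a # [Suc a..<n - 1]" using Cons.prems by (simp add: upt_conv_Cons)
 have st: "sigma_op a (rd R (zip (vseq a n) (h @ x # y # z # w))) = rd R (zip (vseq (Suc a) n) (h @ s # p # q # w))"
  using sigma_step[OF Cons.prems(1) _ _ _ K Cons.prems(3,4), where R = R and w = w and n = n] Cons.prems by simp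
 have "foldl (%u a. sigma_op a u) (rd R (zip (vseq (Suc a) n) ((h @ [s]) @ p # q # w))) [Suc a..<n - 1] =
  rd R (zip (vseq (n - 1) n) ((h @ [s]) @ lam p q w))"
 proof (rule Cons.IH)
  show "q <= p" by (rule K3_row_inv[OF K Cons.prems(1)])
  have "{p, q} \<subseteq> {x, y, z}" using set by blast
  thus "\<forall>i\<in>set (p # q # w). i < R" using Cons.prems(2) by auto
 qed (use Cons.prems in auto)
 thus ?case unfolding up using st K by simp
qed

section \<open>The domino operator on tableaux of lattice words\<close>

definition tab :: "nat list => nat list list" where
 "tab u = tbl (length (sh u)) (zip [1..<Suc (length u)] u)"

lemma length_row: "length vs = length u ==> length (row (zip vs u) j) = ct u j"
 by (induction vs u rule: list_induct2) (auto simp: row_simps ct_def)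

lemma length_sh: "lat u ==> j < length (sh u) \<longleftrightarrow> 0 < ct u j"
proof -
 assume l: "lat u"
 have "sh u \<in> parts (length u)" using l by (intro sh_parts) (simp add: LW_def)
 thus ?thesis using parts_pos fn_sh[OF l] by (metis fn_def less_irrefl nth_mem)
qed

lemma shape_tab: assumes l: "lat u" shows "shape (tab u) = sh u"
proof (rule nth_equalityI)
 fix i assume "i < length (shape (tab u))"
 hence i: "i < length (sh u)" by (simp add: shape_def tab_def tbl_def)
 hence "shape (tab u) ! i = ct u i" by (simp add: shape_def tab_def tbl_def length_row del: upt_Suc)
 thus "shape (tab u) ! i = sh u ! i" using fn_sh[OF l] i by (metis fn_def)
qed (simp add: shape_def tab_def tbl_def)

lemma split_lens_concat: "split_lens (map length Ts) (concat Ts) = Ts"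
 by (induction Ts) auto

lemma refill_reading: "refill (map length T) (reading T) = T"
 unfolding refill_def reading_def rev_map by (simp add: split_lens_concat)

lemma lat_row_lt: "lat u ==> x \<in> set u ==> x < length (sh u)"
 using length_sh ct_pos by blast

lemma mset_lam: "mset (lam x y w) = {#x, y#} + mset w"
proof (induction w arbitrary: x y)
 case (Cons z w)
 obtain s p q where K: "K3 x y z = (s, p, q)" by (metis prod_cases3)
 have e: "{#s, p, q#} = {#x, y, z#}" using K by (auto simp: K3_def split: if_splits)
 have "mset (lam x y (z # w)) = {#s, p, q#} + mset w" using Cons[of p q] K by simp
 thus ?case unfolding e by simp
qed simp

lemma ct_zip_rows: "length vs = length u ==> map length (tbl R (zip vs u)) = map (ct u) [0..<R]"
 by (simp add: tbl_def length_row)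

lemma filter_row_upt: "filter (%j. j < k) [0..<R] = [0..<min k R]"
 by (induction R) (auto simp: min_def le_Suc_eq)

text \<open>After all the sigma operators the cells are those of \<open>Lam u\<close>, with the
  repeated entry \<open>n - 1\<close> on its final pair. Deleting these two cells truncates
  \<open>Lam u\<close>, and the rows that become empty are the ones without letters in the truncated
  word.\<close>

lemma B0_tab:
 assumes l: "lat u" and n: "length u = n" "2 <= n" and d: "\<not> u ! 0 < u ! 1"
 shows "B0 (tab u) = tab (take (n - 2) (Lam u))"
proof -
 define R where "R = length (sh u)"
 obtain x y w where u: "u = x # y # w" using n by (cases u rule: dvw.cases) auto
 have xy: "y <= x" using d u by simp
 have lt: "\<forall>i\<in>set u. i < R" using lat_row_lt[OF l] by (simp add: R_def)
 have T: "tab u = tbl R (zip [1..<Suc n] u)" by (simp add: tab_def R_def n)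
 have len: "length (reading (tab u)) = n"
 proof -
  have "length (reading (tab u)) = sum_list (shape (tab u))" by (simp add: reading_def shape_def length_concat rev_map[symmetric] sum_list_rev)
  thus ?thesis using shape_tab[OF l] sh_parts[of u n] l n by (simp add: LW_def parts_sum)
 qed
 have tau: "tau_m1 (reading (tab u)) = rd R (zip [0..<n] u)"
 proof -
  have "map (%x. x - 1) (row (zip [1..<Suc n] u) j) = row (zip [0..<n] u) j" for j
  proof -
   have "zip [1..<Suc n] u = map (%p. (Suc (fst p), snd p)) (zip [0..<n] u)"
    unfolding One_nat_def map_Suc_upt[symmetric] zip_map1 by (simp add: case_prod_beta)
   thus ?thesis by (simp add: row_def filter_map comp_def)
  qed
  thus ?thesis by (simp add: T reading_tbl tau_m1_def rd_def map_concat comp_def)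
 qed
 have z0: "zip [0..<n] u = [] @ zip [0, 1] [x, y] @ zip [2..<n] w"
  using n u by (simp add: upt_conv_Cons numeral_2_eq_2)
 have z1: "zip (vseq 1 n) u = [] @ zip [1, 1] [x, y] @ zip [2..<n] w"
  by (simp add: vseq_def u numeral_2_eq_2)
 have C: "fst p \<notin> {0, 1}" if "p \<in> set (zip [2..<n] w)" for p
 proof -
  have "fst p \<in> set [2..<n]" using that by (metis prod.collapse set_zip_leftD)
  thus ?thesis by auto
 qed
 have f0: "filter (%v. v \<in> {0, 1}) (rd R (zip [0..<n] u)) = [0, 1]"
 proof -
  have "filter (%v. v \<in> {0, 1}) (rd R (zip [0..<n] u)) = rd R (zip [0, 1] [x, y])"
   unfolding z0 by (rule rd_filter_mid) (use C in auto)
  also have "... = [0, 1]" by (subst rd_sorted) (use xy lt u in auto)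
  finally show ?thesis .
 qed
 have f1: "filter (%v. v \<in> {0, 1}) (rd R (zip (vseq 1 n) u)) = [1, 1]"
 proof -
  have "filter (%v. v \<in> {0, 1}) (rd R (zip (vseq 1 n) u)) = rd R (zip [1, 1] [x, y])"
   unfolding z1 by (rule rd_filter_mid) (use C in auto)
  also have "... = [1, 1]" by (subst rd_sorted) (use xy lt u in auto)
  finally show ?thesis .
 qed
 have r: "r_op 0 1 1 1 (rd R (zip [0..<n] u)) = rd R (zip (vseq 1 n) u)"
 proof -
  have g: "map (%v. if v = 0 then 1 else v) (rd R (zip [0..<n] u)) = map (%v. if v = 0 then 1 else v) (rd R (zip (vseq 1 n) u))"
   unfolding z0 z1 by (rule rd_collapse[where a = 1]) auto
  have "put_at (positions {0, 1} (rd R (zip [0..<n] u))) (filter (%v. v \<in> {0, 1}) (rd R (zip (vseq 1 n) u))) (rd R (zip [0..<n] u)) = rd R (zip (vseq 1 n) u)"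
   by (rule put_at_positions[OF list_all2_collapse[OF g]]) (auto split: if_splits)
  thus ?thesis unfolding r_op_def Let_def map_positions f0 f1 by simp
 qed
 have W: "foldl (%u a. sigma_op a u) (r_op 0 1 1 1 (tau_m1 (reading (tab u)))) [1..<n - 1] = rd R (zip (vseq (n - 1) n) (Lam u))"
  unfolding tau r using sigma_fold[of y x w R "[]" 1 n] xy lt n u by (simp add: Lam_def)
 have lU: "length (Lam u) = n" using n u by (simp add: Lam_def)
 have lv: "length (vseq (n - 1) n) = length (Lam u)" using n lU by (simp add: vseq_def)
 have ctU: "ct (Lam u) = ct u" by (simp add: ct_def Lam_def u mset_lam)
 have O: "on_word (%w. foldl (%u a. sigma_op a u) (r_op 0 1 1 1 (tau_m1 w)) [1..<n - 1]) (tab u) = tbl R (zip (vseq (n - 1) n) (Lam u))"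
 proof -
  have "shape (tab u) = map length (tbl R (zip (vseq (n - 1) n) (Lam u)))"
   unfolding ct_zip_rows[OF lv] ctU shape_def T by (rule ct_zip_rows) (simp add: n)
  thus ?thesis unfolding on_word_def W reading_tbl[symmetric] by (simp add: refill_reading)
 qed
 define v where "v = take (n - 2) (Lam u)"
 have latv: "lat v" unfolding v_def using Lam_tr[OF l] lat_take by blast
 have lenv: "length v = n - 2" by (simp add: v_def lU)
 \<comment> \<open>Separates the last two cells, both with entry \<open>n - 1\<close>, from the
   standard part.\<close>
 have zz: "zip (vseq (n - 1) n) (Lam u) = zip [1..<Suc (length v)] v @ zip [n - 1, n - 1] (drop (n - 2) (Lam u))"
 proof -
  have v1: "vseq (n - 1) n = [1..<Suc (length v)] @ [n - 1, n - 1]"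
  proof -
   have "Suc (length v) = n - 1" "Suc (n - 1) = n" using n lenv by linarith+
   thus ?thesis by (simp only: vseq_def upt_conv_Nil[OF order_refl] append_Nil2)
  qed
  have "Lam u = v @ drop (n - 2) (Lam u)" by (simp add: v_def)
  hence "zip (vseq (n - 1) n) (Lam u) = zip ([1..<Suc (length v)] @ [n - 1, n - 1]) (v @ drop (n - 2) (Lam u))"
   unfolding v1 by (rule arg_cong)
  also have "... = zip [1..<Suc (length v)] v @ zip [n - 1, n - 1] (drop (n - 2) (Lam u))"
   by (rule zip_append) (simp del: upt_Suc)
  finally show ?thesis .
 qed
 have rowf: "filter (%x. x ~= n - 1) (row (zip (vseq (n - 1) n) (Lam u)) j) = row (zip [1..<Suc (length v)] v) j" for j
 proof -
  have "filter (%x. x ~= n - 1) (row (zip [1..<Suc (length v)] v) j) = row (zip [1..<Suc (length v)] v) j"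
   by (rule row_filter_all) (use n lenv in \<open>auto dest!: set_zip_leftD\<close>)
  moreover have "filter (%x. x ~= n - 1) (row (zip [n - 1, n - 1] (drop (n - 2) (Lam u))) j) = []"
   by (rule row_filter_none) (auto dest!: set_zip_leftD)
  ultimately show ?thesis unfolding zz row_append by simp
 qed
 have "del_cells (n - 1) (tbl R (zip (vseq (n - 1) n) (Lam u))) = map (row (zip [1..<Suc (length v)] v)) (filter (%j. row (zip [1..<Suc (length v)] v) j ~= []) [0..<R])"
  unfolding del_cells_def tbl_def map_map comp_def rowf filter_map ..
 also have "filter (%j. row (zip [1..<Suc (length v)] v) j ~= []) [0..<R] = filter (%j. j < length (sh v)) [0..<R]"
 proof (intro filter_cong refl)
  fix j
  show "row (zip [1..<Suc (length v)] v) j ~= [] \<longleftrightarrow> j < length (sh v)"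
   using length_row[of "[1..<Suc (length v)]" v j] length_sh[OF latv, of j] by (metis length_greater_0_conv length_upt diff_Suc_1)
 qed
 also have "... = [0..<length (sh v)]"
 proof -
  have "length (sh v) <= R"
  proof (rule ccontr)
   assume "\<not> length (sh v) <= R"
   hence "0 < ct v R" using length_sh[OF latv, of R] not_le by blast
   hence "R \<in> set (Lam u)" using ct_pos in_set_takeD by (metis v_def)
   hence "0 < ct u R" using ctU ct_pos by metis
   thus False using length_sh[OF l, of R] unfolding R_def by blast
  qed
  thus ?thesis by (simp add: filter_row_upt min_def)
 qed
 finally have "del_cells (n - 1) (tbl R (zip (vseq (n - 1) n) (Lam u))) = tab v"
  by (simp only: tab_def tbl_def)
 thus ?thesis unfolding B0_def Let_def len O v_def[symmetric] .
qed

declare upt_Suc [simp del]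

section \<open>The bijection with standard tableaux\<close>

definition rj :: "nat list => nat => nat list" where "rj u j = row (zip [1..<Suc (length u)] u) j"

lemma rj_snoc: "rj (u @ [x]) j = rj u j @ (if x = j then [Suc (length u)] else [])"
proof -
 have "zip [1..<Suc (length (u @ [x]))] (u @ [x]) = zip ([1..<Suc (length u)] @ [Suc (length u)]) (u @ [x])"
  by (simp add: upt_Suc_append)
 also have "... = zip [1..<Suc (length u)] u @ zip [Suc (length u)] [x]" by (rule zip_append) simp
 finally show ?thesis by (simp add: rj_def row_append row_simps)
qed

lemma rj_Nil [simp]: "rj [] j = []" by (simp add: rj_def row_def)

lemma length_rj: "length (rj u j) = ct u j" unfolding rj_def by (rule length_row) simp

lemma rj_le: "x \<in> set (rj u j) ==> 0 < x & x <= length u"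
proof (induction u rule: rev_induct)
 case (snoc y u)
 hence "x \<in> set (rj u j) | x = Suc (length u)" unfolding rj_snoc by (auto split: if_splits)
 thus ?case using snoc.IH by auto
qed simp

lemma rj_sorted: "sorted_wrt (<) (rj u j)"
proof (induction u rule: rev_induct)
 case (snoc y u)
 have "\<forall>x\<in>set (rj u j). x < Suc (length u)" by (auto simp: less_Suc_eq_le dest: rj_le)
 thus ?case using snoc unfolding rj_snoc by (simp add: sorted_wrt_append)
qed simp

lemma set_rj: "set (rj u j) = {Suc k | k. k < length u & u ! k = j}"
proof (induction u rule: rev_induct)
 case (snoc y u)
 have SUB: "{Suc k |k. k < length (u @ [y]) & (u @ [y]) ! k = j} = {Suc k |k. k < length u & u ! k = j} \<union> (if y = j then {Suc (length u)} else {})"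
 proof (intro set_eqI iffI)
  fix e assume "e \<in> {Suc k |k. k < length (u @ [y]) & (u @ [y]) ! k = j}"
  then obtain k where "e = Suc k" "k < Suc (length u)" "(u @ [y]) ! k = j" by auto
  thus "e \<in> {Suc k |k. k < length u & u ! k = j} \<union> (if y = j then {Suc (length u)} else {})"
   by (cases "k = length u") (auto simp: nth_append)
 next
  fix e assume e: "e \<in> {Suc k |k. k < length u & u ! k = j} \<union> (if y = j then {Suc (length u)} else {})"
  show "e \<in> {Suc k |k. k < length (u @ [y]) & (u @ [y]) ! k = j}"
  proof (cases "e \<in> {Suc k |k. k < length u & u ! k = j}")
   case True
   then obtain k where "e = Suc k" "k < length u" "u ! k = j" by blast
   hence "e = Suc k & k < length (u @ [y]) & (u @ [y]) ! k = j" by (simp add: nth_append)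
   thus ?thesis by blast
  next
   case False
   hence "e \<in> (if y = j then {Suc (length u)} else {})" using e by blast
   hence "y = j" "e = Suc (length u)" by (simp_all split: if_splits)
   hence "e = Suc (length u) & length u < length (u @ [y]) & (u @ [y]) ! length u = j" by simp
   thus ?thesis by blast
  qed
 qed
 have s: "set (if y = j then [Suc (length u)] else []) = (if y = j then {Suc (length u)} else {})" by simp
 show ?case unfolding rj_snoc set_append snoc s by (rule SUB[symmetric])
qed simp

lemma rj_take: "k <= length u ==> \<exists>B. rj u j = rj (take k u) j @ B"
proof (induction u rule: rev_induct)
 case (snoc y u)
 show ?case
 proof (cases "k <= length u")
  case True
  then obtain B where "rj u j = rj (take k u) j @ B" using snoc.IH by blast
  moreover have "take k (u @ [y]) = take k u" using True by simp
  ultimately show ?thesis by (simp only: rj_snoc append_assoc) blast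
 next
  case False
  hence "take k (u @ [y]) = u @ [y]" by simp
  thus ?thesis by (metis append_Nil2)
 qed
qed simp

lemma rj_cell:
 assumes "k < length u" shows "rj u (u ! k) ! ct (take k u) (u ! k) = Suc k" "ct (take k u) (u ! k) < ct u (u ! k)"
proof -
 have t: "take (Suc k) u = take k u @ [u ! k]" using assms by (simp add: take_Suc_conv_app_nth)
 obtain B where B: "rj u (u ! k) = rj (take (Suc k) u) (u ! k) @ B" using rj_take[of "Suc k" u] assms by (meson Suc_leI)
 have e: "rj (take (Suc k) u) (u ! k) = rj (take k u) (u ! k) @ [Suc k]"
  unfolding t rj_snoc using assms by simp
 have l: "length (rj (take k u) (u ! k)) = ct (take k u) (u ! k)" by (rule length_rj)
 show "rj u (u ! k) ! ct (take k u) (u ! k) = Suc k" unfolding B e l[symmetric] by (simp only: append_assoc nth_append_length append_Cons)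
 have "length (rj u (u ! k)) = ct u (u ! k)" by (rule length_rj)
 thus "ct (take k u) (u ! k) < ct u (u ! k)" unfolding B e l[symmetric] by simp
qed

lemma rj_cell_ex:
 assumes "c < ct u j" shows "\<exists>k<length u. u ! k = j & ct (take k u) j = c & rj u j ! c = Suc k"
proof -
 have "rj u j ! c \<in> set (rj u j)" using assms length_rj[of u j] by (metis nth_mem)
 then obtain k where k: "rj u j ! c = Suc k" "k < length u" "u ! k = j" unfolding set_rj by blast
 have "rj u j ! ct (take k u) j = rj u j ! c" "ct (take k u) j < ct u j" using rj_cell[OF k(2)] k by auto
 moreover have "distinct (rj u j)" using rj_sorted strict_sorted_iff by blast
 ultimately have "ct (take k u) j = c" using assms length_rj[of u j] by (metis nth_eq_iff_index_eq)
 thus ?thesis using k by blast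
qed

text \<open>When the cell in the higher row is added, the lattice condition says that the lower row
  already extends past that column, so its entry there is older.\<close>

lemma rj_column:
 assumes l: "lat u" and j: "j < j'" and c: "c < ct u j'"
 shows "rj u j ! c < rj u j' ! c"
proof -
 obtain k where k: "k < length u" "u ! k = j'" "ct (take k u) j' = c" "rj u j' ! c = Suc k" using rj_cell_ex[OF c] by blast
 have "lat (take k u @ [u ! k])" using lat_take[OF l, of "Suc k"] k(1) by (simp add: take_Suc_conv_app_nth)
 hence cj: "c < ct (take k u) j" using j k by (simp add: lat_snoc)
 obtain B where B: "rj u j = rj (take k u) j @ B" using rj_take[of k u] k(1) by (meson less_imp_le)
 have lc: "c < length (rj (take k u) j)" unfolding length_rj by (rule cj)
 hence "rj u j ! c \<in> set (rj (take k u) j)" unfolding B by (simp only: nth_append if_True nth_mem)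
 hence "rj u j ! c <= length (take k u)" using rj_le by blast
 thus ?thesis using k by simp
qed

lemma tab_rj: "tab u = map (rj u) [0..<length (sh u)]" by (simp add: tab_def tbl_def rj_def)

lemma semistandard_tab: assumes l: "lat u" shows "semistandard (tab u)"
 unfolding semistandard_def
proof (intro conjI ballI allI impI)
 fix r assume "r \<in> set (tab u)"
 then obtain j where "r = rj u j" by (auto simp: tab_rj)
 thus "sorted r" using rj_sorted strict_sorted_iff by blast
next
 fix i j assume a: "i + 1 < length (tab u) & j < length (tab u ! (i + 1))"
 hence i: "Suc i < length (sh u)" by (simp add: tab_rj)
 hence "tab u ! (i + 1) = rj u (Suc i)" "tab u ! i = rj u i" by (simp_all add: tab_rj)
 moreover have "j < ct u (Suc i)" using a calculation(1) length_rj by metis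
 ultimately show "tab u ! i ! j < tab u ! (i + 1) ! j" using rj_column[OF l, of i "Suc i" j] by simp
qed

lemma mset_concat_rj:
 "set u \<subseteq> {..<R} ==> mset (concat (map (rj u) [0..<R])) = mset [1..<Suc (length u)]"
proof (induction u rule: rev_induct)
 case (snoc x u)
 have ins: "mset (concat (map (%j. g j @ (if x = j then [v] else [])) [0..<R])) = mset (concat (map g [0..<R])) + (if x < R then {#v#} else {#})"
  for g :: "nat => nat list" and v R by (induction R) (auto simp: less_Suc_eq upt_Suc_append)
 have "rj (u @ [x]) = (%j. rj u j @ (if x = j then [Suc (length u)] else []))" by (rule ext) (rule rj_snoc)
 hence "mset (concat (map (rj (u @ [x])) [0..<R])) = mset (concat (map (rj u) [0..<R])) + {#Suc (length u)#}"
  using snoc.prems by (simp only: ins) simp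
 moreover have "[1..<Suc (length (u @ [x]))] = [1..<Suc (length u)] @ [Suc (length u)]" by (simp add: upt_Suc_append)
 ultimately show ?case using snoc by (simp only: mset_append) simp
qed (simp add: concat_eq_Nil_conv)

lemma standard_tab: assumes u: "u \<in> LW n" shows "standard n (tab u)"
proof -
 have l: "lat u" and n: "length u = n" using u by (auto simp: LW_def)
 have "mset (concat (tab u)) = mset [1..<n + 1]"
  unfolding tab_rj by (subst mset_concat_rj) (use lat_row_lt[OF l] n in auto)
 moreover have "is_partition (shape (tab u))" using sh_parts[OF u] by (simp add: shape_tab[OF l] parts_def)
 ultimately show ?thesis using semistandard_tab[OF l] by (simp add: standard_def)
qed

lemma inj_tab: "inj_on tab (LW n)"
proof (rule inj_onI)
 fix u u' assume u: "u \<in> LW n" "u' \<in> LW n" and e: "tab u = tab u'"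
 have l: "lat u" "lat u'" "length u = n" "length u' = n" using u by (auto simp: LW_def)
 have R: "length (sh u) = length (sh u')" using arg_cong[OF e, of length] by (simp add: tab_rj)
 show "u = u'"
 proof (rule nth_equalityI)
  fix k assume k: "k < length u"
  have j: "u ! k < length (sh u)" using lat_row_lt[OF l(1)] k by simp
  hence "rj u (u ! k) = rj u' (u ! k)"
   using arg_cong[OF e, of "%T. T ! (u ! k)"] R by (simp add: tab_rj)
  moreover have "Suc k \<in> set (rj u (u ! k))" unfolding set_rj using k by blast
  ultimately have "Suc k \<in> set (rj u' (u ! k))" by simp
  thus "u ! k = u' ! k" unfolding set_rj by auto
 qed (simp add: l)
qed

lemma lat_prefix:
 "(\<And>k i. k <= length u ==> ct (take k u) (Suc i) <= ct (take k u) i) ==> lat u"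
proof (induction u rule: rev_induct)
 case (snoc x u)
 have l: "lat u"
 proof (rule snoc.IH)
  fix k i assume "k <= length u"
  thus "ct (take k u) (Suc i) <= ct (take k u) i" using snoc.prems[of k i] by simp
 qed
 have "ct u x < ct u i" if h: "i < x" for i
 proof -
  obtain y where y: "x = Suc y" "i <= y" using h by (cases x) auto
  have "Suc (ct u x) <= ct u y" using snoc.prems[of "Suc (length u)" y] y by (simp add: ct_simps)
  also have "... <= ct u i" using antimonoD[OF lat_antimono[OF l] y(2)] .
  finally show ?thesis by simp
 qed
 thus ?case using l by (simp add: lat_snoc)
qed (simp add: lat_def)

lemma ct_take_rj: "k <= length u ==> ct (take k u) j = length (filter (%e. e <= k) (rj u j))"
proof (induction u rule: rev_induct)
 case (snoc x u)
 show ?case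
 proof (cases "k <= length u")
  case True
  thus ?thesis using snoc.IH by (simp only: rj_snoc) simp
 next
  case False
  hence k: "k = length (u @ [x])" using snoc.prems by simp
  have "filter (%e. e <= k) (rj (u @ [x]) j) = rj (u @ [x]) j" using rj_le[of _ "u @ [x]"] k by (auto intro!: filter_True)
  thus ?thesis using length_rj[of "u @ [x]" j] k by simp
 qed
qed (simp add: ct_simps)

lemma filter_column_le:
 assumes "length R2 <= length R" "\<And>c. c < length R2 ==> R ! c < R2 ! c"
 shows "length (filter (%e. e <= k) R2) <= length (filter (%e. e <= (k::nat)) R)"
 unfolding length_filter_conv_card
 by (rule card_mono) (use assms in \<open>fastforce simp: less_le_trans intro: less_imp_le\<close>)+

text \<open>The word lists the row of each entry. It is a lattice word because, by column
  strictness, no initial interval of entries meets a row more often than the row below it.\<close>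

lemma surj_tab: assumes T: "standard n T" shows "\<exists>u\<in>LW n. tab u = T"
proof -
 define R where "R = length T"
 have part: "is_partition (shape T)" and ss: "semistandard T" and ms: "mset (concat T) = mset [1..<n + 1]"
  using T by (auto simp: standard_def)
 have dist: "distinct (concat T)" using ms distinct_upt mset_eq_imp_distinct_iff by blast
 have setT: "set (concat T) = {1..n}" using mset_eq_setD[OF ms] by auto
 have disj: "i = j" if "i < R" "j < R" "k \<in> set (T ! i)" "k \<in> set (T ! j)" for i j k
 proof -
  have "False" if "i < j" "j < R" "k \<in> set (T ! i)" "k \<in> set (T ! j)" for i j
  proof -
   have "T = take j T @ T ! j # drop (Suc j) T" using that by (simp add: id_take_nth_drop R_def)
   hence "concat T = concat (take j T) @ T ! j @ concat (drop (Suc j) T)" by (metis concat.simps(2) concat_append)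
   hence "set (concat (take j T)) \<inter> set (T ! j) = {}" using dist by auto
   moreover have "T ! i \<in> set (take j T)" using that by (auto simp: R_def in_set_conv_nth intro!: exI[of _ i])
   ultimately show False using that by auto
  qed
  thus ?thesis using that by (metis linorder_neqE_nat)
 qed
 define \<rho> where "\<rho> k = (SOME j. j < R & k \<in> set (T ! j))" for k
 have \<rho>: "\<rho> k < R & k \<in> set (T ! \<rho> k)" if "k \<in> {1..n}" for k
 proof -
  have "\<exists>j. j < R & k \<in> set (T ! j)"
  proof -
   have "k \<in> set (concat T)" using that setT by simp
   then obtain r where "r \<in> set T" "k \<in> set r" by auto
   thus ?thesis by (metis R_def in_set_conv_nth)
  qed
  thus ?thesis unfolding \<rho>_def by (rule someI_ex)
 qed
 define u where "u = map \<rho> [1..<Suc n]"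
 have lu: "length u = n" by (simp add: u_def)
 have unth: "u ! k = \<rho> (Suc k)" if "k < n" for k using that by (simp add: u_def)
 have rows: "rj u j = T ! j" if j: "j < R" for j
 proof (rule strict_sorted_equal[OF _ rj_sorted])
  have d: "distinct (T ! j)" using dist j by (auto simp: R_def distinct_concat_iff)
  have "sorted (T ! j)" using ss j by (auto simp: semistandard_def R_def)
  thus "sorted_wrt (<) (T ! j)" using d by (simp add: strict_sorted_iff)
  show "set (rj u j) = set (T ! j)"
  proof (intro set_eqI iffI)
   fix e assume "e \<in> set (rj u j)"
   then obtain k where "e = Suc k" "k < n" "\<rho> (Suc k) = j" unfolding set_rj using lu unth by auto
   thus "e \<in> set (T ! j)" using \<rho>[of "Suc k"] by auto
  next
   fix e assume e: "e \<in> set (T ! j)"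
   hence en: "e \<in> {1..n}" using setT j by (auto simp: R_def)
   hence "\<rho> e = j" using disj[OF _ j _ e] \<rho>[OF en] by blast
   thus "e \<in> set (rj u j)" unfolding set_rj using en lu unth[of "e - 1"] by (auto intro!: exI[of _ "e - 1"])
  qed
 qed
 have lat: "lat u"
 proof (rule lat_prefix)
  fix k i assume k: "k <= length u"
  show "ct (take k u) (Suc i) <= ct (take k u) i"
  proof (cases "Suc i < R")
   case True
   have "length (T ! Suc i) <= length (T ! i)"
    using part True by (auto simp: is_partition_def shape_def R_def sorted_wrt_iff_nth_less)
   moreover have "T ! i ! c < T ! Suc i ! c" if "c < length (T ! Suc i)" for c
    using ss that True by (simp add: semistandard_def R_def)
   ultimately show ?thesis unfolding ct_take_rj[OF k] rows[OF True] rows[OF Suc_lessD[OF True]]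
    by (rule filter_column_le)
  next
   case False
   have "Suc i \<notin> set u" using \<rho> False by (auto simp: u_def)
   hence "ct (take k u) (Suc i) = 0" by (auto simp: ct_def not_in_iff[symmetric] dest: in_set_takeD)
   thus ?thesis by simp
  qed
 qed
 hence uL: "u \<in> LW n" by (simp add: LW_def lu)
 have "shape T \<in> parts n"
 proof -
  have "sum_list (shape T) = length (concat T)" by (simp add: shape_def length_concat)
  also have "... = n" using arg_cong[OF ms, of size] by simp
  finally show ?thesis using part by (simp add: parts_def)
 qed
 hence "sh u = shape T"
 proof (rule fn_inj[OF sh_parts[OF uL] _ _ order_refl])
  fix j
  show "fn (sh u) j = fn (shape T) j"
  proof (cases "j < R")
   case True
   thus ?thesis using length_rj[of u j] rows[OF True] by (simp add: fn_sh[OF lat] fn_def shape_def R_def)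
  next
   case False
   hence "j \<notin> set u" using \<rho> by (auto simp: u_def)
   thus ?thesis using False by (simp add: fn_sh[OF lat] fn_def shape_def R_def ct_def not_in_iff)
  qed
 qed
 hence "length (sh u) = R" by (simp add: shape_def R_def)
 hence "tab u = T" using rows by (intro nth_equalityI) (simp_all add: tab_rj R_def)
 thus ?thesis using uL by blast
qed

lemma tab_image: "tab ` LW n = std_tableaux n"
 using standard_tab surj_tab by (auto simp: std_tableaux_def) (metis imageI)

section \<open>Statistics and transposition of tableaux\<close>

lemma pos_append_less: "a \<in> set A ==> b \<notin> set A ==> pos (A @ B) a < pos (A @ B) b"
proof -
 assume a: "a \<in> set A" and b: "b \<notin> set A"
 have "takeWhile (%y. y ~= a) (A @ B) = takeWhile (%y. y ~= a) A" by (rule takeWhile_append1[OF a]) simp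
 moreover have "length (takeWhile (%y. y ~= a) A) < length A" using a by (induction A) auto
 moreover have "takeWhile (%y. y ~= b) (A @ B) = A @ takeWhile (%y. y ~= b) B" by (rule takeWhile_append2) (use b in auto)
 ultimately show ?thesis by (simp add: pos_def)
qed

text \<open>Higher rows are read earlier, and within a row the smaller entry comes first; so the
  later of two consecutive entries is read first exactly when its row is higher.\<close>

lemma pos_tab:
 assumes l: "lat u" and k: "Suc k < length u"
 shows "pos (reading (tab u)) (Suc (Suc k)) < pos (reading (tab u)) (Suc k) \<longleftrightarrow> u ! k < u ! Suc k"
proof -
 define R where "R = length (sh u)"
 have w: "reading (tab u) = concat (map (rj u) (rev [0..<R]))" by (simp add: tab_rj reading_def rev_map R_def)
 have inr: "Suc i \<in> set (rj u j) \<longleftrightarrow> u ! i = j" if "i < length u" for i j unfolding set_rj using that by auto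
 have lt: "u ! i < R" if "i < length u" for i using lat_row_lt[OF l] that by (simp add: R_def)
 have split: "concat (map (rj u) (rev [0..<R])) = concat (map (rj u) (rev [r..<R])) @ concat (map (rj u) (rev [0..<r]))" if "r <= R" for r
 proof -
  have "[0..<R] = [0..<r] @ [r..<R]" using that using upt_add_eq_append[of 0 r "R - r"] by simp
  thus ?thesis by simp
 qed
 show ?thesis
 proof (cases "u ! k < u ! Suc k")
  case True
  have "pos (reading (tab u)) (Suc (Suc k)) < pos (reading (tab u)) (Suc k)"
   unfolding w split[OF less_imp_le[OF lt[OF k]]]
  proof (rule pos_append_less)
   show "Suc (Suc k) \<in> set (concat (map (rj u) (rev [u ! Suc k..<R])))" using inr[OF k] lt[OF k] by auto
   show "Suc k \<notin> set (concat (map (rj u) (rev [u ! Suc k..<R])))" using inr[OF Suc_lessD[OF k]] True by auto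
  qed
  thus ?thesis using True by simp
 next
  case False
  let ?r = "u ! k"
  have r: "?r < R" using lt k by simp
  obtain B where B: "rj u ?r = rj (take (Suc k) u) ?r @ B" using rj_take[of "Suc k" u] k by (meson less_imp_le)
  have "[?r..<R] = ?r # [Suc ?r..<R]" using r by (simp add: upt_conv_Cons)
  hence w': "reading (tab u) = (concat (map (rj u) (rev [Suc ?r..<R])) @ rj (take (Suc k) u) ?r) @ (B @ concat (map (rj u) (rev [0..<?r])))"
   unfolding w split[OF less_imp_le[OF r]] using B by simp
  have "pos (reading (tab u)) (Suc k) < pos (reading (tab u)) (Suc (Suc k))"
   unfolding w'
  proof (rule pos_append_less)
   have "Suc k \<in> set (rj (take (Suc k) u) ?r)" unfolding set_rj using k by auto
   thus "Suc k \<in> set (concat (map (rj u) (rev [Suc ?r..<R])) @ rj (take (Suc k) u) ?r)" by simp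
   have "Suc (Suc k) \<notin> set (rj (take (Suc k) u) ?r)" using rj_le[of "Suc (Suc k)" "take (Suc k) u" ?r] by auto
   thus "Suc (Suc k) \<notin> set (concat (map (rj u) (rev [Suc ?r..<R])) @ rj (take (Suc k) u) ?r)"
    using inr[OF k] False by auto
  qed
  thus ?thesis using False by simp
 qed
qed

lemma length_reading_tab: "u \<in> LW n ==> length (reading (tab u)) = n"
proof -
 assume u: "u \<in> LW n"
 have "length (reading (tab u)) = length (concat (tab u))" by (simp add: reading_def length_concat rev_map[symmetric] sum_list_rev)
 also have "... = size (mset [1..<n + 1])" using standard_tab[OF u] unfolding standard_def by (metis size_mset)
 finally show ?thesis by simp
qed

lemma cmaj_sum: "cmaj u = (\<Sum>i<length u. \<Sum>j<i. if u ! j < u ! Suc j then 1 else 0)"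
proof (induction u rule: cmaj.induct)
 case (3 x y w)
 let ?v = "y # w" and ?\<delta> = "if x < y then 1 else 0 :: nat"
 have "(\<Sum>i<length (x # ?v). \<Sum>j<i. if (x # ?v) ! j < (x # ?v) ! Suc j then 1 else 0) =
  (\<Sum>i<length ?v. ?\<delta> + (\<Sum>j<i. if ?v ! j < ?v ! Suc j then 1 else 0))"
  by (simp only: length_Cons[of x] sum.lessThan_Suc_shift nth_Cons_Suc nth_Cons_0 lessThan_0 sum.empty add_0)
 also have "... = length ?v * ?\<delta> + cmaj ?v" unfolding sum.distrib 3 by simp
 finally show ?case by simp
qed simp_all

lemma cocharge_tab: assumes u: "u \<in> LW n" shows "cocharge (reading (tab u)) = cmaj u"
proof -
 let ?w = "reading (tab u)"
 have l: "lat u" "length u = n" using u by (auto simp: LW_def)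
 have "cocharge ?w = (\<Sum>i<n. card {j. 1 <= j & j < Suc i & pos ?w (j + 1) < pos ?w j})"
  unfolding cocharge_def length_reading_tab[OF u]
  by (rule sum.reindex_bij_witness[where i = Suc and j = "%i. i - 1"]) auto
 also have "... = (\<Sum>i<n. \<Sum>j<i. if u ! j < u ! Suc j then 1 else 0)"
 proof (intro sum.cong refl)
  fix i assume i: "i \<in> {..<n}"
  have "{j. 1 <= j & j < Suc i & pos ?w (j + 1) < pos ?w j} = Suc ` {j\<in>{..<i}. u ! j < u ! Suc j}"
  proof (intro set_eqI iffI)
   fix j assume j: "j \<in> {j. 1 <= j & j < Suc i & pos ?w (j + 1) < pos ?w j}"
   then obtain k where "j = Suc k" by (cases j) auto
   thus "j \<in> Suc ` {j\<in>{..<i}. u ! j < u ! Suc j}" using j pos_tab[OF l(1), of k] i l(2) by auto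
  next
   fix j assume "j \<in> Suc ` {j\<in>{..<i}. u ! j < u ! Suc j}"
   then obtain k where "j = Suc k" "k < i" "u ! k < u ! Suc k" by auto
   thus "j \<in> {j. 1 <= j & j < Suc i & pos ?w (j + 1) < pos ?w j}" using pos_tab[OF l(1), of k] i l(2) by auto
  qed
  thus "card {j. 1 <= j & j < Suc i & pos ?w (j + 1) < pos ?w j} = (\<Sum>j<i. if u ! j < u ! Suc j then 1 else 0)"
   by (simp add: card_image sum.inter_filter[symmetric])
 qed
 finally show ?thesis by (simp add: cmaj_sum l)
qed

lemma tr_nth: "k < length u ==> tr u ! k = ct (take k u) (u ! k)"
proof (induction u rule: rev_induct)
 case (snoc x u)
 thus ?case by (auto simp: tr_snoc nth_append less_Suc_eq)
qed simp

text \<open>A row of the transposed tableau lists a column of \<open>tab u\<close>, increasing by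
  \<open>rj_column\<close>; its entries are the times at which \<open>tr u\<close> records this
  column. Two increasing lists with the same set of entries coincide.\<close>

lemma transpose_tab: assumes l: "lat u" shows "tab_transpose (tab u) = tab (tr u)"
proof -
 have lt: "lat (tr u)" by (rule lat_tr[OF l])
 have len: "length (List.transpose (tab u)) = length (sh (tr u))"
 proof (cases "u = []")
  case True
  thus ?thesis by (simp add: tab_def tbl_def tr_def sh_def shp_def)
 next
  case False
  have "sorted_wrt (\<ge>) (map length (tab u))"
   using shape_tab[OF l] sh_parts[of u "length u"] l by (simp add: shape_def LW_def parts_def is_partition_def)
  hence "sorted (rev (map length (tab u)))" by (simp add: sorted_wrt_rev)
  moreover have p: "0 < ct u 0"
  proof -
   have "ct u (u ! 0) <= ct u 0" using antimonoD[OF lat_antimono[OF l]] by simp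
   moreover have "0 < ct u (u ! 0)" using False by (simp add: ct_pos)
   ultimately show ?thesis by simp
  qed
  ultimately have "length (List.transpose (tab u)) = ct u 0"
   using length_sh[OF l, of 0] length_rj[of u 0] by (simp add: length_transpose_sorted tab_rj)
  moreover have "j < length (sh (tr u)) \<longleftrightarrow> j < ct u 0" for j
  proof -
   have "j < length (sh (tr u)) \<longleftrightarrow> {i. j < ct u i} ~= {}"
    unfolding length_sh[OF lt] ct_tr using finite_ct[of j u] card_gt_0_iff by blast
   also have "... \<longleftrightarrow> j < ct u 0"
    using antimonoD[OF lat_antimono[OF l], of 0] by (auto intro: less_le_trans)
   finally show ?thesis .
  qed
  ultimately show ?thesis by (metis linorder_neqE_nat less_irrefl)
 qed
 have "List.transpose (tab u) = tab (tr u)"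
 proof (rule nth_equalityI)
  show "length (List.transpose (tab u)) = length (tab (tr u))" unfolding len by (simp add: tab_rj)
  fix c assume c: "c < length (List.transpose (tab u))"
  let ?F = "filter (%j. c < ct u j) [0..<length (sh u)]"
  have "List.transpose (tab u) ! c = map (%j. rj u j ! c) ?F"
   unfolding nth_transpose[OF c] unfolding tab_rj filter_map map_map comp_def length_rj ..
  also have "... = rj (tr u) c"
  proof (rule strict_sorted_equal[OF rj_sorted])
   have "sorted_wrt (%i j. rj u i ! c < rj u j ! c) ?F"
   proof (rule sorted_wrt_mono_rel)
    show "sorted_wrt (<) ?F" by (rule sorted_wrt_filter) simp
    fix i j assume "i \<in> set ?F" "j \<in> set ?F" "i < j"
    thus "rj u i ! c < rj u j ! c" using rj_column[OF l] by simp
   qed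
   thus "sorted_wrt (<) (map (%j. rj u j ! c) ?F)" by (simp add: sorted_wrt_map)
   show "set (map (%j. rj u j ! c) ?F) = set (rj (tr u) c)"
   proof (intro set_eqI iffI)
    fix e assume "e \<in> set (map (%j. rj u j ! c) ?F)"
    then obtain j where j: "c < ct u j" "e = rj u j ! c" by auto
    from rj_cell_ex[OF j(1)] obtain k where "k < length u" "u ! k = j" "ct (take k u) j = c" "e = Suc k" using j(2) by auto
    thus "e \<in> set (rj (tr u) c)" unfolding set_rj by (auto simp: tr_nth)
   next
    fix e assume "e \<in> set (rj (tr u) c)"
    then obtain k where k: "e = Suc k" "k < length u" "ct (take k u) (u ! k) = c" unfolding set_rj by (auto simp: tr_nth)
    hence "c < ct u (u ! k)" "rj u (u ! k) ! c = e" using rj_cell[OF k(2)] by auto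
    moreover have "u ! k < length (sh u)" using lat_row_lt[OF l] k(2) by simp
    ultimately show "e \<in> set (map (%j. rj u j ! c) ?F)" by (auto simp del: upt_Suc intro!: image_eqI[of _ _ "u ! k"])
   qed
  qed
  also have "... = tab (tr u) ! c" using c len by (simp add: tab_rj)
  finally show "List.transpose (tab u) ! c = tab (tr u) ! c" .
 qed
 thus ?thesis by (simp add: tab_transpose_def)
qed

text \<open>Transposing turns the initial ascent into a weak descent, where \<open>B0_tab\<close>
  applies, and \<open>Lam\<close> commutes with transposition.\<close>

lemma B1_tab:
 assumes l: "lat u" and n: "length u = n" "2 <= n" and d: "u ! 0 < u ! 1"
 shows "B1 (tab u) = tab (take (n - 2) (Lam u))"
proof -
 have t: "take (n - 2) (Lam (tr u)) = tr (take (n - 2) (Lam u))"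
  using Lam_tr[OF l] by (metis tr_def take_trf)
 have lU: "lat (take (n - 2) (Lam u))" using Lam_tr[OF l] lat_take by blast
 obtain x y w where u: "u = x # y # w" using n by (cases u rule: dvw.cases) auto
 have "latf (%_. 0) (x # y # w)" using l by (simp add: lat_latf u)
 from trf_less[OF _ this] d have "\<not> tr u ! 0 < tr u ! 1" by (simp add: u tr_def antimono_def)
 hence "B0 (tab (tr u)) = tab (tr (take (n - 2) (Lam u)))"
  using B0_tab[OF lat_tr[OF l], of n] n unfolding t by simp
 thus ?thesis unfolding B1_def transpose_tab[OF l] by (simp add: transpose_tab[OF lat_tr[OF lU]] tr_tr[OF lU])
qed

lemma dv_aux_tab: "lat u ==> length u <= k ==> dv_aux k (tab u) = dvw u"
proof (induction k arbitrary: u)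
 case (Suc k)
 have u: "u \<in> LW (length u)" using Suc.prems by (simp add: LW_def)
 note len = length_reading_tab[OF u]
 show ?case
 proof (cases "length u <= 1")
  case True
  hence "dvw u = []" by (cases u rule: dvw.cases) auto
  thus ?thesis using True len by simp
 next
  case False
  hence n: "2 <= length u" by simp
  let ?v = "take (length u - 2) (Lam u)"
  have v: "lat ?v" using Lam_tr[OF Suc.prems(1)] lat_take by blast
  have IH: "dv_aux k (tab ?v) = dvw ?v" by (rule Suc.IH[OF v]) (use Suc.prems n in simp)
  have p: "pos (reading (tab u)) 2 < pos (reading (tab u)) 1 \<longleftrightarrow> u ! 0 < u ! 1"
   using pos_tab[OF Suc.prems(1), of 0] n by (simp add: numeral_2_eq_2)
  \<comment> \<open>\<open>dv_aux\<close> tests the positions strictly in the opposite direction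
    from \<open>pos_tab\<close>, so a tie has to be excluded.\<close>
  have ne: "pos (reading (tab u)) 1 ~= pos (reading (tab u)) 2"
  proof
   assume e: "pos (reading (tab u)) 1 = pos (reading (tab u)) 2"
   have "mset (concat (rev T)) = mset (concat T)" for T :: "nat list list"
    by (induction T) (simp_all add: union_commute)
   hence "mset (reading (tab u)) = mset (concat (tab u))" unfolding reading_def .
   hence "set (reading (tab u)) = {1..length u}"
    using standard_tab[OF u] mset_eq_setD[of "reading (tab u)" "[1..<length u + 1]"]
    by (simp add: standard_def atLeastLessThanSuc_atLeastAtMost)
   hence m: "1 \<in> set (reading (tab u))" "2 \<in> set (reading (tab u))" using n by auto
   have P: "reading (tab u) ! pos (reading (tab u)) x = x" if "x \<in> set (reading (tab u))" for x
   proof -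
    have "x \<in> set w ==> length (takeWhile (%y. y ~= x) w) < length w" for w :: "nat list" by (induction w) auto
    from nth_length_takeWhile[OF this[OF that]] show ?thesis unfolding pos_def by simp
   qed
   show False using P[OF m(1)] P[OF m(2)] unfolding e by simp
  qed
  show ?thesis
  proof (cases "u ! 0 < u ! 1")
   case True
   hence "\<not> pos (reading (tab u)) 1 < pos (reading (tab u)) 2" using p by simp
   thus ?thesis using n len dvw_Lam[OF n] True B1_tab[OF Suc.prems(1) refl n True] IH by simp
  next
   case False
   hence "pos (reading (tab u)) 1 < pos (reading (tab u)) 2" using p ne by simp
   thus ?thesis using n len dvw_Lam[OF n] False B0_tab[OF Suc.prems(1) refl n False] IH by simp
  qed
 qed
qed simp

lemma Stat_tab: assumes u: "u \<in> LW n" shows "Stat l (tab u) = qq ^ cmaj u * wgt l n (dvw u)"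
proof -
 have "dv (tab u) = dvw u" unfolding dv_def length_reading_tab[OF u] by (rule dv_aux_tab) (use u in \<open>auto simp: LW_def\<close>)
 thus ?thesis unfolding Stat_def Let_def length_reading_tab[OF u] cocharge_tab[OF u] wgt_def by (simp only: mult.assoc)
qed

theorem theorem27:
  fixes m l eps :: nat
  assumes "eps \<in> {0, 1}"
  shows "macJ (filter (\<lambda>x. 0 < x) [2 * m + l + eps, l]) =
    (\<lambda>\<nu>. \<Sum>T\<in>std_tableaux (2 * m + 2 * l + eps). Stat l T * pleth_Xt (schur (shape T)) \<nu>)"
proof -
 \<comment> \<open>The difference of the two row lengths, \<open>2 * m + eps\<close>, takes the role
   of \<open>m\<close> in the two-row results.\<close>
 let ?n = "2 * m + eps + 2 * l"
 have n: "2 * m + 2 * l + eps = ?n" and t: "filter (%x. 0 < x) [2 * m + l + eps, l] = two (2 * m + eps) l"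
  by (simp_all add: two_def add_ac)
 show ?thesis unfolding n t macJ_lattice tab_image[symmetric] sum.reindex[OF inj_tab] comp_def
  by (intro ext sum.cong refl) (simp add: Stat_tab shape_tab LW_def)
qed

end
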